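(* Let $(R,\mathfrak m,k)$ be a commutative noetherian local ring of Krull dimension $d$. Let $M$ be a finitely generated $R$-module that is locally free on the punctured spectrum of $R$, and let $t=\mathrm{depth}\,M$. Then $M$ belongs to $\left|\bigcup_{i=t}^d\Omega^i\,\mathrm{fl}\,R\right|_{d-t+1}$. In particular, $M$ is in $\mathrm{ext}\left(\bigoplus_{i=t}^d\Omega^ik\right)$.
   Context: All modules are finitely generated; $\mathrm{mod}\,R$ is the category of finitely generated $R$-modules. Subcategories are full and closed under isomorphism. $\mathrm{fl}\,R$ is the subcategory of modules of finite length. $M$ is locally free on the punctured spectrum if $M_{\mathfrak p}$ is a free $R_{\mathfrak p}$-module for every nonmaximal prime $\mathfrak p$. Syzygies: for a subcategory (or family) $\mathcal X$ of $\mathrm{mod}\,R$, $\Omega^i\mathcal X$ consists of all $M$ admitting an exact sequence $0\to M\to P_{i-1}\to\cdots\to P_0\to X\to0$ with each $P_j$ finitely generated free and $X\in\mathcal X$ ($\Omega^0\mathcal X=\mathcal X$). No minimality is required; $\Omega^ik$ is determined up to free summands, and in a generating set all $i$-th syzygies of $k$ are allowed. $\bigcup_i\mathcal X_i$ is the subcategory of modules lying in some $\mathcal X_i$. $\mathrm{add}\,\mathcal X$ is the smallest subcategory containing $\mathcal X$ closed under finite direct sums and direct summands; $\mathrm{ext}\,\mathcal X$ is the smallest subcategory containing $\mathcal X$ closed under direct summands and extensions. $|\mathcal X|_r$ is the subcategory of modules that are direct summands of a module $N$ having a filtration $0=N_0\subseteq\cdots\subseteq N_r=N$ with all $N_j/N_{j-1}\in\mathrm{add}\,\mathcal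 X$. *)

theory Defs
  imports
    "HOL-Algebra.QuotRing"
    "HOL-Algebra.Module"
    "HOL-Algebra.Ring_Divisibility"
    "HOL-Library.FuncSet"
    "HOL-Library.Extended_Nat"
begin

section \<open>Local rings and Krull dimension\<close>

locale noetherian_local_ring = cring R + noetherian_ring R for R (structure) +
  fixes \<mm> :: "'a set"
  assumes maximalideal_iff: "\<And>I. maximalideal I R \<longleftrightarrow> I = \<mm>"

definition krull_dim :: "('a, 'm) ring_scheme \<Rightarrow> enat" where
  "krull_dim R = Sup {enat n | n. \<exists>p :: nat \<Rightarrow> 'a set.
      (\<forall>i\<le>n. primeideal (p i) R) \<and> (\<forall>i<n. p i \<subset> p (Suc i))}"


section \<open>Modules\<close>

text \<open>
  A module is a record extending that of rings; its fields \<open>mult\<close> and \<open>one\<close> play no role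
  in \<^const>\<open>module\<close> and are left undefined in the constructions below.
\<close>

definition mhom :: "('a, 'm) ring_scheme \<Rightarrow> ('a, 'b, 'n) module_scheme
    \<Rightarrow> ('a, 'c, 'l) module_scheme \<Rightarrow> ('b \<Rightarrow> 'c) set" where
  "mhom R M N = {f \<in> carrier M \<rightarrow> carrier N.
      (\<forall>x\<in>carrier M. \<forall>y\<in>carrier M. f (x \<oplus>\<^bsub>M\<^esub> y) = f x \<oplus>\<^bsub>N\<^esub> f y) \<and>
      (\<forall>a\<in>carrier R. \<forall>x\<in>carrier M. f (a \<odot>\<^bsub>M\<^esub> x) = a \<odot>\<^bsub>N\<^esub> f x)}"

definition mod_iso :: "('a, 'm) ring_scheme \<Rightarrow> ('a, 'b, 'n) module_scheme
    \<Rightarrow> ('a, 'c, 'l) module_scheme \<Rightarrow> bool" where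
  "mod_iso R M N \<longleftrightarrow> (\<exists>f\<in>mhom R M N. bij_betw f (carrier M) (carrier N))"

definition mspan :: "('a, 'm) ring_scheme \<Rightarrow> ('a, 'b, 'n) module_scheme \<Rightarrow> 'b set \<Rightarrow> 'b set" where
  "mspan R M A = \<Inter> {N. submodule N R M \<and> A \<subseteq> N}"

definition fg_module :: "('a, 'm) ring_scheme \<Rightarrow> ('a, 'b, 'n) module_scheme \<Rightarrow> bool" where
  "fg_module R M \<longleftrightarrow> module R M \<and>
     (\<exists>A. finite A \<and> A \<subseteq> carrier M \<and> mspan R M A = carrier M)"

definition lin_indep :: "('a, 'm) ring_scheme \<Rightarrow> ('a, 'b, 'n) module_scheme \<Rightarrow> 'b set \<Rightarrow> bool" where
  "lin_indep R M B \<longleftrightarrow> (\<forall>F c. finite F \<and> F \<subseteq> B \<and> c \<in> F \<rightarrow> carrier R \<and>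
      (\<Oplus>\<^bsub>M\<^esub>b\<in>F. c b \<odot>\<^bsub>M\<^esub> b) = \<zero>\<^bsub>M\<^esub> \<longrightarrow> (\<forall>b\<in>F. c b = \<zero>\<^bsub>R\<^esub>))"

definition free_module :: "('a, 'm) ring_scheme \<Rightarrow> ('a, 'b, 'n) module_scheme \<Rightarrow> bool" where
  "free_module R M \<longleftrightarrow> module R M \<and>
     (\<exists>B. B \<subseteq> carrier M \<and> mspan R M B = carrier M \<and> lin_indep R M B)"

definition quot_mod :: "('a, 'm) ring_scheme \<Rightarrow> ('a, 'b, 'n) module_scheme \<Rightarrow> 'b set
    \<Rightarrow> ('a, 'b set) module" where
  "quot_mod R M N = \<lparr>carrier = a_rcosets\<^bsub>M\<^esub> N, mult = undefined, one = undefined,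
     zero = N, add = set_add M,
     smult = (\<lambda>a X. \<Union>x\<in>X. N +>\<^bsub>M\<^esub> (a \<odot>\<^bsub>M\<^esub> x))\<rparr>"

definition dsum :: "'i set \<Rightarrow> ('i \<Rightarrow> ('a, 'b, 'n) module_scheme) \<Rightarrow> ('a, 'i \<Rightarrow> 'b) module" where
  \<comment> \<open>only used for finite \<open>I\<close>, where direct sum and direct product agree\<close>
  "dsum I K = \<lparr>carrier = (\<Pi>\<^sub>E i\<in>I. carrier (K i)), mult = undefined, one = undefined,
     zero = (\<lambda>i\<in>I. \<zero>\<^bsub>K i\<^esub>), add = (\<lambda>x y. \<lambda>i\<in>I. x i \<oplus>\<^bsub>K i\<^esub> y i),
     smult = (\<lambda>a x. \<lambda>i\<in>I. a \<odot>\<^bsub>K i\<^esub> x i)\<rparr>"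

definition self_mod :: "('a, 'm) ring_scheme \<Rightarrow> ('a, 'a) module" where
  "self_mod R = \<lparr>carrier = carrier R, mult = mult R, one = one R,
     zero = zero R, add = add R, smult = mult R\<rparr>"

definition mod_filtration :: "('a, 'm) ring_scheme \<Rightarrow> ('a, 'b, 'n) module_scheme \<Rightarrow> nat
    \<Rightarrow> (nat \<Rightarrow> 'b set) \<Rightarrow> bool" where
  "mod_filtration R M r F \<longleftrightarrow> (\<forall>j\<le>r. submodule (F j) R M) \<and> (\<forall>j<r. F j \<subseteq> F (Suc j)) \<and>
     F 0 = {\<zero>\<^bsub>M\<^esub>} \<and> F r = carrier M"

definition simple_module :: "('a, 'm) ring_scheme \<Rightarrow> ('a, 'b, 'n) module_scheme \<Rightarrow> bool" where
  "simple_module R M \<longleftrightarrow> module R M \<and> carrier M \<noteq> {\<zero>\<^bsub>M\<^esub>} \<and>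
     (\<forall>N. submodule N R M \<longrightarrow> N = {\<zero>\<^bsub>M\<^esub>} \<or> N = carrier M)"

definition finite_length :: "('a, 'm) ring_scheme \<Rightarrow> ('a, 'b, 'n) module_scheme \<Rightarrow> bool" where
  "finite_length R M \<longleftrightarrow> module R M \<and> (\<exists>n F. mod_filtration R M n F \<and>
     (\<forall>j<n. simple_module R (quot_mod R (M\<lparr>carrier := F (Suc j)\<rparr>) (F j))))"


section \<open>Depth\<close>

definition seq_submod :: "('a, 'm) ring_scheme \<Rightarrow> ('a, 'b, 'n) module_scheme \<Rightarrow> 'a list \<Rightarrow> 'b set" where
  "seq_submod R M xs = mspan R M {x \<odot>\<^bsub>M\<^esub> y | x y. x \<in> set xs \<and> y \<in> carrier M}"

definition regular_seq :: "('a, 'm) ring_scheme \<Rightarrow> ('a, 'b, 'n) module_scheme \<Rightarrow> 'a list \<Rightarrow> bool" where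
  "regular_seq R M xs \<longleftrightarrow> set xs \<subseteq> carrier R \<and>
     (\<forall>i<length xs. let Q = quot_mod R M (seq_submod R M (take i xs)) in
        \<forall>y\<in>carrier Q. (xs ! i) \<odot>\<^bsub>Q\<^esub> y = \<zero>\<^bsub>Q\<^esub> \<longrightarrow> y = \<zero>\<^bsub>Q\<^esub>) \<and>
     (let Q = quot_mod R M (seq_submod R M xs) in carrier Q \<noteq> {\<zero>\<^bsub>Q\<^esub>})"

definition depth :: "('a, 'm) ring_scheme \<Rightarrow> 'a set \<Rightarrow> ('a, 'b, 'n) module_scheme \<Rightarrow> enat" where
  "depth R \<mm> M = (if carrier M = {\<zero>\<^bsub>M\<^esub>} then \<infinity>
     else Sup {enat (length xs) | xs. set xs \<subseteq> \<mm> \<and> regular_seq R M xs})"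


section \<open>Localization at a prime\<close>

text \<open>
  \<open>loc_frac R M S x s\<close> is the fraction \<open>x/s\<close>, i.e. the class of \<open>(x, s)\<close> under
  \<open>(x, s) \<sim> (y, t) \<longleftrightarrow> u(tx - sy) = 0\<close> for some \<open>u \<in> S\<close>. In the operations on fractions below,
  all sets in each union coincide.
\<close>

definition loc_frac :: "('a, 'm) ring_scheme \<Rightarrow> ('a, 'b, 'n) module_scheme \<Rightarrow> 'a set \<Rightarrow> 'b \<Rightarrow> 'a
    \<Rightarrow> ('b \<times> 'a) set" where
  "loc_frac R M S x s = {(y, t). y \<in> carrier M \<and> t \<in> S \<and>
     (\<exists>u\<in>S. u \<odot>\<^bsub>M\<^esub> (t \<odot>\<^bsub>M\<^esub> x) = u \<odot>\<^bsub>M\<^esub> (s \<odot>\<^bsub>M\<^esub> y))}"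

definition loc_ring :: "('a, 'm) ring_scheme \<Rightarrow> 'a set \<Rightarrow> ('a \<times> 'a) set ring" where
  "loc_ring R p = (let S = carrier R - p; fr = loc_frac R (self_mod R) S in
     \<lparr>carrier = {fr a s | a s. a \<in> carrier R \<and> s \<in> S},
      mult = (\<lambda>X Y. \<Union>(a, s)\<in>X. \<Union>(b, t)\<in>Y. fr (a \<otimes>\<^bsub>R\<^esub> b) (s \<otimes>\<^bsub>R\<^esub> t)),
      one = fr \<one>\<^bsub>R\<^esub> \<one>\<^bsub>R\<^esub>,
      zero = fr \<zero>\<^bsub>R\<^esub> \<one>\<^bsub>R\<^esub>,
      add = (\<lambda>X Y. \<Union>(a, s)\<in>X. \<Union>(b, t)\<in>Y.
        fr ((t \<otimes>\<^bsub>R\<^esub> a) \<oplus>\<^bsub>R\<^esub> (s \<otimes>\<^bsub>R\<^esub> b)) (s \<otimes>\<^bsub>R\<^esub> t))\<rparr>)"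

definition loc_mod :: "('a, 'm) ring_scheme \<Rightarrow> 'a set \<Rightarrow> ('a, 'b, 'n) module_scheme
    \<Rightarrow> (('a \<times> 'a) set, ('b \<times> 'a) set) module" where
  "loc_mod R p M = (let S = carrier R - p; fr = loc_frac R M S in
     \<lparr>carrier = {fr x s | x s. x \<in> carrier M \<and> s \<in> S},
      mult = undefined, one = undefined,
      zero = fr \<zero>\<^bsub>M\<^esub> \<one>\<^bsub>R\<^esub>,
      add = (\<lambda>X Y. \<Union>(x, s)\<in>X. \<Union>(y, t)\<in>Y.
        fr ((t \<odot>\<^bsub>M\<^esub> x) \<oplus>\<^bsub>M\<^esub> (s \<odot>\<^bsub>M\<^esub> y)) (s \<otimes>\<^bsub>R\<^esub> t)),
      smult = (\<lambda>A X. \<Union>(a, s)\<in>A. \<Union>(x, t)\<in>X. fr (a \<odot>\<^bsub>M\<^esub> x) (s \<otimes>\<^bsub>R\<^esub> t))\<rparr>)"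

definition locally_free_punctured :: "('a, 'm) ring_scheme \<Rightarrow> ('a, 'b, 'n) module_scheme \<Rightarrow> bool" where
  "locally_free_punctured R M \<longleftrightarrow>
     (\<forall>p. primeideal p R \<and> \<not> maximalideal p R \<longrightarrow> free_module (loc_ring R p) (loc_mod R p M))"


section \<open>Subcategories of the category of finitely generated modules\<close>

text \<open>
  Every finitely generated module is isomorphic to some \<open>R\<^sup>n/K\<close>, whose elements are sets of
  functions \<open>nat \<Rightarrow> 'a\<close>. So \<open>mod_cat R\<close>, the finitely generated modules on carriers of that
  type, contains all finitely generated modules up to isomorphism
  (lemma \<open>ex_rmod\<close>).
  A subcategory is a subset of \<open>mod_cat R\<close>; \<open>in_cat R M X\<close> says that \<open>M\<close>, on a carrier of any
  type, belongs to the isomorphism-closed subcategory given by \<open>X\<close>.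
\<close>

type_synonym 'a rmod = "('a, (nat \<Rightarrow> 'a) set) module"

definition mod_cat :: "('a, 'm) ring_scheme \<Rightarrow> 'a rmod set" where
  "mod_cat R = {X. fg_module R X}"

lemma transport_module:
  fixes M :: "('a, 'b, 'n) module_scheme" and \<phi> :: "'b \<Rightarrow> 'c"
  assumes M: "module R M" and inj: "inj_on \<phi> (carrier M)"
  defines "\<psi> \<equiv> the_inv_into (carrier M) \<phi>"
  defines "X \<equiv> \<lparr>carrier = \<phi> ` carrier M, mult = undefined, one = undefined,
     zero = \<phi> \<zero>\<^bsub>M\<^esub>, add = (\<lambda>x y. \<phi> (\<psi> x \<oplus>\<^bsub>M\<^esub> \<psi> y)),
     smult = (\<lambda>a x. \<phi> (a \<odot>\<^bsub>M\<^esub> \<psi> x))\<rparr> :: ('a,'c) module"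
  shows "module R X" and "\<phi> \<in> mhom R M X" and "mod_iso R M X"
proof -
  interpret M: module R M by fact
  have psi [simp]: "\<psi> (\<phi> x) = x" if "x \<in> carrier M" for x
    using that inj by (simp add: \<psi>_def the_inv_into_f_f)
  have ab: "abelian_group X"
  proof (rule abelian_groupI, goal_cases)
    case (6 x)
    then obtain y where y: "y \<in> carrier M" "x = \<phi> y" by (auto simp: X_def)
    show ?case by (rule bexI[of _ "\<phi> (\<ominus>\<^bsub>M\<^esub> y)"]) (use y in \<open>auto simp: X_def M.M.l_neg\<close>)
  qed (auto simp: X_def M.M.a_ac)
  show "module R X"
    by (rule moduleI[OF M.R.is_cring ab])
      (auto simp: X_def M.smult_l_distr M.smult_r_distr M.smult_assoc1)
  show hom: "\<phi> \<in> mhom R M X"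
    by (auto simp: mhom_def X_def)
  show "mod_iso R M X"
    unfolding mod_iso_def by (rule bexI[OF _ hom]) (auto simp: X_def bij_betw_def inj)
qed

lemma mspan_subset: "submodule N R M \<Longrightarrow> A \<subseteq> N \<Longrightarrow> mspan R M A \<subseteq> N"
  by (auto simp: mspan_def)

lemma ex_rmod:
  fixes R :: "('a, 'm) ring_scheme" and M :: "('a, 'b, 'n) module_scheme"
  assumes "fg_module R M"
  shows "\<exists>X\<in>mod_cat R. mod_iso R M X"
proof -
  interpret M: module R M using assms by (simp add: fg_module_def)
  obtain A where A: "finite A" "A \<subseteq> carrier M" "mspan R M A = carrier M"
    using assms by (auto simp: fg_module_def)
  obtain g :: "nat \<Rightarrow> 'b" and n where g: "A = g ` {i. i < n}" 
    using finite_imp_nat_seg_image_inj_on[OF A(1)] by blast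
  have gc [simp]: "g i \<in> carrier M" if "i < n" for i using that A g by auto
  define lc where "lc = (\<lambda>c. \<Oplus>\<^bsub>M\<^esub>i\<in>{..<n}. c i \<odot>\<^bsub>M\<^esub> g i)"
  define C where "C = {..<n} \<rightarrow> carrier R"
  have closed: "lc c \<in> carrier M" if "c \<in> C" for c
    using that unfolding lc_def C_def by (intro M.M.finsum_closed) auto
  have sub: "submodule (lc ` C) R M"
  proof (rule M.submoduleI)
    show "lc ` C \<subseteq> carrier M" using closed by auto
    have "lc (\<lambda>_. \<zero>\<^bsub>R\<^esub>) = \<zero>\<^bsub>M\<^esub>"
      unfolding lc_def by (subst M.M.finsum_cong'[where g = "\<lambda>_. \<zero>\<^bsub>M\<^esub>", OF refl]) auto
    then show "\<zero>\<^bsub>M\<^esub> \<in> lc ` C" by (force simp: C_def)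
  next
    have smul: "a \<odot>\<^bsub>M\<^esub> lc c = lc (\<lambda>i. a \<otimes>\<^bsub>R\<^esub> c i)" if "a \<in> carrier R" "c \<in> C" for a c
    proof -
      have "a \<odot>\<^bsub>M\<^esub> lc c = (\<Oplus>\<^bsub>M\<^esub>i\<in>{..<n}. a \<odot>\<^bsub>M\<^esub> (c i \<odot>\<^bsub>M\<^esub> g i))"
        unfolding lc_def using that by (intro M.finsum_smult_ldistr) (auto simp: C_def)
      also have "\<dots> = lc (\<lambda>i. a \<otimes>\<^bsub>R\<^esub> c i)"
        unfolding lc_def using that 
        by (intro M.M.finsum_cong') (auto simp: C_def M.smult_assoc1 Pi_iff)
      finally show ?thesis .
    qed
    show smc: "a \<odot>\<^bsub>M\<^esub> x \<in> lc ` C" if "a \<in> carrier R" "x \<in> lc ` C" for a x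
      using that smul by (auto simp: C_def Pi_iff intro!: imageI)
    fix a assume a: "a \<in> lc ` C"
    then have "a \<in> carrier M" using closed by auto
    then have "\<ominus>\<^bsub>M\<^esub> a = (\<ominus>\<^bsub>R\<^esub> \<one>\<^bsub>R\<^esub>) \<odot>\<^bsub>M\<^esub> a" by (simp add: M.smult_l_minus)
    then show "\<ominus>\<^bsub>M\<^esub> a \<in> lc ` C" using smc[of "\<ominus>\<^bsub>R\<^esub> \<one>\<^bsub>R\<^esub>" a] a by simp
  next
    fix a b assume "a \<in> lc ` C" "b \<in> lc ` C"
    then obtain c e where ce: "c \<in> C" "a = lc c" "e \<in> C" "b = lc e" by auto
    have "lc (\<lambda>i. c i \<oplus>\<^bsub>R\<^esub> e i) = (\<Oplus>\<^bsub>M\<^esub>i\<in>{..<n}. c i \<odot>\<^bsub>M\<^esub> g i \<oplus>\<^bsub>M\<^esub> e i \<odot>\<^bsub>M\<^esub> g i)"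
      unfolding lc_def using ce
      by (intro M.M.finsum_cong') (auto simp: C_def Pi_def M.smult_l_distr)
    also have "\<dots> = a \<oplus>\<^bsub>M\<^esub> b"
      unfolding ce lc_def using ce by (intro M.M.finsum_addf) (auto simp: C_def)
    finally have "a \<oplus>\<^bsub>M\<^esub> b = lc (\<lambda>i. c i \<oplus>\<^bsub>R\<^esub> e i)" ..
    moreover have "(\<lambda>i. c i \<oplus>\<^bsub>R\<^esub> e i) \<in> C" using ce by (auto simp: C_def)
    ultimately show "a \<oplus>\<^bsub>M\<^esub> b \<in> lc ` C" by auto
  qed
  have "A \<subseteq> lc ` C"
  proof
    fix x assume "x \<in> A"
    then obtain j where j: "j < n" "x = g j" using g by auto
    have "lc (\<lambda>i. if i = j then \<one>\<^bsub>R\<^esub> else \<zero>\<^bsub>R\<^esub>) = 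
        (\<Oplus>\<^bsub>M\<^esub>i\<in>{..<n}. if j = i then g i else \<zero>\<^bsub>M\<^esub>)"
      unfolding lc_def by (intro M.M.finsum_cong') auto
    also have "\<dots> = x" using j by (subst M.M.finsum_singleton) auto
    finally show "x \<in> lc ` C" 
      by (intro image_eqI[of _ _ "\<lambda>i. if i = j then \<one>\<^bsub>R\<^esub> else \<zero>\<^bsub>R\<^esub>"]) (auto simp: C_def)
  qed
  then have surj: "carrier M \<subseteq> lc ` C" using mspan_subset[OF sub, of A] A(3) by simp
  define \<phi> where "\<phi> = (\<lambda>x. {c \<in> C. lc c = x})"
  have inj: "inj_on \<phi> (carrier M)"
    by (rule inj_onI) (use surj in \<open>auto simp: \<phi>_def; blast\<close>)
  note T = transport_module[OF M.module_axioms inj]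
  define \<psi> where "\<psi> = the_inv_into (carrier M) \<phi>"
  define X :: "'a rmod" where "X = \<lparr>carrier = \<phi> ` carrier M, mult = undefined, one = undefined,
     zero = \<phi> \<zero>\<^bsub>M\<^esub>, add = (\<lambda>x y. \<phi> (\<psi> x \<oplus>\<^bsub>M\<^esub> \<psi> y)),
     smult = (\<lambda>a x. \<phi> (a \<odot>\<^bsub>M\<^esub> \<psi> x))\<rparr>"
  have iso: "mod_iso R M X" unfolding X_def \<psi>_def by (rule T)
  show ?thesis
  proof (rule bexI[of _ X])
    show "mod_iso R M X" by (rule iso)
    have X: "module R X" and hom: "\<phi> \<in> mhom R M X" unfolding X_def \<psi>_def by (rule T)+
    interpret X: module R X by (rule X)
    have car: "carrier X = \<phi> ` carrier M" by (simp add: X_def)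
    have "mspan R X (\<phi> ` A) = carrier X"
    proof
      show "mspan R X (\<phi> ` A) \<subseteq> carrier X"
        by (rule mspan_subset[OF X.carrier_is_submodule]) (use A car in auto)
      have "\<phi> x \<in> N" if N: "submodule N R X" "\<phi> ` A \<subseteq> N" and x: "x \<in> carrier M" for N x
      proof -
        let ?P = "{x \<in> carrier M. \<phi> x \<in> N}"
        note E = X.submoduleE[OF N(1)]
        have sm: "a \<odot>\<^bsub>M\<^esub> y \<in> ?P" if "a \<in> carrier R" "y \<in> ?P" for a y
          using that E(4)[of a "\<phi> y"] hom by (auto simp: mhom_def)
        have "submodule ?P R M"
        proof (rule M.submoduleI)
          show "\<zero>\<^bsub>M\<^esub> \<in> ?P" using N(1) subgroup.one_closed[OF submodule.axioms(1)[OF N(1)]]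
            by (simp add: X_def)
          fix a assume a: "a \<in> ?P"
          then have "\<ominus>\<^bsub>M\<^esub> a = (\<ominus>\<^bsub>R\<^esub> \<one>\<^bsub>R\<^esub>) \<odot>\<^bsub>M\<^esub> a" by (simp add: M.smult_l_minus)
          then show "\<ominus>\<^bsub>M\<^esub> a \<in> ?P" using sm[of "\<ominus>\<^bsub>R\<^esub> \<one>\<^bsub>R\<^esub>" a] a by simp
        next
          fix a b assume "a \<in> ?P" "b \<in> ?P"
          then show "a \<oplus>\<^bsub>M\<^esub> b \<in> ?P" using E(5)[of "\<phi> a" "\<phi> b"] hom by (auto simp: mhom_def)
        qed (use sm in auto)
        moreover have "A \<subseteq> ?P" using N A by auto
        ultimately have "mspan R M A \<subseteq> ?P" by (rule mspan_subset)
        then show ?thesis using A x by auto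
      qed
      then show "carrier X \<subseteq> mspan R X (\<phi> ` A)" by (auto simp: mspan_def car)
    qed
    then have "fg_module R X"
      using X A by (auto simp: fg_module_def car intro!: exI[of _ "\<phi> ` A"])
    then show "X \<in> mod_cat R" by (simp add: mod_cat_def)
  qed
qed

definition in_cat :: "('a, 'm) ring_scheme \<Rightarrow> ('a, 'b, 'n) module_scheme \<Rightarrow> 'a rmod set \<Rightarrow> bool" where
  "in_cat R M \<X> \<longleftrightarrow> (\<exists>X\<in>\<X>. mod_iso R M X)"

definition fl_cat :: "('a, 'm) ring_scheme \<Rightarrow> 'a rmod set" where
  "fl_cat R = {X \<in> mod_cat R. finite_length R X}"

definition residue_cat :: "('a, 'm) ring_scheme \<Rightarrow> 'a set \<Rightarrow> 'a rmod set" where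
  "residue_cat R \<mm> = {X \<in> mod_cat R. mod_iso R X (quot_mod R (self_mod R) \<mm>)}"

definition syzygy :: "('a, 'm) ring_scheme \<Rightarrow> nat \<Rightarrow> 'a rmod set \<Rightarrow> 'a rmod set" where
  \<comment> \<open>\<open>E\<close> is the exact sequence, with \<open>E 0 = X\<close>, \<open>E (Suc j) = P\<^sub>j\<close> for \<open>j < i\<close>, \<open>E (Suc i) = M\<close>\<close>
  "syzygy R i \<X> = {M \<in> mod_cat R. \<exists>(E :: nat \<Rightarrow> 'a rmod) f.
     E 0 \<in> \<X> \<and> E (Suc i) = M \<and>
     (\<forall>j<i. E (Suc j) \<in> mod_cat R \<and> free_module R (E (Suc j))) \<and>
     (\<forall>j\<le>i. f j \<in> mhom R (E (Suc j)) (E j)) \<and>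
     inj_on (f i) (carrier (E (Suc i))) \<and>
     (\<forall>j<i. f (Suc j) ` carrier (E (Suc (Suc j))) = a_kernel (E (Suc j)) (E j) (f j)) \<and>
     f 0 ` carrier (E (Suc 0)) = carrier (E 0)}"

definition direct_summand :: "('a, 'm) ring_scheme \<Rightarrow> 'a rmod \<Rightarrow> 'a rmod \<Rightarrow> bool" where
  "direct_summand R M N \<longleftrightarrow>
     (\<exists>M'\<in>mod_cat R. mod_iso R N (dsum UNIV (\<lambda>b. if b then M else M')))"

definition short_exact :: "('a, 'm) ring_scheme \<Rightarrow> 'a rmod \<Rightarrow> 'a rmod \<Rightarrow> 'a rmod \<Rightarrow> bool" where
  \<comment> \<open>there is an exact sequence \<open>0 \<rightarrow> A \<rightarrow> B \<rightarrow> C \<rightarrow> 0\<close>\<close>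
  "short_exact R A B C \<longleftrightarrow> (\<exists>f\<in>mhom R A B. \<exists>g\<in>mhom R B C.
     inj_on f (carrier A) \<and> f ` carrier A = a_kernel B C g \<and> g ` carrier B = carrier C)"

inductive_set add_closure :: "('a, 'm) ring_scheme \<Rightarrow> 'a rmod set \<Rightarrow> 'a rmod set"
  for R :: "('a, 'm) ring_scheme" and \<X> :: "'a rmod set" where
  base: "X \<in> \<X> \<Longrightarrow> M \<in> mod_cat R \<Longrightarrow> mod_iso R M X \<Longrightarrow> M \<in> add_closure R \<X>"
| sum: "finite I \<Longrightarrow> (\<And>i. i \<in> I \<Longrightarrow> K i \<in> add_closure R \<X>) \<Longrightarrow> M \<in> mod_cat R \<Longrightarrow>
    mod_iso R M (dsum (I :: nat set) K) \<Longrightarrow> M \<in> add_closure R \<X>"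
| summand: "N \<in> add_closure R \<X> \<Longrightarrow> M \<in> mod_cat R \<Longrightarrow> direct_summand R M N \<Longrightarrow>
    M \<in> add_closure R \<X>"

inductive_set ext_closure :: "('a, 'm) ring_scheme \<Rightarrow> 'a rmod set \<Rightarrow> 'a rmod set"
  for R :: "('a, 'm) ring_scheme" and \<X> :: "'a rmod set" where
  base: "X \<in> \<X> \<Longrightarrow> M \<in> mod_cat R \<Longrightarrow> mod_iso R M X \<Longrightarrow> M \<in> ext_closure R \<X>"
| extension: "A \<in> ext_closure R \<X> \<Longrightarrow> C \<in> ext_closure R \<X> \<Longrightarrow> M \<in> mod_cat R \<Longrightarrow>
    short_exact R A M C \<Longrightarrow> M \<in> ext_closure R \<X>"
| summand: "N \<in> ext_closure R \<X> \<Longrightarrow> M \<in> mod_cat R \<Longrightarrow> direct_summand R M N \<Longrightarrow>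
    M \<in> ext_closure R \<X>"

definition filt_closure :: "('a, 'm) ring_scheme \<Rightarrow> 'a rmod set \<Rightarrow> nat \<Rightarrow> 'a rmod set" where
  \<comment> \<open>\<open>|\<X>|\<^sub>r\<close>\<close>
  "filt_closure R \<X> r = {M \<in> mod_cat R. \<exists>N\<in>mod_cat R. direct_summand R M N \<and>
     (\<exists>F. mod_filtration R N r F \<and>
       (\<forall>j<r. in_cat R (quot_mod R (N\<lparr>carrier := F (Suc j)\<rparr>) (F j)) (add_closure R \<X>)))}"

definition sum_family :: "('a, 'm) ring_scheme \<Rightarrow> nat set \<Rightarrow> (nat \<Rightarrow> 'a rmod set) \<Rightarrow> 'a rmod set" where
  \<comment> \<open>all direct sums of one module from each \<open>\<Y> i\<close>, \<open>i \<in> I\<close>\<close>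
  "sum_family R I \<Y> = {M \<in> mod_cat R. \<exists>K. (\<forall>i\<in>I. K i \<in> \<Y> i) \<and> mod_iso R M (dsum I K)}"

end

theory Submission
  imports Defs
begin

text \<open>
  Let \<open>M\<close> be nonzero of depth \<open>t\<close>. Call an element \<open>x\<close> of \<open>R\<close> good if multiplication by \<open>x\<close> on
  \<open>M\<close> factors through a finitely generated free module. The good elements form an ideal \<open>J\<close>, and
  since \<open>M\<close> is free at every nonmaximal prime \<open>P\<close>, clearing denominators in the identity of the
  localisation produces a good element outside \<open>P\<close> (\<open>free_localisation_factors\<close>). So \<open>J \<inter> \<mm>\<close>
  lies in no nonmaximal prime. By prime avoidance it contains \<open>x\<^sub>1, \<dots>, x\<^sub>d\<close> such that \<open>\<mm>\<close> is the
  only prime over all of them and \<open>x\<^sub>1, \<dots>, x\<^sub>t\<close> is regular on \<open>M\<close> (\<open>parameters_exist\<close>). That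
  regular elements can be chosen freely without losing depth is the exchange lemma
  \<open>depth_ge_exchange\<close>.

  A good \<open>x\<close> is null-homotopic, in positive degrees, on a free resolution of \<open>M\<close>. Starting with
  the resolution, take successively the mapping cones of \<open>x\<^sub>1, \<dots>, x\<^sub>d\<close>. This is a complex of
  free modules which amounts to the tensor product of the resolution with the Koszul complex. It
  has three properties (\<open>iterated_cone\<close>). Every \<open>x\<^sub>i\<close> is null-homotopic on it, so its homology
  is supported only at \<open>\<mm>\<close> and has finite length. Its homology vanishes above degree \<open>d - t\<close>,
  because the first \<open>t\<close> elements are regular. And the null-homotopies on the earlier stages
  split the projections from each cone, so that \<open>M\<close> is a retract of the cokernel \<open>W\<close> in degree
  \<open>d\<close>.

  The cokernel in degree \<open>n + 1\<close> is an extension of the boundaries in degree \<open>n\<close>, which are a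
  syzygy of the cokernel in degree \<open>n\<close>, by the homology in degree \<open>n + 1\<close>. Unwinding this from
  degree \<open>d\<close> down, \<open>W\<close> is filtered, up to free summands, by the \<open>i\<close>-th syzygies of the homology
  in degree \<open>d - i\<close> for \<open>i = t, \<dots>, d\<close> (\<open>cokernel_built\<close>). The predicate \<open>built\<close> keeps track of
  such filtrations up to free summands; it is stable under syzygies (\<open>built_syzygy\<close>). It yields
  a genuine filtration with \<open>d - t + 1\<close> steps of a module that has \<open>W\<close> as a retract
  (\<open>built_filtered\<close>). Since a module of finite length is built from copies of the residue field,
  it also yields membership in the extension closure of the syzygies of the residue field
  (\<open>fl_syzygies_ext\<close>).
\<close>

section \<open>Submodules, homomorphisms and finite generation\<close>

lemma mhom_closed: "f \<in> mhom R M N \<Longrightarrow> x \<in> carrier M \<Longrightarrow> f x \<in> carrier N"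
  by (auto simp: mhom_def)

lemma mhom_add: "f \<in> mhom R M N \<Longrightarrow> x \<in> carrier M \<Longrightarrow> y \<in> carrier M \<Longrightarrow>
    f (x \<oplus>\<^bsub>M\<^esub> y) = f x \<oplus>\<^bsub>N\<^esub> f y"
  by (auto simp: mhom_def)

lemma mhom_smult: "f \<in> mhom R M N \<Longrightarrow> a \<in> carrier R \<Longrightarrow> x \<in> carrier M \<Longrightarrow>
    f (a \<odot>\<^bsub>M\<^esub> x) = a \<odot>\<^bsub>N\<^esub> f x"
  by (auto simp: mhom_def)

lemma mhomI:
  assumes "\<And>x. x \<in> carrier M \<Longrightarrow> f x \<in> carrier N"
    and "\<And>x y. x \<in> carrier M \<Longrightarrow> y \<in> carrier M \<Longrightarrow> f (x \<oplus>\<^bsub>M\<^esub> y) = f x \<oplus>\<^bsub>N\<^esub> f y"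
    and "\<And>a x. a \<in> carrier R \<Longrightarrow> x \<in> carrier M \<Longrightarrow> f (a \<odot>\<^bsub>M\<^esub> x) = a \<odot>\<^bsub>N\<^esub> f x"
  shows "f \<in> mhom R M N"
  using assms by (auto simp: mhom_def)

lemma mhom_zero:
  assumes "f \<in> mhom R M N" "module R M" "module R N"
  shows "f \<zero>\<^bsub>M\<^esub> = \<zero>\<^bsub>N\<^esub>"
proof -
  interpret M: module R M by fact
  interpret N: module R N by fact
  have "f (\<zero>\<^bsub>R\<^esub> \<odot>\<^bsub>M\<^esub> \<zero>\<^bsub>M\<^esub>) = \<zero>\<^bsub>R\<^esub> \<odot>\<^bsub>N\<^esub> f \<zero>\<^bsub>M\<^esub>" 
    by (rule mhom_smult[OF assms(1)]) auto
  then show ?thesis using mhom_closed[OF assms(1) M.M.zero_closed] by simp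
qed

lemma mhom_minus:
  assumes "f \<in> mhom R M N" "module R M" "module R N" "x \<in> carrier M"
  shows "f (\<ominus>\<^bsub>M\<^esub> x) = \<ominus>\<^bsub>N\<^esub> f x"
proof -
  interpret M: module R M by fact
  interpret N: module R N by fact
  have "f ((\<ominus>\<^bsub>R\<^esub> \<one>\<^bsub>R\<^esub>) \<odot>\<^bsub>M\<^esub> x) = (\<ominus>\<^bsub>R\<^esub> \<one>\<^bsub>R\<^esub>) \<odot>\<^bsub>N\<^esub> f x" 
    by (rule mhom_smult[OF assms(1)]) (use assms(4) in auto)
  then show ?thesis using mhom_closed[OF assms(1,4)] assms(4)
    by (simp add: M.smult_l_minus N.smult_l_minus)
qed

lemma mhom_comp: "f \<in> mhom R M N \<Longrightarrow> g \<in> mhom R N P \<Longrightarrow> (\<lambda>x. g (f x)) \<in> mhom R M P"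
  by (intro mhomI) (simp_all add: mhom_closed mhom_add mhom_smult)

lemma mhom_id: "(\<lambda>x. x) \<in> mhom R M M"
  by (auto simp: mhom_def)

lemma mhom_plus:
  assumes "f \<in> mhom R M N" "g \<in> mhom R M N" "module R N"
  shows "(\<lambda>x. f x \<oplus>\<^bsub>N\<^esub> g x) \<in> mhom R M N"
proof -
  interpret N: module R N by fact
  show ?thesis
    using assms(1,2) by (intro mhomI)
      (simp_all add: mhom_closed mhom_add mhom_smult N.smult_r_distr N.M.a_ac)
qed

lemma mhom_scale:
  assumes "f \<in> mhom R M N" "module R N" "c \<in> carrier R"
  shows "(\<lambda>x. c \<odot>\<^bsub>N\<^esub> f x) \<in> mhom R M N"
proof -
  interpret N: module R N by fact
  show ?thesis
    using assms(1,3) by (intro mhomI)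
      (simp_all add: mhom_closed mhom_add mhom_smult N.smult_r_distr N.R.m_comm
        flip: N.smult_assoc1)
qed

lemma mhom_neg:
  assumes "f \<in> mhom R M N" "module R N"
  shows "(\<lambda>x. \<ominus>\<^bsub>N\<^esub> f x) \<in> mhom R M N"
proof -
  interpret N: module R N by fact
  show ?thesis
    using assms(1) by (intro mhomI)
      (simp_all add: mhom_closed mhom_add mhom_smult N.smult_r_minus N.M.minus_add N.M.a_comm)
qed

lemma mhom_const_zero:
  assumes "module R N"
  shows "(\<lambda>x. \<zero>\<^bsub>N\<^esub>) \<in> mhom R M N"
proof -
  interpret N: module R N by fact
  show ?thesis by (intro mhomI) auto
qed

lemma mod_catD: "X \<in> mod_cat R \<Longrightarrow> module R X"
  by (simp add: mod_cat_def fg_module_def)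

lemma submoduleI':
  assumes "module R M" "N \<subseteq> carrier M" "\<zero>\<^bsub>M\<^esub> \<in> N"
    and "\<And>x y. x \<in> N \<Longrightarrow> y \<in> N \<Longrightarrow> x \<oplus>\<^bsub>M\<^esub> y \<in> N"
    and "\<And>a x. a \<in> carrier R \<Longrightarrow> x \<in> N \<Longrightarrow> a \<odot>\<^bsub>M\<^esub> x \<in> N"
  shows "submodule N R M"
proof -
  interpret M: module R M by fact
  show ?thesis
  proof (rule M.submoduleI)
    fix a assume a: "a \<in> N"
    then have "\<ominus>\<^bsub>M\<^esub> a = (\<ominus>\<^bsub>R\<^esub> \<one>\<^bsub>R\<^esub>) \<odot>\<^bsub>M\<^esub> a" using assms(2) by (auto simp: M.smult_l_minus)
    then show "\<ominus>\<^bsub>M\<^esub> a \<in> N" using assms(5)[of "\<ominus>\<^bsub>R\<^esub> \<one>\<^bsub>R\<^esub>" a] a by simp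
  qed (use assms in auto)
qed

lemma submoduleD:
  assumes "submodule N R M" "module R M"
  shows "N \<subseteq> carrier M" "\<zero>\<^bsub>M\<^esub> \<in> N"
    "\<And>x y. x \<in> N \<Longrightarrow> y \<in> N \<Longrightarrow> x \<oplus>\<^bsub>M\<^esub> y \<in> N"
    "\<And>a x. a \<in> carrier R \<Longrightarrow> x \<in> N \<Longrightarrow> a \<odot>\<^bsub>M\<^esub> x \<in> N"
    "\<And>x. x \<in> N \<Longrightarrow> \<ominus>\<^bsub>M\<^esub> x \<in> N"
    "\<And>x y. x \<in> N \<Longrightarrow> y \<in> N \<Longrightarrow> x \<ominus>\<^bsub>M\<^esub> y \<in> N"
  using module.submoduleE[OF assms(2,1)] subgroup.one_closed[OF submodule.axioms(1)[OF assms(1)]]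
  by (auto simp: a_minus_def)

lemma submodule_add_cancel:
  assumes "submodule N R M" "module R M" "x \<in> N" "y \<in> carrier M"
  shows "x \<oplus>\<^bsub>M\<^esub> y \<in> N \<longleftrightarrow> y \<in> N"
proof -
  interpret M: module R M by fact
  note S = submoduleD[OF assms(1,2)]
  have "x \<in> carrier M" using S assms by auto
  then have "(x \<oplus>\<^bsub>M\<^esub> y) \<ominus>\<^bsub>M\<^esub> x = y" using assms(4)
    by (simp add: a_minus_def M.M.a_comm[of x y] M.M.a_assoc M.M.r_neg)
  then show ?thesis using S(6)[of "x \<oplus>\<^bsub>M\<^esub> y" x] S(3)[of x y] assms by auto
qed

lemma submodule_Int: "submodule A R M \<Longrightarrow> submodule B R M \<Longrightarrow> module R M \<Longrightarrow> submodule (A \<inter> B) R M"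
  by (rule submoduleI') (auto dest: submoduleD)

lemma submodule_module: "submodule N R M \<Longrightarrow> module R M \<Longrightarrow> module R (M\<lparr>carrier := N\<rparr>)"
  by (rule submodule.submodule_is_module)

lemma submodule_zero: "module R M \<Longrightarrow> submodule {\<zero>\<^bsub>M\<^esub>} R M"
proof -
  assume M: "module R M"
  interpret M: module R M by fact
  show ?thesis by (rule submoduleI'[OF M]) auto
qed

lemma submodule_of_submodule:
  assumes "submodule N R M" "module R M"
  shows "submodule T R (M\<lparr>carrier := N\<rparr>) \<longleftrightarrow> submodule T R M \<and> T \<subseteq> N"
proof
  assume "submodule T R (M\<lparr>carrier := N\<rparr>)"
  note T = submoduleD[OF this submodule_module[OF assms]]
  show "submodule T R M \<and> T \<subseteq> N"
    using T submoduleD(1)[OF assms] by (auto intro!: submoduleI'[OF assms(2)])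
next
  assume "submodule T R M \<and> T \<subseteq> N"
  then show "submodule T R (M\<lparr>carrier := N\<rparr>)"
    using submoduleD[OF _ assms(2), of T] by (auto intro!: submoduleI'[OF submodule_module[OF assms]])
qed

lemma submodule_vimage:
  assumes "f \<in> mhom R M N" "module R M" "module R N" "submodule K R N"
  shows "submodule {x \<in> carrier M. f x \<in> K} R M"
proof -
  interpret M: module R M by fact
  note K = submoduleD[OF assms(4,3)]
  show ?thesis
    by (rule submoduleI'[OF assms(2)])
      (auto simp: mhom_add[OF assms(1)] mhom_smult[OF assms(1)] mhom_zero[OF assms(1-3)] K)
qed

lemma submodule_kernel:
  assumes "f \<in> mhom R M N" "module R M" "module R N"
  shows "submodule {x \<in> carrier M. f x = \<zero>\<^bsub>N\<^esub>} R M"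
  using submodule_vimage[OF assms submodule_zero[OF assms(3)]] by simp

lemma submodule_image:
  assumes "f \<in> mhom R M N" "module R M" "module R N" "submodule K R M"
  shows "submodule (f ` K) R N"
proof -
  interpret M: module R M by fact
  note K = submoduleD[OF assms(4,2)]
  show ?thesis
  proof (rule submoduleI'[OF assms(3)])
    show "\<zero>\<^bsub>N\<^esub> \<in> f ` K" using K(2) mhom_zero[OF assms(1-3)] by force
    show "x \<oplus>\<^bsub>N\<^esub> y \<in> f ` K" if xy: "x \<in> f ` K" "y \<in> f ` K" for x y
    proof -
      obtain u v where "u \<in> K" "v \<in> K" "x = f u" "y = f v" using xy by blast
      then show ?thesis using K(3)[of u v] K(1) mhom_add[OF assms(1), of u v] by force
    qed
    show "a \<odot>\<^bsub>N\<^esub> x \<in> f ` K" if a: "a \<in> carrier R" and x: "x \<in> f ` K" for a x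
    proof -
      obtain u where "u \<in> K" "x = f u" using x by auto
      then show ?thesis using K(4)[of a u] K(1) mhom_smult[OF assms(1), of a u] a by force
    qed
  qed (use K mhom_closed[OF assms(1)] in auto)
qed

lemma mspan_incl: "A \<subseteq> mspan R M A"
  by (auto simp: mspan_def)

lemma mspan_submodule:
  assumes "module R M" "A \<subseteq> carrier M"
  shows "submodule (mspan R M A) R M"
proof -
  interpret M: module R M by fact
  note c = M.carrier_is_submodule
  show ?thesis
    by (rule submoduleI'[OF assms(1)])
      (use c assms in \<open>auto simp: mspan_def submoduleD[OF _ assms(1)]\<close>)
qed

lemma mspan_mono: "module R M \<Longrightarrow> A \<subseteq> B \<Longrightarrow> mspan R M A \<subseteq> mspan R M B"
  by (auto simp: mspan_def)

lemma mspan_eqI: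
  "submodule N R M \<Longrightarrow> A \<subseteq> N \<Longrightarrow> N \<subseteq> mspan R M A \<Longrightarrow> mspan R M A = N"
  using mspan_subset by blast

lemma mspan_of_submodule:
  assumes "submodule N R M" "module R M" "A \<subseteq> N"
  shows "mspan R (M\<lparr>carrier := N\<rparr>) A = mspan R M A"
proof
  have "submodule (mspan R M A) R M"
    using mspan_submodule[OF assms(2)] submoduleD(1)[OF assms(1,2)] assms(3) by auto
  then show "mspan R (M\<lparr>carrier := N\<rparr>) A \<subseteq> mspan R M A"
    by (intro mspan_subset) (simp_all add: submodule_of_submodule assms mspan_incl mspan_subset)
  show "mspan R M A \<subseteq> mspan R (M\<lparr>carrier := N\<rparr>) A"
    using assms submodule_of_submodule[OF assms(1,2)] by (auto simp: mspan_def)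
qed

lemma fg_image:
  assumes "f \<in> mhom R M N" "fg_module R M" "module R N" "f ` carrier M = carrier N"
  shows "fg_module R N"
proof -
  have M: "module R M" using assms by (simp add: fg_module_def)
  interpret N: module R N by fact
  obtain A where A: "finite A" "A \<subseteq> carrier M" "mspan R M A = carrier M"
    using assms by (auto simp: fg_module_def)
  have fA: "f ` A \<subseteq> carrier N" using A assms by auto
  have sub: "submodule {x \<in> carrier M. f x \<in> mspan R N (f ` A)} R M"
    by (rule submodule_vimage[OF assms(1) M assms(3)]) (rule mspan_submodule[OF assms(3) fA])
  have "mspan R M A \<subseteq> {x \<in> carrier M. f x \<in> mspan R N (f ` A)}"
    by (rule mspan_subset[OF sub]) (use A mspan_incl in fast)
  then have "f ` carrier M \<subseteq> mspan R N (f ` A)" unfolding A(3) by blast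
  then have "carrier N \<subseteq> mspan R N (f ` A)" unfolding assms(4) .
  then have "mspan R N (f ` A) = carrier N"
    using mspan_subset[OF N.carrier_is_submodule fA] by blast
  then show ?thesis using A fA assms(3) unfolding fg_module_def by blast
qed

lemma mhom_eq_on_mspan:
  assumes "f \<in> mhom R M N" "g \<in> mhom R M N" "module R M" "module R N" "A \<subseteq> carrier M"
    and "\<And>x. x \<in> A \<Longrightarrow> f x = g x" "x \<in> mspan R M A"
  shows "f x = g x"
proof -
  interpret M: module R M by fact
  have "submodule {x \<in> carrier M. f x = g x} R M"
    by (rule submoduleI'[OF assms(3)])
      (auto simp: mhom_add[OF assms(1)] mhom_smult[OF assms(1)] mhom_add[OF assms(2)]
        mhom_smult[OF assms(2)] mhom_zero[OF assms(1,3,4)] mhom_zero[OF assms(2,3,4)])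
  then have "mspan R M A \<subseteq> {x \<in> carrier M. f x = g x}"
    by (rule mspan_subset) (use assms in auto)
  then show ?thesis using assms(7) by auto
qed

text \<open>
  \<open>K + xM\<close>: its quotient \<open>M/(K + xM)\<close> is \<open>(M/K)/x(M/K)\<close>.
\<close>

definition add_mult :: "('a, 'b, 'n) module_scheme \<Rightarrow> 'b set \<Rightarrow> 'a \<Rightarrow> 'b set" where
  "add_mult M K x = {u \<oplus>\<^bsub>M\<^esub> x \<odot>\<^bsub>M\<^esub> v | u v. u \<in> K \<and> v \<in> carrier M}"

lemma add_mult_submodule:
  assumes M: "module R M" and K: "submodule K R M" and x: "x \<in> carrier R"
  shows "submodule (add_mult M K x) R M" "K \<subseteq> add_mult M K x"
    "\<And>v. v \<in> carrier M \<Longrightarrow> x \<odot>\<^bsub>M\<^esub> v \<in> add_mult M K x"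
proof -
  interpret M: module R M by fact
  note k = submoduleD[OF K M]
  have kc[simp]: "u \<in> K \<Longrightarrow> u \<in> carrier M" for u using k by auto
  show "submodule (add_mult M K x) R M"
  proof (rule submoduleI'[OF M])
    show "add_mult M K x \<subseteq> carrier M" using x by (auto simp: add_mult_def)
    show "\<zero>\<^bsub>M\<^esub> \<in> add_mult M K x" using k x unfolding add_mult_def
      by (intro CollectI exI[of _ "\<zero>\<^bsub>M\<^esub>"]) auto
    show "a \<odot>\<^bsub>M\<^esub> w \<in> add_mult M K x" if a: "a \<in> carrier R" and w: "w \<in> add_mult M K x" for a w
    proof -
      obtain u v where uv: "w = u \<oplus>\<^bsub>M\<^esub> x \<odot>\<^bsub>M\<^esub> v" "u \<in> K" "v \<in> carrier M"
        using w by (auto simp: add_mult_def)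
      have "a \<odot>\<^bsub>M\<^esub> w = a \<odot>\<^bsub>M\<^esub> u \<oplus>\<^bsub>M\<^esub> x \<odot>\<^bsub>M\<^esub> (a \<odot>\<^bsub>M\<^esub> v)"
        using uv a x by (simp add: M.smult_r_distr M.R.m_comm flip: M.smult_assoc1)
      then show ?thesis using uv a k(4)[of a u] by (auto simp: add_mult_def)
    qed
    show "w \<oplus>\<^bsub>M\<^esub> w' \<in> add_mult M K x" if w: "w \<in> add_mult M K x" "w' \<in> add_mult M K x" for w w'
    proof -
      obtain u v where uv: "w = u \<oplus>\<^bsub>M\<^esub> x \<odot>\<^bsub>M\<^esub> v" "u \<in> K" "v \<in> carrier M"
        using w by (auto simp: add_mult_def)
      obtain u' v' where uv': "w' = u' \<oplus>\<^bsub>M\<^esub> x \<odot>\<^bsub>M\<^esub> v'" "u' \<in> K" "v' \<in> carrier M"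
        using w by (auto simp: add_mult_def)
      have "w \<oplus>\<^bsub>M\<^esub> w' = (u \<oplus>\<^bsub>M\<^esub> u') \<oplus>\<^bsub>M\<^esub> x \<odot>\<^bsub>M\<^esub> (v \<oplus>\<^bsub>M\<^esub> v')"
        using uv uv' x by (simp add: M.smult_r_distr M.M.a_ac)
      then show ?thesis using uv uv' k(3)[of u u'] by (auto simp: add_mult_def)
    qed
  qed
  show "K \<subseteq> add_mult M K x"
  proof
    fix u assume "u \<in> K"
    then show "u \<in> add_mult M K x" using x unfolding add_mult_def
      by (intro CollectI exI[of _ u] exI[of _ "\<zero>\<^bsub>M\<^esub>"]) auto
  qed
  show "x \<odot>\<^bsub>M\<^esub> v \<in> add_mult M K x" if "v \<in> carrier M" for v
    using that x k unfolding add_mult_def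
    by (intro CollectI exI[of _ "\<zero>\<^bsub>M\<^esub>"] exI[of _ v]) auto
qed

lemma add_mult_least:
  assumes "module R M" "submodule N R M" "K \<subseteq> N" "\<And>v. v \<in> carrier M \<Longrightarrow> x \<odot>\<^bsub>M\<^esub> v \<in> N"
  shows "add_mult M K x \<subseteq> N"
  using assms submoduleD(3)[OF assms(2,1)] by (auto simp: add_mult_def)

lemma add_mult_commute:
  assumes M: "module R M" and K: "submodule K R M" and x: "x \<in> carrier R" and y: "y \<in> carrier R"
  shows "add_mult M (add_mult M K x) y = add_mult M (add_mult M K y) x"
proof -
  have "add_mult M (add_mult M K x) y \<subseteq> add_mult M (add_mult M K y) x"
    if x: "x \<in> carrier R" and y: "y \<in> carrier R" for x y
  proof -
    note A = add_mult_submodule[OF M K y]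
    note B = add_mult_submodule[OF M A(1) x]
    show ?thesis
      by (intro add_mult_least[OF M B(1)]) (use A B in auto)
  qed
  then show ?thesis using x y by blast
qed


section \<open>Noetherian modules\<close>

context cring
begin

lemma idealI':
  assumes "I \<subseteq> carrier R" "\<zero> \<in> I" "\<And>x y. x \<in> I \<Longrightarrow> y \<in> I \<Longrightarrow> x \<oplus> y \<in> I"
    and "\<And>a x. a \<in> carrier R \<Longrightarrow> x \<in> I \<Longrightarrow> a \<otimes> x \<in> I"
  shows "ideal I R"
proof (rule idealI[OF ring_axioms])
  show "subgroup I (add_monoid R)"
  proof (rule subgroup.intro)
    fix x assume x: "x \<in> I"
    then have "\<ominus> x = (\<ominus> \<one>) \<otimes> x" using assms(1) by (simp add: l_minus subset_iff)
    then have "\<ominus> x \<in> I" using assms(4)[of "\<ominus> \<one>" x] x by simp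
    then show "inv\<^bsub>add_monoid R\<^esub> x \<in> I" by (simp add: a_inv_def)
  qed (use assms in auto)
  show "x \<otimes> a \<in> I" if "a \<in> I" "x \<in> carrier R" for a x using that assms by auto
  show "a \<otimes> x \<in> I" if "a \<in> I" "x \<in> carrier R" for a x
  proof -
    have "a \<otimes> x = x \<otimes> a" using that assms(1) by (simp add: m_comm subset_iff)
    then show ?thesis using that assms by auto
  qed
qed

lemma mspan_insert:
  assumes M: "module R M" and g: "g \<in> carrier M" and A: "A \<subseteq> carrier M"
  shows "mspan R M (insert g A) = {r \<odot>\<^bsub>M\<^esub> g \<oplus>\<^bsub>M\<^esub> y | r y. r \<in> carrier R \<and> y \<in> mspan R M A}"
    (is "_ = ?T")
proof (rule mspan_eqI)
  interpret M: module R M by fact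
  note S = submoduleD[OF mspan_submodule[OF M A] M]
  have [simp]: "y \<in> carrier M" if "y \<in> mspan R M A" for y using that S(1) by auto
  show "submodule ?T R M"
  proof (rule submoduleI'[OF M])
    show "?T \<subseteq> carrier M" using g by auto
    show "\<zero>\<^bsub>M\<^esub> \<in> ?T" using g S(2) by (intro CollectI exI[of _ \<zero>] exI[of _ "\<zero>\<^bsub>M\<^esub>"]) auto
    show "w \<oplus>\<^bsub>M\<^esub> w' \<in> ?T" if w: "w \<in> ?T" "w' \<in> ?T" for w w'
    proof -
      obtain r y where a: "w = r \<odot>\<^bsub>M\<^esub> g \<oplus>\<^bsub>M\<^esub> y" "r \<in> carrier R" "y \<in> mspan R M A" using w by auto
      obtain r' y' where b: "w' = r' \<odot>\<^bsub>M\<^esub> g \<oplus>\<^bsub>M\<^esub> y'" "r' \<in> carrier R" "y' \<in> mspan R M A" using w by auto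
      have "w \<oplus>\<^bsub>M\<^esub> w' = (r \<oplus> r') \<odot>\<^bsub>M\<^esub> g \<oplus>\<^bsub>M\<^esub> (y \<oplus>\<^bsub>M\<^esub> y')"
        using a b g by (simp add: M.smult_l_distr M.M.a_ac)
      then show ?thesis using a b S(3)[of y y'] by blast
    qed
    show "a \<odot>\<^bsub>M\<^esub> w \<in> ?T" if a: "a \<in> carrier R" and w: "w \<in> ?T" for a w
    proof -
      obtain r y where y: "w = r \<odot>\<^bsub>M\<^esub> g \<oplus>\<^bsub>M\<^esub> y" "r \<in> carrier R" "y \<in> mspan R M A" using w by auto
      have "a \<odot>\<^bsub>M\<^esub> w = (a \<otimes> r) \<odot>\<^bsub>M\<^esub> g \<oplus>\<^bsub>M\<^esub> a \<odot>\<^bsub>M\<^esub> y"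
        using a y g by (simp add: M.smult_r_distr M.smult_assoc1)
      then show ?thesis using a y S(4)[of a y] by blast
    qed
  qed
  show "insert g A \<subseteq> ?T"
  proof
    fix x assume "x \<in> insert g A"
    then show "x \<in> ?T"
    proof
      assume "x = g" then show ?thesis
        using g S(2) by (intro CollectI exI[of _ \<one>] exI[of _ "\<zero>\<^bsub>M\<^esub>"]) auto
    next
      assume "x \<in> A" then have "x \<in> mspan R M A" using mspan_incl by fast
      then show ?thesis using g by (intro CollectI exI[of _ \<zero>] exI[of _ x]) auto
    qed
  qed
  have iA: "insert g A \<subseteq> carrier M" using g A by auto
  note S' = submoduleD[OF mspan_submodule[OF M iA] M]
  have "g \<in> mspan R M (insert g A)" using mspan_incl[of "insert g A"] by fast
  moreover have "mspan R M A \<subseteq> mspan R M (insert g A)" by (rule mspan_mono[OF M]) auto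
  ultimately show "?T \<subseteq> mspan R M (insert g A)" using S' by auto
qed

lemma mspan_empty:
  assumes M: "module R M"
  shows "mspan R M {} = {\<zero>\<^bsub>M\<^esub>}"
  by (rule mspan_eqI[OF submodule_zero[OF M]])
    (use submoduleD(2)[OF mspan_submodule[OF M, of "{}"] M] in auto)

end

context noetherian_local_ring
begin

text \<open>
  Hilbert's argument, by induction on the number of generators of the ambient span: the
  coefficients of one generator, over all elements of \<open>S\<close>, form an ideal. Finitely many elements
  of \<open>S\<close> realise the generators of that ideal, and what remains of \<open>S\<close> lies in the span of the
  other generators.
\<close>

lemma submodule_of_mspan_fg:
  assumes M: "module R M" and "finite A" "A \<subseteq> carrier M"
    and "submodule S R M" "S \<subseteq> mspan R M A"
  shows "\<exists>B. finite B \<and> B \<subseteq> S \<and> mspan R M B = S"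
  using assms(2-)
proof (induction A arbitrary: S)
  case empty
  then have "S = {\<zero>\<^bsub>M\<^esub>}" using mspan_empty[OF M] submoduleD(2)[OF empty(2) M] by auto
  then show ?case using mspan_empty[OF M] by (intro exI[of _ "{}"]) auto
next
  case (insert g A)
  interpret M: module R M by fact
  have g: "g \<in> carrier M" and A: "A \<subseteq> carrier M" using insert by auto
  note sp = mspan_submodule[OF M A]
  note spD = submoduleD[OF sp M]
  note S = submoduleD[OF insert.prems(2) M]
  have [simp]: "y \<in> carrier M" if "y \<in> mspan R M A" for y using that spD(1) by auto
  (* the ideal of coefficients of g in N *)
  define co where "co N = {r \<in> carrier R. \<exists>y\<in>mspan R M A. r \<odot>\<^bsub>M\<^esub> g \<oplus>\<^bsub>M\<^esub> y \<in> N}" for N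
  have co_ideal: "ideal (co N) R" if N: "submodule N R M" for N
  proof (rule idealI')
    note n = submoduleD[OF N M]
    show "\<zero> \<in> co N" using g spD(2) n(2) by (auto simp: co_def intro!: bexI[of _ "\<zero>\<^bsub>M\<^esub>"])
    show "x \<oplus> y \<in> co N" if xy: "x \<in> co N" "y \<in> co N" for x y
    proof -
      obtain u v where u: "u \<in> mspan R M A" "x \<odot>\<^bsub>M\<^esub> g \<oplus>\<^bsub>M\<^esub> u \<in> N" 
        and v: "v \<in> mspan R M A" "y \<odot>\<^bsub>M\<^esub> g \<oplus>\<^bsub>M\<^esub> v \<in> N" and c: "x \<in> carrier R" "y \<in> carrier R"
        using xy by (auto simp: co_def)
      have "(x \<oplus> y) \<odot>\<^bsub>M\<^esub> g \<oplus>\<^bsub>M\<^esub> (u \<oplus>\<^bsub>M\<^esub> v) = (x \<odot>\<^bsub>M\<^esub> g \<oplus>\<^bsub>M\<^esub> u) \<oplus>\<^bsub>M\<^esub> (y \<odot>\<^bsub>M\<^esub> g \<oplus>\<^bsub>M\<^esub> v)"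
        using u v c g by (simp add: M.smult_l_distr M.M.a_ac)
      then show ?thesis using u v c n(3) spD(3)[of u v] by (auto simp: co_def intro!: bexI[of _ "u \<oplus>\<^bsub>M\<^esub> v"])
    qed
    show "a \<otimes> x \<in> co N" if a: "a \<in> carrier R" and x: "x \<in> co N" for a x
    proof -
      obtain u where u: "u \<in> mspan R M A" "x \<odot>\<^bsub>M\<^esub> g \<oplus>\<^bsub>M\<^esub> u \<in> N" and c: "x \<in> carrier R"
        using x by (auto simp: co_def)
      have "(a \<otimes> x) \<odot>\<^bsub>M\<^esub> g \<oplus>\<^bsub>M\<^esub> (a \<odot>\<^bsub>M\<^esub> u) = a \<odot>\<^bsub>M\<^esub> (x \<odot>\<^bsub>M\<^esub> g \<oplus>\<^bsub>M\<^esub> u)"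
        using u c a g by (simp add: M.smult_r_distr M.smult_assoc1)
      then show ?thesis using u a c n(4) spD(4)[of a u] by (auto simp: co_def intro!: bexI[of _ "a \<odot>\<^bsub>M\<^esub> u"])
    qed
  qed (auto simp: co_def)
  obtain G where G: "G \<subseteq> carrier R" "finite G" "co S = Idl G"
    using finetely_gen[OF co_ideal[OF insert.prems(2)]] by auto
  have "\<forall>r\<in>G. \<exists>y\<in>mspan R M A. r \<odot>\<^bsub>M\<^esub> g \<oplus>\<^bsub>M\<^esub> y \<in> S"
    using genideal_self[OF G(1)] G(3) by (auto simp: co_def)
  then obtain h where h: "\<And>r. r \<in> G \<Longrightarrow> h r \<in> mspan R M A" "\<And>r. r \<in> G \<Longrightarrow> r \<odot>\<^bsub>M\<^esub> g \<oplus>\<^bsub>M\<^esub> h r \<in> S"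
    by metis
  obtain B' where B': "finite B'" "B' \<subseteq> S \<inter> mspan R M A" "mspan R M B' = S \<inter> mspan R M A"
    using insert.IH[OF A submodule_Int[OF insert.prems(2) sp M]] by auto
  define B where "B = B' \<union> (\<lambda>r. r \<odot>\<^bsub>M\<^esub> g \<oplus>\<^bsub>M\<^esub> h r) ` G"
  have BS: "B \<subseteq> S" using B' h by (auto simp: B_def)
  then have Bc: "B \<subseteq> carrier M" using S(1) by auto
  note Bsp = mspan_submodule[OF M Bc]
  note BspD = submoduleD[OF Bsp M]
  have "G \<subseteq> co (mspan R M B)"
    using G h mspan_incl[of B R M] by (fastforce simp: co_def B_def)
  then have IT: "co S \<subseteq> co (mspan R M B)"
    using G(3) genideal_minimal[OF co_ideal[OF Bsp]] by auto
  have "S \<subseteq> mspan R M B"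
  proof
    fix s assume s: "s \<in> S"
    then obtain r y where ry: "s = r \<odot>\<^bsub>M\<^esub> g \<oplus>\<^bsub>M\<^esub> y" "r \<in> carrier R" "y \<in> mspan R M A"
      using insert.prems(3) mspan_insert[OF M g A] by auto
    then have "r \<in> co (mspan R M B)" using s IT by (auto simp: co_def)
    then obtain y' where y': "y' \<in> mspan R M A" "r \<odot>\<^bsub>M\<^esub> g \<oplus>\<^bsub>M\<^esub> y' \<in> mspan R M B" (is "?z \<in> _")
      by (auto simp: co_def)
    have zS: "?z \<in> S" using y' mspan_subset[OF insert.prems(2) BS] by auto
    have eq: "s \<ominus>\<^bsub>M\<^esub> ?z = y \<ominus>\<^bsub>M\<^esub> y'"
      using ry y' g M.M.r_neg1[of "r \<odot>\<^bsub>M\<^esub> g"]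
      by (simp add: a_minus_def M.M.minus_add M.M.a_assoc M.M.a_comm[of _ y]
        M.M.a_lcomm[of y "\<ominus>\<^bsub>M\<^esub> (r \<odot>\<^bsub>M\<^esub> g)"] M.M.a_comm[of "r \<odot>\<^bsub>M\<^esub> g"] M.M.r_neg2 M.M.l_neg)
    then have "s \<ominus>\<^bsub>M\<^esub> ?z \<in> S \<inter> mspan R M A" using S(6)[OF s zS] spD(6)[OF ry(3) y'(1)] by simp
    then have "s \<ominus>\<^bsub>M\<^esub> ?z \<in> mspan R M B" using B'(3) mspan_mono[OF M, of B' B] by (auto simp: B_def)
    then have "(s \<ominus>\<^bsub>M\<^esub> ?z) \<oplus>\<^bsub>M\<^esub> ?z \<in> mspan R M B" using BspD(3) y'(2) by blast
    moreover have "(s \<ominus>\<^bsub>M\<^esub> ?z) \<oplus>\<^bsub>M\<^esub> ?z = s"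
      using s zS S(1) by (simp add: a_minus_def M.M.a_assoc M.M.l_neg subset_iff)
    ultimately show "s \<in> mspan R M B" by simp
  qed
  then have "mspan R M B = S" using mspan_eqI[OF insert.prems(2) BS] by auto
  moreover have "finite B" using B' G by (auto simp: B_def)
  ultimately show ?case using BS by auto
qed

lemma submodule_generators:
  assumes "fg_module R M" "submodule S R M"
  shows "\<exists>B. finite B \<and> B \<subseteq> S \<and> mspan R M B = S"
proof -
  have M: "module R M" using assms by (simp add: fg_module_def)
  obtain A where A: "finite A" "A \<subseteq> carrier M" "mspan R M A = carrier M"
    using assms by (auto simp: fg_module_def)
  show ?thesis using submodule_of_mspan_fg[OF M A(1,2) assms(2)] A(3) submoduleD(1)[OF assms(2) M] by auto
qed

lemma submodule_fg:
  assumes "fg_module R M" "submodule S R M"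
  shows "fg_module R (M\<lparr>carrier := S\<rparr>)"
proof -
  have M: "module R M" using assms by (simp add: fg_module_def)
  obtain B where B: "finite B" "B \<subseteq> S" "mspan R M B = S" using submodule_generators[OF assms] by auto
  show ?thesis unfolding fg_module_def
    using submodule_module[OF assms(2) M] mspan_of_submodule[OF assms(2) M B(2)] B by auto
qed

lemma submodule_mod_cat: "X \<in> mod_cat R \<Longrightarrow> submodule S R X \<Longrightarrow> X\<lparr>carrier := S\<rparr> \<in> mod_cat R"
  by (simp add: mod_cat_def submodule_fg)

text \<open>
  A chain of submodules is bounded by its union: the union is finitely generated, so it is
  already a member of the chain and inherits the property \<open>Q\<close>.
\<close>

lemma maximal_submodule:
  assumes M: "fg_module R M" and S0: "submodule S0 R M" "Q S0"
  obtains S where "submodule S R M" "Q S" "\<And>T. submodule T R M \<Longrightarrow> Q T \<Longrightarrow> S \<subseteq> T \<Longrightarrow> T = S"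
proof -
  define \<S> where "\<S> = {S. submodule S R M \<and> Q S}"
  have sub: "\<And>S. S \<in> \<S> \<Longrightarrow> submodule S R M" by (simp add: \<S>_def)
  have ne: "\<S> \<noteq> {}" using S0 by (auto simp: \<S>_def)
  have "\<exists>S\<in>\<S>. \<forall>T\<in>\<S>. S \<subseteq> T \<longrightarrow> T = S"
  proof (rule subset_Zorn_nonempty[OF ne])
    have mM: "module R M" using M by (simp add: fg_module_def)
    fix C assume C: "C \<noteq> {}" "subset.chain \<S> C"
    have CS: "C \<subseteq> \<S>" using C by (auto simp: subset.chain_def)
    have tot: "A \<subseteq> B \<or> B \<subseteq> A" if "A \<in> C" "B \<in> C" for A B 
      using C(2) that unfolding subset.chain_def by blast
    have U: "submodule (\<Union>C) R M"
    proof (rule submoduleI'[OF mM])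
      show "\<Union>C \<subseteq> carrier M" using CS sub submoduleD(1)[OF _ mM] by blast
      obtain c where "c \<in> C" using C by auto
      then show "\<zero>\<^bsub>M\<^esub> \<in> \<Union>C" using CS sub submoduleD(2)[OF _ mM] by blast
      show "x \<oplus>\<^bsub>M\<^esub> y \<in> \<Union>C" if xy: "x \<in> \<Union>C" "y \<in> \<Union>C" for x y
      proof -
        obtain A B where AB: "A \<in> C" "B \<in> C" "x \<in> A" "y \<in> B" using xy by auto
        then obtain D where "D \<in> C" "x \<in> D" "y \<in> D" using tot[of A B] by blast
        then show ?thesis using CS sub submoduleD(3)[OF _ mM] by blast
      qed
      show "a \<odot>\<^bsub>M\<^esub> x \<in> \<Union>C" if "a \<in> carrier R" "x \<in> \<Union>C" for a x
        using that CS sub submoduleD(4)[OF _ mM] by blast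
    qed
    obtain B where B: "finite B" "B \<subseteq> \<Union>C" "mspan R M B = \<Union>C" using submodule_generators[OF M U] by auto
    obtain c where c: "c \<in> C" "B \<subseteq> c"
      using finite_subset_Union_chain[OF B(1,2) C] by blast
    have "\<Union>C \<subseteq> c" using mspan_subset[OF sub c(2)] CS c B by auto
    then have "\<Union>C = c" using c by auto
    then show "\<Union>C \<in> \<S>" using c CS by auto
  qed
  then obtain S where S: "S \<in> \<S>" "\<forall>T\<in>\<S>. S \<subseteq> T \<longrightarrow> T = S" by (elim bexE)
  show ?thesis by (rule that[of S]) (use S in \<open>simp_all add: \<S>_def\<close>)
qed

lemma maximal_ideal_with:
  assumes "ideal I R" "Q I"
  obtains J where "ideal J R" "Q J" "\<And>K. ideal K R \<Longrightarrow> Q K \<Longrightarrow> J \<subseteq> K \<Longrightarrow> K = J"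
proof -
  let ?F = "{J. ideal J R \<and> Q J}"
  have "\<exists>J\<in>?F. \<forall>K\<in>?F. J \<subseteq> K \<longrightarrow> K = J"
  proof (rule subset_Zorn_nonempty)
    show "?F \<noteq> {}" using assms by auto
    fix C assume C: "C \<noteq> {}" "subset.chain ?F C"
    then have "subset.chain {I. ideal I R} C" by (auto simp: subset.chain_def)
    then have "\<Union>C \<in> C" by (rule ideal_chain_is_trivial[OF C(1)])
    then show "\<Union>C \<in> ?F" using C(2) unfolding subset.chain_def by fast
  qed
  then obtain J where J: "J \<in> ?F" "\<forall>K\<in>?F. J \<subseteq> K \<longrightarrow> K = J" by (elim bexE)
  show ?thesis by (rule that[of J]) (use J in simp_all)
qed

end

section \<open>Primes, annihilators and avoidance\<close>

lemma primeideal_ideal: "primeideal P R \<Longrightarrow> ideal P R"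
  by (simp add: primeideal_def)

context cring
begin

lemma module_self: "module R (self_mod R)"
proof (rule moduleI[OF is_cring])
  show "abelian_group (self_mod R)"
  proof (rule abelian_groupI, goal_cases)
    case (6 x)
    then show ?case by (intro bexI[of _ "\<ominus> x"]) (auto simp: self_mod_def l_neg)
  qed (auto simp: self_mod_def a_ac)
qed (auto simp: self_mod_def l_distr r_distr m_assoc)

lemma self_mod_simps [simp]:
  "carrier (self_mod R) = carrier R" "zero (self_mod R) = \<zero>" "add (self_mod R) = add R"
  "smult (self_mod R) = mult R"
  by (auto simp: self_mod_def)

lemma idealD:
  assumes "ideal I R"
  shows "I \<subseteq> carrier R" "\<zero> \<in> I" "\<And>x y. x \<in> I \<Longrightarrow> y \<in> I \<Longrightarrow> x \<oplus> y \<in> I"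
    "\<And>a x. a \<in> carrier R \<Longrightarrow> x \<in> I \<Longrightarrow> a \<otimes> x \<in> I" "\<And>a x. a \<in> carrier R \<Longrightarrow> x \<in> I \<Longrightarrow> x \<otimes> a \<in> I"
    "\<And>x. x \<in> I \<Longrightarrow> \<ominus> x \<in> I"
proof -
  interpret ideal I R by fact
  show "I \<subseteq> carrier R" by (rule a_subset)
  show "\<zero> \<in> I" by (rule zero_closed)
  show "x \<oplus> y \<in> I" if "x \<in> I" "y \<in> I" for x y using that by (rule a_closed)
  show "a \<otimes> x \<in> I" if "a \<in> carrier R" "x \<in> I" for a x using I_l_closed[OF that(2,1)] .
  show "x \<otimes> a \<in> I" if "a \<in> carrier R" "x \<in> I" for a x using I_r_closed[OF that(2,1)] .
  show "\<ominus> x \<in> I" if "x \<in> I" for x using that by (rule a_inv_closed)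
qed

lemma submodule_self_iff: "submodule I R (self_mod R) \<longleftrightarrow> ideal I R"
proof
  assume "submodule I R (self_mod R)"
  note I = submoduleD[OF this module_self, unfolded self_mod_simps]
  show "ideal I R" by (rule idealI') (use I in auto)
next
  assume "ideal I R"
  note I = idealD[OF this]
  show "submodule I R (self_mod R)"
    by (rule submoduleI'[OF module_self]) (use I in \<open>simp_all\<close>)
qed

lemma primeD:
  assumes "primeideal P R"
  shows "\<one> \<notin> P" "\<And>a b. a \<in> carrier R \<Longrightarrow> b \<in> carrier R \<Longrightarrow> a \<otimes> b \<in> P \<Longrightarrow> a \<in> P \<or> b \<in> P"
proof -
  interpret primeideal P R by fact
  show "\<one> \<notin> P" using I_notcarr one_imp_carrier by metis
  show "a \<in> P \<or> b \<in> P" if "a \<in> carrier R" "b \<in> carrier R" "a \<otimes> b \<in> P" for a b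
    using I_prime[OF that] .
qed

lemma primeI:
  assumes "ideal P R" "\<one> \<notin> P" "\<And>a b. a \<in> carrier R \<Longrightarrow> b \<in> carrier R \<Longrightarrow> a \<otimes> b \<in> P \<Longrightarrow> a \<notin> P \<Longrightarrow> b \<in> P"
  shows "primeideal P R"
proof (rule primeidealI[OF assms(1) is_cring])
  show "carrier R \<noteq> P" using assms(2) one_closed by metis
  show "a \<in> P \<or> b \<in> P" if "a \<in> carrier R" "b \<in> carrier R" "a \<otimes> b \<in> P" for a b
    using assms(3)[OF that] by metis
qed

text \<open>
  The product of elements, one from each ideal and all outside the prime, lies in every ideal
  and, by primality, outside the prime.
\<close>

lemma intersection_not_in_prime:
  assumes "finite \<I>" "primeideal P R" "\<And>I. I \<in> \<I> \<Longrightarrow> ideal I R \<and> \<not> I \<subseteq> P"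
  shows "\<exists>r\<in>carrier R. r \<notin> P \<and> (\<forall>I\<in>\<I>. r \<in> I)"
  using assms(1,3)
proof (induction rule: finite_induct)
  case empty
  then show ?case using primeD(1)[OF assms(2)] by auto
next
  case (insert I F)
  then obtain r where r: "r \<in> carrier R" "r \<notin> P" "\<forall>I\<in>F. r \<in> I" by auto
  obtain s where s: "s \<in> I" "s \<notin> P" using insert by auto
  have sc: "s \<in> carrier R" using s insert idealD(1) by blast
  have "r \<otimes> s \<notin> P" using primeD(2)[OF assms(2) r(1) sc] r s by auto
  moreover have "r \<otimes> s \<in> J" if "J \<in> insert I F" for J
    using that insert.prems[of J] r s sc idealD(4,5)[of J] by auto
  ultimately show ?case using r sc by auto
qed

text \<open>
  By induction on the set of primes, which may be assumed pairwise incomparable. If \<open>x \<in> I\<close>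
  avoids all primes but \<open>Q\<close>, and \<open>y \<in> I\<close> lies in all primes but \<open>Q\<close>, then \<open>x\<close> or \<open>x + y\<close> avoids
  them all.
\<close>

lemma prime_avoidance:
  assumes "finite \<P>" "ideal I R" "\<And>P. P \<in> \<P> \<Longrightarrow> primeideal P R" "\<And>P. P \<in> \<P> \<Longrightarrow> \<not> I \<subseteq> P"
  shows "\<exists>x\<in>I. \<forall>P\<in>\<P>. x \<notin> P"
  using assms(1,3,4)
proof (induction \<P> rule: finite_psubset_induct)
  case (psubset \<P>)
  show ?case
  proof (cases "\<exists>P\<in>\<P>. \<exists>Q\<in>\<P>. P \<noteq> Q \<and> P \<subseteq> Q")
    case True
    then obtain P Q where PQ: "P \<in> \<P>" "Q \<in> \<P>" "P \<noteq> Q" "P \<subseteq> Q" by auto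
    have "\<P> - {P} \<subset> \<P>" using PQ by auto
    from psubset.IH[OF this] psubset.prems obtain x where "x \<in> I" "\<forall>P\<in>\<P> - {P}. x \<notin> P" by auto
    then show ?thesis using PQ by (intro bexI[of _ x]) auto
  next
    case anti: False
    show ?thesis
    proof (cases "\<P> = {}")
      case True
      then show ?thesis using idealD(2)[OF assms(2)] by auto
    next
      case False
      then obtain Q where Q: "Q \<in> \<P>" by auto
      have pQ: "primeideal Q R" using Q psubset.prems by auto
      have "\<P> - {Q} \<subset> \<P>" using Q by auto
      from psubset.IH[OF this] psubset.prems obtain x where x: "x \<in> I" "\<forall>P\<in>\<P> - {Q}. x \<notin> P" by auto
      show ?thesis
      proof (cases "x \<in> Q")
        case xQ: True
        have "\<exists>r\<in>carrier R. r \<notin> Q \<and> (\<forall>J\<in>insert I (\<P> - {Q}). r \<in> J)"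
          by (rule intersection_not_in_prime[OF _ pQ])
            (use psubset.hyps assms(2) psubset.prems anti Q in \<open>auto dest: primeideal_ideal\<close>)
        then obtain y where y: "y \<in> carrier R" "y \<notin> Q" "y \<in> I" "\<forall>P\<in>\<P> - {Q}. y \<in> P" by auto
        have xc: "x \<in> carrier R" using x idealD(1)[OF assms(2)] by auto
        have e1: "(x \<oplus> y) \<oplus> \<ominus> y = x" using xc y(1) by (simp add: a_assoc r_neg)
        have e2: "(x \<oplus> y) \<oplus> \<ominus> x = y" using xc y(1) by (simp add: a_comm[of x y] a_assoc r_neg)
        have "x \<oplus> y \<notin> P" if P: "P \<in> \<P>" for P
        proof
          assume a: "x \<oplus> y \<in> P"
          note d = idealD[OF primeideal_ideal[OF psubset.prems(1)[OF P]]]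
          show False
          proof (cases "P = Q")
            case True
            then have "(x \<oplus> y) \<oplus> \<ominus> x \<in> P" using d(3)[OF a d(6)[of x]] xQ by simp
            then show False using e2 y True by simp
          next
            case False
            then have "(x \<oplus> y) \<oplus> \<ominus> y \<in> P" using d(3)[OF a d(6)[of y]] y P by simp
            then show False using e1 x P False by simp
          qed
        qed
        moreover have "x \<oplus> y \<in> I" using x y idealD(3)[OF assms(2)] by auto
        ultimately show ?thesis by auto
      qed (use x in auto)
    qed
  qed
qed

end

text \<open>
  \<open>colon R M U v\<close> is the annihilator of the class of \<open>v\<close> in \<open>M/U\<close>, and \<open>quot_ann R M U\<close> that of
  \<open>M/U\<close>.
\<close>

definition colon :: "('a, 'm) ring_scheme \<Rightarrow> ('a, 'b, 'n) module_scheme \<Rightarrow> 'b set \<Rightarrow> 'b \<Rightarrow> 'a set" where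
  "colon R M U v = {r \<in> carrier R. r \<odot>\<^bsub>M\<^esub> v \<in> U}"

definition quot_ann :: "('a, 'm) ring_scheme \<Rightarrow> ('a, 'b, 'n) module_scheme \<Rightarrow> 'b set \<Rightarrow> 'a set" where
  "quot_ann R M U = {r \<in> carrier R. \<forall>v\<in>carrier M. r \<odot>\<^bsub>M\<^esub> v \<in> U}"

lemma colon_ideal:
  assumes M: "module R M" and U: "submodule U R M" and v: "v \<in> carrier M"
  shows "ideal (colon R M U v) R"
proof -
  interpret M: module R M by fact
  note u = submoduleD[OF U M]
  show ?thesis
  proof (rule M.R.idealI')
    show "colon R M U v \<subseteq> carrier R" by (auto simp: colon_def)
    show "\<zero>\<^bsub>R\<^esub> \<in> colon R M U v" using v u(2) by (simp add: colon_def)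
    show "x \<oplus>\<^bsub>R\<^esub> y \<in> colon R M U v" if "x \<in> colon R M U v" "y \<in> colon R M U v" for x y
      using that v u(3)[of "x \<odot>\<^bsub>M\<^esub> v" "y \<odot>\<^bsub>M\<^esub> v"] by (simp add: colon_def M.smult_l_distr)
    show "a \<otimes>\<^bsub>R\<^esub> x \<in> colon R M U v" if "a \<in> carrier R" "x \<in> colon R M U v" for a x
      using that v u(4)[of a "x \<odot>\<^bsub>M\<^esub> v"] by (simp add: colon_def M.smult_assoc1)
  qed
qed

lemma quot_ann_ideal:
  assumes M: "module R M" and U: "submodule U R M"
  shows "ideal (quot_ann R M U) R"
proof -
  interpret M: module R M by fact
  note u = submoduleD[OF U M]
  show ?thesis
  proof (rule M.R.idealI')
    show "quot_ann R M U \<subseteq> carrier R" by (auto simp: quot_ann_def)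
    show "\<zero>\<^bsub>R\<^esub> \<in> quot_ann R M U" using u(2) by (simp add: quot_ann_def)
    show "x \<oplus>\<^bsub>R\<^esub> y \<in> quot_ann R M U" if "x \<in> quot_ann R M U" "y \<in> quot_ann R M U" for x y
      using that u(3) by (simp add: quot_ann_def M.smult_l_distr)
    show "a \<otimes>\<^bsub>R\<^esub> x \<in> quot_ann R M U" if "a \<in> carrier R" "x \<in> quot_ann R M U" for a x
      using that u(4) by (simp add: quot_ann_def M.smult_assoc1)
  qed
qed

context noetherian_local_ring
begin

lemma m_max: "maximalideal \<mm> R"
  using maximalideal_iff by blast

lemma m_prime: "primeideal \<mm> R"
  by (rule maximalideal_prime[OF m_max])

lemma m_ideal: "ideal \<mm> R"
  by (rule primeideal_ideal[OF m_prime])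

lemma m_carrier: "x \<in> \<mm> \<Longrightarrow> x \<in> carrier R"
  using idealD(1)[OF m_ideal] by auto

lemma proper_ideal_in_m:
  assumes I: "ideal I R" "\<one> \<notin> I"
  shows "I \<subseteq> \<mm>"
proof -
  have I0: "I \<subseteq> I \<and> \<one> \<notin> I" using I by simp
  obtain J where J: "ideal J R" "I \<subseteq> J \<and> \<one> \<notin> J"
    and mx: "\<And>K. ideal K R \<Longrightarrow> I \<subseteq> K \<and> \<one> \<notin> K \<Longrightarrow> J \<subseteq> K \<Longrightarrow> K = J"
    by (rule maximal_ideal_with[where Q = "\<lambda>J. I \<subseteq> J \<and> \<one> \<notin> J", OF I(1) I0]) (rule that)
  have "maximalideal J R"
  proof (rule maximalidealI[OF J(1)])
    show "carrier R \<noteq> J" using J(2) one_closed by metis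
    fix K assume K: "ideal K R" "J \<subseteq> K" "K \<subseteq> carrier R"
    show "K = J \<or> K = carrier R"
    proof (cases "\<one> \<in> K")
      case True
      then show ?thesis using ideal.one_imp_carrier[OF K(1)] by simp
    next
      case False
      then show ?thesis using mx[OF K(1)] K(2) J(2) by blast
    qed
  qed
  then show ?thesis using J maximalideal_iff by auto
qed

lemma prime_in_m: "primeideal P R \<Longrightarrow> P \<subseteq> \<mm>"
  using proper_ideal_in_m primeideal_ideal primeD(1) by blast

lemma nonmaximal_iff: "primeideal P R \<Longrightarrow> \<not> maximalideal P R \<longleftrightarrow> P \<noteq> \<mm>"
  using maximalideal_iff by auto

lemma unit_outside_m:
  assumes "a \<in> carrier R" "a \<notin> \<mm>"
  shows "\<exists>b\<in>carrier R. b \<otimes> a = \<one>"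
proof (rule ccontr)
  assume n: "\<not> ?thesis"
  have "ideal (PIdl a) R" using assms(1) by (rule cgenideal_ideal)
  moreover have "\<one> \<notin> PIdl a" using n assms(1) by (auto simp: cgenideal_def)
  ultimately have "PIdl a \<subseteq> \<mm>" by (rule proper_ideal_in_m)
  then show False using assms cgenideal_self[OF assms(1)] by auto
qed

text \<open>
  An ideal maximal among those that contain \<open>I\<close> and miss \<open>S\<close> is prime: if neither \<open>a\<close> nor \<open>b\<close>
  lies in it, enlarging it by either one reaches \<open>S\<close>, and the product of the two elements
  reached shows that \<open>ab\<close> does not lie in it.
\<close>

lemma prime_disjoint_from_multiplicative:
  assumes I: "ideal I R" and S: "S \<noteq> {}" "S \<subseteq> carrier R" "\<And>a b. a \<in> S \<Longrightarrow> b \<in> S \<Longrightarrow> a \<otimes> b \<in> S"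
    and dis: "I \<inter> S = {}"
  shows "\<exists>P. primeideal P R \<and> I \<subseteq> P \<and> P \<inter> S = {}"
proof -
  have I0: "I \<subseteq> I \<and> I \<inter> S = {}" using dis by simp
  obtain J where J': "ideal J R" "I \<subseteq> J \<and> J \<inter> S = {}"
    and mx': "\<And>K. ideal K R \<Longrightarrow> I \<subseteq> K \<and> K \<inter> S = {} \<Longrightarrow> J \<subseteq> K \<Longrightarrow> K = J"
    by (rule maximal_ideal_with[where Q = "\<lambda>J. I \<subseteq> J \<and> J \<inter> S = {}", OF I I0]) (rule that)
  have J: "ideal J R" "I \<subseteq> J" "J \<inter> S = {}" using J' by simp_all
  have mx: "K = J" if "ideal K R" "J \<subseteq> K" "K \<inter> S = {}" for K
    using mx'[OF that(1)] that J(2) by simp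
  note j = idealD[OF J(1)]
  have hit: "\<exists>c\<in>J. \<exists>r\<in>carrier R. c \<oplus> a \<otimes> r \<in> S" if a: "a \<in> carrier R" "a \<notin> J" for a
  proof -
    have JS: "submodule J R (self_mod R)" using J by (simp add: submodule_self_iff)
    have a': "a \<in> carrier R" using a by simp
    note K = add_mult_submodule[OF module_self JS a']
    have "a \<otimes> \<one> \<in> add_mult (self_mod R) J a" using K(3)[of \<one>] by simp
    then have "add_mult (self_mod R) J a \<noteq> J" using a by auto
    then have "add_mult (self_mod R) J a \<inter> S \<noteq> {}"
      using mx[of "add_mult (self_mod R) J a"] K(1,2) submodule_self_iff by auto
    then show ?thesis by (auto simp: add_mult_def)
  qed
  have "primeideal J R"
  proof (rule primeI[OF J(1)])
    obtain s where "s \<in> S" using S by auto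
    then have "s \<notin> J" "s \<in> carrier R" using J(3) S(2) by blast+
    then have "s \<otimes> \<one> \<notin> J" by simp
    then show "\<one> \<notin> J" using j(4)[of s \<one>] \<open>s \<in> S\<close> S(2) by auto
    fix a b assume ab: "a \<in> carrier R" "b \<in> carrier R" "a \<otimes> b \<in> J" "a \<notin> J"
    show "b \<in> J"
    proof (rule ccontr)
      assume "b \<notin> J"
      then obtain c r c' r' where h: "c \<in> J" "r \<in> carrier R" "c \<oplus> a \<otimes> r \<in> S"
        "c' \<in> J" "r' \<in> carrier R" "c' \<oplus> b \<otimes> r' \<in> S" using hit ab by metis
      have cc: "c \<in> carrier R" "c' \<in> carrier R" using h j(1) by auto
      have "(c \<oplus> a \<otimes> r) \<otimes> (c' \<oplus> b \<otimes> r') = c \<otimes> (c' \<oplus> b \<otimes> r') \<oplus> ((a \<otimes> r) \<otimes> c' \<oplus> (r \<otimes> r') \<otimes> (a \<otimes> b))"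
        using h cc ab by (simp add: l_distr r_distr m_ac a_ac)
      also have "\<dots> \<in> J"
        using j(5)[OF _ h(1), of "c' \<oplus> b \<otimes> r'"] j(4)[OF _ h(4), of "a \<otimes> r"]
          j(4)[OF _ ab(3), of "r \<otimes> r'"] h cc ab by (intro j(3)) simp_all
      finally show False using S(3)[OF h(3,6)] J(3) by auto
    qed
  qed
  then show ?thesis using J by auto
qed

text \<open>
  Noetherian induction. An ideal \<open>J\<close> maximal among the counterexamples is proper and not prime,
  say \<open>ab \<in> J\<close> with \<open>a, b \<notin> J\<close>. Every prime over \<open>J\<close> contains \<open>J + (a)\<close> or \<open>J + (b)\<close>, so the
  finite sets for these two ideals serve for \<open>J\<close> as well.
\<close>

lemma finite_covering_primes:
  assumes "ideal I R"
  shows "\<exists>\<Q>. finite \<Q> \<and> (\<forall>Q\<in>\<Q>. primeideal Q R \<and> I \<subseteq> Q) \<and>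
    (\<forall>P. primeideal P R \<and> I \<subseteq> P \<longrightarrow> (\<exists>Q\<in>\<Q>. Q \<subseteq> P))" (is "?ok I")
proof (rule ccontr)
  assume I0: "\<not> ?ok I"
  obtain J where J: "ideal J R" "\<not> ?ok J" and
    mx': "\<And>K. ideal K R \<Longrightarrow> \<not> ?ok K \<Longrightarrow> J \<subseteq> K \<Longrightarrow> K = J"
    by (rule maximal_ideal_with[where Q = "\<lambda>J. \<not> ?ok J", OF assms I0]) (rule that)
  have mx: "?ok K" if "ideal K R" "J \<subseteq> K" "K \<noteq> J" for K
    by (rule ccontr) (use mx'[OF that(1) _ that(2)] that(3) in simp)
  have JS: "submodule J R (self_mod R)" using J by (simp add: submodule_self_iff)
  have ok: "?ok (add_mult (self_mod R) J a)" if a: "a \<in> carrier R" "a \<notin> J" for a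
  proof (rule mx)
    note K = add_mult_submodule[OF module_self JS a(1)]
    show "ideal (add_mult (self_mod R) J a) R" using K(1) submodule_self_iff by auto
    show "J \<subseteq> add_mult (self_mod R) J a" by (rule K)
    have "a \<otimes> \<one> \<in> add_mult (self_mod R) J a" using K(3)[of \<one>] by simp
    then show "add_mult (self_mod R) J a \<noteq> J" using a by auto
  qed
  have one: "\<one> \<notin> J"
  proof
    assume o: "\<one> \<in> J"
    have "?ok J" using primeD(1) o by (intro exI[of _ "{}"]) blast
    then show False using J by simp
  qed
  have "\<not> primeideal J R"
  proof
    assume p: "primeideal J R"
    have "?ok J" using p by (intro exI[of _ "{J}"]) auto
    then show False using J by simp
  qed
  then obtain a b where ab: "a \<in> carrier R" "b \<in> carrier R" "a \<otimes> b \<in> J" "a \<notin> J" "b \<notin> J"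
    using primeI[OF J(1) one] by blast
  note Ka = add_mult_submodule[OF module_self JS ab(1)]
  note Kb = add_mult_submodule[OF module_self JS ab(2)]
  obtain A where A: "finite A" "\<forall>Q\<in>A. primeideal Q R \<and> add_mult (self_mod R) J a \<subseteq> Q"
    "\<forall>P. primeideal P R \<and> add_mult (self_mod R) J a \<subseteq> P \<longrightarrow> (\<exists>Q\<in>A. Q \<subseteq> P)" using ok[OF ab(1,4)] by blast
  obtain B where B: "finite B" "\<forall>Q\<in>B. primeideal Q R \<and> add_mult (self_mod R) J b \<subseteq> Q"
    "\<forall>P. primeideal P R \<and> add_mult (self_mod R) J b \<subseteq> P \<longrightarrow> (\<exists>Q\<in>B. Q \<subseteq> P)" using ok[OF ab(2,5)] by blast
  have ex: "\<exists>Q\<in>A \<union> B. Q \<subseteq> P" if P: "primeideal P R" "J \<subseteq> P" for P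
  proof -
    note pd = idealD[OF primeideal_ideal[OF P(1)]]
    have PS: "submodule P R (self_mod R)" using primeideal_ideal[OF P(1)] by (simp add: submodule_self_iff)
    have "a \<in> P \<or> b \<in> P" using primeD(2)[OF P(1) ab(1,2)] ab P by auto
    then show ?thesis
    proof
      assume "a \<in> P"
      then have "add_mult (self_mod R) J a \<subseteq> P"
        by (intro add_mult_least[OF module_self PS P(2)]) (simp add: pd(5))
      then obtain Q where "Q \<in> A" "Q \<subseteq> P" using A(3) P(1) by meson
      then show ?thesis by (intro bexI[of _ Q]) simp_all
    next
      assume "b \<in> P"
      then have "add_mult (self_mod R) J b \<subseteq> P"
        by (intro add_mult_least[OF module_self PS P(2)]) (simp add: pd(5))
      then obtain Q where "Q \<in> B" "Q \<subseteq> P" using B(3) P(1) by meson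
      then show ?thesis by (intro bexI[of _ Q]) simp_all
    qed
  qed
  have inc: "primeideal Q R \<and> J \<subseteq> Q" if "Q \<in> A \<union> B" for Q
    using that A(2) B(2) Ka(2) Kb(2) by (meson UnE subset_trans)
  have "?ok J"
    by (rule exI[of _ "A \<union> B"]) (use A(1) B(1) inc ex in simp)
  then show False using J by simp
qed

text \<open>
  A maximal annihilator of a nonzero class in \<open>M/U\<close> is a prime: if \<open>ab\<close> kills \<open>w\<close> and \<open>b\<close> does
  not, then the annihilator of \<open>bw\<close> contains that of \<open>w\<close>, so equals it, and contains \<open>a\<close>.
\<close>

lemma maximal_colon_prime:
  assumes M: "module R M" and U: "submodule U R M" and w: "w \<in> carrier M" "w \<notin> U"
    and mx: "\<And>v. v \<in> carrier M \<Longrightarrow> v \<notin> U \<Longrightarrow> colon R M U w \<subseteq> colon R M U v \<Longrightarrow> colon R M U v = colon R M U w"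
  shows "primeideal (colon R M U w) R"
proof (rule primeI[OF colon_ideal[OF M U w(1)]])
  interpret M: module R M by fact
  note u = submoduleD[OF U M]
  show "\<one> \<notin> colon R M U w" using w by (simp add: colon_def)
  fix a b assume ab: "a \<in> carrier R" "b \<in> carrier R" "a \<otimes> b \<in> colon R M U w" "a \<notin> colon R M U w"
  have aw: "a \<odot>\<^bsub>M\<^esub> w \<in> carrier M" "a \<odot>\<^bsub>M\<^esub> w \<notin> U" using ab w by (auto simp: colon_def)
  have "colon R M U w \<subseteq> colon R M U (a \<odot>\<^bsub>M\<^esub> w)"
  proof
    fix r assume r: "r \<in> colon R M U w"
    then have rc: "r \<in> carrier R" by (simp add: colon_def)
    have "r \<odot>\<^bsub>M\<^esub> (a \<odot>\<^bsub>M\<^esub> w) = a \<odot>\<^bsub>M\<^esub> (r \<odot>\<^bsub>M\<^esub> w)"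
      using rc ab w by (simp add: m_comm flip: M.smult_assoc1)
    then show "r \<in> colon R M U (a \<odot>\<^bsub>M\<^esub> w)" using r u(4)[OF ab(1), of "r \<odot>\<^bsub>M\<^esub> w"] by (simp add: colon_def)
  qed
  then have e: "colon R M U (a \<odot>\<^bsub>M\<^esub> w) = colon R M U w" using mx[OF aw] by simp
  have "b \<odot>\<^bsub>M\<^esub> (a \<odot>\<^bsub>M\<^esub> w) = (a \<otimes> b) \<odot>\<^bsub>M\<^esub> w"
    using ab w by (simp add: m_comm flip: M.smult_assoc1)
  then have "b \<in> colon R M U (a \<odot>\<^bsub>M\<^esub> w)" using ab by (simp add: colon_def)
  then show "b \<in> colon R M U w" using e by simp
qed

text \<open>
  The maximal annihilators of nonzero classes of \<open>M/U\<close> are finitely many primes whose union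
  consists of the elements that fail to be regular on \<open>M/U\<close>. These associated primes are all
  that prime avoidance needs.
\<close>

definition max_colons :: "('a, 'e, 'k) module_scheme \<Rightarrow> 'e set \<Rightarrow> 'a set set" where
  "max_colons M U = {colon R M U w | w. w \<in> carrier M \<and> w \<notin> U \<and>
     (\<forall>v\<in>carrier M. v \<notin> U \<longrightarrow> colon R M U w \<subseteq> colon R M U v \<longrightarrow> colon R M U v = colon R M U w)}"

lemma max_colons_prime:
  assumes M: "module R M" and U: "submodule U R M" and P: "P \<in> max_colons M U"
  shows "primeideal P R"
proof -
  obtain w where w: "P = colon R M U w" "w \<in> carrier M" "w \<notin> U"
    "\<forall>v\<in>carrier M. v \<notin> U \<longrightarrow> colon R M U w \<subseteq> colon R M U v \<longrightarrow> colon R M U v = colon R M U w"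
    using P by (auto simp: max_colons_def)
  show ?thesis unfolding w(1) by (rule maximal_colon_prime[OF M U w(2,3)]) (use w(4) in blast)
qed

lemma colon_below_max:
  assumes M: "module R M" and U: "submodule U R M" and v: "v \<in> carrier M" "v \<notin> U"
  shows "\<exists>P\<in>max_colons M U. colon R M U v \<subseteq> P"
proof -
  let ?Q = "\<lambda>J. \<exists>w. J = colon R M U w \<and> w \<in> carrier M \<and> w \<notin> U \<and> colon R M U v \<subseteq> colon R M U w"
  have Q0: "?Q (colon R M U v)" using v by blast
  obtain J where J: "ideal J R" "?Q J"
    and mx': "\<And>K. ideal K R \<Longrightarrow> ?Q K \<Longrightarrow> J \<subseteq> K \<Longrightarrow> K = J"
    by (rule maximal_ideal_with[where Q = ?Q, OF colon_ideal[OF M U v(1)] Q0]) (rule that)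
  obtain w where w: "w \<in> carrier M" "w \<notin> U" "colon R M U v \<subseteq> colon R M U w" and Jw: "J = colon R M U w"
    using J(2) by blast
  have "colon R M U w \<in> max_colons M U"
    unfolding max_colons_def
  proof (intro CollectI exI[of _ w] conjI ballI impI refl w)
    fix v' assume h: "v' \<in> carrier M" "v' \<notin> U" "colon R M U w \<subseteq> colon R M U v'"
    then have "?Q (colon R M U v')" using w by blast
    then show "colon R M U v' = colon R M U w"
      using mx'[OF colon_ideal[OF M U h(1)]] h(3) unfolding Jw by simp
  qed
  then show ?thesis using w by blast
qed

text \<open>
  Representatives of the maximal annihilators generate, together with \<open>U\<close>, a submodule that is
  already generated by finitely many of them; an element that kills those kills all, so each
  maximal annihilator contains the intersection of finitely many, hence, being a prime, contains
  and therefore equals one of them.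
\<close>

lemma finite_max_colons:
  assumes fg: "fg_module R M" and U: "submodule U R M"
  shows "finite (max_colons M U)"
proof -
  have M: "module R M" using fg by (simp add: fg_module_def)
  interpret M: module R M by fact
  note u = submoduleD[OF U M]
  have "\<forall>P\<in>max_colons M U. \<exists>w. P = colon R M U w \<and> w \<in> carrier M \<and> w \<notin> U \<and>
     (\<forall>v\<in>carrier M. v \<notin> U \<longrightarrow> P \<subseteq> colon R M U v \<longrightarrow> colon R M U v = P)"
    by (auto simp: max_colons_def)
  then obtain w where ww: "\<forall>P\<in>max_colons M U. P = colon R M U (w P) \<and> w P \<in> carrier M \<and> w P \<notin> U \<and>
     (\<forall>v\<in>carrier M. v \<notin> U \<longrightarrow> P \<subseteq> colon R M U v \<longrightarrow> colon R M U v = P)"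
    unfolding bchoice_iff by (elim exE)
  have w: "\<And>P. P \<in> max_colons M U \<Longrightarrow> P = colon R M U (w P)"
    "\<And>P. P \<in> max_colons M U \<Longrightarrow> w P \<in> carrier M" "\<And>P. P \<in> max_colons M U \<Longrightarrow> w P \<notin> U"
    "\<And>P v. P \<in> max_colons M U \<Longrightarrow> v \<in> carrier M \<Longrightarrow> v \<notin> U \<Longrightarrow> P \<subseteq> colon R M U v \<Longrightarrow> colon R M U v = P"
    using ww by blast+
  let ?F = "{mspan R M (U \<union> w ` F) | F. finite F \<and> F \<subseteq> max_colons M U}"
  have gen: "U \<union> w ` F \<subseteq> carrier M" if "F \<subseteq> max_colons M U" for F
    using that w(2) u(1) by auto
  have S0: "mspan R M (U \<union> w ` {}) \<in> ?F" by blast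
  have S1: "submodule (mspan R M (U \<union> w ` {})) R M" by (rule mspan_submodule[OF M gen]) simp
  obtain S where S: "submodule S R M" "S \<in> ?F"
    and mx': "\<And>T. submodule T R M \<Longrightarrow> T \<in> ?F \<Longrightarrow> S \<subseteq> T \<Longrightarrow> T = S"
    by (rule maximal_submodule[OF fg S1, where Q = "\<lambda>S. S \<in> ?F", OF S0]) (rule that)
  obtain F where F: "finite F" "F \<subseteq> max_colons M U" and SF: "S = mspan R M (U \<union> w ` F)"
    using S(2) unfolding mem_Collect_eq by (elim exE conjE) (rule that)
  have mx: "T = mspan R M (U \<union> w ` F)" if "T \<in> ?F" "mspan R M (U \<union> w ` F) \<subseteq> T" for T
  proof -
    have "submodule T R M" using that(1) gen mspan_submodule[OF M] by auto
    then show ?thesis using mx'[OF _ that(1)] that(2) SF by simp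
  qed
  have "P \<in> F" if P: "P \<in> max_colons M U" for P
  proof -
    have "mspan R M (U \<union> w ` insert P F) \<in> ?F" using P F by blast
    moreover have "mspan R M (U \<union> w ` F) \<subseteq> mspan R M (U \<union> w ` insert P F)" by (rule mspan_mono[OF M]) auto
    ultimately have "mspan R M (U \<union> w ` insert P F) = mspan R M (U \<union> w ` F)" by (rule mx)
    moreover have "w P \<in> mspan R M (U \<union> w ` insert P F)" using mspan_incl by fast
    ultimately have wP: "w P \<in> mspan R M (U \<union> w ` F)" by simp
    have pP: "primeideal P R" by (rule max_colons_prime[OF M U P])
    have "\<exists>Q\<in>F. Q \<subseteq> P"
    proof (rule ccontr)
      assume n: "\<not> ?thesis"
      have "\<exists>r\<in>carrier R. r \<notin> P \<and> (\<forall>I\<in>F. r \<in> I)"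
        by (rule intersection_not_in_prime[OF F(1) pP])
          (use n F(2) max_colons_prime[OF M U] primeideal_ideal in blast)
      then obtain r where r: "r \<in> carrier R" "r \<notin> P" "\<And>Q. Q \<in> F \<Longrightarrow> r \<in> Q" by auto
      have "r \<odot>\<^bsub>M\<^esub> w Q \<in> U" if "Q \<in> F" for Q
        using r(3)[OF that] w(1)[of Q] F(2) that by (auto simp: colon_def)
      moreover have "submodule {v \<in> carrier M. r \<odot>\<^bsub>M\<^esub> v \<in> U} R M"
        using submodule_vimage[OF mhom_scale[OF mhom_id M r(1)] M M U] by simp
      ultimately have "mspan R M (U \<union> w ` F) \<subseteq> {v \<in> carrier M. r \<odot>\<^bsub>M\<^esub> v \<in> U}"
        using gen[OF F(2)] u(4)[OF r(1)] by (intro mspan_subset) auto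
      then have "r \<in> P" using wP r(1) w(1)[OF P] by (auto simp: colon_def)
      then show False using r by simp
    qed
    then obtain Q where Q: "Q \<in> F" "Q \<subseteq> P" by auto
    have "colon R M U (w P) = Q"
      by (rule w(4)) (use Q F P w in auto)
    then show ?thesis using w(1)[OF P] Q by simp
  qed
  then have "max_colons M U \<subseteq> F" by (rule subsetI)
  then show ?thesis using F(1) by (rule finite_subset)
qed


section \<open>Regular elements and depth\<close>

text \<open>
  Properties of \<open>M/U\<close> are stated in terms of \<open>M\<close> and \<open>U\<close>. A further quotient by \<open>x\<close> only
  enlarges \<open>U\<close> to \<open>U + xM\<close>, and interchanging two elements becomes an equality of submodules.
  Here \<open>regular_mod M U x\<close> says that \<open>x\<close> is a nonzerodivisor on \<open>M/U\<close>, and \<open>socle_free M U\<close> that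
  \<open>\<mm>\<close> kills no nonzero class of \<open>M/U\<close>.
\<close>

definition regular_mod :: "('a, 'e, 'k) module_scheme \<Rightarrow> 'e set \<Rightarrow> 'a \<Rightarrow> bool" where
  "regular_mod M U x \<longleftrightarrow> (\<forall>u\<in>carrier M. x \<odot>\<^bsub>M\<^esub> u \<in> U \<longrightarrow> u \<in> U)"

definition socle_free :: "('a, 'e, 'k) module_scheme \<Rightarrow> 'e set \<Rightarrow> bool" where
  "socle_free M U \<longleftrightarrow> (\<forall>u\<in>carrier M. (\<forall>r\<in>\<mm>. r \<odot>\<^bsub>M\<^esub> u \<in> U) \<longrightarrow> u \<in> U)"

text \<open>
  There are \<open>n\<close> elements of \<open>\<mm>\<close>, each regular on the quotient of \<open>M/U\<close> by its predecessors. The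
  last quotient may vanish.
\<close>

primrec depth_ge :: "('a, 'e, 'k) module_scheme \<Rightarrow> nat \<Rightarrow> 'e set \<Rightarrow> bool" where
  "depth_ge M 0 U = True"
| "depth_ge M (Suc n) U = (\<exists>x\<in>\<mm>. regular_mod M U x \<and> depth_ge M n (add_mult M U x))"

lemma regular_imp_socle_free: "x \<in> \<mm> \<Longrightarrow> regular_mod M U x \<Longrightarrow> socle_free M U"
  by (auto simp: regular_mod_def socle_free_def)

lemma depth_ge_Suc_socle_free: "depth_ge M (Suc n) U \<Longrightarrow> socle_free M U"
  using regular_imp_socle_free by auto

text \<open>
  Take the maximal annihilators. They contain every element that is not regular, and \<open>\<mm>\<close> is not
  among them because it would be the annihilator of a class in the socle.
\<close>

lemma socle_free_primes:
  assumes fg: "fg_module R M" and U: "submodule U R M" and s: "socle_free M U"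
  shows "\<exists>\<P>. finite \<P> \<and> (\<forall>P\<in>\<P>. primeideal P R \<and> P \<noteq> \<mm>) \<and>
    (\<forall>x\<in>carrier R. (\<forall>P\<in>\<P>. x \<notin> P) \<longrightarrow> regular_mod M U x)"
proof (intro exI[of _ "max_colons M U"] conjI ballI impI)
  have M: "module R M" using fg by (simp add: fg_module_def)
  show "finite (max_colons M U)" by (rule finite_max_colons[OF fg U])
  show "primeideal P R" if "P \<in> max_colons M U" for P by (rule max_colons_prime[OF M U that])
  show "P \<noteq> \<mm>" if P: "P \<in> max_colons M U" for P
  proof
    assume "P = \<mm>"
    then obtain w where "\<mm> = colon R M U w" "w \<in> carrier M" "w \<notin> U" using P by (auto simp: max_colons_def)
    moreover have "r \<odot>\<^bsub>M\<^esub> w \<in> U" if "r \<in> \<mm>" for r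
      using that \<open>\<mm> = colon R M U w\<close> unfolding colon_def by blast
    ultimately show False using s unfolding socle_free_def by blast
  qed
  fix x assume x: "x \<in> carrier R" "\<forall>P\<in>max_colons M U. x \<notin> P"
  show "regular_mod M U x" unfolding regular_mod_def
  proof (intro ballI impI, rule ccontr)
    fix u assume u: "u \<in> carrier M" "x \<odot>\<^bsub>M\<^esub> u \<in> U" "u \<notin> U"
    then obtain P where "P \<in> max_colons M U" "colon R M U u \<subseteq> P" using colon_below_max[OF M U] by blast
    then show False using x u by (auto simp: colon_def)
  qed
qed

lemma not_m_subset: "primeideal P R \<Longrightarrow> P \<noteq> \<mm> \<Longrightarrow> \<not> \<mm> \<subseteq> P"
  using prime_in_m by blast

text \<open>
  If \<open>y, z\<close> is a regular sequence, then \<open>yw = zv\<close> in \<open>M/U\<close> gives \<open>v = yt\<close> for some \<open>t\<close>, and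
  cancelling \<open>y\<close> gives \<open>w = zt\<close>.
\<close>

lemma regular_swap:
  assumes M: "module R M" and U: "submodule U R M" and z: "z \<in> carrier R" and y: "y \<in> carrier R"
    and ry: "regular_mod M U y" and rz: "regular_mod M (add_mult M U y) z"
  shows "regular_mod M (add_mult M U z) y"
  unfolding regular_mod_def
proof (intro ballI impI)
  interpret M: module R M by fact
  note u = submoduleD[OF U M]
  note Uy = add_mult_submodule[OF M U y]
  note Uyd = submoduleD[OF Uy(1) M]
  fix w assume w: "w \<in> carrier M" "y \<odot>\<^bsub>M\<^esub> w \<in> add_mult M U z"
  then obtain a v where a: "a \<in> U" "v \<in> carrier M" "y \<odot>\<^bsub>M\<^esub> w = a \<oplus>\<^bsub>M\<^esub> z \<odot>\<^bsub>M\<^esub> v"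
    by (auto simp: add_mult_def)
  have ac: "a \<in> carrier M" using a u by auto
  have "a \<oplus>\<^bsub>M\<^esub> z \<odot>\<^bsub>M\<^esub> v \<in> add_mult M U y" using a(3) Uy(3)[OF w(1)] by simp
  then have "z \<odot>\<^bsub>M\<^esub> v \<in> add_mult M U y"
    using submodule_add_cancel[OF Uy(1) M, of a "z \<odot>\<^bsub>M\<^esub> v"] a Uy(2) z by auto
  then have "v \<in> add_mult M U y" using rz a by (auto simp: regular_mod_def)
  then obtain b t where b: "b \<in> U" "t \<in> carrier M" "v = b \<oplus>\<^bsub>M\<^esub> y \<odot>\<^bsub>M\<^esub> t"
    by (auto simp: add_mult_def)
  have bc: "b \<in> carrier M" using b u by auto
  have "y \<odot>\<^bsub>M\<^esub> w = (a \<oplus>\<^bsub>M\<^esub> z \<odot>\<^bsub>M\<^esub> b) \<oplus>\<^bsub>M\<^esub> y \<odot>\<^bsub>M\<^esub> (z \<odot>\<^bsub>M\<^esub> t)"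
    unfolding a(3) b(3) using ac bc b z y
    by (simp add: M.smult_r_distr M.M.a_assoc m_comm flip: M.smult_assoc1)
  then have "y \<odot>\<^bsub>M\<^esub> (w \<oplus>\<^bsub>M\<^esub> \<ominus>\<^bsub>M\<^esub> (z \<odot>\<^bsub>M\<^esub> t)) = a \<oplus>\<^bsub>M\<^esub> z \<odot>\<^bsub>M\<^esub> b"
    using w b z y ac bc by (simp add: M.smult_r_distr M.smult_r_minus M.M.a_assoc M.M.r_neg)
  then have "w \<oplus>\<^bsub>M\<^esub> \<ominus>\<^bsub>M\<^esub> (z \<odot>\<^bsub>M\<^esub> t) \<in> U"
    using ry w b z u(3)[OF a(1) u(4)[OF z b(1)]] by (auto simp: regular_mod_def)
  moreover have "w = (w \<oplus>\<^bsub>M\<^esub> \<ominus>\<^bsub>M\<^esub> (z \<odot>\<^bsub>M\<^esub> t)) \<oplus>\<^bsub>M\<^esub> z \<odot>\<^bsub>M\<^esub> t"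
    using w b z by (simp add: M.M.a_assoc M.M.l_neg)
  ultimately show "w \<in> add_mult M U z" using b unfolding add_mult_def by blast
qed

text \<open>
  For a class \<open>w\<close> killed by \<open>\<mm>\<close> in \<open>M/(U + xM)\<close>, the equation \<open>yw = xv\<close> in \<open>M/U\<close> defines a class
  \<open>v\<close> killed by \<open>\<mm>\<close> in \<open>M/(U + yM)\<close>, since \<open>x\<close> is regular. If that class vanishes, then so does
  \<open>w\<close>, since \<open>y\<close> is regular.
\<close>

lemma socle_free_exchange:
  assumes M: "module R M" and U: "submodule U R M" and x: "x \<in> \<mm>" and y: "y \<in> \<mm>"
    and rx: "regular_mod M U x" and ry: "regular_mod M U y" and s: "socle_free M (add_mult M U y)"
  shows "socle_free M (add_mult M U x)"
  unfolding socle_free_def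
proof (intro ballI impI)
  interpret M: module R M by fact
  note u = submoduleD[OF U M]
  have xc: "x \<in> carrier R" and yc: "y \<in> carrier R" using x y m_carrier by auto
  fix w assume w: "w \<in> carrier M" "\<forall>r\<in>\<mm>. r \<odot>\<^bsub>M\<^esub> w \<in> add_mult M U x"
  then obtain a v where a: "a \<in> U" "v \<in> carrier M" "y \<odot>\<^bsub>M\<^esub> w = a \<oplus>\<^bsub>M\<^esub> x \<odot>\<^bsub>M\<^esub> v"
    using y by (fastforce simp: add_mult_def)
  have ac: "a \<in> carrier M" using a u by auto
  have "r \<odot>\<^bsub>M\<^esub> v \<in> add_mult M U y" if r: "r \<in> \<mm>" for r
  proof -
    have rc: "r \<in> carrier R" using r m_carrier by auto
    obtain b t where b: "b \<in> U" "t \<in> carrier M" "r \<odot>\<^bsub>M\<^esub> w = b \<oplus>\<^bsub>M\<^esub> x \<odot>\<^bsub>M\<^esub> t"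
      using w r by (fastforce simp: add_mult_def)
    have bc: "b \<in> carrier M" using b u by auto
    have "r \<odot>\<^bsub>M\<^esub> (y \<odot>\<^bsub>M\<^esub> w) = y \<odot>\<^bsub>M\<^esub> (r \<odot>\<^bsub>M\<^esub> w)"
      using rc yc w by (simp add: m_comm flip: M.smult_assoc1)
    then have e: "r \<odot>\<^bsub>M\<^esub> a \<oplus>\<^bsub>M\<^esub> x \<odot>\<^bsub>M\<^esub> (r \<odot>\<^bsub>M\<^esub> v) = y \<odot>\<^bsub>M\<^esub> b \<oplus>\<^bsub>M\<^esub> x \<odot>\<^bsub>M\<^esub> (y \<odot>\<^bsub>M\<^esub> t)"
      unfolding a(3) b(3) using ac bc b a rc xc yc
      by (simp add: M.smult_r_distr m_comm flip: M.smult_assoc1)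
    have "x \<odot>\<^bsub>M\<^esub> (r \<odot>\<^bsub>M\<^esub> v \<oplus>\<^bsub>M\<^esub> \<ominus>\<^bsub>M\<^esub> (y \<odot>\<^bsub>M\<^esub> t))
        = \<ominus>\<^bsub>M\<^esub> (r \<odot>\<^bsub>M\<^esub> a) \<oplus>\<^bsub>M\<^esub> ((r \<odot>\<^bsub>M\<^esub> a \<oplus>\<^bsub>M\<^esub> x \<odot>\<^bsub>M\<^esub> (r \<odot>\<^bsub>M\<^esub> v)) \<oplus>\<^bsub>M\<^esub> \<ominus>\<^bsub>M\<^esub> (x \<odot>\<^bsub>M\<^esub> (y \<odot>\<^bsub>M\<^esub> t)))"
      using ac a b rc xc yc by (simp add: M.smult_r_distr M.smult_r_minus M.M.a_assoc M.M.r_neg1)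
    also have "\<dots> = \<ominus>\<^bsub>M\<^esub> (r \<odot>\<^bsub>M\<^esub> a) \<oplus>\<^bsub>M\<^esub> y \<odot>\<^bsub>M\<^esub> b"
      unfolding e using ac a b bc rc xc yc by (simp add: M.M.a_assoc M.M.r_neg)
    also have "\<dots> \<in> U" using u rc yc a b by auto
    finally have "r \<odot>\<^bsub>M\<^esub> v \<oplus>\<^bsub>M\<^esub> \<ominus>\<^bsub>M\<^esub> (y \<odot>\<^bsub>M\<^esub> t) \<in> U"
      using rx a b rc yc by (auto simp: regular_mod_def)
    moreover have "r \<odot>\<^bsub>M\<^esub> v = (r \<odot>\<^bsub>M\<^esub> v \<oplus>\<^bsub>M\<^esub> \<ominus>\<^bsub>M\<^esub> (y \<odot>\<^bsub>M\<^esub> t)) \<oplus>\<^bsub>M\<^esub> y \<odot>\<^bsub>M\<^esub> t"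
      using a b rc yc by (simp add: M.M.a_assoc M.M.l_neg)
    ultimately show ?thesis using b unfolding add_mult_def by blast
  qed
  then have "v \<in> add_mult M U y" using s a by (auto simp: socle_free_def)
  then obtain b t where b: "b \<in> U" "t \<in> carrier M" "v = b \<oplus>\<^bsub>M\<^esub> y \<odot>\<^bsub>M\<^esub> t"
    by (auto simp: add_mult_def)
  have bc: "b \<in> carrier M" using b u by auto
  have "y \<odot>\<^bsub>M\<^esub> w = (a \<oplus>\<^bsub>M\<^esub> x \<odot>\<^bsub>M\<^esub> b) \<oplus>\<^bsub>M\<^esub> y \<odot>\<^bsub>M\<^esub> (x \<odot>\<^bsub>M\<^esub> t)"
    unfolding a(3) b(3) using ac bc b xc yc
    by (simp add: M.smult_r_distr M.M.a_assoc m_comm flip: M.smult_assoc1)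
  then have "y \<odot>\<^bsub>M\<^esub> (w \<oplus>\<^bsub>M\<^esub> \<ominus>\<^bsub>M\<^esub> (x \<odot>\<^bsub>M\<^esub> t)) = a \<oplus>\<^bsub>M\<^esub> x \<odot>\<^bsub>M\<^esub> b"
    using w b xc yc ac bc by (simp add: M.smult_r_distr M.smult_r_minus M.M.a_assoc M.M.r_neg)
  then have "w \<oplus>\<^bsub>M\<^esub> \<ominus>\<^bsub>M\<^esub> (x \<odot>\<^bsub>M\<^esub> t) \<in> U"
    using ry w b xc u(3)[OF a(1) u(4)[OF xc b(1)]] by (auto simp: regular_mod_def)
  moreover have "w = (w \<oplus>\<^bsub>M\<^esub> \<ominus>\<^bsub>M\<^esub> (x \<odot>\<^bsub>M\<^esub> t)) \<oplus>\<^bsub>M\<^esub> x \<odot>\<^bsub>M\<^esub> t"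
    using w b xc by (simp add: M.M.a_assoc M.M.l_neg)
  ultimately show "w \<in> add_mult M U x" using b unfolding add_mult_def by blast
qed

text \<open>
  Any regular element may begin a sequence of the available length. Let \<open>y\<close> begin a given
  sequence, and choose \<open>z \<in> \<mm>\<close> regular on \<open>M/U\<close>, \<open>M/(U + xM)\<close> and \<open>M/(U + yM)\<close>, which is
  possible because none of them has a socle. By induction, \<open>y\<close> can be continued by \<open>z\<close>, hence
  \<open>z\<close> by \<open>y\<close>; by induction again \<open>z\<close> can be continued by \<open>x\<close>, hence \<open>x\<close> by \<open>z\<close>, each time
  without loss of length.
\<close>

lemma depth_ge_exchange:
  assumes fg: "fg_module R M"
  shows "submodule U R M \<Longrightarrow> x \<in> \<mm> \<Longrightarrow> regular_mod M U x \<Longrightarrow> depth_ge M (Suc n) U \<Longrightarrow>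
    depth_ge M n (add_mult M U x)"
proof (induction n arbitrary: U x)
  case (Suc n)
  have M: "module R M" using fg by (simp add: fg_module_def)
  have xc: "x \<in> carrier R" using Suc m_carrier by auto
  obtain y where y: "y \<in> \<mm>" "regular_mod M U y" "depth_ge M (Suc n) (add_mult M U y)"
    using Suc.prems by auto
  have yc: "y \<in> carrier R" using y m_carrier by auto
  note Ux = add_mult_submodule[OF M Suc.prems(1) xc]
  note Uy = add_mult_submodule[OF M Suc.prems(1) yc]
  have sy: "socle_free M (add_mult M U y)" using depth_ge_Suc_socle_free[OF y(3)] .
  have sx: "socle_free M (add_mult M U x)"
    by (rule socle_free_exchange[OF M Suc.prems(1,2) y(1) Suc.prems(3) y(2) sy])
  have su: "socle_free M U" by (rule regular_imp_socle_free[OF y(1,2)])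
  obtain P1 where P1: "finite P1" "\<forall>P\<in>P1. primeideal P R \<and> P \<noteq> \<mm>"
    "\<forall>x\<in>carrier R. (\<forall>P\<in>P1. x \<notin> P) \<longrightarrow> regular_mod M (add_mult M U y) x"
    using socle_free_primes[OF fg Uy(1) sy] by auto
  obtain P2 where P2: "finite P2" "\<forall>P\<in>P2. primeideal P R \<and> P \<noteq> \<mm>"
    "\<forall>z\<in>carrier R. (\<forall>P\<in>P2. z \<notin> P) \<longrightarrow> regular_mod M (add_mult M U x) z"
    using socle_free_primes[OF fg Ux(1) sx] by auto
  obtain P3 where P3: "finite P3" "\<forall>P\<in>P3. primeideal P R \<and> P \<noteq> \<mm>"
    "\<forall>z\<in>carrier R. (\<forall>P\<in>P3. z \<notin> P) \<longrightarrow> regular_mod M U z"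
    using socle_free_primes[OF fg Suc.prems(1) su] by auto
  have PP: "primeideal P R" "\<not> \<mm> \<subseteq> P" if "P \<in> P1 \<union> P2 \<union> P3" for P
  proof -
    have "primeideal P R \<and> P \<noteq> \<mm>" using that P1(2) P2(2) P3(2) by (elim UnE) simp_all
    then show "primeideal P R" "\<not> \<mm> \<subseteq> P" using not_m_subset by simp_all
  qed
  have "finite (P1 \<union> P2 \<union> P3)" using P1 P2 P3 by simp
  then have "\<exists>z\<in>\<mm>. \<forall>P\<in>P1 \<union> P2 \<union> P3. z \<notin> P"
    by (rule prime_avoidance[OF _ m_ideal PP])
  then obtain z where z: "z \<in> \<mm>" "\<forall>P\<in>P1 \<union> P2 \<union> P3. z \<notin> P" by auto
  have zc: "z \<in> carrier R" using z m_carrier by auto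
  have rz: "regular_mod M (add_mult M U y) z" "regular_mod M (add_mult M U x) z" "regular_mod M U z"
    using P1 P2 P3 z zc by auto
  note Uz = add_mult_submodule[OF M Suc.prems(1) zc]
  have "depth_ge M n (add_mult M (add_mult M U y) z)" by (rule Suc.IH[OF Uy(1) z(1) rz(1) y(3)])
  then have "depth_ge M n (add_mult M (add_mult M U z) y)"
    by (simp add: add_mult_commute[OF M Suc.prems(1) yc zc])
  moreover have "regular_mod M (add_mult M U z) y"
    by (rule regular_swap[OF M Suc.prems(1) zc yc y(2) rz(1)])
  ultimately have dz: "depth_ge M (Suc n) (add_mult M U z)" using y by auto
  have "regular_mod M (add_mult M U z) x"
    by (rule regular_swap[OF M Suc.prems(1) zc xc Suc.prems(3) rz(2)])
  then have "depth_ge M n (add_mult M (add_mult M U z) x)"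
    by (rule Suc.IH[OF Uz(1) Suc.prems(2) _ dz])
  then have "depth_ge M n (add_mult M (add_mult M U x) z)"
    by (simp add: add_mult_commute[OF M Suc.prems(1) zc xc])
  then show ?case using z rz by auto
qed simp

end

section \<open>Chains of primes and submodules generated by sequences\<close>

definition prime_chain :: "('a, 'm) ring_scheme \<Rightarrow> nat \<Rightarrow> (nat \<Rightarrow> 'a set) \<Rightarrow> bool" where
  "prime_chain R n p \<longleftrightarrow> (\<forall>i\<le>n. primeideal (p i) R) \<and> (\<forall>i<n. p i \<subset> p (Suc i))"

lemma prime_chain_le_krull_dim:
  assumes "krull_dim R = enat d" "prime_chain R n p"
  shows "n \<le> d"
proof -
  have "enat n \<le> krull_dim R"
    unfolding krull_dim_def using assms(2) by (intro Sup_upper) (auto simp: prime_chain_def)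
  then show ?thesis using assms(1) by simp
qed

lemma prime_chain_snoc:
  assumes "prime_chain R n p" "primeideal q R" "p n \<subset> q"
  shows "prime_chain R (Suc n) (p(Suc n := q))"
  using assms by (auto simp: prime_chain_def le_Suc_eq less_Suc_eq)

lemma prime_chain_Cons:
  assumes "prime_chain R n p" "primeideal q R" "q \<subset> p 0"
  shows "prime_chain R (Suc n) (case_nat q p)"
  using assms by (auto simp: prime_chain_def split: nat.splits)

text \<open>
  \<open>(x\<^sub>1, \<dots>, x\<^sub>n)M\<close>, with one element added at a time as in a regular sequence.
\<close>

definition seq_sub :: "('a, 'b, 'n) module_scheme \<Rightarrow> 'a list \<Rightarrow> 'b set" where
  "seq_sub M xs = foldl (add_mult M) {\<zero>\<^bsub>M\<^esub>} xs"

lemma seq_sub_snoc [simp]: "seq_sub M (xs @ [x]) = add_mult M (seq_sub M xs) x"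
  by (simp add: seq_sub_def)

lemma seq_sub_Nil [simp]: "seq_sub M [] = {\<zero>\<^bsub>M\<^esub>}"
  by (simp add: seq_sub_def)

lemma seq_sub_submodule:
  assumes "module R M" "set xs \<subseteq> carrier R"
  shows "submodule (seq_sub M xs) R M"
  using assms(2)
proof (induction xs rule: rev_induct)
  case Nil
  then show ?case using submodule_zero[OF assms(1)] by simp
next
  case (snoc x xs)
  then show ?case using add_mult_submodule(1)[OF assms(1)] by simp
qed

lemma seq_submod_eq:
  assumes M: "module R M" and xs: "set xs \<subseteq> carrier R"
  shows "seq_submod R M xs = seq_sub M xs"
  using xs
proof (induction xs rule: rev_induct)
  case Nil
  interpret M: module R M by fact
  have "mspan R M {} = {\<zero>\<^bsub>M\<^esub>}" by (rule cring.mspan_empty[OF M.R.is_cring M])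
  then show ?case by (simp add: seq_submod_def)
next
  case (snoc x xs)
  interpret M: module R M by fact
  let ?G = "\<lambda>xs. {x \<odot>\<^bsub>M\<^esub> y | x y. x \<in> set xs \<and> y \<in> carrier M}"
  have x: "x \<in> carrier R" and xs: "set xs \<subseteq> carrier R" using snoc by auto
  have IH: "mspan R M (?G xs) = seq_sub M xs" using snoc by (simp add: seq_submod_def)
  note S = seq_sub_submodule[OF M xs]
  note A = add_mult_submodule[OF M S x]
  have G: "?G xs \<subseteq> seq_sub M xs" unfolding IH[symmetric] by (rule mspan_incl)
  have Gc: "?G (xs @ [x]) \<subseteq> carrier M" using x xs by auto
  have "mspan R M (?G (xs @ [x])) = add_mult M (seq_sub M xs) x"
  proof (rule mspan_eqI[OF A(1)])
    show "?G (xs @ [x]) \<subseteq> add_mult M (seq_sub M xs) x" using G A(2,3) by auto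
    show "add_mult M (seq_sub M xs) x \<subseteq> mspan R M (?G (xs @ [x]))"
    proof (rule add_mult_least[OF M mspan_submodule[OF M Gc]])
      show "seq_sub M xs \<subseteq> mspan R M (?G (xs @ [x]))"
        unfolding IH[symmetric] by (rule mspan_mono[OF M]) auto
      show "x \<odot>\<^bsub>M\<^esub> v \<in> mspan R M (?G (xs @ [x]))" if "v \<in> carrier M" for v
        by (rule subsetD[OF mspan_incl]) (use that in auto)
    qed
  qed
  then show ?case by (simp add: seq_submod_def)
qed

section \<open>Quotient modules\<close>

lemma quot_mod_simps [simp]:
  "carrier (quot_mod R M N) = a_rcosets\<^bsub>M\<^esub> N" "\<zero>\<^bsub>quot_mod R M N\<^esub> = N"
  "add (quot_mod R M N) = set_add M"
  by (simp_all add: quot_mod_def)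

context
  fixes R :: "('a, 'm) ring_scheme" and M :: "('a, 'b, 'n) module_scheme" and N :: "'b set"
  assumes M: "module R M" and N: "submodule N R M"
begin

interpretation M: module R M by (rule M)

lemma quot_abelian_subgroup: "abelian_subgroup N M"
proof -
  have "abelian_group M" ..
  moreover have "additive_subgroup N M"
    by (rule additive_subgroup.intro) (rule submodule.axioms(1)[OF N])
  ultimately show ?thesis by (intro abelian_subgroupI3)
qed

interpretation N: abelian_subgroup N M by (rule quot_abelian_subgroup)

lemma coset_carrier: "x \<in> carrier M \<Longrightarrow> N +>\<^bsub>M\<^esub> x \<in> a_rcosets\<^bsub>M\<^esub> N"
  using M.a_rcosetsI[OF N.a_subset] .

lemma coset_cases:
  assumes "X \<in> a_rcosets\<^bsub>M\<^esub> N"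
  obtains x where "x \<in> carrier M" "X = N +>\<^bsub>M\<^esub> x"
  using assms by (auto simp: A_RCOSETS_def')

lemma coset_eq_iff:
  assumes "x \<in> carrier M" "y \<in> carrier M"
  shows "N +>\<^bsub>M\<^esub> x = N +>\<^bsub>M\<^esub> y \<longleftrightarrow> x \<ominus>\<^bsub>M\<^esub> y \<in> N"
proof
  assume "N +>\<^bsub>M\<^esub> x = N +>\<^bsub>M\<^esub> y"
  then have "x \<in> N +>\<^bsub>M\<^esub> y" using N.a_rcos_self[OF assms(1)] by simp
  then show "x \<ominus>\<^bsub>M\<^esub> y \<in> N" using N.a_rcos_module[OF assms(2,1)] by (simp add: a_minus_def)
next
  assume "x \<ominus>\<^bsub>M\<^esub> y \<in> N"
  then have "x \<in> N +>\<^bsub>M\<^esub> y" using N.a_rcos_module[OF assms(2,1)] by (simp add: a_minus_def)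
  then show "N +>\<^bsub>M\<^esub> x = N +>\<^bsub>M\<^esub> y" using N.a_repr_independence'[OF _ assms(2)] by simp
qed

lemma coset_zero_iff:
  assumes "x \<in> carrier M"
  shows "N +>\<^bsub>M\<^esub> x = N \<longleftrightarrow> x \<in> N"
proof -
  have "N +>\<^bsub>M\<^esub> \<zero>\<^bsub>M\<^esub> = N" using M.a_coset_add_zero[OF N.a_subset] .
  moreover have "x \<ominus>\<^bsub>M\<^esub> \<zero>\<^bsub>M\<^esub> = x"
    using assms M.M.r_neg[OF M.M.zero_closed] by (simp add: a_minus_def)
  ultimately show ?thesis using coset_eq_iff[OF assms M.M.zero_closed] by simp
qed

lemma coset_add: "x \<in> carrier M \<Longrightarrow> y \<in> carrier M \<Longrightarrow> (N +>\<^bsub>M\<^esub> x) <+>\<^bsub>M\<^esub> (N +>\<^bsub>M\<^esub> y) = N +>\<^bsub>M\<^esub> (x \<oplus>\<^bsub>M\<^esub> y)"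
  by (rule N.a_rcos_sum)

lemma coset_smult:
  assumes a: "a \<in> carrier R" and x: "x \<in> carrier M"
  shows "a \<odot>\<^bsub>quot_mod R M N\<^esub> (N +>\<^bsub>M\<^esub> x) = N +>\<^bsub>M\<^esub> (a \<odot>\<^bsub>M\<^esub> x)"
proof -
  have "N +>\<^bsub>M\<^esub> (a \<odot>\<^bsub>M\<^esub> y) = N +>\<^bsub>M\<^esub> (a \<odot>\<^bsub>M\<^esub> x)" if y: "y \<in> N +>\<^bsub>M\<^esub> x" for y
  proof -
    have yc: "y \<in> carrier M" using N.a_elemrcos_carrier[OF x y] .
    have "y \<ominus>\<^bsub>M\<^esub> x \<in> N" using y N.a_rcos_module[OF x yc] by (simp add: a_minus_def)
    then have "a \<odot>\<^bsub>M\<^esub> (y \<ominus>\<^bsub>M\<^esub> x) \<in> N" by (rule submoduleD(4)[OF N M a])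
    then show ?thesis using a x yc
      by (subst coset_eq_iff) (simp_all add: a_minus_def M.smult_r_distr M.smult_r_minus)
  qed
  then have "\<forall>y\<in>N +>\<^bsub>M\<^esub> x. N +>\<^bsub>M\<^esub> (a \<odot>\<^bsub>M\<^esub> y) = N +>\<^bsub>M\<^esub> (a \<odot>\<^bsub>M\<^esub> x)" by simp
  from UN_constant_eq[OF N.a_rcos_self[OF x] this] show ?thesis by (simp add: quot_mod_def)
qed

lemma quot_module: "module R (quot_mod R M N)"
proof (rule moduleI[OF M.R.is_cring])
  let ?Q = "quot_mod R M N"
  show "abelian_group ?Q"
  proof (rule abelian_groupI)
    show "X \<oplus>\<^bsub>?Q\<^esub> Y \<in> carrier ?Q" if "X \<in> carrier ?Q" "Y \<in> carrier ?Q" for X Y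
      using that by (auto elim!: coset_cases simp: coset_add coset_carrier)
    show "\<zero>\<^bsub>?Q\<^esub> \<in> carrier ?Q" using coset_carrier[OF M.M.zero_closed] coset_zero_iff[of "\<zero>\<^bsub>M\<^esub>"]
      submoduleD(2)[OF N M] by simp
    show "X \<oplus>\<^bsub>?Q\<^esub> Y \<oplus>\<^bsub>?Q\<^esub> Z = X \<oplus>\<^bsub>?Q\<^esub> (Y \<oplus>\<^bsub>?Q\<^esub> Z)"
      if "X \<in> carrier ?Q" "Y \<in> carrier ?Q" "Z \<in> carrier ?Q" for X Y Z
      using that by (auto elim!: coset_cases simp: coset_add M.M.a_assoc)
    show "X \<oplus>\<^bsub>?Q\<^esub> Y = Y \<oplus>\<^bsub>?Q\<^esub> X" if "X \<in> carrier ?Q" "Y \<in> carrier ?Q" for X Y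
      using that by (auto elim!: coset_cases simp: coset_add M.M.a_comm)
    have N0: "N = N +>\<^bsub>M\<^esub> \<zero>\<^bsub>M\<^esub>" using coset_zero_iff[OF M.M.zero_closed] submoduleD(2)[OF N M] by simp
    show "\<zero>\<^bsub>?Q\<^esub> \<oplus>\<^bsub>?Q\<^esub> X = X" if X: "X \<in> carrier ?Q" for X
    proof -
      obtain x where x: "x \<in> carrier M" "X = N +>\<^bsub>M\<^esub> x" using X by (auto elim: coset_cases)
      have "(N +>\<^bsub>M\<^esub> \<zero>\<^bsub>M\<^esub>) <+>\<^bsub>M\<^esub> X = X" using x by (simp add: coset_add)
      then show ?thesis using N0 by simp
    qed
    show "\<exists>Y\<in>carrier ?Q. Y \<oplus>\<^bsub>?Q\<^esub> X = \<zero>\<^bsub>?Q\<^esub>" if X: "X \<in> carrier ?Q" for X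
    proof -
      obtain x where x: "x \<in> carrier M" "X = N +>\<^bsub>M\<^esub> x" using X by (auto elim: coset_cases)
      have "(N +>\<^bsub>M\<^esub> (\<ominus>\<^bsub>M\<^esub> x)) <+>\<^bsub>M\<^esub> X = N" using x N0 by (simp add: coset_add M.M.l_neg)
      then show ?thesis using x coset_carrier[of "\<ominus>\<^bsub>M\<^esub> x"] by (intro bexI[of _ "N +>\<^bsub>M\<^esub> (\<ominus>\<^bsub>M\<^esub> x)"]) simp_all
    qed
  qed
qed (auto elim!: coset_cases simp: coset_smult coset_add coset_carrier M.smult_l_distr M.smult_r_distr M.smult_assoc1)

lemma quot_map: "(\<lambda>x. N +>\<^bsub>M\<^esub> x) \<in> mhom R M (quot_mod R M N)"
  by (rule mhomI) (simp_all add: coset_carrier coset_add coset_smult)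

lemma quot_map_surj: "(\<lambda>x. N +>\<^bsub>M\<^esub> x) ` carrier M = carrier (quot_mod R M N)"
  by (auto simp: coset_carrier elim: coset_cases)

end

lemma regular_quot_imp:
  assumes M: "module R M" and N: "submodule N R M" and x: "x \<in> carrier R"
    and reg: "\<forall>y\<in>carrier (quot_mod R M N). x \<odot>\<^bsub>quot_mod R M N\<^esub> y = \<zero>\<^bsub>quot_mod R M N\<^esub> \<longrightarrow> y = \<zero>\<^bsub>quot_mod R M N\<^esub>"
  shows "\<forall>u\<in>carrier M. x \<odot>\<^bsub>M\<^esub> u \<in> N \<longrightarrow> u \<in> N"
proof (intro ballI impI)
  interpret M: module R M by fact
  fix u assume u: "u \<in> carrier M" "x \<odot>\<^bsub>M\<^esub> u \<in> N"
  have "x \<odot>\<^bsub>quot_mod R M N\<^esub> (N +>\<^bsub>M\<^esub> u) = N"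
    using u x by (simp add: coset_smult[OF M N] coset_zero_iff[OF M N])
  then have "N +>\<^bsub>M\<^esub> u = N" using reg coset_carrier[OF M N u(1)] by simp
  then show "u \<in> N" using coset_zero_iff[OF M N u(1)] by simp
qed

section \<open>Depth and systems of parameters\<close>

context noetherian_local_ring
begin

text \<open>
  Were the prime \<open>P\<close> minimal over the annihilator of \<open>M/U\<close>, some \<open>sx\<^sup>n\<close> with \<open>s \<notin> P\<close> would kill
  \<open>M/U\<close>; regularity of \<open>x\<close> then makes \<open>s\<close> kill it as well.
\<close>

lemma prime_below_regular:
  assumes M: "module R M" and U: "submodule U R M" and x: "x \<in> carrier R" "regular_mod M U x"
    and P: "primeideal P R" "quot_ann R M (add_mult M U x) \<subseteq> P"
  shows "\<exists>Q. primeideal Q R \<and> Q \<subset> P \<and> quot_ann R M U \<subseteq> Q"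
proof -
  interpret M: module R M by fact
  note A = add_mult_submodule[OF M U x(1)]
  have xP: "x \<in> P" using x A(3) P(2) by (auto simp: quot_ann_def)
  define S where "S = {s \<otimes> x [^] (n::nat) | s n. s \<in> carrier R \<and> s \<notin> P}"
  have one: "\<one> \<notin> P" by (rule primeD(1)[OF P(1)])
  have "\<one> \<otimes> x [^] (0::nat) \<in> S" "\<one> \<otimes> x [^] (1::nat) \<in> S" unfolding S_def using one by blast+
  then have oS: "\<one> \<in> S" and xS: "x \<in> S" using x by simp_all
  have Sc: "S \<subseteq> carrier R" using x by (auto simp: S_def)
  have mult: "a \<otimes> b \<in> S" if ab: "a \<in> S" "b \<in> S" for a b
  proof -
    obtain s n s' n' where s: "a = s \<otimes> x [^] (n::nat)" "b = s' \<otimes> x [^] (n'::nat)"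
      "s \<in> carrier R" "s \<notin> P" "s' \<in> carrier R" "s' \<notin> P" using ab unfolding S_def by blast
    have "a \<otimes> b = (s \<otimes> s') \<otimes> x [^] (n + n')"
      using s x by (simp add: m_ac flip: nat_pow_mult)
    moreover have "s \<otimes> s' \<notin> P" using primeD(2)[OF P(1) s(3,5)] s by auto
    ultimately show ?thesis unfolding S_def using s by blast
  qed
  have canc: "s \<odot>\<^bsub>M\<^esub> v \<in> U" if "(s \<otimes> x [^] (n::nat)) \<odot>\<^bsub>M\<^esub> v \<in> U" "s \<in> carrier R" "v \<in> carrier M" for s n v
    using that(1)
  proof (induction n)
    case 0
    then show ?case using that by simp
  next
    case (Suc n)
    have "(s \<otimes> x [^] Suc n) \<odot>\<^bsub>M\<^esub> v = x \<odot>\<^bsub>M\<^esub> ((s \<otimes> x [^] n) \<odot>\<^bsub>M\<^esub> v)"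
      using that x by (simp add: m_ac flip: M.smult_assoc1)
    then have "(s \<otimes> x [^] n) \<odot>\<^bsub>M\<^esub> v \<in> U" using Suc.prems x that by (simp add: regular_mod_def)
    then show ?case by (rule Suc.IH)
  qed
  have "quot_ann R M U \<inter> S = {}"
  proof (rule ccontr)
    assume "quot_ann R M U \<inter> S \<noteq> {}"
    then obtain s n where s: "s \<in> carrier R" "s \<notin> P" "\<forall>v\<in>carrier M. (s \<otimes> x [^] (n::nat)) \<odot>\<^bsub>M\<^esub> v \<in> U"
      by (auto simp: S_def quot_ann_def)
    then have "\<forall>v\<in>carrier M. s \<odot>\<^bsub>M\<^esub> v \<in> U" using canc by metis
    then have "s \<in> quot_ann R M (add_mult M U x)" using A(2) s(1) by (auto simp: quot_ann_def)
    then show False using P(2) s(2) by auto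
  qed
  then obtain Q where Q: "primeideal Q R" "quot_ann R M U \<subseteq> Q" "Q \<inter> S = {}"
    using prime_disjoint_from_multiplicative[OF quot_ann_ideal[OF M U] _ Sc mult] oS
    by (metis empty_iff)
  have "Q \<subseteq> P"
  proof
    fix q assume q: "q \<in> Q"
    have qc: "q \<in> carrier R" using q idealD(1)[OF primeideal_ideal[OF Q(1)]] by auto
    show "q \<in> P"
    proof (rule ccontr)
      assume "q \<notin> P"
      then have "q \<otimes> x [^] (0::nat) \<in> S" unfolding S_def using qc by blast
      then show False using q Q(3) qc by auto
    qed
  qed
  moreover have "x \<notin> Q" using xS Q(3) by auto
  ultimately show ?thesis using Q xP by blast
qed

text \<open>
  The regular sequences in \<open>\<mm>\<close>, in the recursive form that suits induction.
\<close>

primrec regular_chain :: "('a, 'e, 'k) module_scheme \<Rightarrow> 'e set \<Rightarrow> 'a list \<Rightarrow> bool" where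
  "regular_chain M U [] = (U \<noteq> carrier M)"
| "regular_chain M U (x # xs) = (x \<in> \<mm> \<and> regular_mod M U x \<and> regular_chain M (add_mult M U x) xs)"

lemma regular_chain_depth_ge: "regular_chain M U xs \<Longrightarrow> depth_ge M (length xs) U"
  by (induction xs arbitrary: U) auto

text \<open>
  A regular sequence of length \<open>n\<close> gives a chain of primes of length \<open>n\<close> upwards from the
  annihilator: start with \<open>\<mm>\<close> over the annihilator of the last quotient and descend properly
  with every element that is taken back.
\<close>

lemma regular_chain_primes:
  assumes M: "module R M"
  shows "submodule U R M \<Longrightarrow> regular_chain M U xs \<Longrightarrow>
    \<exists>p. prime_chain R (length xs) p \<and> quot_ann R M U \<subseteq> p 0"
proof (induction xs arbitrary: U)
  case Nil
  interpret M: module R M by fact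
  have "\<one> \<notin> quot_ann R M U"
  proof
    assume "\<one> \<in> quot_ann R M U"
    then have "carrier M \<subseteq> U" by (auto simp: quot_ann_def)
    then show False using Nil submoduleD(1)[OF Nil(1) M] by auto
  qed
  then have "quot_ann R M U \<subseteq> \<mm>" by (rule proper_ideal_in_m[OF quot_ann_ideal[OF M Nil(1)]])
  then show ?case using m_prime by (intro exI[of _ "\<lambda>_. \<mm>"]) (simp add: prime_chain_def)
next
  case (Cons x xs)
  have x: "x \<in> carrier R" "regular_mod M U x" using Cons.prems m_carrier by auto
  obtain p where p: "prime_chain R (length xs) p" "quot_ann R M (add_mult M U x) \<subseteq> p 0"
    using Cons.IH[OF add_mult_submodule(1)[OF M Cons.prems(1) x(1)]] Cons.prems by auto
  have p0: "primeideal (p 0) R" using p(1) by (simp add: prime_chain_def)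
  obtain Q where Q: "primeideal Q R" "Q \<subset> p 0" "quot_ann R M U \<subseteq> Q"
    using prime_below_regular[OF M Cons.prems(1) x p0 p(2)] by auto
  have "prime_chain R (length (x # xs)) (case_nat Q p)" using prime_chain_Cons[OF p(1) Q(1,2)] by simp
  then show ?case using Q(3) by (intro exI[of _ "case_nat Q p"]) simp
qed

lemma regular_seq_imp_chain:
  assumes M: "module R M" and r: "regular_seq R M xs" and m: "set xs \<subseteq> \<mm>"
  shows "regular_chain M {\<zero>\<^bsub>M\<^esub>} xs"
proof -
  have c: "set xs \<subseteq> carrier R" using m m_carrier by auto
  have reg: "regular_mod M (seq_sub M (take i xs)) (xs ! i)" if i: "i < length xs" for i
  proof -
    have ti: "set (take i xs) \<subseteq> carrier R" using c set_take_subset[of i xs] by auto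
    have xi: "xs ! i \<in> carrier R" using i c by auto
    have "\<forall>y\<in>carrier (quot_mod R M (seq_sub M (take i xs))). (xs ! i) \<odot>\<^bsub>quot_mod R M (seq_sub M (take i xs))\<^esub> y
        = \<zero>\<^bsub>quot_mod R M (seq_sub M (take i xs))\<^esub> \<longrightarrow> y = \<zero>\<^bsub>quot_mod R M (seq_sub M (take i xs))\<^esub>"
      using r i unfolding regular_seq_def Let_def seq_submod_eq[OF M ti, symmetric] by blast
    then show ?thesis
      unfolding regular_mod_def by (rule regular_quot_imp[OF M seq_sub_submodule[OF M ti] xi])
  qed
  have ne: "seq_sub M xs \<noteq> carrier M"
  proof
    assume e: "seq_sub M xs = carrier M"
    have s: "submodule (seq_sub M xs) R M" by (rule seq_sub_submodule[OF M c])
    have "carrier (quot_mod R M (seq_sub M xs)) = {\<zero>\<^bsub>quot_mod R M (seq_sub M xs)\<^esub>}"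
    proof -
      have "X = seq_sub M xs" if X: "X \<in> a_rcosets\<^bsub>M\<^esub> (seq_sub M xs)" for X
      proof -
        obtain u where "u \<in> carrier M" "X = seq_sub M xs +>\<^bsub>M\<^esub> u" by (rule coset_cases[OF M s X])
        then show ?thesis using coset_zero_iff[OF M s, of u] e by simp
      qed
      moreover have "seq_sub M xs \<in> a_rcosets\<^bsub>M\<^esub> (seq_sub M xs)"
        using coset_carrier[OF M s, of "\<zero>\<^bsub>M\<^esub>"] coset_zero_iff[OF M s, of "\<zero>\<^bsub>M\<^esub>"] submoduleD(1,2)[OF s M] by auto
      ultimately show ?thesis by (auto simp only: quot_mod_simps)
    qed
    then show False using r by (simp add: regular_seq_def Let_def seq_submod_eq[OF M c])
  qed
  have "regular_chain M (seq_sub M (take i xs)) (drop i xs)" if "i \<le> length xs" for i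
    using that
  proof (induction "length xs - i" arbitrary: i)
    case 0
    then show ?case using ne by simp
  next
    case (Suc k)
    then have i: "i < length xs" by auto
    have "seq_sub M (take (Suc i) xs) = add_mult M (seq_sub M (take i xs)) (xs ! i)"
      using i by (simp add: take_Suc_conv_app_nth)
    moreover have "regular_chain M (seq_sub M (take (Suc i) xs)) (drop (Suc i) xs)"
      using Suc(1)[of "Suc i"] Suc(2) i by simp
    moreover have "drop i xs = xs ! i # drop (Suc i) xs" using i by (simp add: Cons_nth_drop_Suc)
    moreover have "xs ! i \<in> \<mm>" using i m by auto
    ultimately show ?case using reg[OF i] by simp
  qed
  from this[of 0] show ?thesis by simp
qed

lemma regular_seq_length:
  assumes d: "krull_dim R = enat d" and M: "module R M" and xs: "regular_seq R M xs" "set xs \<subseteq> \<mm>"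
  shows "length xs \<le> d"
  using regular_chain_primes[OF M submodule_zero[OF M] regular_seq_imp_chain[OF M xs]]
    prime_chain_le_krull_dim[OF d] by blast

text \<open>
  The lengths of regular sequences in \<open>\<mm>\<close> are bounded by \<open>d\<close>, so the supremum that defines depth
  is a maximum.
\<close>

lemma depth_attained:
  assumes d: "krull_dim R = enat d" and M: "module R M" and nz: "carrier M \<noteq> {\<zero>\<^bsub>M\<^esub>}"
  obtains t where "depth R \<mm> M = enat t" "t \<le> d" "depth_ge M t {\<zero>\<^bsub>M\<^esub>}"
proof -
  interpret M: module R M by fact
  let ?L = "{length xs | xs. set xs \<subseteq> \<mm> \<and> regular_seq R M xs}"
  have bound: "l \<le> d" if "l \<in> ?L" for l using that regular_seq_length[OF d M] by blast
  have fin: "finite ?L" by (rule finite_subset[of _ "{..d}"]) (use bound in \<open>simp_all add: subset_iff\<close>)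
  have s0: "submodule {\<zero>\<^bsub>M\<^esub>} R M" by (rule submodule_zero[OF M])
  have "regular_seq R M []"
  proof -
    obtain u where u: "u \<in> carrier M" "u \<noteq> \<zero>\<^bsub>M\<^esub>" using nz M.M.zero_closed by blast
    have "{\<zero>\<^bsub>M\<^esub>} +>\<^bsub>M\<^esub> u \<noteq> {\<zero>\<^bsub>M\<^esub>}" using coset_zero_iff[OF M s0 u(1)] u(2) by simp
    moreover have "{\<zero>\<^bsub>M\<^esub>} +>\<^bsub>M\<^esub> u \<in> a_rcosets\<^bsub>M\<^esub> {\<zero>\<^bsub>M\<^esub>}" by (rule coset_carrier[OF M s0 u(1)])
    ultimately show ?thesis
      by (auto simp: regular_seq_def Let_def seq_submod_eq[OF M])
  qed
  then have "length [] \<in> ?L" by (intro CollectI exI[of _ "[]"]) simp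
  then have ne: "?L \<noteq> {}" by blast
  have mx: "Max ?L \<in> ?L" by (rule Max_in[OF fin ne])
  then obtain xs where xs: "Max ?L = length xs" "set xs \<subseteq> \<mm>" "regular_seq R M xs" by blast
  have "depth R \<mm> M = Sup (enat ` ?L)"
    unfolding depth_def using nz by (simp add: image_Collect) (rule arg_cong[of _ _ Sup], blast)
  also have "\<dots> = enat (Max ?L)"
  proof (rule antisym)
    show "Sup (enat ` ?L) \<le> enat (Max ?L)" by (rule Sup_least) (use Max_ge[OF fin] in \<open>force simp del: Max_ge\<close>)
    show "enat (Max ?L) \<le> Sup (enat ` ?L)" by (rule Sup_upper) (use mx in blast)
  qed
  finally have "depth R \<mm> M = enat (Max ?L)" .
  moreover have "Max ?L \<le> d" using bound mx by blast
  moreover have "depth_ge M (Max ?L) {\<zero>\<^bsub>M\<^esub>}"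
    unfolding xs(1) by (rule regular_chain_depth_ge[OF regular_seq_imp_chain[OF M xs(3,2)]])
  ultimately show ?thesis by (rule that)
qed

definition height_ge :: "nat \<Rightarrow> 'a set \<Rightarrow> bool" where
  "height_ge n q \<longleftrightarrow> (\<exists>p. prime_chain R n p \<and> p n = q)"

text \<open>
  Each new element avoids the nonmaximal members of a finite set of primes that covers the
  primes over the previous ones (so that heights grow) and, as long as the depth is not used up,
  the finitely many primes that obstruct regularity. The exchange lemma keeps the depth of what
  remains under control whichever regular elements are chosen.
\<close>

lemma parameter_step:
  assumes fg: "fg_module R M" and I: "ideal I R" "\<And>P. primeideal P R \<Longrightarrow> P \<noteq> \<mm> \<Longrightarrow> \<not> I \<subseteq> P" "I \<subseteq> \<mm>"
    and xs: "set xs \<subseteq> I" and dp: "depth_ge M (t - length xs) (seq_sub M xs)"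
    and ht: "\<And>q. primeideal q R \<Longrightarrow> q \<noteq> \<mm> \<Longrightarrow> set xs \<subseteq> q \<Longrightarrow> height_ge (length xs) q"
  shows "\<exists>x\<in>I. (length xs < t \<longrightarrow> regular_mod M (seq_sub M xs) x) \<and>
    depth_ge M (t - Suc (length xs)) (seq_sub M (xs @ [x])) \<and>
    (\<forall>q. primeideal q R \<and> q \<noteq> \<mm> \<and> set (xs @ [x]) \<subseteq> q \<longrightarrow> height_ge (Suc (length xs)) q)"
proof -
  have M: "module R M" using fg by (simp add: fg_module_def)
  have xc: "set xs \<subseteq> carrier R" using xs idealD(1)[OF I(1)] by auto
  note S = seq_sub_submodule[OF M xc]
  obtain A where A: "finite A" "\<forall>Q\<in>A. primeideal Q R \<and> Idl (set xs) \<subseteq> Q"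
    "\<forall>P. primeideal P R \<and> Idl (set xs) \<subseteq> P \<longrightarrow> (\<exists>Q\<in>A. Q \<subseteq> P)"
    using finite_covering_primes[OF genideal_ideal[OF xc]] by auto
  have "\<exists>B. finite B \<and> (\<forall>P\<in>B. primeideal P R \<and> P \<noteq> \<mm>) \<and>
    (length xs < t \<longrightarrow> (\<forall>x\<in>carrier R. (\<forall>P\<in>B. x \<notin> P) \<longrightarrow> regular_mod M (seq_sub M xs) x))"
  proof (cases "length xs < t")
    case True
    then obtain k where "t - length xs = Suc k" by (metis Suc_diff_Suc)
    then have "socle_free M (seq_sub M xs)" using dp depth_ge_Suc_socle_free by metis
    then show ?thesis using socle_free_primes[OF fg S] by meson
  qed (auto intro: exI[of _ "{}"])
  then obtain B where B: "finite B" "\<forall>P\<in>B. primeideal P R \<and> P \<noteq> \<mm>"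
    "length xs < t \<longrightarrow> (\<forall>x\<in>carrier R. (\<forall>P\<in>B. x \<notin> P) \<longrightarrow> regular_mod M (seq_sub M xs) x)" by auto
  have PP: "primeideal P R" "\<not> I \<subseteq> P" if "P \<in> (A - {\<mm>}) \<union> B" for P
  proof -
    have "primeideal P R \<and> P \<noteq> \<mm>" using that A(2) B(2) by (elim UnE) simp_all
    then show "primeideal P R" "\<not> I \<subseteq> P" using I(2) by simp_all
  qed
  have "finite ((A - {\<mm>}) \<union> B)" using A B by simp
  then have "\<exists>x\<in>I. \<forall>P\<in>(A - {\<mm>}) \<union> B. x \<notin> P" by (rule prime_avoidance[OF _ I(1) PP])
  then obtain x where x: "x \<in> I" "\<forall>P\<in>(A - {\<mm>}) \<union> B. x \<notin> P" by auto
  have xR: "x \<in> carrier R" and xm: "x \<in> \<mm>" using x I(3) m_carrier by auto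
  have reg: "regular_mod M (seq_sub M xs) x" if "length xs < t" using that B x xR by simp
  have "depth_ge M (t - Suc (length xs)) (seq_sub M (xs @ [x]))"
  proof (cases "length xs < t")
    case True
    then have "t - length xs = Suc (t - Suc (length xs))" by simp
    then show ?thesis using depth_ge_exchange[OF fg S xm reg[OF True]] dp by simp
  qed simp
  moreover have "height_ge (Suc (length xs)) q"
    if q: "primeideal q R" "q \<noteq> \<mm>" "set (xs @ [x]) \<subseteq> q" for q
  proof -
    have "Idl (set xs) \<subseteq> q" using genideal_minimal[OF primeideal_ideal[OF q(1)], of "set xs"] q(3) by simp
    then obtain q' where q': "q' \<in> A" "q' \<subseteq> q" using A(3) q(1) by meson
    have pq': "primeideal q' R" using A(2) q'(1) by simp
    have xq': "set xs \<subseteq> q'" using A(2) q'(1) genideal_self[OF xc] by (meson subset_trans)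
    (* q' omits x, so it is strictly below q and its chain grows by one step *)
    have nm: "q' \<noteq> \<mm>" using q'(2) q(2) prime_in_m[OF q(1)] by blast
    have "x \<notin> q'" using x(2) q'(1) nm by simp
    then have "q' \<subset> q" using q'(2) q(3) by auto
    moreover obtain p where p: "prime_chain R (length xs) p" "p (length xs) = q'"
      using ht[OF pq' nm xq'] by (auto simp: height_ge_def)
    ultimately have "prime_chain R (Suc (length xs)) (p(Suc (length xs) := q))"
      using prime_chain_snoc[OF p(1) q(1)] by simp
    then show ?thesis unfolding height_ge_def by (intro exI[of _ "p(Suc (length xs) := q)"]) simp
  qed
  ultimately show ?thesis using x(1) reg by blast
qed

text \<open>
  After \<open>n\<close> steps every nonmaximal prime over the chosen elements has height at least \<open>n\<close>. For
  \<open>n = d\<close> there is no such prime, since \<open>\<mm>\<close> on top of it would give a chain of length \<open>d + 1\<close>.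
\<close>

lemma parameters_exist:
  assumes d: "krull_dim R = enat d" and fg: "fg_module R M"
    and I: "ideal I R" "\<And>P. primeideal P R \<Longrightarrow> P \<noteq> \<mm> \<Longrightarrow> \<not> I \<subseteq> P" "I \<subseteq> \<mm>"
    and dp: "depth_ge M t {\<zero>\<^bsub>M\<^esub>}"
  obtains xs where "length xs = d" "set xs \<subseteq> I"
    "\<And>i. i < t \<Longrightarrow> i < d \<Longrightarrow> regular_mod M (seq_sub M (take i xs)) (xs ! i)"
    "\<And>q. primeideal q R \<Longrightarrow> set xs \<subseteq> q \<Longrightarrow> q = \<mm>"
proof -
  let ?inv = "\<lambda>xs. set xs \<subseteq> I \<and> depth_ge M (t - length xs) (seq_sub M xs) \<and>
    (\<forall>q. primeideal q R \<and> q \<noteq> \<mm> \<and> set xs \<subseteq> q \<longrightarrow> height_ge (length xs) q) \<and>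
    (\<forall>i<length xs. i < t \<longrightarrow> regular_mod M (seq_sub M (take i xs)) (xs ! i))"
  have "\<exists>xs. length xs = n \<and> ?inv xs" for n
  proof (induction n)
    case 0
    have "?inv []"
      using dp by (auto simp: height_ge_def prime_chain_def intro: exI[of _ "\<lambda>_. q" for q])
    then show ?case by (intro exI[of _ "[]"]) simp
  next
    case (Suc n)
    then obtain xs where xs: "length xs = n" "?inv xs" by auto
    obtain x where x: "x \<in> I" "length xs < t \<longrightarrow> regular_mod M (seq_sub M xs) x"
      "depth_ge M (t - Suc (length xs)) (seq_sub M (xs @ [x]))"
      "\<forall>q. primeideal q R \<and> q \<noteq> \<mm> \<and> set (xs @ [x]) \<subseteq> q \<longrightarrow> height_ge (Suc (length xs)) q"
      using parameter_step[OF fg I, of xs t] xs(2) by auto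
    have "regular_mod M (seq_sub M (take i (xs @ [x]))) ((xs @ [x]) ! i)"
      if "i < Suc (length xs)" "i < t" for i
      using that xs(2) x(2) by (cases "i = length xs") (simp_all add: nth_append)
    then have "?inv (xs @ [x])" using xs(2) x by simp
    then show ?case using xs(1) by (intro exI[of _ "xs @ [x]"]) simp
  qed
  from this[of d] obtain xs where xs: "length xs = d" "?inv xs" by (elim exE conjE) blast
  have "q = \<mm>" if q: "primeideal q R" "set xs \<subseteq> q" for q
  proof (rule ccontr)
    assume nm: "q \<noteq> \<mm>"
    then have "height_ge d q" using xs q by metis
    then obtain p where p: "prime_chain R d p" "p d = q" by (auto simp: height_ge_def)
    (* the maximal ideal would extend the chain beyond the dimension *)
    have "prime_chain R (Suc d) (p(Suc d := \<mm>))"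
      using prime_chain_snoc[OF p(1) m_prime] p(2) nm prime_in_m[OF q(1)] by blast
    then show False using prime_chain_le_krull_dim[OF d] by fastforce
  qed
  then show ?thesis using xs by (intro that[of xs]) simp_all
qed

end

section \<open>Isomorphisms and factorisation\<close>

lemma mhom_diff:
  assumes "f \<in> mhom R M N" "module R M" "module R N" "x \<in> carrier M" "y \<in> carrier M"
  shows "f (x \<ominus>\<^bsub>M\<^esub> y) = f x \<ominus>\<^bsub>N\<^esub> f y"
proof -
  interpret M: module R M by fact
  interpret N: module R N by fact
  show ?thesis using assms by (simp add: a_minus_def mhom_add[OF assms(1)] mhom_minus[OF assms(1-3)])
qed

lemma module_diff_zero_iff:
  assumes "module R M" "x \<in> carrier M" "y \<in> carrier M"
  shows "x \<ominus>\<^bsub>M\<^esub> y = \<zero>\<^bsub>M\<^esub> \<longleftrightarrow> x = y"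
proof -
  interpret M: module R M by fact
  have "x = (x \<ominus>\<^bsub>M\<^esub> y) \<oplus>\<^bsub>M\<^esub> y" using assms by (simp add: a_minus_def M.M.a_assoc M.M.l_neg)
  then show ?thesis using assms by (auto simp: a_minus_def M.M.r_neg)
qed

lemma mhom_eq_iff:
  assumes "f \<in> mhom R M N" "module R M" "module R N" "x \<in> carrier M" "y \<in> carrier M"
  shows "f x = f y \<longleftrightarrow> f (x \<ominus>\<^bsub>M\<^esub> y) = \<zero>\<^bsub>N\<^esub>"
  using mhom_diff[OF assms] module_diff_zero_iff[OF assms(3), of "f x" "f y"] assms
  by (simp add: mhom_closed[OF assms(1)])

lemma mhom_inj_onI:
  assumes "f \<in> mhom R M N" "module R M" "module R N"
    "\<And>x. x \<in> carrier M \<Longrightarrow> f x = \<zero>\<^bsub>N\<^esub> \<Longrightarrow> x = \<zero>\<^bsub>M\<^esub>"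
  shows "inj_on f (carrier M)"
proof (rule inj_onI)
  interpret M: module R M by fact
  fix x y assume h: "x \<in> carrier M" "y \<in> carrier M" "f x = f y"
  then have "x \<ominus>\<^bsub>M\<^esub> y = \<zero>\<^bsub>M\<^esub>" using mhom_eq_iff[OF assms(1-3), of x y] assms(4)[of "x \<ominus>\<^bsub>M\<^esub> y"] by simp
  then show "x = y" using module_diff_zero_iff[OF assms(2)] h by simp
qed

lemma mod_isoI:
  assumes "f \<in> mhom R M N" "module R M" "module R N" "f ` carrier M = carrier N"
    "\<And>x. x \<in> carrier M \<Longrightarrow> f x = \<zero>\<^bsub>N\<^esub> \<Longrightarrow> x = \<zero>\<^bsub>M\<^esub>"
  shows "mod_iso R M N"
  using mhom_inj_onI[OF assms(1,2,3,5)] assms(1,4) by (auto simp: mod_iso_def bij_betw_def)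

lemma mod_iso_refl: "mod_iso R M M"
  unfolding mod_iso_def by (rule bexI[OF _ mhom_id]) (simp add: bij_betw_def)

lemma mod_iso_trans: "mod_iso R M N \<Longrightarrow> mod_iso R N P \<Longrightarrow> mod_iso R M P"
  unfolding mod_iso_def
proof (elim bexE)
  fix f g assume "f \<in> mhom R M N" "bij_betw f (carrier M) (carrier N)" "g \<in> mhom R N P" "bij_betw g (carrier N) (carrier P)"
  then show "\<exists>f\<in>mhom R M P. bij_betw f (carrier M) (carrier P)"
    using mhom_comp[of f R M N g P] bij_betw_trans[of f _ _ g] by (intro bexI[of _ "g \<circ> f"]) (simp_all add: comp_def)
qed

lemma mod_isoE:
  assumes "mod_iso R M N" "module R M" "module R N"
  obtains f g where "f \<in> mhom R M N" "g \<in> mhom R N M"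
    "\<And>x. x \<in> carrier M \<Longrightarrow> g (f x) = x" "\<And>y. y \<in> carrier N \<Longrightarrow> f (g y) = y"
proof -
  interpret M: module R M by fact
  obtain f where f: "f \<in> mhom R M N" "bij_betw f (carrier M) (carrier N)"
    using assms(1) by (auto simp: mod_iso_def)
  define g where "g = the_inv_into (carrier M) f"
  have inj: "inj_on f (carrier M)" and im: "f ` carrier M = carrier N" using f by (auto simp: bij_betw_def)
  have gf: "g (f x) = x" if "x \<in> carrier M" for x using that inj by (simp add: g_def the_inv_into_f_f)
  have fg: "f (g y) = y" if "y \<in> carrier N" for y using that inj im by (simp add: g_def f_the_inv_into_f)
  have gc: "g y \<in> carrier M" if "y \<in> carrier N" for y
    using that im gf by (metis imageE)
  have "g \<in> mhom R N M"
  proof (rule mhomI)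
    show "g (x \<oplus>\<^bsub>N\<^esub> y) = g x \<oplus>\<^bsub>M\<^esub> g y" if h: "x \<in> carrier N" "y \<in> carrier N" for x y
      using gf[of "g x \<oplus>\<^bsub>M\<^esub> g y"] mhom_add[OF f(1), of "g x" "g y"] h gc fg by simp
    show "g (a \<odot>\<^bsub>N\<^esub> x) = a \<odot>\<^bsub>M\<^esub> g x" if h: "a \<in> carrier R" "x \<in> carrier N" for a x
      using gf[of "a \<odot>\<^bsub>M\<^esub> g x"] mhom_smult[OF f(1), of a "g x"] h gc fg by simp
  qed (rule gc)
  then show ?thesis using that f(1) gf fg by blast
qed

lemma mod_iso_sym:
  assumes "mod_iso R M N" "module R M" "module R N"
  shows "mod_iso R N M"
proof -
  obtain f g where h: "f \<in> mhom R M N" "g \<in> mhom R N M"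
    "\<And>x. x \<in> carrier M \<Longrightarrow> g (f x) = x" "\<And>y. y \<in> carrier N \<Longrightarrow> f (g y) = y"
    by (rule mod_isoE[OF assms]) (rule that)
  have "bij_betw g (carrier N) (carrier M)"
    by (rule bij_betwI[of _ _ _ f]) (use h mhom_closed in \<open>auto simp: mhom_def\<close>)
  then show ?thesis using h(2) by (auto simp: mod_iso_def)
qed

lemma factor_through_surjection:
  assumes f: "f \<in> mhom R M W" and g: "g \<in> mhom R M N" and M: "module R M" "module R W" "module R N"
    and surj: "f ` carrier M = carrier W"
    and ker: "\<And>x. x \<in> carrier M \<Longrightarrow> f x = \<zero>\<^bsub>W\<^esub> \<Longrightarrow> g x = \<zero>\<^bsub>N\<^esub>"
  shows "\<exists>h\<in>mhom R W N. \<forall>x\<in>carrier M. h (f x) = g x"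
proof -
  interpret M: module R M by fact
  define s where "s w = (SOME x. x \<in> carrier M \<and> f x = w)" for w
  have s: "s w \<in> carrier M" "f (s w) = w" if "w \<in> carrier W" for w
  proof -
    have "w \<in> f ` carrier M" using that surj by simp
    then have "\<exists>x. x \<in> carrier M \<and> f x = w" by (elim imageE) (metis)
    then have "s w \<in> carrier M \<and> f (s w) = w" unfolding s_def by (rule someI_ex)
    then show "s w \<in> carrier M" "f (s w) = w" by simp_all
  qed
  have eq: "g x = g y" if "x \<in> carrier M" "y \<in> carrier M" "f x = f y" for x y
    using that mhom_eq_iff[OF f M(1,2), of x y] mhom_eq_iff[OF g M(1,3), of x y] ker[of "x \<ominus>\<^bsub>M\<^esub> y"] by simp
  have fc: "f x \<in> carrier W" if "x \<in> carrier M" for x using mhom_closed[OF f that] .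
  have key: "g (s (f x)) = g x" if "x \<in> carrier M" for x
    by (rule eq) (use s[OF fc[OF that]] that in simp_all)
  have hom: "(\<lambda>w. g (s w)) \<in> mhom R W N"
  proof (rule mhomI)
    show "g (s w) \<in> carrier N" if "w \<in> carrier W" for w using s[OF that] mhom_closed[OF g] by simp
    show "g (s (x \<oplus>\<^bsub>W\<^esub> y)) = g (s x) \<oplus>\<^bsub>N\<^esub> g (s y)" if h: "x \<in> carrier W" "y \<in> carrier W" for x y
      using key[of "s x \<oplus>\<^bsub>M\<^esub> s y"] s[OF h(1)] s[OF h(2)] by (simp add: mhom_add[OF f] mhom_add[OF g])
    show "g (s (a \<odot>\<^bsub>W\<^esub> x)) = a \<odot>\<^bsub>N\<^esub> g (s x)" if h: "a \<in> carrier R" "x \<in> carrier W" for a x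
      using key[of "a \<odot>\<^bsub>M\<^esub> s x"] s[OF h(2)] h(1) by (simp add: mhom_smult[OF f] mhom_smult[OF g])
  qed
  show ?thesis by (rule bexI[OF _ hom]) (use key in simp)
qed

lemma quot_mod_iso:
  assumes M: "module R M" and W: "module R W" and N: "submodule N R M" and f: "f \<in> mhom R M W"
    and surj: "f ` carrier M = carrier W" and ker: "\<And>x. x \<in> carrier M \<Longrightarrow> f x = \<zero>\<^bsub>W\<^esub> \<longleftrightarrow> x \<in> N"
  shows "mod_iso R (quot_mod R M N) W"
proof -
  note Q = quot_module[OF M N]
  obtain h where h: "h \<in> mhom R (quot_mod R M N) W" "\<forall>x\<in>carrier M. h (N +>\<^bsub>M\<^esub> x) = f x"
    using factor_through_surjection[OF quot_map[OF M N] f M Q W quot_map_surj[OF M N]]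
      coset_zero_iff[OF M N] ker by auto
  show ?thesis
  proof (rule mod_isoI[OF h(1) Q W])
    show "h ` carrier (quot_mod R M N) = carrier W"
      unfolding quot_map_surj[OF M N, symmetric] image_image using h(2) surj by simp
    fix X assume X: "X \<in> carrier (quot_mod R M N)" "h X = \<zero>\<^bsub>W\<^esub>"
    then obtain x where x: "x \<in> carrier M" "X = N +>\<^bsub>M\<^esub> x" using coset_cases[OF M N] by (metis quot_mod_simps(1))
    then show "X = \<zero>\<^bsub>quot_mod R M N\<^esub>" using X(2) h(2) ker[OF x(1)] coset_zero_iff[OF M N x(1)] by simp
  qed
qed

text \<open>
  Quotients live on cosets, outside \<open>mod_cat R\<close>. Later on a quotient is therefore any object
  with a surjection of the right kernel.
\<close>

lemma ex_quotient:
  fixes M :: "('a, 'e, 'k) module_scheme"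
  assumes fg: "fg_module R M" and N: "submodule N R M"
  obtains W w where "W \<in> mod_cat R" "w \<in> mhom R M W" "w ` carrier M = carrier W"
    "\<And>x. x \<in> carrier M \<Longrightarrow> w x = \<zero>\<^bsub>W\<^esub> \<longleftrightarrow> x \<in> N"
proof -
  have M: "module R M" using fg by (simp add: fg_module_def)
  note Q = quot_module[OF M N]
  have "fg_module R (quot_mod R M N)"
    by (rule fg_image[OF quot_map[OF M N] fg Q quot_map_surj[OF M N]])
  then obtain W where W: "W \<in> mod_cat R" "mod_iso R (quot_mod R M N) W" using ex_rmod by blast
  note WM = mod_catD[OF W(1)]
  obtain f g where fg: "f \<in> mhom R (quot_mod R M N) W" "g \<in> mhom R W (quot_mod R M N)"
    "\<And>x. x \<in> carrier (quot_mod R M N) \<Longrightarrow> g (f x) = x" "\<And>y. y \<in> carrier W \<Longrightarrow> f (g y) = y"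
    by (rule mod_isoE[OF W(2) Q WM]) (rule that)
  show ?thesis
  proof (rule that[OF W(1) mhom_comp[OF quot_map[OF M N] fg(1)]])
    have "f ` carrier (quot_mod R M N) = carrier W"
      using fg mhom_closed[OF fg(1)] mhom_closed[OF fg(2)] by (metis (no_types, lifting) image_eqI image_subsetI subsetI subset_antisym)
    then show "(\<lambda>x. f (N +>\<^bsub>M\<^esub> x)) ` carrier M = carrier W"
      unfolding quot_map_surj[OF M N, symmetric] image_image .
    fix x assume x: "x \<in> carrier M"
    have c: "N +>\<^bsub>M\<^esub> x \<in> carrier (quot_mod R M N)" using coset_carrier[OF M N x] by simp
    have "f (N +>\<^bsub>M\<^esub> x) = \<zero>\<^bsub>W\<^esub> \<longleftrightarrow> N +>\<^bsub>M\<^esub> x = N"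
      using fg(3)[OF c] mhom_zero[OF fg(2) WM Q] mhom_zero[OF fg(1) Q WM] by (metis quot_mod_simps(2))
    then show "f (N +>\<^bsub>M\<^esub> x) = \<zero>\<^bsub>W\<^esub> \<longleftrightarrow> x \<in> N" using coset_zero_iff[OF M N x] by simp
  qed
qed

lemma mhom_finsum:
  assumes f: "f \<in> mhom R M N" and M: "module R M" "module R N" and "finite A" "g \<in> A \<rightarrow> carrier M"
  shows "f (\<Oplus>\<^bsub>M\<^esub>i\<in>A. g i) = (\<Oplus>\<^bsub>N\<^esub>i\<in>A. f (g i))"
  using assms(4,5)
proof (induction rule: finite_induct)
  case empty
  interpret M: module R M by fact
  interpret N: module R N by fact
  show ?case using mhom_zero[OF f M] by simp
next
  case (insert x A)
  interpret M: module R M by fact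
  interpret N: module R N by fact
  have "(\<lambda>i. f (g i)) \<in> A \<rightarrow> carrier N" using insert.prems mhom_closed[OF f] by auto
  then show ?case using insert mhom_closed[OF f] by (simp add: Pi_def mhom_add[OF f])
qed

lemma lin_indepD:
  assumes "lin_indep R M B" "finite F" "F \<subseteq> B" "\<And>b. b \<in> F \<Longrightarrow> c b \<in> carrier R"
    "(\<Oplus>\<^bsub>M\<^esub>b\<in>F. c b \<odot>\<^bsub>M\<^esub> b) = \<zero>\<^bsub>M\<^esub>" "b \<in> F"
  shows "c b = \<zero>\<^bsub>R\<^esub>"
proof -
  have "finite F \<and> F \<subseteq> B \<and> c \<in> F \<rightarrow> carrier R \<and> (\<Oplus>\<^bsub>M\<^esub>b\<in>F. c b \<odot>\<^bsub>M\<^esub> b) = \<zero>\<^bsub>M\<^esub>"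
    using assms(2-5) by (simp add: Pi_iff)
  from assms(1)[unfolded lin_indep_def, THEN spec, THEN spec, THEN mp, OF this] assms(6)
  show ?thesis by simp
qed

section \<open>Biproducts and free modules\<close>

type_synonym 'a elem = "(nat \<Rightarrow> 'a) set"

context noetherian_local_ring
begin

lemma one_not_m: "\<one> \<notin> \<mm>"
  by (rule primeD(1)[OF m_prime])

lemma zero_neq_one: "\<zero> \<noteq> \<one>"
  using one_not_m idealD(2)[OF m_ideal] by auto

text \<open>
  Pairs of elements of objects of \<open>mod_cat R\<close>, coded as such elements: the first entry \<open>\<zero>\<close> or
  \<open>\<one>\<close> of a sequence tells the two components apart. So the direct sum of two objects is an
  object again, with projections \<open>fstc\<close> and \<open>sndc\<close> that are defined everywhere.
\<close>

definition pairc :: "'a elem \<Rightarrow> 'a elem \<Rightarrow> 'a elem" where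
  "pairc A B = case_nat \<zero> ` A \<union> case_nat \<one> ` B"

definition fstc :: "'a elem \<Rightarrow> 'a elem" where "fstc P = {a. case_nat \<zero> a \<in> P}"
definition sndc :: "'a elem \<Rightarrow> 'a elem" where "sndc P = {a. case_nat \<one> a \<in> P}"

lemma case_nat_eq_iff: "case_nat x a = case_nat y b \<longleftrightarrow> x = y \<and> a = b"
proof
  assume e: "case_nat x a = case_nat y b"
  have "x = y" using fun_cong[OF e, of 0] by simp
  moreover have "a n = b n" for n using fun_cong[OF e, of "Suc n"] by simp
  ultimately show "x = y \<and> a = b" by auto
qed auto

lemma fstc_pairc [simp]: "fstc (pairc A B) = A"
  using zero_neq_one by (auto simp: fstc_def pairc_def case_nat_eq_iff)

lemma sndc_pairc [simp]: "sndc (pairc A B) = B"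
  using zero_neq_one by (auto simp: sndc_def pairc_def case_nat_eq_iff)

lemma pairc_eq_iff [simp]: "pairc A B = pairc C D \<longleftrightarrow> A = C \<and> B = D"
  using fstc_pairc sndc_pairc by metis

definition bip :: "'a rmod \<Rightarrow> 'a rmod \<Rightarrow> 'a rmod" where
  "bip X Y = \<lparr>carrier = {pairc a b | a b. a \<in> carrier X \<and> b \<in> carrier Y},
     mult = undefined, one = undefined, zero = pairc \<zero>\<^bsub>X\<^esub> \<zero>\<^bsub>Y\<^esub>,
     add = (\<lambda>u v. pairc (fstc u \<oplus>\<^bsub>X\<^esub> fstc v) (sndc u \<oplus>\<^bsub>Y\<^esub> sndc v)),
     smult = (\<lambda>r u. pairc (r \<odot>\<^bsub>X\<^esub> fstc u) (r \<odot>\<^bsub>Y\<^esub> sndc u))\<rparr>"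

lemma bip_simps [simp]:
  "pairc a b \<in> carrier (bip X Y) \<longleftrightarrow> a \<in> carrier X \<and> b \<in> carrier Y"
  "pairc a b \<oplus>\<^bsub>bip X Y\<^esub> pairc c d = pairc (a \<oplus>\<^bsub>X\<^esub> c) (b \<oplus>\<^bsub>Y\<^esub> d)"
  "r \<odot>\<^bsub>bip X Y\<^esub> pairc a b = pairc (r \<odot>\<^bsub>X\<^esub> a) (r \<odot>\<^bsub>Y\<^esub> b)"
  "\<zero>\<^bsub>bip X Y\<^esub> = pairc \<zero>\<^bsub>X\<^esub> \<zero>\<^bsub>Y\<^esub>"
  by (auto simp: bip_def)

lemma bip_cases:
  assumes "u \<in> carrier (bip X Y)"
  obtains a b where "u = pairc a b" "a \<in> carrier X" "b \<in> carrier Y"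
  using assms by (auto simp: bip_def)

lemma bip_carrier: "u \<in> carrier (bip X Y) \<longleftrightarrow> (\<exists>a\<in>carrier X. \<exists>b\<in>carrier Y. u = pairc a b)"
  by (auto simp: bip_def)

lemma bip_module:
  assumes X: "module R X" and Y: "module R Y"
  shows "module R (bip X Y)"
proof (rule moduleI[OF is_cring])
  interpret X: module R X by fact
  interpret Y: module R Y by fact
  show "abelian_group (bip X Y)"
  proof (rule abelian_groupI)
    show "\<exists>v\<in>carrier (bip X Y). v \<oplus>\<^bsub>bip X Y\<^esub> u = \<zero>\<^bsub>bip X Y\<^esub>" if "u \<in> carrier (bip X Y)" for u
    proof -
      obtain a b where ab: "u = pairc a b" "a \<in> carrier X" "b \<in> carrier Y" using \<open>u \<in> _\<close> by (rule bip_cases)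
      show ?thesis using ab by (intro bexI[of _ "pairc (\<ominus>\<^bsub>X\<^esub> a) (\<ominus>\<^bsub>Y\<^esub> b)"]) (simp_all add: X.M.l_neg Y.M.l_neg)
    qed
  qed (auto simp: bip_carrier X.M.a_ac Y.M.a_ac)
qed (auto simp: bip_carrier module.smult_l_distr[OF X] module.smult_l_distr[OF Y] module.smult_r_distr[OF X]
    module.smult_r_distr[OF Y] module.smult_assoc1[OF X] module.smult_assoc1[OF Y]
    module.smult_closed[OF X] module.smult_closed[OF Y] module.smult_one[OF X] module.smult_one[OF Y])

lemma bip_fst: "fstc \<in> mhom R (bip X Y) X"
  by (rule mhomI) (auto simp: bip_carrier)

lemma bip_snd: "sndc \<in> mhom R (bip X Y) Y"
  by (rule mhomI) (auto simp: bip_carrier)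

lemma bip_pair: "f \<in> mhom R Z X \<Longrightarrow> g \<in> mhom R Z Y \<Longrightarrow> (\<lambda>z. pairc (f z) (g z)) \<in> mhom R Z (bip X Y)"
  by (rule mhomI) (simp_all add: mhom_closed mhom_add mhom_smult)

lemma bip_inl: "module R Y \<Longrightarrow> (\<lambda>x. pairc x \<zero>\<^bsub>Y\<^esub>) \<in> mhom R X (bip X Y)"
  by (rule bip_pair[OF mhom_id mhom_const_zero])

lemma bip_inr: "module R X \<Longrightarrow> (\<lambda>y. pairc \<zero>\<^bsub>X\<^esub> y) \<in> mhom R Y (bip X Y)"
  by (rule bip_pair[OF mhom_const_zero mhom_id])

lemma bip_copair:
  "f \<in> mhom R X Z \<Longrightarrow> g \<in> mhom R Y Z \<Longrightarrow> module R Z \<Longrightarrow> (\<lambda>u. f (fstc u) \<oplus>\<^bsub>Z\<^esub> g (sndc u)) \<in> mhom R (bip X Y) Z"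
  by (rule mhom_plus[OF mhom_comp[OF bip_fst] mhom_comp[OF bip_snd]])

lemma bip_mod_cat:
  assumes "X \<in> mod_cat R" "Y \<in> mod_cat R"
  shows "bip X Y \<in> mod_cat R"
proof -
  have X: "module R X" and Y: "module R Y" using assms by (simp_all add: mod_catD)
  interpret X: module R X by fact
  interpret Y: module R Y by fact
  note B = bip_module[OF X Y]
  interpret B: module R "bip X Y" by fact
  obtain A where A: "finite A" "A \<subseteq> carrier X" "mspan R X A = carrier X"
    using assms by (auto simp: mod_cat_def fg_module_def)
  obtain C where C: "finite C" "C \<subseteq> carrier Y" "mspan R Y C = carrier Y"
    using assms by (auto simp: mod_cat_def fg_module_def)
  let ?G = "(\<lambda>x. pairc x \<zero>\<^bsub>Y\<^esub>) ` A \<union> (\<lambda>y. pairc \<zero>\<^bsub>X\<^esub> y) ` C"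
  have G: "?G \<subseteq> carrier (bip X Y)" using A C by auto
  note S = mspan_submodule[OF B G]
  have "mspan R X A \<subseteq> {x \<in> carrier X. pairc x \<zero>\<^bsub>Y\<^esub> \<in> mspan R (bip X Y) ?G}"
    by (rule mspan_subset[OF submodule_vimage[OF bip_inl[OF Y] X B S]]) (use A mspan_incl in fast)
  then have x: "pairc x \<zero>\<^bsub>Y\<^esub> \<in> mspan R (bip X Y) ?G" if "x \<in> carrier X" for x using A(3) that by auto
  have "mspan R Y C \<subseteq> {y \<in> carrier Y. pairc \<zero>\<^bsub>X\<^esub> y \<in> mspan R (bip X Y) ?G}"
    by (rule mspan_subset[OF submodule_vimage[OF bip_inr[OF X] Y B S]]) (use C mspan_incl in fast)
  then have y: "pairc \<zero>\<^bsub>X\<^esub> y \<in> mspan R (bip X Y) ?G" if "y \<in> carrier Y" for y using C(3) that by auto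
  have "carrier (bip X Y) \<subseteq> mspan R (bip X Y) ?G"
  proof
    fix u assume "u \<in> carrier (bip X Y)"
    then obtain a b where ab: "u = pairc a b" "a \<in> carrier X" "b \<in> carrier Y" by (rule bip_cases)
    then show "u \<in> mspan R (bip X Y) ?G"
      using submoduleD(3)[OF S B x[OF ab(2)] y[OF ab(3)]] by simp
  qed
  then have "mspan R (bip X Y) ?G = carrier (bip X Y)"
    using mspan_subset[OF B.carrier_is_submodule G] by auto
  moreover have "finite ?G" using A(1) C(1) by simp
  ultimately show ?thesis unfolding mod_cat_def fg_module_def
    using B G by (intro CollectI conjI exI[of _ ?G])
qed

lemma fg_self: "fg_module R (self_mod R)"
proof -
  have "carrier R \<subseteq> mspan R (self_mod R) {\<one>}"
  proof
    fix r assume r: "r \<in> carrier R"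
    have "r \<odot>\<^bsub>self_mod R\<^esub> \<one> \<in> mspan R (self_mod R) {\<one>}"
      by (rule submoduleD(4)[OF mspan_submodule[OF module_self] module_self])
        (use r mspan_incl[of "{\<one>}"] in auto)
    then show "r \<in> mspan R (self_mod R) {\<one>}" using r by simp
  qed
  moreover have "mspan R (self_mod R) {\<one>} \<subseteq> carrier R"
    using mspan_subset[OF module.carrier_is_submodule[OF module_self]] by auto
  ultimately show ?thesis unfolding fg_module_def using module_self by (intro conjI exI[of _ "{\<one>}"]) auto
qed

text \<open>A copy of \<open>R\<close> in \<open>mod_cat R\<close>.\<close>

definition base_obj :: "'a rmod" where
  "base_obj = (SOME X. X \<in> mod_cat R \<and> mod_iso R (self_mod R) X)"

lemma base_obj: "base_obj \<in> mod_cat R" "mod_iso R (self_mod R) base_obj"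
proof -
  have "\<exists>X. X \<in> mod_cat R \<and> mod_iso R (self_mod R) X" using ex_rmod[OF fg_self] by blast
  then have "base_obj \<in> mod_cat R \<and> mod_iso R (self_mod R) base_obj" unfolding base_obj_def by (rule someI_ex)
  then show "base_obj \<in> mod_cat R" "mod_iso R (self_mod R) base_obj" by simp_all
qed

lemma base_coordinates:
  obtains u c where "u \<in> carrier base_obj" "c \<in> mhom R base_obj (self_mod R)"
    "\<And>p. p \<in> carrier base_obj \<Longrightarrow> p = c p \<odot>\<^bsub>base_obj\<^esub> u" "\<And>r. r \<in> carrier R \<Longrightarrow> c (r \<odot>\<^bsub>base_obj\<^esub> u) = r"
proof -
  note B = mod_catD[OF base_obj(1)]
  interpret B: module R base_obj by (rule B)
  obtain f c where f: "f \<in> mhom R (self_mod R) base_obj" "c \<in> mhom R base_obj (self_mod R)"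
    "\<And>x. x \<in> carrier (self_mod R) \<Longrightarrow> c (f x) = x" "\<And>y. y \<in> carrier base_obj \<Longrightarrow> f (c y) = y"
    by (rule mod_isoE[OF base_obj(2) module_self B]) (rule that)
  have fr: "f r = r \<odot>\<^bsub>base_obj\<^esub> f \<one>" if "r \<in> carrier R" for r
    using mhom_smult[OF f(1), of r \<one>] that by simp
  show ?thesis
  proof (rule that[of "f \<one>" c])
    show "f \<one> \<in> carrier base_obj" using mhom_closed[OF f(1), of \<one>] by simp
    show "c \<in> mhom R base_obj (self_mod R)" by (rule f(2))
    show "p = c p \<odot>\<^bsub>base_obj\<^esub> f \<one>" if "p \<in> carrier base_obj" for p
      using fr[of "c p"] f(4)[OF that] mhom_closed[OF f(2) that] by simp
    show "c (r \<odot>\<^bsub>base_obj\<^esub> f \<one>) = r" if "r \<in> carrier R" for r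
      using f(3)[of r] fr[OF that] that by simp
  qed
qed

definition zero_obj :: "'a rmod" where
  "zero_obj = \<lparr>carrier = {{}}, mult = undefined, one = undefined, zero = {}, add = (\<lambda>_ _. {}), smult = (\<lambda>_ _. {})\<rparr>"

lemma zero_obj_simps [simp]: "carrier zero_obj = {{}}" "\<zero>\<^bsub>zero_obj\<^esub> = {}"
  by (simp_all add: zero_obj_def)

lemma zero_obj_module: "module R zero_obj"
  by (rule moduleI[OF is_cring], rule abelian_groupI) (auto simp: zero_obj_def)

lemma zero_obj: "zero_obj \<in> mod_cat R"
proof -
  have "mspan R zero_obj {} = {\<zero>\<^bsub>zero_obj\<^esub>}" by (rule mspan_empty[OF zero_obj_module])
  then show ?thesis unfolding mod_cat_def fg_module_def
    using zero_obj_module by (intro CollectI conjI exI[of _ "{}"]) simp_all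
qed

text \<open>
  Finite direct sums of copies of \<open>R\<close>, put together one summand at a time, so that the lifting
  property, freeness and the clearing of denominators follow by induction.
\<close>

inductive_set frees :: "'a rmod set" where
  zero: "zero_obj \<in> frees"
| base: "base_obj \<in> frees"
| bip: "P \<in> frees \<Longrightarrow> Q \<in> frees \<Longrightarrow> bip P Q \<in> frees"

lemma frees_mod_cat: "P \<in> frees \<Longrightarrow> P \<in> mod_cat R"
  by (induction rule: frees.induct) (simp_all add: zero_obj base_obj bip_mod_cat)

lemma frees_module: "P \<in> frees \<Longrightarrow> module R P"
  using frees_mod_cat mod_catD by blast

text \<open>
  Projectivity, also for maps \<open>g\<close> whose image merely lies in that of \<open>f\<close>, as happens in an exact
  complex.
\<close>

lemma frees_lift:
  fixes X :: "('a, 'e, 'k) module_scheme" and Y :: "('a, 'f, 'l) module_scheme"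
  assumes P: "P \<in> frees" and f: "f \<in> mhom R X Y" and g: "g \<in> mhom R P Y" and X: "module R X" and Y: "module R Y"
    and im: "\<And>p. p \<in> carrier P \<Longrightarrow> g p \<in> f ` carrier X"
  shows "\<exists>h\<in>mhom R P X. \<forall>p\<in>carrier P. f (h p) = g p"
  using P g im
proof (induction P arbitrary: g rule: frees.induct)
  case zero
  have "(\<lambda>_. \<zero>\<^bsub>X\<^esub>) \<in> mhom R zero_obj X" by (rule mhom_const_zero[OF X])
  moreover have "f \<zero>\<^bsub>X\<^esub> = g {}"
    using mhom_zero[OF f X Y] mhom_zero[OF zero(1) zero_obj_module Y] by simp
  ultimately show ?case by (intro bexI) auto
next
  case base
  interpret X: module R X by fact
  note B = mod_catD[OF base_obj(1)]
  obtain u c where u: "u \<in> carrier base_obj" "c \<in> mhom R base_obj (self_mod R)"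
    "\<And>p. p \<in> carrier base_obj \<Longrightarrow> p = c p \<odot>\<^bsub>base_obj\<^esub> u" "\<And>r. r \<in> carrier R \<Longrightarrow> c (r \<odot>\<^bsub>base_obj\<^esub> u) = r"
    by (rule base_coordinates) (rule that)
  obtain x where x: "x \<in> carrier X" "f x = g u" using base(2)[OF u(1)] by auto
  have cc: "c p \<in> carrier R" if "p \<in> carrier base_obj" for p using mhom_closed[OF u(2) that] by simp
  show ?case
  proof (rule bexI[of _ "\<lambda>p. c p \<odot>\<^bsub>X\<^esub> x"])
    show "(\<lambda>p. c p \<odot>\<^bsub>X\<^esub> x) \<in> mhom R base_obj X"
      by (rule mhomI) (use x cc in \<open>simp_all add: mhom_add[OF u(2)] mhom_smult[OF u(2)] X.smult_l_distr X.smult_assoc1\<close>)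
    show "\<forall>p\<in>carrier base_obj. f (c p \<odot>\<^bsub>X\<^esub> x) = g p"
    proof
      fix p assume p: "p \<in> carrier base_obj"
      have "f (c p \<odot>\<^bsub>X\<^esub> x) = g (c p \<odot>\<^bsub>base_obj\<^esub> u)"
        using x cc[OF p] u(1) by (simp add: mhom_smult[OF f] mhom_smult[OF base(1)])
      then show "f (c p \<odot>\<^bsub>X\<^esub> x) = g p" using u(3)[OF p] by simp
    qed
  qed
next
  case (bip P Q)
  interpret X: module R X by fact
  note PQ = frees_module[OF bip(1)] frees_module[OF bip(2)]
  interpret P: module R P by (rule PQ)
  interpret Q: module R Q by (rule PQ)
  have "\<exists>h\<in>mhom R P X. \<forall>p\<in>carrier P. f (h p) = g (pairc p \<zero>\<^bsub>Q\<^esub>)"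
    by (rule bip.IH(1)[OF mhom_comp[OF bip_inl[OF PQ(2)] bip.prems(1)]]) (use bip.prems(2) in simp)
  then obtain h1 where h1: "h1 \<in> mhom R P X" "\<forall>p\<in>carrier P. f (h1 p) = g (pairc p \<zero>\<^bsub>Q\<^esub>)" by auto
  have "\<exists>h\<in>mhom R Q X. \<forall>p\<in>carrier Q. f (h p) = g (pairc \<zero>\<^bsub>P\<^esub> p)"
    by (rule bip.IH(2)[OF mhom_comp[OF bip_inr[OF PQ(1)] bip.prems(1)]]) (use bip.prems(2) in simp)
  then obtain h2 where h2: "h2 \<in> mhom R Q X" "\<forall>p\<in>carrier Q. f (h2 p) = g (pairc \<zero>\<^bsub>P\<^esub> p)" by auto
  show ?case
  proof (rule bexI[OF _ bip_copair[OF h1(1) h2(1) X]], rule ballI)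
    fix u assume "u \<in> carrier (bip P Q)"
    then obtain a b where ab: "u = pairc a b" "a \<in> carrier P" "b \<in> carrier Q" by (rule bip_cases)
    have "f (h1 a \<oplus>\<^bsub>X\<^esub> h2 b) = g (pairc a \<zero>\<^bsub>Q\<^esub> \<oplus>\<^bsub>bip P Q\<^esub> pairc \<zero>\<^bsub>P\<^esub> b)"
      using ab h1 h2 by (simp add: mhom_add[OF f] mhom_closed[OF h1(1)] mhom_closed[OF h2(1)]
          mhom_add[OF bip.prems(1)] del: bip_simps(2))
    then show "f (h1 (fstc u) \<oplus>\<^bsub>X\<^esub> h2 (sndc u)) = g u" using ab by simp
  qed
qed

lemma ex_cover:
  fixes M :: "('a, 'e, 'k) module_scheme"
  assumes fg: "fg_module R M"
  obtains P f where "P \<in> frees" "f \<in> mhom R P M" "f ` carrier P = carrier M"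
proof -
  have M: "module R M" using fg by (simp add: fg_module_def)
  interpret M: module R M by fact
  obtain A where A: "finite A" "A \<subseteq> carrier M" "mspan R M A = carrier M"
    using fg by (auto simp: fg_module_def)
  have "\<exists>P\<in>frees. \<exists>f\<in>mhom R P M. A \<subseteq> f ` carrier P"
    using A(1,2)
  proof (induction rule: finite_induct)
    case empty
    then show ?case using frees.zero mhom_const_zero[OF M] by blast
  next
    case (insert g A)
    then obtain P f where P: "P \<in> frees" "f \<in> mhom R P M" "A \<subseteq> f ` carrier P" by auto
    have g: "g \<in> carrier M" using insert by auto
    note Pm = frees_module[OF P(1)]
    interpret P: module R P by (rule Pm)
    note B = mod_catD[OF base_obj(1)]
    interpret B: module R base_obj by (rule B)
    obtain u c where u: "u \<in> carrier base_obj" "c \<in> mhom R base_obj (self_mod R)"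
      "\<And>p. p \<in> carrier base_obj \<Longrightarrow> p = c p \<odot>\<^bsub>base_obj\<^esub> u" "\<And>r. r \<in> carrier R \<Longrightarrow> c (r \<odot>\<^bsub>base_obj\<^esub> u) = r"
      by (rule base_coordinates) (rule that)
    have cc: "c p \<in> carrier R" if "p \<in> carrier base_obj" for p using mhom_closed[OF u(2) that] by simp
    have k: "(\<lambda>p. c p \<odot>\<^bsub>M\<^esub> g) \<in> mhom R base_obj M"
      by (rule mhomI) (use g cc in \<open>simp_all add: mhom_add[OF u(2)] mhom_smult[OF u(2)] M.smult_l_distr M.smult_assoc1\<close>)
    let ?f = "\<lambda>v. c (fstc v) \<odot>\<^bsub>M\<^esub> g \<oplus>\<^bsub>M\<^esub> f (sndc v)"
    have hf: "?f \<in> mhom R (bip base_obj P) M" by (rule bip_copair[OF k P(2) M])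
    have c1: "c u = \<one>" using u(4)[of \<one>] u(1) by simp
    have c0: "c \<zero>\<^bsub>base_obj\<^esub> = \<zero>" using mhom_zero[OF u(2) B module_self] by simp
    have "g \<in> ?f ` carrier (bip base_obj P)"
      by (rule image_eqI[of _ _ "pairc u \<zero>\<^bsub>P\<^esub>"]) (use u(1) c1 mhom_zero[OF P(2) Pm M] g in simp_all)
    moreover have "A \<subseteq> ?f ` carrier (bip base_obj P)"
    proof
      fix a assume "a \<in> A"
      then obtain p where p: "p \<in> carrier P" "a = f p" using P(3) by auto
      show "a \<in> ?f ` carrier (bip base_obj P)"
        by (rule image_eqI[of _ _ "pairc \<zero>\<^bsub>base_obj\<^esub> p"]) (use p c0 g mhom_closed[OF P(2)] in simp_all)
    qed
    ultimately show ?case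
      by (intro bexI[of _ "bip base_obj P"] bexI[OF _ hf] frees.bip frees.base P(1)) simp
  qed
  then obtain P f where P: "P \<in> frees" "f \<in> mhom R P M" "A \<subseteq> f ` carrier P" by auto
  note Pm = frees_module[OF P(1)]
  have "submodule (f ` carrier P) R M"
    by (rule submodule_image[OF P(2) Pm M module.carrier_is_submodule[OF Pm]])
  then have "carrier M \<subseteq> f ` carrier P" using mspan_subset[of _ R M A] A(3) P(3) by metis
  then have "f ` carrier P = carrier M" using mhom_closed[OF P(2)] by auto
  then show ?thesis using that P by blast
qed

lemma bip_free_module:
  assumes X: "free_module R X" and Y: "free_module R Y"
  shows "free_module R (bip X Y)"
proof -
  have mX: "module R X" and mY: "module R Y" using X Y by (simp_all add: free_module_def)
  interpret X: module R X by fact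
  interpret Y: module R Y by fact
  note B = bip_module[OF mX mY]
  interpret B: module R "bip X Y" by fact
  obtain A where A: "A \<subseteq> carrier X" "mspan R X A = carrier X" "lin_indep R X A"
    using X by (auto simp: free_module_def)
  obtain C where C: "C \<subseteq> carrier Y" "mspan R Y C = carrier Y" "lin_indep R Y C"
    using Y by (auto simp: free_module_def)
  let ?A = "(\<lambda>x. pairc x \<zero>\<^bsub>Y\<^esub>) ` A" and ?C = "(\<lambda>y. pairc \<zero>\<^bsub>X\<^esub> y) ` C"
  let ?G = "?A \<union> ?C"
  have G: "?G \<subseteq> carrier (bip X Y)" using A C by auto
  note S = mspan_submodule[OF B G]
  have "mspan R X A \<subseteq> {x \<in> carrier X. pairc x \<zero>\<^bsub>Y\<^esub> \<in> mspan R (bip X Y) ?G}"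
    by (rule mspan_subset[OF submodule_vimage[OF bip_inl[OF mY] mX B S]]) (use A mspan_incl in fast)
  then have x: "pairc x \<zero>\<^bsub>Y\<^esub> \<in> mspan R (bip X Y) ?G" if "x \<in> carrier X" for x using A(2) that by auto
  have "mspan R Y C \<subseteq> {y \<in> carrier Y. pairc \<zero>\<^bsub>X\<^esub> y \<in> mspan R (bip X Y) ?G}"
    by (rule mspan_subset[OF submodule_vimage[OF bip_inr[OF mX] mY B S]]) (use C mspan_incl in fast)
  then have y: "pairc \<zero>\<^bsub>X\<^esub> y \<in> mspan R (bip X Y) ?G" if "y \<in> carrier Y" for y using C(2) that by auto
  have "carrier (bip X Y) \<subseteq> mspan R (bip X Y) ?G"
  proof
    fix u assume "u \<in> carrier (bip X Y)"
    then obtain a b where ab: "u = pairc a b" "a \<in> carrier X" "b \<in> carrier Y" by (rule bip_cases)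
    then show "u \<in> mspan R (bip X Y) ?G"
      using submoduleD(3)[OF S B x[OF ab(2)] y[OF ab(3)]] by simp
  qed
  then have span: "mspan R (bip X Y) ?G = carrier (bip X Y)"
    using mspan_subset[OF B.carrier_is_submodule G] by auto
  have "lin_indep R (bip X Y) ?G"
    unfolding lin_indep_def
  proof (intro allI impI ballI)
    fix F c b
    assume h: "finite F \<and> F \<subseteq> ?G \<and> c \<in> F \<rightarrow> carrier R \<and> (\<Oplus>\<^bsub>bip X Y\<^esub>b\<in>F. c b \<odot>\<^bsub>bip X Y\<^esub> b) = \<zero>\<^bsub>bip X Y\<^esub>"
      and b: "b \<in> F"
    have fin: "finite F" and FG: "F \<subseteq> ?G" and c: "c \<in> F \<rightarrow> carrier R" using h by auto
    have Fc: "f \<in> carrier (bip X Y)" if "f \<in> F" for f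
      using subsetD[OF G subsetD[OF FG that]] .
    have cf: "c f \<in> carrier R" if "f \<in> F" for f using c that by auto
    have cF: "(\<lambda>b. c b \<odot>\<^bsub>bip X Y\<^esub> b) \<in> F \<rightarrow> carrier (bip X Y)" using Fc cf by auto
    have sm: "fstc (r \<odot>\<^bsub>bip X Y\<^esub> f) = r \<odot>\<^bsub>X\<^esub> fstc f" "sndc (r \<odot>\<^bsub>bip X Y\<^esub> f) = r \<odot>\<^bsub>Y\<^esub> sndc f" if "f \<in> F" for r f
      using Fc[OF that] by (auto elim!: bip_cases)
    have s1: "(\<Oplus>\<^bsub>X\<^esub>b\<in>F. c b \<odot>\<^bsub>X\<^esub> fstc b) = \<zero>\<^bsub>X\<^esub>"
    proof -
      have "fstc (\<Oplus>\<^bsub>bip X Y\<^esub>b\<in>F. c b \<odot>\<^bsub>bip X Y\<^esub> b) = (\<Oplus>\<^bsub>X\<^esub>b\<in>F. fstc (c b \<odot>\<^bsub>bip X Y\<^esub> b))"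
        by (rule mhom_finsum[OF bip_fst B mX fin cF])
      also have "\<dots> = (\<Oplus>\<^bsub>X\<^esub>b\<in>F. c b \<odot>\<^bsub>X\<^esub> fstc b)"
        by (rule X.M.finsum_cong') (use sm cf mhom_closed[OF bip_fst[of X Y]] Fc in auto)
      finally show ?thesis using h by simp
    qed
    have s2: "(\<Oplus>\<^bsub>Y\<^esub>b\<in>F. c b \<odot>\<^bsub>Y\<^esub> sndc b) = \<zero>\<^bsub>Y\<^esub>"
    proof -
      have "sndc (\<Oplus>\<^bsub>bip X Y\<^esub>b\<in>F. c b \<odot>\<^bsub>bip X Y\<^esub> b) = (\<Oplus>\<^bsub>Y\<^esub>b\<in>F. sndc (c b \<odot>\<^bsub>bip X Y\<^esub> b))"
        by (rule mhom_finsum[OF bip_snd B mY fin cF])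
      also have "\<dots> = (\<Oplus>\<^bsub>Y\<^esub>b\<in>F. c b \<odot>\<^bsub>Y\<^esub> sndc b)"
        by (rule Y.M.finsum_cong') (use sm cf mhom_closed[OF bip_snd[of X Y]] Fc in auto)
      finally show ?thesis using h by simp
    qed
    show "c b = \<zero>"
    proof (cases "b \<in> ?A")
      case True
      let ?F = "{x \<in> A. pairc x \<zero>\<^bsub>Y\<^esub> \<in> F}"
      have im: "(\<lambda>x. pairc x \<zero>\<^bsub>Y\<^esub>) ` ?F = F \<inter> ?A" by auto
      have inj: "inj_on (\<lambda>x. pairc x \<zero>\<^bsub>Y\<^esub>) ?F" by (auto simp: inj_on_def)
      have fF: "finite ?F" using finite_imageD[OF _ inj] fin im by auto
      have "(\<Oplus>\<^bsub>X\<^esub>b\<in>F. c b \<odot>\<^bsub>X\<^esub> fstc b) = (\<Oplus>\<^bsub>X\<^esub>b\<in>F \<inter> ?A. c b \<odot>\<^bsub>X\<^esub> fstc b)"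
        by (rule X.M.add.finprod_mono_neutral_cong_right[simplified])
          (use fin FG cf A mhom_closed[OF bip_fst[of X Y]] Fc in auto)
      also have "\<dots> = (\<Oplus>\<^bsub>X\<^esub>x\<in>?F. c (pairc x \<zero>\<^bsub>Y\<^esub>) \<odot>\<^bsub>X\<^esub> x)"
        unfolding im[symmetric] by (subst X.M.finsum_reindex[OF _ inj]) (use cf A in auto)
      finally have "(\<Oplus>\<^bsub>X\<^esub>x\<in>?F. c (pairc x \<zero>\<^bsub>Y\<^esub>) \<odot>\<^bsub>X\<^esub> x) = \<zero>\<^bsub>X\<^esub>" using s1 by simp
      then have "c (pairc x \<zero>\<^bsub>Y\<^esub>) = \<zero>" if "x \<in> ?F" for x
        using lin_indepD[OF A(3) fF, of "\<lambda>x. c (pairc x \<zero>\<^bsub>Y\<^esub>)" x] cf that by simp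
      then show ?thesis using True b by auto
    next
      case False
      then have bC: "b \<in> ?C" using FG b by auto
      let ?F = "{x \<in> C. pairc \<zero>\<^bsub>X\<^esub> x \<in> F}"
      have im: "(\<lambda>x. pairc \<zero>\<^bsub>X\<^esub> x) ` ?F = F \<inter> ?C" by auto
      have inj: "inj_on (\<lambda>x. pairc \<zero>\<^bsub>X\<^esub> x) ?F" by (auto simp: inj_on_def)
      have fF: "finite ?F" using finite_imageD[OF _ inj] fin im by auto
      have "(\<Oplus>\<^bsub>Y\<^esub>b\<in>F. c b \<odot>\<^bsub>Y\<^esub> sndc b) = (\<Oplus>\<^bsub>Y\<^esub>b\<in>F \<inter> ?C. c b \<odot>\<^bsub>Y\<^esub> sndc b)"
        by (rule Y.M.add.finprod_mono_neutral_cong_right[simplified])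
          (use fin FG cf C mhom_closed[OF bip_snd[of X Y]] Fc in auto)
      also have "\<dots> = (\<Oplus>\<^bsub>Y\<^esub>x\<in>?F. c (pairc \<zero>\<^bsub>X\<^esub> x) \<odot>\<^bsub>Y\<^esub> x)"
        unfolding im[symmetric] by (subst Y.M.finsum_reindex[OF _ inj]) (use cf C in auto)
      finally have "(\<Oplus>\<^bsub>Y\<^esub>x\<in>?F. c (pairc \<zero>\<^bsub>X\<^esub> x) \<odot>\<^bsub>Y\<^esub> x) = \<zero>\<^bsub>Y\<^esub>" using s2 by simp
      then have "c (pairc \<zero>\<^bsub>X\<^esub> x) = \<zero>" if "x \<in> ?F" for x
        using lin_indepD[OF C(3) fF, of "\<lambda>x. c (pairc \<zero>\<^bsub>X\<^esub> x)" x] cf that by simp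
      then show ?thesis using bC b by auto
    qed
  qed
  then show ?thesis unfolding free_module_def using B G span by (intro conjI exI[of _ ?G])
qed

lemma base_free_module: "free_module R base_obj"
proof -
  note B = mod_catD[OF base_obj(1)]
  interpret B: module R base_obj by (rule B)
  obtain u c where u: "u \<in> carrier base_obj" "c \<in> mhom R base_obj (self_mod R)"
    "\<And>p. p \<in> carrier base_obj \<Longrightarrow> p = c p \<odot>\<^bsub>base_obj\<^esub> u" "\<And>r. r \<in> carrier R \<Longrightarrow> c (r \<odot>\<^bsub>base_obj\<^esub> u) = r"
    by (rule base_coordinates) (rule that)
  have cc: "c p \<in> carrier R" if "p \<in> carrier base_obj" for p using mhom_closed[OF u(2) that] by simp
  have uc: "{u} \<subseteq> carrier base_obj" using u by simp
  have "carrier base_obj \<subseteq> mspan R base_obj {u}"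
  proof
    fix p assume p: "p \<in> carrier base_obj"
    have "c p \<odot>\<^bsub>base_obj\<^esub> u \<in> mspan R base_obj {u}"
      by (rule submoduleD(4)[OF mspan_submodule[OF B uc] B cc[OF p]]) (use mspan_incl in fast)
    then show "p \<in> mspan R base_obj {u}" using u(3)[OF p] by simp
  qed
  then have "mspan R base_obj {u} = carrier base_obj"
    using mspan_subset[OF B.carrier_is_submodule uc] by auto
  moreover have "lin_indep R base_obj {u}"
    unfolding lin_indep_def
  proof (intro allI impI ballI)
    fix F a b
    assume h: "finite F \<and> F \<subseteq> {u} \<and> a \<in> F \<rightarrow> carrier R \<and> (\<Oplus>\<^bsub>base_obj\<^esub>b\<in>F. a b \<odot>\<^bsub>base_obj\<^esub> b) = \<zero>\<^bsub>base_obj\<^esub>"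
      and b: "b \<in> F"
    then have F: "F = {u}" "b = u" and a: "a u \<in> carrier R" by auto
    then have "a u \<odot>\<^bsub>base_obj\<^esub> u = \<zero>\<^bsub>base_obj\<^esub>" using h u(1) by simp
    then have "a u = c \<zero>\<^bsub>base_obj\<^esub>" using u(4)[OF a] by simp
    then show "a b = \<zero>" using mhom_zero[OF u(2) B module_self] F by simp
  qed
  ultimately show ?thesis unfolding free_module_def using B uc by (intro conjI exI[of _ "{u}"])
qed

lemma frees_free_module: "P \<in> frees \<Longrightarrow> free_module R P"
proof (induction rule: frees.induct)
  case zero
  have "mspan R zero_obj {} = carrier zero_obj" using mspan_empty[OF zero_obj_module] by simp
  moreover have "lin_indep R zero_obj {}" by (auto simp: lin_indep_def)
  ultimately show ?case unfolding free_module_def using zero_obj_module by (intro conjI exI[of _ "{}"]) simp_all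
qed (simp_all add: base_free_module bip_free_module)

end

section \<open>Complexes of free modules and mapping cones\<close>

lemma (in abelian_group) cancel_inner:
  assumes "p \<in> carrier G" "q \<in> carrier G" "r \<in> carrier G"
  shows "(p \<oplus> \<ominus> q) \<oplus> (r \<oplus> q) = p \<oplus> r" "(p \<oplus> q) \<oplus> (r \<oplus> \<ominus> q) = p \<oplus> r"
    "(p \<oplus> q) \<oplus> \<ominus> q = p" "(p \<oplus> \<ominus> q) \<oplus> q = p"
proof -
  have "(p \<oplus> \<ominus> q) \<oplus> (r \<oplus> q) = (p \<oplus> r) \<oplus> (\<ominus> q \<oplus> q)" using assms by (simp only: a_ac a_closed a_inv_closed)
  then show "(p \<oplus> \<ominus> q) \<oplus> (r \<oplus> q) = p \<oplus> r" using assms by (simp add: l_neg)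
  have "(p \<oplus> q) \<oplus> (r \<oplus> \<ominus> q) = (p \<oplus> r) \<oplus> (q \<oplus> \<ominus> q)" using assms by (simp only: a_ac a_closed a_inv_closed)
  then show "(p \<oplus> q) \<oplus> (r \<oplus> \<ominus> q) = p \<oplus> r" using assms by (simp add: r_neg)
  show "(p \<oplus> q) \<oplus> \<ominus> q = p" using assms by (simp add: a_assoc r_neg)
  show "(p \<oplus> \<ominus> q) \<oplus> q = p" using assms by (simp add: a_assoc l_neg)
qed

context noetherian_local_ring
begin

text \<open>
  Complexes are indexed homologically, the differential \<open>d n\<close> going from degree \<open>n + 1\<close> to
  degree \<open>n\<close>.
\<close>

definition chain_complex :: "(nat \<Rightarrow> 'a rmod) \<Rightarrow> (nat \<Rightarrow> 'a elem \<Rightarrow> 'a elem) \<Rightarrow> bool" where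
  "chain_complex G d \<longleftrightarrow> (\<forall>n. G n \<in> frees) \<and> (\<forall>n. d n \<in> mhom R (G (Suc n)) (G n)) \<and>
     (\<forall>n. \<forall>a\<in>carrier (G (Suc (Suc n))). d n (d (Suc n) a) = \<zero>\<^bsub>G n\<^esub>)"

text \<open>
  \<open>dh + hd = y\<close> in all degrees \<open>\<ge> l\<close>; there is no term \<open>hd\<close> in degree \<open>0\<close>. The bound is needed
  because \<open>y\<close> is not null-homotopic on a resolution of \<open>M\<close> in degree \<open>0\<close> unless it kills \<open>M\<close>.
\<close>

definition null_homotopic :: "(nat \<Rightarrow> 'a rmod) \<Rightarrow> (nat \<Rightarrow> 'a elem \<Rightarrow> 'a elem) \<Rightarrow> 'a \<Rightarrow> nat \<Rightarrow> bool" where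
  "null_homotopic G d y l \<longleftrightarrow> (\<exists>h. (\<forall>n. h n \<in> mhom R (G n) (G (Suc n))) \<and>
     (l = 0 \<longrightarrow> (\<forall>a\<in>carrier (G 0). d 0 (h 0 a) = y \<odot>\<^bsub>G 0\<^esub> a)) \<and>
     (\<forall>n. l \<le> Suc n \<longrightarrow> (\<forall>a\<in>carrier (G (Suc n)).
        d (Suc n) (h (Suc n) a) \<oplus>\<^bsub>G (Suc n)\<^esub> h n (d n a) = y \<odot>\<^bsub>G (Suc n)\<^esub> a)))"

lemma null_homotopicE:
  assumes "null_homotopic G d y l"
  obtains h where "\<And>n. h n \<in> mhom R (G n) (G (Suc n))"
    "\<And>a. l = 0 \<Longrightarrow> a \<in> carrier (G 0) \<Longrightarrow> d 0 (h 0 a) = y \<odot>\<^bsub>G 0\<^esub> a"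
    "\<And>n a. l \<le> Suc n \<Longrightarrow> a \<in> carrier (G (Suc n)) \<Longrightarrow>
        d (Suc n) (h (Suc n) a) \<oplus>\<^bsub>G (Suc n)\<^esub> h n (d n a) = y \<odot>\<^bsub>G (Suc n)\<^esub> a"
proof -
  obtain h where h: "(\<forall>n. h n \<in> mhom R (G n) (G (Suc n))) \<and>
     (l = 0 \<longrightarrow> (\<forall>a\<in>carrier (G 0). d 0 (h 0 a) = y \<odot>\<^bsub>G 0\<^esub> a)) \<and>
     (\<forall>n. l \<le> Suc n \<longrightarrow> (\<forall>a\<in>carrier (G (Suc n)).
        d (Suc n) (h (Suc n) a) \<oplus>\<^bsub>G (Suc n)\<^esub> h n (d n a) = y \<odot>\<^bsub>G (Suc n)\<^esub> a))"
    using assms unfolding null_homotopic_def by (elim exE)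
  show ?thesis by (rule that[of h]) (use h in simp_all)
qed

text \<open>The homology vanishes in all degrees \<open>> s\<close>.\<close>

definition exact_above :: "(nat \<Rightarrow> 'a rmod) \<Rightarrow> (nat \<Rightarrow> 'a elem \<Rightarrow> 'a elem) \<Rightarrow> nat \<Rightarrow> bool" where
  "exact_above G d s \<longleftrightarrow> (\<forall>n\<ge>s. \<forall>a\<in>carrier (G (Suc n)). d n a = \<zero>\<^bsub>G n\<^esub> \<longrightarrow> a \<in> d (Suc n) ` carrier (G (Suc (Suc n))))"

text \<open>
  The mapping cone of multiplication by \<open>x\<close>: in degree \<open>n\<close> it is \<open>G n \<oplus> G (n - 1)\<close>, and its
  differential maps \<open>(a, b)\<close> to \<open>(d a + x b, - d b)\<close>.
\<close>

definition cone :: "(nat \<Rightarrow> 'a rmod) \<Rightarrow> nat \<Rightarrow> 'a rmod" where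
  "cone G n = (case n of 0 \<Rightarrow> G 0 | Suc m \<Rightarrow> bip (G (Suc m)) (G m))"

definition cone_d :: "'a \<Rightarrow> (nat \<Rightarrow> 'a rmod) \<Rightarrow> (nat \<Rightarrow> 'a elem \<Rightarrow> 'a elem) \<Rightarrow>
    nat \<Rightarrow> 'a elem \<Rightarrow> 'a elem" where
  "cone_d x G d n u = (let e = d n (fstc u) \<oplus>\<^bsub>G n\<^esub> x \<odot>\<^bsub>G n\<^esub> sndc u in
     case n of 0 \<Rightarrow> e | Suc m \<Rightarrow> pairc e (\<ominus>\<^bsub>G m\<^esub> d m (sndc u)))"

lemma cone_simps [simp]:
  "cone G 0 = G 0" "cone G (Suc n) = bip (G (Suc n)) (G n)"
  "cone_d x G d 0 (pairc a b) = d 0 a \<oplus>\<^bsub>G 0\<^esub> x \<odot>\<^bsub>G 0\<^esub> b"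
  "cone_d x G d (Suc n) (pairc a b) = pairc (d (Suc n) a \<oplus>\<^bsub>G (Suc n)\<^esub> x \<odot>\<^bsub>G (Suc n)\<^esub> b) (\<ominus>\<^bsub>G n\<^esub> d n b)"
  by (simp_all add: cone_def cone_d_def)

context
  fixes G :: "nat \<Rightarrow> 'a rmod" and d :: "nat \<Rightarrow> 'a elem \<Rightarrow> 'a elem"
  assumes cx: "chain_complex G d"
begin

lemma cx_free: "G n \<in> frees" and cx_hom: "d n \<in> mhom R (G (Suc n)) (G n)"
  and cx_dd: "a \<in> carrier (G (Suc (Suc n))) \<Longrightarrow> d n (d (Suc n) a) = \<zero>\<^bsub>G n\<^esub>"
  using cx by (auto simp: chain_complex_def)

lemma cx_module: "module R (G n)"
  by (rule frees_module[OF cx_free])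

interpretation G: module R "G n" for n by (rule cx_module)

lemmas cx_d = mhom_closed[OF cx_hom] mhom_add[OF cx_hom] mhom_smult[OF cx_hom]
  mhom_minus[OF cx_hom cx_module cx_module] mhom_zero[OF cx_hom cx_module cx_module]

context
  fixes x :: 'a
  assumes x: "x \<in> carrier R"
begin

lemma cone_d_hom: "cone_d x G d n \<in> mhom R (cone G (Suc n)) (cone G n)"
proof (cases n)
  case 0
  have "(\<lambda>u. d 0 (fstc u) \<oplus>\<^bsub>G 0\<^esub> x \<odot>\<^bsub>G 0\<^esub> sndc u) \<in> mhom R (bip (G (Suc 0)) (G 0)) (G 0)"
    by (intro mhom_plus mhom_scale mhom_comp[OF bip_fst cx_hom] bip_snd cx_module x)
  moreover have "cone_d x G d 0 = (\<lambda>u. d 0 (fstc u) \<oplus>\<^bsub>G 0\<^esub> x \<odot>\<^bsub>G 0\<^esub> sndc u)"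
    by (simp add: fun_eq_iff cone_d_def)
  ultimately show ?thesis by (simp add: 0)
next
  case (Suc m)
  have "(\<lambda>u. pairc (d n (fstc u) \<oplus>\<^bsub>G n\<^esub> x \<odot>\<^bsub>G n\<^esub> sndc u) (\<ominus>\<^bsub>G m\<^esub> d m (sndc u)))
      \<in> mhom R (bip (G (Suc n)) (G n)) (bip (G n) (G m))"
    unfolding Suc
    by (intro bip_pair mhom_plus mhom_scale mhom_neg mhom_comp[OF bip_fst cx_hom]
        mhom_comp[OF bip_snd cx_hom] bip_snd cx_module x)
  moreover have "cone_d x G d n = (\<lambda>u. pairc (d n (fstc u) \<oplus>\<^bsub>G n\<^esub> x \<odot>\<^bsub>G n\<^esub> sndc u) (\<ominus>\<^bsub>G m\<^esub> d m (sndc u)))"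
    by (simp add: fun_eq_iff cone_d_def Suc)
  ultimately show ?thesis by (simp add: Suc)
qed

lemma cone_complex: "chain_complex (cone G) (cone_d x G d)"
  unfolding chain_complex_def
proof (intro conjI allI ballI)
  show "cone G n \<in> frees" for n by (cases n) (simp_all add: cx_free frees.bip)
  show "cone_d x G d n \<in> mhom R (cone G (Suc n)) (cone G n)" for n by (rule cone_d_hom)
  fix n u assume "u \<in> carrier (cone G (Suc (Suc n)))"
  then obtain a b where u: "u = pairc a b" "a \<in> carrier (G (Suc (Suc n)))" "b \<in> carrier (G (Suc n))"
    by (auto elim: bip_cases)
  have e: "d n (d (Suc n) a \<oplus>\<^bsub>G (Suc n)\<^esub> x \<odot>\<^bsub>G (Suc n)\<^esub> b) \<oplus>\<^bsub>G n\<^esub> x \<odot>\<^bsub>G n\<^esub> (\<ominus>\<^bsub>G n\<^esub> d n b) = \<zero>\<^bsub>G n\<^esub>"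
    using u x by (simp add: cx_d cx_dd G.smult_r_minus G.M.r_neg)
  show "cone_d x G d n (cone_d x G d (Suc n) u) = \<zero>\<^bsub>cone G n\<^esub>"
  proof (cases n)
    case 0
    then show ?thesis using e u by simp
  next
    case (Suc m)
    then have "\<ominus>\<^bsub>G m\<^esub> d m (\<ominus>\<^bsub>G n\<^esub> d n b) = \<zero>\<^bsub>G m\<^esub>" using u by (simp add: cx_d cx_dd)
    then show ?thesis using e u Suc by simp
  qed
qed

text \<open>
  From a null-homotopy \<open>h\<close> of \<open>y\<close> on \<open>G\<close>, the maps \<open>(a, b) \<mapsto> (h a, - h b)\<close> form one on the cone.
  In degree \<open>n\<close> they involve degree \<open>n - 1\<close> of \<open>G\<close>, so a bound \<open>l\<close> on the degrees moves up by
  one, except that \<open>l = 0\<close> stays.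
\<close>

lemma cone_null_homotopic:
  assumes "null_homotopic G d y l" and y: "y \<in> carrier R"
  shows "null_homotopic (cone G) (cone_d x G d) y (if l = 0 then 0 else Suc l)"
proof -
  obtain h where h: "\<And>n. h n \<in> mhom R (G n) (G (Suc n))"
    and h0: "\<And>a. l = 0 \<Longrightarrow> a \<in> carrier (G 0) \<Longrightarrow> d 0 (h 0 a) = y \<odot>\<^bsub>G 0\<^esub> a"
    and hS: "\<And>n a. l \<le> Suc n \<Longrightarrow> a \<in> carrier (G (Suc n)) \<Longrightarrow>
        d (Suc n) (h (Suc n) a) \<oplus>\<^bsub>G (Suc n)\<^esub> h n (d n a) = y \<odot>\<^bsub>G (Suc n)\<^esub> a"
    by (rule null_homotopicE[OF assms(1)]) (rule that)
  note hh = mhom_closed[OF h] mhom_add[OF h] mhom_smult[OF h]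
    mhom_minus[OF h cx_module cx_module] mhom_zero[OF h cx_module cx_module]
  define H where "H n u = (case n of 0 \<Rightarrow> pairc (h 0 u) \<zero>\<^bsub>G 0\<^esub>
    | Suc m \<Rightarrow> pairc (h n (fstc u)) (\<ominus>\<^bsub>G n\<^esub> h m (sndc u)))" for n u
  have H: "H n \<in> mhom R (cone G n) (cone G (Suc n))" for n
  proof (cases n)
    case 0
    have "(\<lambda>u. pairc (h 0 u) \<zero>\<^bsub>G 0\<^esub>) \<in> mhom R (G 0) (bip (G (Suc 0)) (G 0))"
      by (intro bip_pair h mhom_const_zero cx_module)
    moreover have "H 0 = (\<lambda>u. pairc (h 0 u) \<zero>\<^bsub>G 0\<^esub>)" by (simp add: fun_eq_iff H_def)
    ultimately show ?thesis by (simp add: 0)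
  next
    case (Suc m)
    have "(\<lambda>u. pairc (h n (fstc u)) (\<ominus>\<^bsub>G n\<^esub> h m (sndc u))) \<in> mhom R (bip (G n) (G m)) (bip (G (Suc n)) (G n))"
      unfolding Suc by (intro bip_pair mhom_neg mhom_comp[OF bip_fst h] mhom_comp[OF bip_snd h] cx_module)
    moreover have "H n = (\<lambda>u. pairc (h n (fstc u)) (\<ominus>\<^bsub>G n\<^esub> h m (sndc u)))" by (simp add: fun_eq_iff H_def Suc)
    ultimately show ?thesis by (simp add: Suc)
  qed
  show ?thesis
    unfolding null_homotopic_def
  proof (intro exI[of _ H] conjI allI impI ballI H)
    fix a assume l: "(if l = 0 then 0 else Suc l) = 0" and a: "a \<in> carrier (cone G 0)"
    then show "cone_d x G d 0 (H 0 a) = y \<odot>\<^bsub>cone G 0\<^esub> a" using h0 x y by (simp add: H_def cx_d hh split: if_splits)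
  next
    fix n u assume l: "(if l = 0 then 0 else Suc l) \<le> Suc n" and "u \<in> carrier (cone G (Suc n))"
    then obtain a b where u: "u = pairc a b" "a \<in> carrier (G (Suc n))" "b \<in> carrier (G n)"
      by (auto elim: bip_cases)
    have la: "l \<le> Suc n" using l by (auto split: if_splits)
    have e1: "(d (Suc n) (h (Suc n) a) \<oplus>\<^bsub>G (Suc n)\<^esub> x \<odot>\<^bsub>G (Suc n)\<^esub> (\<ominus>\<^bsub>G (Suc n)\<^esub> h n b)) \<oplus>\<^bsub>G (Suc n)\<^esub>
        h n (d n a \<oplus>\<^bsub>G n\<^esub> x \<odot>\<^bsub>G n\<^esub> b) = y \<odot>\<^bsub>G (Suc n)\<^esub> a"
      using hS[OF la u(2)] u x by (simp add: cx_d hh G.smult_r_minus G.M.cancel_inner)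
    show "cone_d x G d (Suc n) (H (Suc n) u) \<oplus>\<^bsub>cone G (Suc n)\<^esub> H n (cone_d x G d n u) = y \<odot>\<^bsub>cone G (Suc n)\<^esub> u"
    proof (cases n)
      case 0
      then have "l = 0" using l by (auto split: if_splits)
      then have "d 0 (h 0 b) = y \<odot>\<^bsub>G 0\<^esub> b" using h0 u 0 by simp
      then show ?thesis using e1 u 0 y by (simp add: H_def cx_d hh)
    next
      case (Suc m)
      have lb: "l \<le> Suc m" using l Suc by (auto split: if_splits)
      have "\<ominus>\<^bsub>G n\<^esub> d n (\<ominus>\<^bsub>G (Suc n)\<^esub> h n b) \<oplus>\<^bsub>G n\<^esub> \<ominus>\<^bsub>G n\<^esub> h m (\<ominus>\<^bsub>G m\<^esub> d m b) = y \<odot>\<^bsub>G n\<^esub> b"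
        using hS[OF lb] u Suc by (simp add: cx_d hh)
      then show ?thesis using e1 u Suc by (simp add: H_def)
    qed
  qed
qed

text \<open>
  On its own cone, \<open>x\<close> is null-homotopic through \<open>(a, b) \<mapsto> (0, a)\<close>.
\<close>

lemma cone_self_null_homotopic: "null_homotopic (cone G) (cone_d x G d) x 0"
proof -
  define H where "H n u = (case n of 0 \<Rightarrow> pairc \<zero>\<^bsub>G (Suc n)\<^esub> u | Suc m \<Rightarrow> pairc \<zero>\<^bsub>G (Suc n)\<^esub> (fstc u))" for n u
  have H: "H n \<in> mhom R (cone G n) (cone G (Suc n))" for n
  proof (cases n)
    case 0
    have "(\<lambda>u. pairc \<zero>\<^bsub>G (Suc 0)\<^esub> u) \<in> mhom R (G 0) (bip (G (Suc 0)) (G 0))" by (rule bip_inr[OF cx_module])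
    moreover have "H 0 = (\<lambda>u. pairc \<zero>\<^bsub>G (Suc 0)\<^esub> u)" by (simp add: fun_eq_iff H_def)
    ultimately show ?thesis by (simp add: 0)
  next
    case (Suc m)
    have "(\<lambda>u. pairc \<zero>\<^bsub>G (Suc n)\<^esub> (fstc u)) \<in> mhom R (bip (G n) (G m)) (bip (G (Suc n)) (G n))"
      by (intro bip_pair mhom_const_zero bip_fst cx_module)
    moreover have "H n = (\<lambda>u. pairc \<zero>\<^bsub>G (Suc n)\<^esub> (fstc u))" by (simp add: fun_eq_iff H_def Suc)
    ultimately show ?thesis by (simp add: Suc)
  qed
  show ?thesis
    unfolding null_homotopic_def
  proof (intro exI[of _ H] conjI allI impI ballI H)
    show "cone_d x G d 0 (H 0 a) = x \<odot>\<^bsub>cone G 0\<^esub> a" if "a \<in> carrier (cone G 0)" for a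
      using that x by (simp add: H_def cx_d)
    fix n u assume "u \<in> carrier (cone G (Suc n))"
    then obtain a b where u: "u = pairc a b" "a \<in> carrier (G (Suc n))" "b \<in> carrier (G n)"
      by (auto elim: bip_cases)
    have e: "\<ominus>\<^bsub>G n\<^esub> d n a \<oplus>\<^bsub>G n\<^esub> (d n a \<oplus>\<^bsub>G n\<^esub> x \<odot>\<^bsub>G n\<^esub> b) = x \<odot>\<^bsub>G n\<^esub> b"
      using u x by (simp add: cx_d G.M.r_neg1)
    show "cone_d x G d (Suc n) (H (Suc n) u) \<oplus>\<^bsub>cone G (Suc n)\<^esub> H n (cone_d x G d n u) = x \<odot>\<^bsub>cone G (Suc n)\<^esub> u"
    proof (cases n)
      case 0
      then show ?thesis using u x e by (simp add: H_def cx_d)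
    next
      case (Suc m)
      then show ?thesis using u x e by (simp add: H_def cx_d)
    qed
  qed
qed

text \<open>
  If the second component of a cycle \<open>(a, b)\<close> is a boundary \<open>d b'\<close>, then \<open>a + x b'\<close> is a cycle,
  hence a boundary \<open>d a'\<close>, and \<open>(a, b)\<close> is the boundary of \<open>(a', - b')\<close>.
\<close>

lemma cone_boundary:
  assumes ab: "a \<in> carrier (G (Suc n))" "b \<in> carrier (G n)" "d n a \<oplus>\<^bsub>G n\<^esub> x \<odot>\<^bsub>G n\<^esub> b = \<zero>\<^bsub>G n\<^esub>"
    and b': "b' \<in> carrier (G (Suc n))" "b = d n b'"
    and ex: "\<And>a. a \<in> carrier (G (Suc n)) \<Longrightarrow> d n a = \<zero>\<^bsub>G n\<^esub> \<Longrightarrow> a \<in> d (Suc n) ` carrier (G (Suc (Suc n)))"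
  shows "pairc a b \<in> cone_d x G d (Suc n) ` carrier (cone G (Suc (Suc n)))"
proof -
  have "d n (a \<oplus>\<^bsub>G (Suc n)\<^esub> x \<odot>\<^bsub>G (Suc n)\<^esub> b') = \<zero>\<^bsub>G n\<^esub>" using ab b' x by (simp add: cx_d)
  then obtain a' where a': "a' \<in> carrier (G (Suc (Suc n)))" "a \<oplus>\<^bsub>G (Suc n)\<^esub> x \<odot>\<^bsub>G (Suc n)\<^esub> b' = d (Suc n) a'"
    using ex[of "a \<oplus>\<^bsub>G (Suc n)\<^esub> x \<odot>\<^bsub>G (Suc n)\<^esub> b'"] ab b' x by auto
  have "d (Suc n) a' \<oplus>\<^bsub>G (Suc n)\<^esub> x \<odot>\<^bsub>G (Suc n)\<^esub> (\<ominus>\<^bsub>G (Suc n)\<^esub> b') = a"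
    unfolding a'(2)[symmetric] using ab b' x by (simp add: G.smult_r_minus G.M.cancel_inner)
  then have "cone_d x G d (Suc n) (pairc a' (\<ominus>\<^bsub>G (Suc n)\<^esub> b')) = pairc a b" using b' by (simp add: cx_d)
  then show ?thesis using a' b' by (intro image_eqI[of _ _ "pairc a' (\<ominus>\<^bsub>G (Suc n)\<^esub> b')"]) simp_all
qed

lemma cone_exact_step:
  assumes ex: "exact_above G d s" and n: "s \<le> n" and u: "u \<in> carrier (cone G (Suc (Suc n)))"
    and z: "cone_d x G d (Suc n) u = \<zero>\<^bsub>cone G (Suc n)\<^esub>"
  shows "u \<in> cone_d x G d (Suc (Suc n)) ` carrier (cone G (Suc (Suc (Suc n))))"
proof -
  obtain a b where ab: "u = pairc a b" "a \<in> carrier (G (Suc (Suc n)))" "b \<in> carrier (G (Suc n))"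
    using u by (auto elim: bip_cases)
  have e: "d (Suc n) a \<oplus>\<^bsub>G (Suc n)\<^esub> x \<odot>\<^bsub>G (Suc n)\<^esub> b = \<zero>\<^bsub>G (Suc n)\<^esub>" "\<ominus>\<^bsub>G n\<^esub> d n b = \<zero>\<^bsub>G n\<^esub>"
    using z ab by simp_all
  have "\<ominus>\<^bsub>G n\<^esub> (\<ominus>\<^bsub>G n\<^esub> d n b) = \<zero>\<^bsub>G n\<^esub>" unfolding e(2) by simp
  then have "d n b = \<zero>\<^bsub>G n\<^esub>" using ab by (simp add: cx_d)
  then obtain b' where b': "b' \<in> carrier (G (Suc (Suc n)))" "b = d (Suc n) b'"
    using ex n ab(3) unfolding exact_above_def by (metis imageE)
  show ?thesis unfolding ab(1)
    by (rule cone_boundary[OF ab(2,3) e(1) b']) (use ex n in \<open>simp add: exact_above_def\<close>)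
qed

lemma cone_exact_above:
  assumes ex: "exact_above G d s"
  shows "exact_above (cone G) (cone_d x G d) (Suc s)"
  unfolding exact_above_def
proof (intro allI impI ballI)
  fix n u assume n: "Suc s \<le> n" and u: "u \<in> carrier (cone G (Suc n))" "cone_d x G d n u = \<zero>\<^bsub>cone G n\<^esub>"
  obtain m where m: "n = Suc m" "s \<le> m" using n by (cases n) auto
  show "u \<in> cone_d x G d (Suc n) ` carrier (cone G (Suc (Suc n)))"
    using cone_exact_step[OF ex m(2)] u unfolding m(1) by simp
qed

text \<open>
  If \<open>x\<close> is regular on the homology in degree \<open>0\<close>, then a cycle \<open>(a, b)\<close> of degree \<open>1\<close> has
  \<open>x b\<close>, hence \<open>b\<close>, in the boundaries. So the cone is exact in positive degrees, as \<open>G\<close> is.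
\<close>

lemma cone_exact_regular:
  assumes ex: "exact_above G d 0"
    and reg: "\<And>b. b \<in> carrier (G 0) \<Longrightarrow> x \<odot>\<^bsub>G 0\<^esub> b \<in> d 0 ` carrier (G (Suc 0)) \<Longrightarrow> b \<in> d 0 ` carrier (G (Suc 0))"
  shows "exact_above (cone G) (cone_d x G d) 0"
  unfolding exact_above_def
proof (intro allI impI ballI)
  fix n u assume u: "u \<in> carrier (cone G (Suc n))" "cone_d x G d n u = \<zero>\<^bsub>cone G n\<^esub>"
  show "u \<in> cone_d x G d (Suc n) ` carrier (cone G (Suc (Suc n)))"
  proof (cases n)
    case 0
    then obtain a b where ab: "u = pairc a b" "a \<in> carrier (G (Suc 0))" "b \<in> carrier (G 0)"
      using u by (auto elim: bip_cases)
    have e: "d 0 a \<oplus>\<^bsub>G 0\<^esub> x \<odot>\<^bsub>G 0\<^esub> b = \<zero>\<^bsub>G 0\<^esub>" using u ab 0 by simp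
    have "x \<odot>\<^bsub>G 0\<^esub> b = \<ominus>\<^bsub>G 0\<^esub> d 0 a \<oplus>\<^bsub>G 0\<^esub> (d 0 a \<oplus>\<^bsub>G 0\<^esub> x \<odot>\<^bsub>G 0\<^esub> b)"
      using ab x by (simp add: cx_d G.M.r_neg1)
    then have "x \<odot>\<^bsub>G 0\<^esub> b = d 0 (\<ominus>\<^bsub>G (Suc 0)\<^esub> a)" using e ab by (simp add: cx_d)
    then have "x \<odot>\<^bsub>G 0\<^esub> b \<in> d 0 ` carrier (G (Suc 0))" using ab by simp
    then obtain b' where b': "b' \<in> carrier (G (Suc 0))" "b = d 0 b'" using reg[OF ab(3)] by auto
    show ?thesis unfolding ab(1) 0
      by (rule cone_boundary[OF ab(2,3) e b']) (use ex in \<open>simp add: exact_above_def\<close>)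
  next
    case (Suc m)
    show ?thesis using cone_exact_step[OF ex, of m] u unfolding Suc by simp
  qed
qed

end

end

end

section \<open>Resolutions and iterated cones\<close>

context noetherian_local_ring
begin

definition factors_through_free :: "('a, 'e, 'k) module_scheme \<Rightarrow> 'a \<Rightarrow> bool" where
  "factors_through_free M y \<longleftrightarrow> (\<exists>P\<in>frees. \<exists>s\<in>mhom R M P. \<exists>g\<in>mhom R P M. \<forall>u\<in>carrier M. g (s u) = y \<odot>\<^bsub>M\<^esub> u)"

text \<open>
  Choose successively free covers of the kernels; a triple of the sequence consists of a kernel,
  its cover and the covering map.
\<close>

lemma resolution_exists:
  fixes M :: "('a, 'e, 'k) module_scheme"
  assumes fg: "fg_module R M"
  obtains F d e where "chain_complex F d" "exact_above F d 0" "e \<in> mhom R (F 0) M" "e ` carrier (F 0) = carrier M"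
    "\<And>p. p \<in> carrier (F 0) \<Longrightarrow> e p = \<zero>\<^bsub>M\<^esub> \<longleftrightarrow> p \<in> d 0 ` carrier (F (Suc 0))"
proof -
  have M: "module R M" using fg by (simp add: fg_module_def)
  obtain P0 e where P0: "P0 \<in> frees" and e: "e \<in> mhom R P0 M" "e ` carrier P0 = carrier M"
    by (rule ex_cover[OF fg]) (rule that)
  note P0m = frees_module[OF P0]
  define K0 where "K0 = P0\<lparr>carrier := {p \<in> carrier P0. e p = \<zero>\<^bsub>M\<^esub>}\<rparr>"
  have K0: "K0 \<in> mod_cat R"
    unfolding K0_def by (rule submodule_mod_cat[OF frees_mod_cat[OF P0] submodule_kernel[OF e(1) P0m M]])
  define ker :: "'a rmod \<Rightarrow> 'a rmod \<Rightarrow> ('a elem \<Rightarrow> 'a elem) \<Rightarrow> 'a rmod" where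
    "ker P K f = P\<lparr>carrier := {p \<in> carrier P. f p = \<zero>\<^bsub>K\<^esub>}\<rparr>" for P K f
  let ?P = "\<lambda>n (t :: 'a rmod \<times> 'a rmod \<times> ('a elem \<Rightarrow> 'a elem)).
    (n = (0::nat) \<longrightarrow> fst t = K0) \<and> fst t \<in> mod_cat R \<and> fst (snd t) \<in> frees \<and>
    snd (snd t) \<in> mhom R (fst (snd t)) (fst t) \<and> snd (snd t) ` carrier (fst (snd t)) = carrier (fst t)"
  let ?Q = "\<lambda>(n::nat) t t'. fst t' = ker (fst (snd t)) (fst t) (snd (snd t))"
  have step: "\<exists>P f. P \<in> frees \<and> f \<in> mhom R P K \<and> f ` carrier P = carrier K" if "K \<in> mod_cat R" for K
  proof -
    have "fg_module R K" using that by (simp add: mod_cat_def)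
    from ex_cover[OF this] show ?thesis by metis
  qed
  have "\<exists>t. \<forall>n. ?P n (t n) \<and> ?Q n (t n) (t (Suc n))"
  proof (rule dependent_nat_choice)
    obtain P f where "P \<in> frees" "f \<in> mhom R P K0" "f ` carrier P = carrier K0" using step[OF K0] by auto
    then show "\<exists>t. ?P 0 t" using K0 by (intro exI[of _ "(K0, P, f)"]) simp
  next
    fix t n assume t: "?P n t"
    let ?K = "ker (fst (snd t)) (fst t) (snd (snd t))"
    have "?K \<in> mod_cat R" unfolding ker_def
      using t frees_mod_cat frees_module mod_catD by (intro submodule_mod_cat submodule_kernel) auto
    then obtain P f where "P \<in> frees" "f \<in> mhom R P ?K" "f ` carrier P = carrier ?K" using step by metis
    then show "\<exists>t'. ?P (Suc n) t' \<and> ?Q n t t'" using \<open>?K \<in> mod_cat R\<close> by (intro exI[of _ "(?K, P, f)"]) simp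
  qed
  then obtain t where t: "\<And>n. ?P n (t n)" "\<And>n. ?Q n (t n) (t (Suc n))" by auto
  define F where "F n = (case n of 0 \<Rightarrow> P0 | Suc m \<Rightarrow> fst (snd (t m)))" for n
  define d where "d n = snd (snd (t n))" for n
  define K where "K n = fst (t n)" for n
  have F0: "F 0 = P0" and FS: "\<And>n. F (Suc n) = fst (snd (t n))" by (simp_all add: F_def)
  have Kz: "K 0 = K0" using t(1)[of 0] by (simp add: K_def)
  have KS: "K (Suc n) = ker (F (Suc n)) (K n) (d n)" for n using t(2)[of n] by (simp add: K_def FS d_def)
  have Ff: "F n \<in> frees" for n using t(1) by (cases n) (simp_all add: F0 FS P0)
  have dK: "d n \<in> mhom R (F (Suc n)) (K n)" "d n ` carrier (F (Suc n)) = carrier (K n)" for n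
    using t(1)[of n] by (simp_all add: d_def FS K_def)
  have KF: "K n = (F n)\<lparr>carrier := carrier (K n)\<rparr>" "carrier (K n) \<subseteq> carrier (F n)" for n
    by (cases n; auto simp: Kz K0_def F0 KS ker_def)+
  have Kz': "\<zero>\<^bsub>K n\<^esub> = \<zero>\<^bsub>F n\<^esub>" for n using arg_cong[OF KF(1)[of n], of zero] by simp
  have Ka: "add (K n) = add (F n)" for n using arg_cong[OF KF(1)[of n], of add] by simp
  have Ks: "smult (K n) = smult (F n)" for n using arg_cong[OF KF(1)[of n], of smult] by simp
  have d: "d n \<in> mhom R (F (Suc n)) (F n)" for n
    using dK(1)[of n] KF(2)[of n] by (auto simp: mhom_def Ka Ks)
  have KSc: "carrier (K (Suc n)) = {p \<in> carrier (F (Suc n)). d n p = \<zero>\<^bsub>F n\<^esub>}" for n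
    by (simp add: KS ker_def Kz')
  show ?thesis
  proof (rule that)
    show "chain_complex F d"
      unfolding chain_complex_def
    proof (intro conjI allI ballI Ff d)
      fix n a assume "a \<in> carrier (F (Suc (Suc n)))"
      then have "d (Suc n) a \<in> carrier (K (Suc n))" using dK(2)[of "Suc n"] by auto
      then show "d n (d (Suc n) a) = \<zero>\<^bsub>F n\<^esub>" by (simp add: KSc)
    qed
    show "exact_above F d 0"
      unfolding exact_above_def using dK(2) KSc by (simp add: dK(2))
    show "e \<in> mhom R (F 0) M" "e ` carrier (F 0) = carrier M" by (simp_all add: F0 e)
    show "e p = \<zero>\<^bsub>M\<^esub> \<longleftrightarrow> p \<in> d 0 ` carrier (F (Suc 0))" if "p \<in> carrier (F 0)" for p
      using that dK(2)[of 0] by (simp add: Kz K0_def F0)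
  qed
qed

text \<open>
  If \<open>y\<close> on \<open>M\<close> is a composite of \<open>s : M \<rightarrow> P\<close> and \<open>g : P \<rightarrow> M\<close>, lift \<open>g\<close> to \<open>g' : P \<rightarrow> F 0\<close>. Then
  \<open>y - g' s e\<close> maps \<open>F 0\<close> into the kernel of \<open>e\<close>, hence lifts to \<open>h 0\<close>. The other \<open>h n\<close> are
  obtained by lifting \<open>y - h d\<close>. Since \<open>e d = 0\<close>, the correction \<open>g' s e\<close> disappears from degree
  \<open>1\<close> on.
\<close>

lemma resolution_null_homotopic:
  fixes M :: "('a, 'e, 'k) module_scheme"
  assumes M: "module R M" and cx: "chain_complex F d" and ex: "exact_above F d 0"
    and e: "e \<in> mhom R (F 0) M" "e ` carrier (F 0) = carrier M"
      "\<And>p. p \<in> carrier (F 0) \<Longrightarrow> e p = \<zero>\<^bsub>M\<^esub> \<longleftrightarrow> p \<in> d 0 ` carrier (F (Suc 0))"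
    and y: "y \<in> carrier R" and fac: "factors_through_free M y"
  shows "null_homotopic F d y (Suc 0)"
proof -
  interpret M: module R M by (rule M)
  note F = cx_free[OF cx] cx_hom[OF cx] cx_dd[OF cx] and Fm = cx_module[OF cx]
  interpret F: module R "F n" for n by (rule Fm)
  note dh = cx_d[OF cx]
  obtain P s g where P: "P \<in> frees" and s: "s \<in> mhom R M P" and g: "g \<in> mhom R P M"
    and gs: "\<And>u. u \<in> carrier M \<Longrightarrow> g (s u) = y \<odot>\<^bsub>M\<^esub> u"
    using fac unfolding factors_through_free_def by blast
  obtain g' where g': "g' \<in> mhom R P (F 0)" "\<forall>p\<in>carrier P. e (g' p) = g p"
    using frees_lift[OF P e(1) g Fm M] e(2) mhom_closed[OF g] by auto
  define k where "k a = y \<odot>\<^bsub>F 0\<^esub> a \<oplus>\<^bsub>F 0\<^esub> \<ominus>\<^bsub>F 0\<^esub> g' (s (e a))" for a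
  have k: "k \<in> mhom R (F 0) (F 0)"
    unfolding k_def
    by (intro mhom_plus mhom_scale mhom_neg mhom_id y Fm
        mhom_comp[OF mhom_comp[OF e(1) s] g'(1)])
  have ec: "e a \<in> carrier M" if "a \<in> carrier (F 0)" for a using mhom_closed[OF e(1) that] .
  have sc: "s u \<in> carrier P" if "u \<in> carrier M" for u using mhom_closed[OF s that] .
  have kim: "k a \<in> d 0 ` carrier (F (Suc 0))" if a: "a \<in> carrier (F 0)" for a
  proof -
    have "e (k a) = \<zero>\<^bsub>M\<^esub>"
      unfolding k_def using a y ec[OF a] sc[OF ec[OF a]] mhom_closed[OF g'(1)] g'(2)
      by (simp add: mhom_add[OF e(1)] mhom_smult[OF e(1)] mhom_minus[OF e(1) Fm M] gs M.M.r_neg)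
    then show ?thesis using e(3) mhom_closed[OF k a] by simp
  qed
  obtain h0 where h0: "h0 \<in> mhom R (F 0) (F (Suc 0))" "\<forall>a\<in>carrier (F 0). d 0 (h0 a) = k a"
    using frees_lift[OF F(1) F(2) k Fm Fm kim] by auto
  let ?P = "\<lambda>n h. h \<in> mhom R (F n) (F (Suc n)) \<and>
    (\<forall>b\<in>carrier (F (Suc n)). d n (h (d n b)) = y \<odot>\<^bsub>F n\<^esub> d n b)"
  let ?Q = "\<lambda>n h h'. \<forall>b\<in>carrier (F (Suc n)). d (Suc n) (h' b) = y \<odot>\<^bsub>F (Suc n)\<^esub> b \<oplus>\<^bsub>F (Suc n)\<^esub> \<ominus>\<^bsub>F (Suc n)\<^esub> h (d n b)"
  have "\<exists>h. \<forall>n. ?P n (h n) \<and> ?Q n (h n) (h (Suc n))"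
  proof (rule dependent_nat_choice)
    have "k (d 0 b) = y \<odot>\<^bsub>F 0\<^esub> d 0 b" if b: "b \<in> carrier (F (Suc 0))" for b
    proof -
      have "e (d 0 b) = \<zero>\<^bsub>M\<^esub>" using e(3)[of "d 0 b"] b by (simp add: dh)
      then show ?thesis using b y
        by (simp add: k_def dh mhom_zero[OF s M frees_module[OF P]] mhom_zero[OF g'(1) frees_module[OF P] Fm])
    qed
    then have "?P 0 h0" using h0 by (simp add: dh)
    then show "\<exists>h. ?P 0 h" by (rule exI[of _ h0])
  next
    fix h n assume h: "?P n h"
    have hh: "h \<in> mhom R (F n) (F (Suc n))" using h by simp
    let ?g = "\<lambda>b. y \<odot>\<^bsub>F (Suc n)\<^esub> b \<oplus>\<^bsub>F (Suc n)\<^esub> \<ominus>\<^bsub>F (Suc n)\<^esub> h (d n b)"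
    have g: "?g \<in> mhom R (F (Suc n)) (F (Suc n))"
      by (intro mhom_plus mhom_scale mhom_neg mhom_id y Fm mhom_comp[OF F(2) hh])
    have gim: "?g b \<in> d (Suc n) ` carrier (F (Suc (Suc n)))" if b: "b \<in> carrier (F (Suc n))" for b
    proof -
      have "d n (?g b) = \<zero>\<^bsub>F n\<^esub>"
        using b y h mhom_closed[OF hh] by (simp add: dh F.M.r_neg)
      moreover have "?g b \<in> carrier (F (Suc n))" using mhom_closed[OF g b] .
      ultimately show ?thesis using ex unfolding exact_above_def by simp
    qed
    obtain h' where h': "h' \<in> mhom R (F (Suc n)) (F (Suc (Suc n)))" "\<forall>b\<in>carrier (F (Suc n)). d (Suc n) (h' b) = ?g b"
      using frees_lift[OF F(1) F(2) g Fm Fm gim] by auto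
    have "d (Suc n) (h' (d (Suc n) c)) = y \<odot>\<^bsub>F (Suc n)\<^esub> d (Suc n) c" if c: "c \<in> carrier (F (Suc (Suc n)))" for c
      using h'(2) c y by (simp add: dh F(3) mhom_zero[OF hh Fm Fm])
    then show "\<exists>h'. ?P (Suc n) h' \<and> ?Q n h h'" using h' by (intro exI[of _ h']) simp
  qed
  then obtain h where hq: "\<forall>n. ?P n (h n) \<and> ?Q n (h n) (h (Suc n))" by (elim exE)
  have h: "\<And>n. ?P n (h n)" "\<And>n. ?Q n (h n) (h (Suc n))" using hq by simp_all
  have hm: "h n \<in> mhom R (F n) (F (Suc n))" for n using h(1) by simp
  show ?thesis
    unfolding null_homotopic_def
  proof (intro exI[of _ h] conjI allI impI ballI hm)
    fix n a assume a: "a \<in> carrier (F (Suc n))"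
    show "d (Suc n) (h (Suc n) a) \<oplus>\<^bsub>F (Suc n)\<^esub> h n (d n a) = y \<odot>\<^bsub>F (Suc n)\<^esub> a"
      using h(2)[of n] a y mhom_closed[OF hm] by (simp add: dh F.M.cancel_inner)
  qed simp
qed

text \<open>
  \<open>M\<close> is a retract of the cokernel of \<open>d k\<close>: the map \<open>\<alpha>\<close> induces the projection onto \<open>M\<close>, and
  \<open>\<gamma>\<close> the section. The section is given on a module \<open>P\<close> that \<open>e\<close> maps onto \<open>M\<close>, so that neither
  the cokernel nor a choice of preimages enters.
\<close>

definition retract_of_coker :: "('a, 'e, 'k) module_scheme \<Rightarrow> 'a rmod \<Rightarrow> ('a elem \<Rightarrow> 'e) \<Rightarrow>
    (nat \<Rightarrow> 'a rmod) \<Rightarrow> (nat \<Rightarrow> 'a elem \<Rightarrow> 'a elem) \<Rightarrow> nat \<Rightarrow> bool" where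
  "retract_of_coker M P e G d k \<longleftrightarrow> (\<exists>\<alpha> \<gamma>. \<alpha> \<in> mhom R (G k) M \<and> \<gamma> \<in> mhom R P (G k) \<and>
     (\<forall>a\<in>carrier (G (Suc k)). \<alpha> (d k a) = \<zero>\<^bsub>M\<^esub>) \<and> (\<forall>p\<in>carrier P. \<alpha> (\<gamma> p) = e p) \<and>
     (\<forall>p\<in>carrier P. e p = \<zero>\<^bsub>M\<^esub> \<longrightarrow> \<gamma> p \<in> d k ` carrier (G (Suc k))))"

text \<open>
  The cokernel of the cone in degree \<open>k + 1\<close> projects, by the second component, onto that of \<open>G\<close>
  in degree \<open>k\<close>; the null-homotopy \<open>h\<close> of \<open>x\<close> gives the section \<open>b \<mapsto> (- h b, b)\<close>. On a boundary
  \<open>b = d v\<close> its value is the boundary of \<open>(h v, - v)\<close>.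
\<close>

lemma cone_retract:
  fixes M :: "('a, 'e, 'k) module_scheme"
  assumes M: "module R M" and cx: "chain_complex G d" and x: "x \<in> carrier R" and P: "module R P"
    and nh: "null_homotopic G d x (Suc k)" and ret: "retract_of_coker M P e G d k"
  shows "retract_of_coker M P e (cone G) (cone_d x G d) (Suc k)"
proof -
  interpret M: module R M by (rule M)
  note Gm = cx_module[OF cx]
  interpret G: module R "G n" for n by (rule Gm)
  note dh = cx_d[OF cx]
  obtain h where h: "\<And>n. h n \<in> mhom R (G n) (G (Suc n))"
    and hS: "\<And>n a. Suc k \<le> Suc n \<Longrightarrow> a \<in> carrier (G (Suc n)) \<Longrightarrow>
        d (Suc n) (h (Suc n) a) \<oplus>\<^bsub>G (Suc n)\<^esub> h n (d n a) = x \<odot>\<^bsub>G (Suc n)\<^esub> a"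
    by (rule null_homotopicE[OF nh]) (rule that)
  note hh = mhom_closed[OF h] mhom_minus[OF h Gm Gm]
  obtain \<alpha> \<gamma> where a: "\<alpha> \<in> mhom R (G k) M" "\<gamma> \<in> mhom R P (G k)"
    "\<And>a. a \<in> carrier (G (Suc k)) \<Longrightarrow> \<alpha> (d k a) = \<zero>\<^bsub>M\<^esub>" "\<And>p. p \<in> carrier P \<Longrightarrow> \<alpha> (\<gamma> p) = e p"
    "\<And>p. p \<in> carrier P \<Longrightarrow> e p = \<zero>\<^bsub>M\<^esub> \<Longrightarrow> \<gamma> p \<in> d k ` carrier (G (Suc k))"
    using ret unfolding retract_of_coker_def by (elim exE conjE) metis
  let ?s = "\<lambda>p. pairc (\<ominus>\<^bsub>G (Suc k)\<^esub> h k (\<gamma> p)) (\<gamma> p)"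
  show ?thesis
    unfolding retract_of_coker_def
  proof (intro exI conjI ballI impI)
    show "(\<lambda>u. \<alpha> (sndc u)) \<in> mhom R (cone G (Suc k)) M" using mhom_comp[OF bip_snd a(1)] by simp
    have "?s \<in> mhom R P (bip (G (Suc k)) (G k))"
      by (intro bip_pair mhom_neg a Gm mhom_comp[OF a(2) h])
    then show "?s \<in> mhom R P (cone G (Suc k))" by simp
    show "\<alpha> (sndc (cone_d x G d (Suc k) u)) = \<zero>\<^bsub>M\<^esub>" if "u \<in> carrier (cone G (Suc (Suc k)))" for u
    proof -
      obtain a' b where u: "u = pairc a' b" "a' \<in> carrier (G (Suc (Suc k)))" "b \<in> carrier (G (Suc k))"
        using \<open>u \<in> _\<close> by (auto elim: bip_cases)
      then show ?thesis using a(3)[OF u(3)] by (simp add: mhom_minus[OF a(1) Gm M] dh)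
    qed
    show "\<alpha> (sndc (?s p)) = e p" if "p \<in> carrier P" for p using a(4)[OF that] by simp
    fix p assume p: "p \<in> carrier P" "e p = \<zero>\<^bsub>M\<^esub>"
    then obtain v where v: "v \<in> carrier (G (Suc k))" "\<gamma> p = d k v" using a(5) by auto
    let ?w = "pairc (h (Suc k) v) (\<ominus>\<^bsub>G (Suc k)\<^esub> v)"
    have "d (Suc k) (h (Suc k) v) \<oplus>\<^bsub>G (Suc k)\<^esub> x \<odot>\<^bsub>G (Suc k)\<^esub> (\<ominus>\<^bsub>G (Suc k)\<^esub> v) = \<ominus>\<^bsub>G (Suc k)\<^esub> h k (d k v)"
    proof -
      have c: "d (Suc k) (h (Suc k) v) \<in> carrier (G (Suc k))" "h k (d k v) \<in> carrier (G (Suc k))"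
        using v by (simp_all add: dh hh)
      have "d (Suc k) (h (Suc k) v) \<oplus>\<^bsub>G (Suc k)\<^esub> \<ominus>\<^bsub>G (Suc k)\<^esub> (x \<odot>\<^bsub>G (Suc k)\<^esub> v) = \<ominus>\<^bsub>G (Suc k)\<^esub> h k (d k v)"
        unfolding hS[OF order_refl v(1), symmetric] using c
        by (simp add: G.M.minus_add G.M.r_neg1 flip: G.M.a_assoc) (simp add: G.M.r_neg)
      then show ?thesis using x v by (simp add: G.smult_r_minus)
    qed
    then have "cone_d x G d (Suc k) ?w = ?s p" using v by (simp add: dh)
    moreover have "?w \<in> carrier (cone G (Suc (Suc k)))" using v by (simp add: hh)
    ultimately show "?s p \<in> cone_d x G d (Suc k) ` carrier (cone G (Suc (Suc k)))" by (metis image_eqI)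
  qed
qed

text \<open>
  Start with a free resolution of \<open>M\<close> and take the cone of one \<open>x\<close> of the sequence after the
  other. Every \<open>x\<close> already used is null-homotopic in all degrees, so the homology is killed by
  them in the end. Those still to come are null-homotopic from degree \<open>k + 1\<close> on after \<open>k\<close>
  steps, which is just enough for \<open>M\<close> to stay a retract of the cokernel in degree \<open>k\<close>. Each cone
  raises the top degree of homology by at most one, and by none while the sequence is regular on
  \<open>M\<close>.
\<close>

lemma iterated_cone:
  fixes M :: "('a, 'e, 'k) module_scheme"
  assumes fg: "fg_module R M" and J: "J \<subseteq> carrier R" "\<And>y. y \<in> J \<Longrightarrow> factors_through_free M y"
    and xs: "set xs \<subseteq> J"
    and reg: "\<And>i. i < t \<Longrightarrow> i < length xs \<Longrightarrow> regular_mod M (seq_sub M (take i xs)) (xs ! i)"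
  obtains G d P e where "chain_complex G d" "\<And>y. y \<in> set xs \<Longrightarrow> null_homotopic G d y 0"
    "retract_of_coker M P e G d (length xs)" "P \<in> frees" "e \<in> mhom R P M" "e ` carrier P = carrier M"
    "exact_above G d (length xs - t)"
proof -
  have M: "module R M" using fg by (simp add: fg_module_def)
  interpret M: module R M by (rule M)
  obtain F d e where F: "chain_complex F d" "exact_above F d 0" and e: "e \<in> mhom R (F 0) M" "e ` carrier (F 0) = carrier M"
    "\<And>p. p \<in> carrier (F 0) \<Longrightarrow> e p = \<zero>\<^bsub>M\<^esub> \<longleftrightarrow> p \<in> d 0 ` carrier (F (Suc 0))"
    by (rule resolution_exists[OF fg]) (rule that)
  (* the penultimate condition says that the homology in degree 0 is
     M modulo the first k elements; regularity refers to it *)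
  define stage where "stage k G d \<longleftrightarrow> chain_complex G d \<and> G 0 = F 0 \<and> (\<forall>y\<in>J. null_homotopic G d y (Suc k)) \<and>
    (\<forall>y\<in>set (take k xs). null_homotopic G d y 0) \<and> retract_of_coker M (F 0) e G d k \<and>
    (\<forall>c\<in>carrier (F 0). c \<in> d 0 ` carrier (G (Suc 0)) \<longleftrightarrow> e c \<in> seq_sub M (take k xs)) \<and>
    exact_above G d (k - t)" for k G d
  have "k \<le> length xs \<Longrightarrow> \<exists>G d. stage k G d" for k
  proof (induction k)
    case 0
    have "retract_of_coker M (F 0) e F d 0"
      unfolding retract_of_coker_def
    proof (intro exI conjI ballI impI)
      show "e \<in> mhom R (F 0) M" by (rule e)
      show "(\<lambda>p. p) \<in> mhom R (F 0) (F 0)" by (rule mhom_id)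
      show "e (d 0 a) = \<zero>\<^bsub>M\<^esub>" if "a \<in> carrier (F (Suc 0))" for a
        using e(3)[of "d 0 a"] that cx_d(1)[OF F(1), of a 0] by simp
    qed (use e(3) in simp_all)
    moreover have "null_homotopic F d y (Suc 0)" if "y \<in> J" for y
      by (rule resolution_null_homotopic[OF M F e]) (use that J in auto)
    ultimately have "stage 0 F d" unfolding stage_def using F e(3) by simp
    then show ?case by blast
  next
    case (Suc k)
    then obtain G d where G: "stage k G d" by auto
    have cx: "chain_complex G d" and G0: "G 0 = F 0" and hJ: "\<And>y. y \<in> J \<Longrightarrow> null_homotopic G d y (Suc k)"
      and hx: "\<And>y. y \<in> set (take k xs) \<Longrightarrow> null_homotopic G d y 0" and ret: "retract_of_coker M (F 0) e G d k"
      and im: "\<And>c. c \<in> carrier (F 0) \<Longrightarrow> c \<in> d 0 ` carrier (G (Suc 0)) \<longleftrightarrow> e c \<in> seq_sub M (take k xs)"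
      and ex: "exact_above G d (k - t)"
      using G unfolding stage_def by simp_all
    define x where "x = xs ! k"
    have kl: "k < length xs" using Suc.prems by simp
    have xJ: "x \<in> J" using kl xs by (auto simp: x_def)
    then have xc: "x \<in> carrier R" using J by auto
    have tk: "take (Suc k) xs = take k xs @ [x]" using kl by (simp add: take_Suc_conv_app_nth x_def)
    have tc: "set (take k xs) \<subseteq> carrier R" using xs J set_take_subset[of k xs] by auto
    interpret G: module R "G n" for n by (rule cx_module[OF cx])
    note dh = cx_d[OF cx]
    note S = seq_sub_submodule[OF M tc]
    have "stage (Suc k) (cone G) (cone_d x G d)"
      unfolding stage_def
    proof (intro conjI ballI)
      show "chain_complex (cone G) (cone_d x G d)" by (rule cone_complex[OF cx xc])
      show "cone G 0 = F 0" by (simp add: G0)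
      show "null_homotopic (cone G) (cone_d x G d) y (Suc (Suc k))" if y: "y \<in> J" for y
        using cone_null_homotopic[OF cx xc hJ[OF y]] y J(1) by auto
      show "null_homotopic (cone G) (cone_d x G d) y 0" if y: "y \<in> set (take (Suc k) xs)" for y
      proof (cases "y = x")
        case True
        then show ?thesis using cone_self_null_homotopic[OF cx xc] by simp
      next
        case False
        then have "y \<in> set (take k xs)" using y tk by simp
        then show ?thesis using cone_null_homotopic[OF cx xc hx] tc by auto
      qed
      show "retract_of_coker M (F 0) e (cone G) (cone_d x G d) (Suc k)"
        by (rule cone_retract[OF M cx xc _ hJ[OF xJ] ret]) (rule frees_module[OF cx_free[OF F(1)]])
      show "exact_above (cone G) (cone_d x G d) (Suc k - t)"
      proof (cases "k < t")
        case True
        have r: "regular_mod M (seq_sub M (take k xs)) x" using reg[OF True kl] by (simp add: x_def)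
        have "exact_above (cone G) (cone_d x G d) 0"
        proof (rule cone_exact_regular[OF cx xc])
          show "exact_above G d 0" using ex True by simp
          fix b assume b: "b \<in> carrier (G 0)" "x \<odot>\<^bsub>G 0\<^esub> b \<in> d 0 ` carrier (G (Suc 0))"
          have b0: "b \<in> carrier (F 0)" using b G0 by simp
          have "x \<odot>\<^bsub>F 0\<^esub> b \<in> carrier (F 0)" using b(1) xc G.smult_closed[of x b 0] unfolding G0 by simp
          then have "e (x \<odot>\<^bsub>F 0\<^esub> b) \<in> seq_sub M (take k xs)" using im b(2) G0 by simp
          then have "e b \<in> seq_sub M (take k xs)"
            using r mhom_closed[OF e(1) b0] b0 xc by (simp add: regular_mod_def mhom_smult[OF e(1)])
          then show "b \<in> d 0 ` carrier (G (Suc 0))" using im b0 by simp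
        qed
        then show ?thesis using True by simp
      next
        case False
        then show ?thesis using cone_exact_above[OF cx xc ex] by (simp add: Suc_diff_le)
      qed
      show "c \<in> cone_d x G d 0 ` carrier (cone G (Suc 0)) \<longleftrightarrow> e c \<in> seq_sub M (take (Suc k) xs)"
        if c: "c \<in> carrier (F 0)" for c
      proof
        assume "c \<in> cone_d x G d 0 ` carrier (cone G (Suc 0))"
        then obtain u where u: "u \<in> carrier (bip (G (Suc 0)) (G 0))" "c = cone_d x G d 0 u" by auto
        obtain a b where ab: "u = pairc a b" "a \<in> carrier (G (Suc 0))" "b \<in> carrier (G 0)"
          using u(1) by (rule bip_cases)
        have da: "d 0 a \<in> carrier (F 0)" "b \<in> carrier (F 0)" using ab dh(1)[of a 0] G0 by simp_all
        have xb: "x \<odot>\<^bsub>F 0\<^esub> b \<in> carrier (F 0)" using ab xc G.smult_closed[of x b 0] unfolding G0 by simp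
        have "e (d 0 a) \<in> seq_sub M (take k xs)" using im[OF da(1)] ab(2) by simp
        moreover have "e c = e (d 0 a) \<oplus>\<^bsub>M\<^esub> x \<odot>\<^bsub>M\<^esub> e b"
          using u ab da xb xc G0 by (simp add: mhom_add[OF e(1)] mhom_smult[OF e(1)])
        ultimately show "e c \<in> seq_sub M (take (Suc k) xs)"
          unfolding tk seq_sub_snoc add_mult_def using mhom_closed[OF e(1) da(2)] by blast
      next
        assume "e c \<in> seq_sub M (take (Suc k) xs)"
        then obtain w v where w: "w \<in> seq_sub M (take k xs)" "v \<in> carrier M" "e c = w \<oplus>\<^bsub>M\<^esub> x \<odot>\<^bsub>M\<^esub> v"
          unfolding tk seq_sub_snoc add_mult_def by blast
        have wc: "w \<in> carrier M" using w submoduleD(1)[OF S M] by auto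
        obtain b where b: "b \<in> carrier (F 0)" "e b = v" using w(2) e(2) by (metis imageE)
        interpret F0: module R "F 0" by (rule cx_module[OF F(1)])
        let ?c = "c \<oplus>\<^bsub>F 0\<^esub> \<ominus>\<^bsub>F 0\<^esub> (x \<odot>\<^bsub>F 0\<^esub> b)"
        have "e ?c = w"
          using c b xc w wc F0.module_axioms
          by (simp add: mhom_add[OF e(1)] mhom_minus[OF e(1) F0.module_axioms M] mhom_smult[OF e(1)] M.M.cancel_inner)
        then have "?c \<in> d 0 ` carrier (G (Suc 0))" using im[of ?c] c b xc w(1) by simp
        then obtain a where a: "a \<in> carrier (G (Suc 0))" "?c = d 0 a" by auto
        have "cone_d x G d 0 (pairc a b) = c"
          using a b c xc G0 by (simp add: a(2)[symmetric] F0.M.cancel_inner)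
        moreover have "pairc a b \<in> carrier (cone G (Suc 0))" using a b G0 by simp
        ultimately show "c \<in> cone_d x G d 0 ` carrier (cone G (Suc 0))" by (metis image_eqI)
      qed
    qed
    then show ?case by blast
  qed
  then obtain G d' where G: "stage (length xs) G d'" by blast
  show ?thesis
    by (rule that[of G d' "F 0" e]) (use G e cx_free[OF F(1)] in \<open>simp_all add: stage_def\<close>)
qed

end

section \<open>Syzygies of filtered modules\<close>

context noetherian_local_ring
begin

text \<open>Short exact sequences with named maps.\<close>

definition ses :: "('a elem \<Rightarrow> 'a elem) \<Rightarrow> ('a elem \<Rightarrow> 'a elem) \<Rightarrow>
    'a rmod \<Rightarrow> 'a rmod \<Rightarrow> 'a rmod \<Rightarrow> bool" where
  "ses f g A B C \<longleftrightarrow> f \<in> mhom R A B \<and> g \<in> mhom R B C \<and> inj_on f (carrier A) \<and> g ` carrier B = carrier C \<and>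
     (\<forall>b\<in>carrier B. g b = \<zero>\<^bsub>C\<^esub> \<longleftrightarrow> b \<in> f ` carrier A)"

lemma sesD:
  assumes "ses f g A B C"
  shows "f \<in> mhom R A B" "g \<in> mhom R B C" "inj_on f (carrier A)" "g ` carrier B = carrier C"
    "\<And>b. b \<in> carrier B \<Longrightarrow> g b = \<zero>\<^bsub>C\<^esub> \<longleftrightarrow> b \<in> f ` carrier A"
  using assms by (simp_all add: ses_def)

lemma ses_short_exact: "ses f g A B C \<Longrightarrow> short_exact R A B C"
  unfolding short_exact_def
proof (intro bexI conjI)
  assume s: "ses f g A B C"
  show "f ` carrier A = a_kernel B C g"
    using sesD(5)[OF s] mhom_closed[OF sesD(1)[OF s]] by (auto simp: a_kernel_def')
qed (simp_all add: ses_def)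

lemma kernel_ses:
  assumes f: "f \<in> mhom R B C" and B: "B \<in> mod_cat R" and C: "module R C" and s: "f ` carrier B = carrier C"
  shows "B\<lparr>carrier := {b \<in> carrier B. f b = \<zero>\<^bsub>C\<^esub>}\<rparr> \<in> mod_cat R"
    "ses (\<lambda>b. b) f (B\<lparr>carrier := {b \<in> carrier B. f b = \<zero>\<^bsub>C\<^esub>}\<rparr>) B C"
proof -
  show "B\<lparr>carrier := {b \<in> carrier B. f b = \<zero>\<^bsub>C\<^esub>}\<rparr> \<in> mod_cat R"
    by (rule submodule_mod_cat[OF B submodule_kernel[OF f mod_catD[OF B] C]])
  show "ses (\<lambda>b. b) f (B\<lparr>carrier := {b \<in> carrier B. f b = \<zero>\<^bsub>C\<^esub>}\<rparr>) B C"
    using f s by (auto simp: ses_def mhom_def)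
qed

lemma lift_through_injection:
  fixes A :: "('a, 'e, 'k) module_scheme" and B :: "('a, 'f, 'l) module_scheme" and W :: "('a, 'g, 'p) module_scheme"
  assumes i: "i \<in> mhom R A B" and inj: "inj_on i (carrier A)" and h: "h \<in> mhom R W B" and W: "module R W" and A: "module R A"
    and im: "\<And>w. w \<in> carrier W \<Longrightarrow> h w \<in> i ` carrier A"
  shows "\<exists>k\<in>mhom R W A. \<forall>w\<in>carrier W. i (k w) = h w"
proof -
  interpret A: module R A by fact
  interpret W: module R W by fact
  define k where "k w = the_inv_into (carrier A) i (h w)" for w
  have k: "k w \<in> carrier A" "i (k w) = h w" if "w \<in> carrier W" for w
    using the_inv_into_into[OF inj im[OF that] subset_refl] f_the_inv_into_f[OF inj im[OF that]] by (simp_all add: k_def)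
  have eq: "a = b" if "a \<in> carrier A" "b \<in> carrier A" "i a = i b" for a b using inj that by (simp add: inj_on_eq_iff)
  have "k \<in> mhom R W A"
  proof (rule mhomI)
    show "k (x \<oplus>\<^bsub>W\<^esub> y) = k x \<oplus>\<^bsub>A\<^esub> k y" if "x \<in> carrier W" "y \<in> carrier W" for x y
      by (rule eq) (use that k in \<open>simp_all add: mhom_add[OF i] mhom_add[OF h]\<close>)
    show "k (r \<odot>\<^bsub>W\<^esub> x) = r \<odot>\<^bsub>A\<^esub> k x" if "r \<in> carrier R" "x \<in> carrier W" for r x
      by (rule eq) (use that k in \<open>simp_all add: mhom_smult[OF i] mhom_smult[OF h]\<close>)
  qed (rule k)
  then show ?thesis using k by blast
qed

lemma bip_mem: "u \<in> carrier (bip X Y) \<longleftrightarrow> fstc u \<in> carrier X \<and> sndc u \<in> carrier Y \<and> u = pairc (fstc u) (sndc u)"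
proof
  assume "u \<in> carrier (bip X Y)"
  then obtain a b where "u = pairc a b" "a \<in> carrier X" "b \<in> carrier Y" by (rule bip_cases)
  then show "fstc u \<in> carrier X \<and> sndc u \<in> carrier Y \<and> u = pairc (fstc u) (sndc u)" by simp
next
  assume h: "fstc u \<in> carrier X \<and> sndc u \<in> carrier Y \<and> u = pairc (fstc u) (sndc u)"
  have "pairc (fstc u) (sndc u) \<in> carrier (bip X Y)" by (rule bip_simps(1)[THEN iffD2]) (use h in blast)
  then show "u \<in> carrier (bip X Y)" using h by metis
qed

definition syzygies :: "'a rmod set \<Rightarrow> 'a rmod set" where
  "syzygies \<Y> = {Z \<in> mod_cat R. \<exists>X\<in>\<Y>. X \<in> mod_cat R \<and> (\<exists>P\<in>frees. \<exists>i p. ses i p Z P X)}"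

text \<open>
  \<open>built [Y\<^sub>1, \<dots>, Y\<^sub>n] X\<close>: up to free direct summands, taken off again at each stage, \<open>X\<close> has a
  filtration whose successive quotients, from the bottom, lie in \<open>Y\<^sub>1, \<dots>, Y\<^sub>n\<close>. Allowing free
  summands at each stage is what makes the notion stable under arbitrary, not just minimal,
  syzygies.
\<close>

inductive built :: "'a rmod set list \<Rightarrow> 'a rmod \<Rightarrow> bool" where
  base: "X \<in> \<Y> \<Longrightarrow> X \<in> mod_cat R \<Longrightarrow> built [\<Y>] X"
| step: "A \<in> \<Y> \<Longrightarrow> A \<in> mod_cat R \<Longrightarrow> X \<in> mod_cat R \<Longrightarrow> Q \<in> frees \<Longrightarrow> C \<in> mod_cat R \<Longrightarrow>
    ses f g A (bip X Q) C \<Longrightarrow> built \<Y>s C \<Longrightarrow> built (\<Y> # \<Y>s) X"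

lemma built_extension:
  assumes A: "A \<in> \<Y>" "A \<in> mod_cat R" and X: "X \<in> mod_cat R" and C: "C \<in> mod_cat R"
    and s: "ses f g A X C" and b: "built \<Y>s C"
  shows "built (\<Y> # \<Y>s) X"
proof (rule built.step[OF A X frees.zero C _ b])
  show "ses (\<lambda>a. pairc (f a) \<zero>\<^bsub>zero_obj\<^esub>) (\<lambda>u. g (fstc u)) A (bip X zero_obj) C"
    unfolding ses_def
  proof (intro conjI ballI)
    show "(\<lambda>a. pairc (f a) \<zero>\<^bsub>zero_obj\<^esub>) \<in> mhom R A (bip X zero_obj)"
      by (rule bip_pair[OF sesD(1)[OF s] mhom_const_zero[OF zero_obj_module]])
    show "(\<lambda>u. g (fstc u)) \<in> mhom R (bip X zero_obj) C" by (rule mhom_comp[OF bip_fst sesD(2)[OF s]])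
    show "inj_on (\<lambda>a. pairc (f a) \<zero>\<^bsub>zero_obj\<^esub>) (carrier A)" using sesD(3)[OF s] by (simp add: inj_on_def)
    have "fstc ` carrier (bip X zero_obj) = carrier X"
      by (auto simp: bip_carrier intro!: image_eqI[of _ _ "pairc x {}" for x])
    then have "(\<lambda>u. g (fstc u)) ` carrier (bip X zero_obj) = g ` carrier X"
      unfolding image_image[of g fstc, symmetric] by simp
    then show "(\<lambda>u. g (fstc u)) ` carrier (bip X zero_obj) = carrier C" using sesD(4)[OF s] by simp
    show "(g (fstc b) = \<zero>\<^bsub>C\<^esub>) = (b \<in> (\<lambda>a. pairc (f a) \<zero>\<^bsub>zero_obj\<^esub>) ` carrier A)"
      if "b \<in> carrier (bip X zero_obj)" for b
    proof -
      obtain x y where b: "b = pairc x y" "x \<in> carrier X" "y = {}" using \<open>b \<in> _\<close> by (auto elim: bip_cases)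
      then show ?thesis using sesD(5)[OF s b(2)] by (simp add: image_iff)
    qed
  qed
qed

text \<open>
  Given \<open>0 \<rightarrow> A \<rightarrow> X \<oplus> Q \<rightarrow> C \<rightarrow> 0\<close> and a free cover \<open>P \<rightarrow> X\<close> with kernel \<open>Z\<close>, the composite
  \<open>P \<oplus> Q \<rightarrow> C\<close> is a free cover whose kernel \<open>Z'\<close> is an extension of \<open>A\<close> by \<open>Z\<close>. Pulling that
  extension back along a free cover \<open>Q' \<rightarrow> A\<close> splits it and gives \<open>0 \<rightarrow> A' \<rightarrow> Z \<oplus> Q' \<rightarrow> Z' \<rightarrow> 0\<close> with
  \<open>A'\<close> a syzygy of \<open>A\<close>.
\<close>

lemma built_syzygy:
  "built \<Y>s X \<Longrightarrow> Z \<in> mod_cat R \<Longrightarrow> P \<in> frees \<Longrightarrow> ses i p Z P X \<Longrightarrow> built (map syzygies \<Y>s) Z"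
proof (induction arbitrary: Z P i p rule: built.induct)
  case (base X \<Y>)
  then have "Z \<in> syzygies \<Y>" unfolding syzygies_def by blast
  then show ?case using base by (simp add: built.base)
next
  case (step A \<Y> X Q C f g \<Y>s)
  note s = sesD[OF step.hyps(6)]
  note z = sesD[OF step.prems(3)]
  note mods = mod_catD[OF step.hyps(2)] mod_catD[OF step.hyps(3)] frees_module[OF step.hyps(4)]
    mod_catD[OF step.hyps(5)] mod_catD[OF step.prems(1)] frees_module[OF step.prems(2)]
  interpret A: module R A by (rule mods)
  interpret X: module R X by (rule mods)
  interpret Q: module R Q by (rule mods)
  interpret C: module R C by (rule mods)
  interpret Z: module R Z by (rule mods)
  interpret P: module R P by (rule mods)
  let ?PQ = "bip P Q"
  have PQf: "?PQ \<in> frees" by (rule frees.bip[OF step.prems(2) step.hyps(4)])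
  note PQm = frees_module[OF PQf] and XQm = bip_module[OF mods(2,3)]
  interpret PQ: module R ?PQ by (rule PQm)
  interpret XQ: module R "bip X Q" by (rule XQm)
  (* r : P + Q -> X + Q covers the middle term, and q = g r covers C with kernel Z' *)
  define r where "r u = pairc (p (fstc u)) (sndc u)" for u
  have r: "r \<in> mhom R ?PQ (bip X Q)"
    unfolding r_def by (intro bip_pair mhom_comp[OF bip_fst z(2)] bip_snd)
  have rsurj: "r ` carrier ?PQ = carrier (bip X Q)"
  proof
    show "r ` carrier ?PQ \<subseteq> carrier (bip X Q)" using mhom_closed[OF r] by auto
    show "carrier (bip X Q) \<subseteq> r ` carrier ?PQ"
    proof
      fix w assume "w \<in> carrier (bip X Q)"
      then obtain a b where w: "w = pairc a b" "a \<in> carrier X" "b \<in> carrier Q" by (rule bip_cases)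
      then obtain a' where "a' \<in> carrier P" "a = p a'" using z(4) by (metis imageE)
      then show "w \<in> r ` carrier ?PQ" using w by (intro image_eqI[of _ _ "pairc a' b"]) (simp_all add: r_def)
    qed
  qed
  define q where "q u = g (r u)" for u
  have q: "q \<in> mhom R ?PQ C" unfolding q_def by (rule mhom_comp[OF r s(2)])
  have qsurj: "q ` carrier ?PQ = carrier C"
    unfolding q_def image_image[of g r, symmetric] rsurj by (rule s(4))
  define Z' where "Z' = ?PQ\<lparr>carrier := {u \<in> carrier ?PQ. q u = \<zero>\<^bsub>C\<^esub>}\<rparr>"
  note K = kernel_ses[OF q frees_mod_cat[OF PQf] mods(4) qsurj, folded Z'_def]
  have IH: "built (map syzygies \<Y>s) Z'" by (rule step.IH[OF K(1) PQf K(2)])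
  have Z'c: "u \<in> carrier Z' \<longleftrightarrow> u \<in> carrier ?PQ \<and> q u = \<zero>\<^bsub>C\<^esub>" for u by (simp add: Z'_def)
  have Z'a: "add Z' = add ?PQ" "smult Z' = smult ?PQ" "\<zero>\<^bsub>Z'\<^esub> = \<zero>\<^bsub>?PQ\<^esub>" by (simp_all add: Z'_def)
  obtain Q' c where Q': "Q' \<in> frees" and c: "c \<in> mhom R Q' A" "c ` carrier Q' = carrier A"
    by (rule ex_cover[of A]) (use step.hyps(2) in \<open>simp add: mod_cat_def\<close>, rule that)
  note Q'm = frees_module[OF Q']
  interpret Q': module R Q' by (rule Q'm)
  define A' where "A' = Q'\<lparr>carrier := {u \<in> carrier Q'. c u = \<zero>\<^bsub>A\<^esub>}\<rparr>"
  note KA = kernel_ses[OF c(1) frees_mod_cat[OF Q'] mods(1) c(2), folded A'_def]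
  have A'O: "A' \<in> syzygies \<Y>" unfolding syzygies_def using KA step.hyps(1,2) Q' by blast
  have A'c: "w \<in> carrier A' \<longleftrightarrow> w \<in> carrier Q' \<and> c w = \<zero>\<^bsub>A\<^esub>" for w by (simp add: A'_def)
  have A'a: "add A' = add Q'" "smult A' = smult Q'" "\<zero>\<^bsub>A'\<^esub> = \<zero>\<^bsub>Q'\<^esub>" by (simp_all add: A'_def)
  have fc: "(\<lambda>w. f (c w)) \<in> mhom R Q' (bip X Q)" by (rule mhom_comp[OF c(1) s(1)])
  (* c' lifts f c along r; adding it to the inclusion of Z gives \<phi> : Z + Q' -> Z' *)
  obtain c' where c': "c' \<in> mhom R Q' ?PQ" "\<forall>w\<in>carrier Q'. r (c' w) = f (c w)"
    using frees_lift[OF Q' r fc PQm XQm] rsurj mhom_closed[OF fc] by auto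
  have gf: "g (f a) = \<zero>\<^bsub>C\<^esub>" if "a \<in> carrier A" for a
    using s(5)[OF mhom_closed[OF s(1) that]] that by simp
  have f0: "f a = \<zero>\<^bsub>bip X Q\<^esub> \<longleftrightarrow> a = \<zero>\<^bsub>A\<^esub>" if "a \<in> carrier A" for a
    using inj_on_eq_iff[OF s(3) that A.M.zero_closed] mhom_zero[OF s(1) mods(1) XQm] by simp
  have rz: "r u = \<zero>\<^bsub>bip X Q\<^esub> \<longleftrightarrow> u \<in> (\<lambda>z. pairc (i z) \<zero>\<^bsub>Q\<^esub>) ` carrier Z" if "u \<in> carrier ?PQ" for u
  proof -
    obtain a b where u: "u = pairc a b" "a \<in> carrier P" "b \<in> carrier Q" using \<open>u \<in> _\<close> by (rule bip_cases)
    have "r u = \<zero>\<^bsub>bip X Q\<^esub> \<longleftrightarrow> a \<in> i ` carrier Z \<and> b = \<zero>\<^bsub>Q\<^esub>" using z(5)[OF u(2)] u by (simp add: r_def)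
    then show ?thesis using u by (simp add: image_iff)
  qed
  define \<phi> where "\<phi> v = pairc (i (fstc v)) \<zero>\<^bsub>Q\<^esub> \<oplus>\<^bsub>?PQ\<^esub> c' (sndc v)" for v
  have iz: "(\<lambda>z. pairc (i z) \<zero>\<^bsub>Q\<^esub>) \<in> mhom R Z ?PQ" by (rule bip_pair[OF z(1) mhom_const_zero[OF mods(3)]])
  have \<phi>: "\<phi> \<in> mhom R (bip Z Q') ?PQ"
    unfolding \<phi>_def by (rule bip_copair[OF iz c'(1) PQm])
  have r\<phi>: "r (\<phi> v) = f (c (sndc v))" if "v \<in> carrier (bip Z Q')" for v
  proof -
    have v: "fstc v \<in> carrier Z" "sndc v \<in> carrier Q'"
      using mhom_closed[OF bip_fst that] mhom_closed[OF bip_snd that] by auto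
    have "r (pairc (i (fstc v)) \<zero>\<^bsub>Q\<^esub>) = \<zero>\<^bsub>bip X Q\<^esub>"
      using rz[OF mhom_closed[OF iz v(1)]] v(1) by blast
    then show ?thesis
      unfolding \<phi>_def using mhom_add[OF r mhom_closed[OF iz v(1)] mhom_closed[OF c'(1) v(2)]]
        c'(2) v(2) mhom_closed[OF fc v(2)] XQ.M.l_zero by simp
  qed
  have \<phi>Z': "\<phi> v \<in> carrier Z'" if "v \<in> carrier (bip Z Q')" for v
    using mhom_closed[OF \<phi> that] r\<phi>[OF that] gf mhom_closed[OF c(1) mhom_closed[OF bip_snd that]]
    by (simp add: Z'c q_def)
  have \<phi>h: "\<phi> \<in> mhom R (bip Z Q') Z'"
    by (rule mhomI) (use \<phi>Z' in \<open>simp_all add: Z'a mhom_add[OF \<phi>] mhom_smult[OF \<phi>]\<close>)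
  have \<phi>surj: "\<phi> ` carrier (bip Z Q') = carrier Z'"
  proof
    show "\<phi> ` carrier (bip Z Q') \<subseteq> carrier Z'" using \<phi>Z' by auto
    show "carrier Z' \<subseteq> \<phi> ` carrier (bip Z Q')"
    proof
      fix u assume "u \<in> carrier Z'"
      then have u: "u \<in> carrier ?PQ" "g (r u) = \<zero>\<^bsub>C\<^esub>" by (simp_all add: Z'c q_def)
      then obtain a where a: "a \<in> carrier A" "r u = f a" using s(5)[OF mhom_closed[OF r u(1)]] by auto
      obtain w where w: "w \<in> carrier Q'" "a = c w" using a(1) c(2) by (metis imageE)
      have cw: "c' w \<in> carrier ?PQ" by (rule mhom_closed[OF c'(1) w(1)])
      let ?u = "u \<oplus>\<^bsub>?PQ\<^esub> \<ominus>\<^bsub>?PQ\<^esub> c' w"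
      have "r ?u = \<zero>\<^bsub>bip X Q\<^esub>"
        using a w c'(2) cw u mhom_closed[OF fc w(1)] XQ.M.r_neg
        by (simp add: mhom_add[OF r] mhom_minus[OF r PQm XQm] del: bip_simps)
      then obtain zz where zz: "zz \<in> carrier Z" "?u = pairc (i zz) \<zero>\<^bsub>Q\<^esub>" using rz[of ?u] u cw by auto
      have "\<phi> (pairc zz w) = u" using zz(2)[symmetric] u cw PQ.M.cancel_inner(4)[OF u(1) cw cw] by (simp add: \<phi>_def del: bip_simps)
      then show "u \<in> \<phi> ` carrier (bip Z Q')" using zz w by (intro image_eqI[of _ _ "pairc zz w"]) simp_all
    qed
  qed
  (* on A' the lift c' lands in Z, and \<zeta> is its negative *)
  have A'Q: "(\<lambda>w. w) \<in> mhom R A' Q'" by (rule sesD(1)[OF KA(2)])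
  have nc: "(\<lambda>w. \<ominus>\<^bsub>P\<^esub> fstc (c' w)) \<in> mhom R A' P"
    by (rule mhom_neg[OF mhom_comp[OF mhom_comp[OF A'Q c'(1)] bip_fst] mods(6)])
  have c'z: "r (c' w) = \<zero>\<^bsub>bip X Q\<^esub>" if "w \<in> carrier A'" for w
    using that c'(2) f0[of "c w"] mhom_closed[OF c(1)] by (simp add: A'c del: bip_simps)
  have ncim: "\<ominus>\<^bsub>P\<^esub> fstc (c' w) \<in> i ` carrier Z" if w: "w \<in> carrier A'" for w
  proof -
    have "c' w \<in> carrier ?PQ" using w mhom_closed[OF c'(1)] by (simp add: A'c)
    then obtain zz where "zz \<in> carrier Z" "c' w = pairc (i zz) \<zero>\<^bsub>Q\<^esub>" using rz c'z[OF w] by auto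
    then show ?thesis using mhom_minus[OF z(1) mods(5,6)] by (intro image_eqI[of _ _ "\<ominus>\<^bsub>Z\<^esub> zz"]) simp_all
  qed
  obtain \<zeta> where \<zeta>: "\<zeta> \<in> mhom R A' Z" "\<forall>w\<in>carrier A'. i (\<zeta> w) = \<ominus>\<^bsub>P\<^esub> fstc (c' w)"
    using lift_through_injection[OF z(1,3) nc mod_catD[OF KA(1)] mods(5) ncim] by auto
  define \<psi> where "\<psi> w = pairc (\<zeta> w) w" for w
  have \<psi>: "\<psi> \<in> mhom R A' (bip Z Q')" unfolding \<psi>_def by (rule bip_pair[OF \<zeta>(1) A'Q])
  have "ses \<psi> \<phi> A' (bip Z Q') Z'"
    unfolding ses_def
  proof (intro conjI ballI \<psi> \<phi>h \<phi>surj)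
    show "inj_on \<psi> (carrier A')" by (simp add: inj_on_def \<psi>_def)
    fix v assume v: "v \<in> carrier (bip Z Q')"
    then obtain zz w where zw: "v = pairc zz w" "zz \<in> carrier Z" "w \<in> carrier Q'" by (rule bip_cases)
    have cw: "c' w \<in> carrier ?PQ" by (rule mhom_closed[OF c'(1) zw(3)])
    obtain a b where ab: "c' w = pairc a b" "a \<in> carrier P" "b \<in> carrier Q" using cw by (rule bip_cases)
    have izc: "i zz \<in> carrier P" by (rule mhom_closed[OF z(1) zw(2)])
    show "\<phi> v = \<zero>\<^bsub>Z'\<^esub> \<longleftrightarrow> v \<in> \<psi> ` carrier A'"
    proof
      assume e: "\<phi> v = \<zero>\<^bsub>Z'\<^esub>"
      then have "r (\<phi> v) = \<zero>\<^bsub>bip X Q\<^esub>" using mhom_zero[OF r PQm XQm] by (simp add: Z'a del: bip_simps)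
      then have "c w = \<zero>\<^bsub>A\<^esub>" using r\<phi>[OF v] f0[of "c w"] mhom_closed[OF c(1) zw(3)] zw by (simp del: bip_simps)
      then have w: "w \<in> carrier A'" using zw by (simp add: A'c)
      have "i zz \<oplus>\<^bsub>P\<^esub> a = \<zero>\<^bsub>P\<^esub>" using e zw ab by (simp add: \<phi>_def Z'a)
      then have "i zz = \<ominus>\<^bsub>P\<^esub> a" using P.M.cancel_inner(3)[OF izc ab(2) ab(2)] ab(2) by simp
      then have "i zz = i (\<zeta> w)" using \<zeta>(2) w ab by simp
      then have "zz = \<zeta> w" using inj_on_eq_iff[OF z(3) zw(2) mhom_closed[OF \<zeta>(1) w]] by simp
      then show "v \<in> \<psi> ` carrier A'" using w zw by (simp add: \<psi>_def)
    next
      assume "v \<in> \<psi> ` carrier A'"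
      then have w: "w \<in> carrier A'" "zz = \<zeta> w" using zw by (auto simp: \<psi>_def)
      then obtain z2 where z2: "z2 \<in> carrier Z" "c' w = pairc (i z2) \<zero>\<^bsub>Q\<^esub>" using rz[OF cw] c'z[OF w(1)] by auto
      then have "i zz = \<ominus>\<^bsub>P\<^esub> (i z2)" using \<zeta>(2) w by simp
      then show "\<phi> v = \<zero>\<^bsub>Z'\<^esub>"
        using zw z2 mhom_closed[OF z(1) z2(1)] by (simp add: \<phi>_def Z'a P.M.l_neg)
    qed
  qed
  from built.step[OF A'O KA(1) step.prems(1) Q' K(1) this IH] show ?case by simp
qed

section \<open>Direct summands and the three closures\<close>

definition retract_of :: "'a rmod \<Rightarrow> 'a rmod \<Rightarrow> bool" where
  "retract_of X N \<longleftrightarrow> (\<exists>i\<in>mhom R X N. \<exists>p\<in>mhom R N X. \<forall>x\<in>carrier X. p (i x) = x)"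

text \<open>The complement is the kernel of the projection.\<close>

lemma retract_direct_summand:
  assumes X: "X \<in> mod_cat R" and N: "N \<in> mod_cat R" and r: "retract_of X N"
  shows "direct_summand R X N"
proof -
  obtain i p where i: "i \<in> mhom R X N" and p: "p \<in> mhom R N X" and pi: "\<And>x. x \<in> carrier X \<Longrightarrow> p (i x) = x"
    using r unfolding retract_of_def by blast
  note Xm = mod_catD[OF X] and Nm = mod_catD[OF N]
  interpret X: module R X by (rule Xm)
  interpret N: module R N by (rule Nm)
  define K where "K = N\<lparr>carrier := {n \<in> carrier N. p n = \<zero>\<^bsub>X\<^esub>}\<rparr>"
  have K: "K \<in> mod_cat R" unfolding K_def by (rule submodule_mod_cat[OF N submodule_kernel[OF p Nm Xm]])
  let ?D = "dsum UNIV (\<lambda>b. if b then X else K)"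
  define f where "f n = (\<lambda>b. if b then p n else n \<oplus>\<^bsub>N\<^esub> \<ominus>\<^bsub>N\<^esub> i (p n))" for n
  have ic: "i x \<in> carrier N" if "x \<in> carrier X" for x using mhom_closed[OF i that] .
  have pc: "p x \<in> carrier X" if "x \<in> carrier N" for x using mhom_closed[OF p that] .
  have Dc: "s \<in> carrier ?D \<longleftrightarrow> s True \<in> carrier X \<and> s False \<in> carrier N \<and> p (s False) = \<zero>\<^bsub>X\<^esub>" for s :: "bool \<Rightarrow> 'a elem"
    by (auto simp: dsum_def K_def PiE_UNIV_domain Pi_def split: if_splits)
  have fc: "f n \<in> carrier ?D" if "n \<in> carrier N" for n
    unfolding Dc f_def using that ic pc by (simp add: mhom_add[OF p] mhom_minus[OF p Nm Xm] pi X.M.r_neg)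
  have e: "(n \<oplus>\<^bsub>N\<^esub> m) \<oplus>\<^bsub>N\<^esub> (a \<oplus>\<^bsub>N\<^esub> b) = (n \<oplus>\<^bsub>N\<^esub> a) \<oplus>\<^bsub>N\<^esub> (m \<oplus>\<^bsub>N\<^esub> b)"
    if "n \<in> carrier N" "m \<in> carrier N" "a \<in> carrier N" "b \<in> carrier N" for n m a b
    using that by (simp add: N.M.a_ac)
  have f: "f \<in> mhom R N ?D"
  proof (rule mhomI)
    show "f (n \<oplus>\<^bsub>N\<^esub> m) = f n \<oplus>\<^bsub>?D\<^esub> f m" if "n \<in> carrier N" "m \<in> carrier N" for n m
      using that ic pc by (auto simp: fun_eq_iff dsum_def f_def K_def mhom_add[OF p] mhom_add[OF i] N.M.minus_add e)
    show "f (a \<odot>\<^bsub>N\<^esub> n) = a \<odot>\<^bsub>?D\<^esub> f n" if "a \<in> carrier R" "n \<in> carrier N" for a n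
      using that ic pc by (auto simp: fun_eq_iff dsum_def f_def K_def mhom_smult[OF p] mhom_smult[OF i] N.smult_r_distr N.smult_r_minus)
  qed (rule fc)
  have "bij_betw f (carrier N) (carrier ?D)"
  proof (rule bij_betwI[of _ _ _ "\<lambda>s. i (s True) \<oplus>\<^bsub>N\<^esub> s False"])
    show "f \<in> carrier N \<rightarrow> carrier ?D" using fc by auto
    show "(\<lambda>s. i (s True) \<oplus>\<^bsub>N\<^esub> s False) \<in> carrier ?D \<rightarrow> carrier N" using ic by (auto simp: Dc)
    show "i (f n True) \<oplus>\<^bsub>N\<^esub> f n False = n" if "n \<in> carrier N" for n
      using that ic pc N.M.cancel_inner(4)[of n "i (p n)" n]
      by (simp add: f_def N.M.a_comm[of "i (p n)"])
    show "f (i (s True) \<oplus>\<^bsub>N\<^esub> s False) = s" if "s \<in> carrier ?D" for s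
      using that ic pc N.M.cancel_inner(3)[of "s False" "i (s True)"]
      by (auto simp: fun_eq_iff Dc f_def mhom_add[OF p] pi N.M.a_comm[of "i (s True)"])
  qed
  then have "mod_iso R N ?D" using f unfolding mod_iso_def by blast
  then show ?thesis unfolding direct_summand_def using K by blast
qed

lemma retract_trans:
  assumes "retract_of X W" "retract_of W N"
  shows "retract_of X N"
proof -
  obtain i p where 1: "i \<in> mhom R X W" "p \<in> mhom R W X" "\<forall>x\<in>carrier X. p (i x) = x"
    using assms(1) unfolding retract_of_def by blast
  obtain j q where 2: "j \<in> mhom R W N" "q \<in> mhom R N W" "\<forall>x\<in>carrier W. q (j x) = x"
    using assms(2) unfolding retract_of_def by blast
  show ?thesis unfolding retract_of_def
    by (rule bexI[OF _ mhom_comp[OF 1(1) 2(1)]], rule bexI[OF _ mhom_comp[OF 2(2) 1(2)]])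
      (use 1(3) 2(3) mhom_closed[OF 1(1)] in simp)
qed

lemma retract_bip: "module R Y \<Longrightarrow> retract_of X (bip X Y)"
  unfolding retract_of_def
  by (rule bexI[OF _ bip_inl], rule bexI[OF _ bip_fst]) simp_all

text \<open>
  Each step of \<open>built\<close> is an extension followed by the removal of a direct summand.
\<close>

lemma built_ext_closure:
  "built \<Y>s X \<Longrightarrow> (\<And>\<Y>. \<Y> \<in> set \<Y>s \<Longrightarrow> \<Y> \<inter> mod_cat R \<subseteq> ext_closure R \<X>) \<Longrightarrow> X \<in> ext_closure R \<X>"
proof (induction rule: built.induct)
  case (base X \<Y>)
  then show ?case by auto
next
  case (step A \<Y> X Q C f g \<Y>s)
  have B: "bip X Q \<in> mod_cat R" by (rule bip_mod_cat[OF step.hyps(3) frees_mod_cat[OF step.hyps(4)]])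
  have "A \<in> ext_closure R \<X>" using step.prems[of \<Y>] step.hyps by auto
  moreover have "C \<in> ext_closure R \<X>" using step by simp
  ultimately have "bip X Q \<in> ext_closure R \<X>"
    by (rule ext_closure.extension[OF _ _ B ses_short_exact[OF step.hyps(6)]])
  then show ?case
    by (rule ext_closure.summand[OF _ step.hyps(3) retract_direct_summand[OF step.hyps(3) B retract_bip]])
      (rule frees_module[OF step.hyps(4)])
qed

text \<open>
  The \<open>j\<close>-th factor is described by a surjection \<open>F (j + 1) \<rightarrow> A\<close> with kernel \<open>F j\<close>.
\<close>

definition filtered :: "'a rmod \<Rightarrow> 'a rmod set list \<Rightarrow> bool" where
  "filtered N \<Y>s \<longleftrightarrow> (\<exists>F. mod_filtration R N (length \<Y>s) F \<and> (\<forall>j<length \<Y>s. \<exists>A\<in>\<Y>s ! j. A \<in> mod_cat R \<and>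
     (\<exists>a\<in>mhom R (N\<lparr>carrier := F (Suc j)\<rparr>) A. a ` F (Suc j) = carrier A \<and> (\<forall>u\<in>F (Suc j). a u = \<zero>\<^bsub>A\<^esub> \<longleftrightarrow> u \<in> F j))))"

text \<open>
  Given \<open>0 \<rightarrow> A \<rightarrow> X \<oplus> Q \<rightarrow> C \<rightarrow> 0\<close> and a filtered \<open>N'\<close> that contains \<open>C\<close> as a retract, let \<open>N\<close> be
  the pullback of \<open>X \<oplus> Q\<close> and \<open>N'\<close> over \<open>C\<close>. It is an extension of \<open>N'\<close> by \<open>A\<close>, so it is
  filtered with \<open>A\<close> at the bottom; and the section of \<open>N' \<rightarrow> C\<close> makes \<open>X \<oplus> Q\<close>, hence \<open>X\<close>, a
  retract of \<open>N\<close>. So all free summands are split off at once, at the end.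
\<close>

lemma built_filtered:
  "built \<Y>s X \<Longrightarrow> \<exists>N\<in>mod_cat R. retract_of X N \<and> filtered N \<Y>s"
proof (induction rule: built.induct)
  case (base X \<Y>)
  note Xm = mod_catD[OF base(2)]
  interpret X: module R X by (rule Xm)
  let ?F = "\<lambda>n. if n = (0::nat) then {\<zero>\<^bsub>X\<^esub>} else carrier X"
  have "mod_filtration R X (length [\<Y>]) ?F"
    unfolding mod_filtration_def using submodule_zero[OF Xm] X.carrier_is_submodule by auto
  then have "filtered X [\<Y>]"
    unfolding filtered_def using base mhom_id[of R X]
    by (intro exI[of _ ?F]) (auto intro!: bexI[of _ X] bexI[of _ "\<lambda>x. x"])
  moreover have "retract_of X X" unfolding retract_of_def by (rule bexI[OF _ mhom_id], rule bexI[OF _ mhom_id]) simp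
  ultimately show ?case using base by blast
next
  case (step A \<Y> X Q C f g \<Y>s)
  note s = sesD[OF step.hyps(6)]
  obtain N' where N': "N' \<in> mod_cat R" "retract_of C N'" "filtered N' \<Y>s" using step.IH by blast
  obtain i p where i: "i \<in> mhom R C N'" and p: "p \<in> mhom R N' C" and pi: "\<And>x. x \<in> carrier C \<Longrightarrow> p (i x) = x"
    using N'(2) unfolding retract_of_def by blast
  obtain F' where F': "mod_filtration R N' (length \<Y>s) F'"
    and pc: "\<And>j. j < length \<Y>s \<Longrightarrow> \<exists>A\<in>\<Y>s ! j. A \<in> mod_cat R \<and> (\<exists>a\<in>mhom R (N'\<lparr>carrier := F' (Suc j)\<rparr>) A.
       a ` F' (Suc j) = carrier A \<and> (\<forall>u\<in>F' (Suc j). a u = \<zero>\<^bsub>A\<^esub> \<longleftrightarrow> u \<in> F' j))"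
    using N'(3) unfolding filtered_def by blast
  let ?E = "bip X Q"
  have E: "?E \<in> mod_cat R" by (rule bip_mod_cat[OF step.hyps(3) frees_mod_cat[OF step.hyps(4)]])
  have B: "bip ?E N' \<in> mod_cat R" by (rule bip_mod_cat[OF E N'(1)])
  note mods = mod_catD[OF step.hyps(2)] mod_catD[OF step.hyps(3)] frees_module[OF step.hyps(4)]
    mod_catD[OF step.hyps(5)] mod_catD[OF E] mod_catD[OF N'(1)] mod_catD[OF B]
  interpret C: module R C by (rule mods)
  interpret E: module R ?E by (rule mods)
  interpret N': module R N' by (rule mods)
  interpret B: module R "bip ?E N'" by (rule mods)
  define k where "k u = g (fstc u) \<oplus>\<^bsub>C\<^esub> \<ominus>\<^bsub>C\<^esub> p (sndc u)" for u
  have k: "k \<in> mhom R (bip ?E N') C"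
    unfolding k_def by (intro mhom_plus mhom_neg mhom_comp[OF bip_fst s(2)] mhom_comp[OF bip_snd p] mods)
  define S where "S = {u \<in> carrier (bip ?E N'). k u = \<zero>\<^bsub>C\<^esub>}"
  have Ssub: "submodule S R (bip ?E N')" unfolding S_def by (rule submodule_kernel[OF k mods(7,4)])
  have S: "u \<in> S \<longleftrightarrow> fstc u \<in> carrier ?E \<and> sndc u \<in> carrier N' \<and> u = pairc (fstc u) (sndc u) \<and> g (fstc u) = p (sndc u)" for u
  proof -
    have "k u = \<zero>\<^bsub>C\<^esub> \<longleftrightarrow> g (fstc u) = p (sndc u)" if "u \<in> carrier (bip ?E N')"
      using module_diff_zero_iff[OF mods(4) mhom_closed[OF s(2) mhom_closed[OF bip_fst that]]
          mhom_closed[OF p mhom_closed[OF bip_snd that]]] by (simp add: k_def a_minus_def)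
    then show ?thesis unfolding S_def using bip_mem[of u ?E N'] by blast
  qed
  define N where "N = (bip ?E N')\<lparr>carrier := S\<rparr>"
  have N: "N \<in> mod_cat R" unfolding N_def by (rule submodule_mod_cat[OF B Ssub])
  note Nm = mod_catD[OF N]
  have Nc: "carrier N = S" by (simp add: N_def)
  have Nops: "add N = add (bip ?E N')" "smult N = smult (bip ?E N')" "\<zero>\<^bsub>N\<^esub> = pairc \<zero>\<^bsub>?E\<^esub> \<zero>\<^bsub>N'\<^esub>"
    by (simp_all add: N_def)
  have incl: "(\<lambda>u. u) \<in> mhom R N (bip ?E N')" by (auto simp: mhom_def Nc Nops S_def)
  have Nf: "fstc \<in> mhom R N ?E" and Ns: "sndc \<in> mhom R N N'"
    using mhom_comp[OF incl bip_fst] mhom_comp[OF incl bip_snd] by simp_all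
  let ?i = "\<lambda>x. pairc (pairc x \<zero>\<^bsub>Q\<^esub>) (i (g (pairc x \<zero>\<^bsub>Q\<^esub>)))"
  have "?i \<in> mhom R X (bip ?E N')"
    by (intro bip_pair bip_inl mods mhom_comp[OF mhom_comp[OF bip_inl[OF mods(3)] s(2)] i])
  moreover have iS: "?i x \<in> S" if "x \<in> carrier X" for x
  proof -
    have "pairc x \<zero>\<^bsub>Q\<^esub> \<in> carrier ?E" using that mhom_closed[OF bip_inl[OF mods(3)]] by blast
    then show ?thesis using mhom_closed[OF i mhom_closed[OF s(2)]] pi[OF mhom_closed[OF s(2)]] by (simp only: S) simp
  qed
  ultimately have ih: "?i \<in> mhom R X N" by (auto simp: mhom_def Nc Nops)
  have ret: "retract_of X N"
    unfolding retract_of_def by (rule bexI[OF _ ih], rule bexI[OF _ mhom_comp[OF Nf bip_fst]]) simp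
  define F where "F n = (case n of 0 \<Rightarrow> {\<zero>\<^bsub>N\<^esub>} | Suc m \<Rightarrow> {u \<in> carrier N. sndc u \<in> F' m})" for n
  have F0: "F 0 = {\<zero>\<^bsub>N\<^esub>}" and FS: "F (Suc m) = {u \<in> carrier N. sndc u \<in> F' m}" for m by (simp_all add: F_def)
  have F'0: "F' 0 = {\<zero>\<^bsub>N'\<^esub>}" and F'r: "F' (length \<Y>s) = carrier N'"
    and F's: "\<And>j. j \<le> length \<Y>s \<Longrightarrow> submodule (F' j) R N'" and F'm: "\<And>j. j < length \<Y>s \<Longrightarrow> F' j \<subseteq> F' (Suc j)"
    using F' by (auto simp: mod_filtration_def)
  have Fsub: "submodule (F j) R N" if "j \<le> Suc (length \<Y>s)" for j
    using that submodule_zero[OF Nm] submodule_vimage[OF Ns Nm mods(6) F's] by (cases j) (simp_all add: F0 FS)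
  have "mod_filtration R N (length (\<Y> # \<Y>s)) F"
    unfolding mod_filtration_def
  proof (intro conjI allI impI)
    show "submodule (F j) R N" if "j \<le> length (\<Y> # \<Y>s)" for j using Fsub that by simp
    show "F j \<subseteq> F (Suc j)" if j: "j < length (\<Y> # \<Y>s)" for j
    proof (cases j)
      case 0
      then show ?thesis using submoduleD(2)[OF Fsub[of "Suc 0"] Nm] by (simp add: F0)
    next
      case (Suc m)
      then show ?thesis using F'm[of m] j by (auto simp: FS)
    qed
    show "F 0 = {\<zero>\<^bsub>N\<^esub>}" by (rule F0)
    show "F (length (\<Y> # \<Y>s)) = carrier N" using mhom_closed[OF Ns] by (auto simp: FS F'r)
  qed
  moreover have "\<exists>A\<in>(\<Y> # \<Y>s) ! j. A \<in> mod_cat R \<and> (\<exists>a\<in>mhom R (N\<lparr>carrier := F (Suc j)\<rparr>) A.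
       a ` F (Suc j) = carrier A \<and> (\<forall>u\<in>F (Suc j). a u = \<zero>\<^bsub>A\<^esub> \<longleftrightarrow> u \<in> F j))" if j: "j < length (\<Y> # \<Y>s)" for j
  proof (cases j)
    case 0
    let ?W = "N\<lparr>carrier := F (Suc 0)\<rparr>"
    note Ws = Fsub[of "Suc 0", simplified]
    have F1: "u \<in> F (Suc 0) \<longleftrightarrow> u \<in> S \<and> sndc u = \<zero>\<^bsub>N'\<^esub>" for u by (simp add: FS F'0 Nc)
    have h: "fstc \<in> mhom R ?W ?E" using Nf by (auto simp: mhom_def FS)
    have im: "fstc w \<in> f ` carrier A" if "w \<in> carrier ?W" for w
    proof -
      have "w \<in> S" "sndc w = \<zero>\<^bsub>N'\<^esub>" using that F1 by auto
      then have "fstc w \<in> carrier ?E" "g (fstc w) = \<zero>\<^bsub>C\<^esub>"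
        using S[of w] mhom_zero[OF p mods(6,4)] by (simp_all del: bip_simps)
      then show ?thesis using s(5) by blast
    qed
    obtain a where a: "a \<in> mhom R ?W A" "\<forall>w\<in>carrier ?W. f (a w) = fstc w"
      using lift_through_injection[OF s(1,3) h submodule_module[OF Ws Nm] mods(1) im] by auto
    have ac: "a u \<in> carrier A" if "u \<in> F (Suc 0)" for u using mhom_closed[OF a(1)] that by simp
    have surj: "a ` F (Suc 0) = carrier A"
    proof
      show "a ` F (Suc 0) \<subseteq> carrier A" using ac by auto
      show "carrier A \<subseteq> a ` F (Suc 0)"
      proof
        fix b assume b: "b \<in> carrier A"
        let ?u = "pairc (f b) \<zero>\<^bsub>N'\<^esub>"
        have fb: "f b \<in> carrier ?E" "g (f b) = \<zero>\<^bsub>C\<^esub>"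
          using mhom_closed[OF s(1) b] s(5)[OF mhom_closed[OF s(1) b]] b by simp_all
        then have u: "?u \<in> F (Suc 0)" unfolding F1 S using mhom_zero[OF p mods(6,4)] by simp
        then have "f (a ?u) = f b" using a(2) by simp
        then have "a ?u = b" using inj_on_eq_iff[OF s(3) ac[OF u] b] by simp
        then show "b \<in> a ` F (Suc 0)" using u by blast
      qed
    qed
    have ker: "a u = \<zero>\<^bsub>A\<^esub> \<longleftrightarrow> u \<in> F 0" if u: "u \<in> F (Suc 0)" for u
    proof -
      interpret A: module R A by (rule mods)
      have "a u = \<zero>\<^bsub>A\<^esub> \<longleftrightarrow> f (a u) = f \<zero>\<^bsub>A\<^esub>" using inj_on_eq_iff[OF s(3) ac[OF u] A.M.zero_closed] by simp
      also have "\<dots> \<longleftrightarrow> fstc u = \<zero>\<^bsub>?E\<^esub>" using a(2) u mhom_zero[OF s(1) mods(1,5)] by simp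
      also have "\<dots> \<longleftrightarrow> u = \<zero>\<^bsub>N\<^esub>" using u S[of u] unfolding F1 Nops(3) by (metis fstc_pairc)
      finally show ?thesis by (simp add: F0)
    qed
    have "\<exists>a\<in>mhom R ?W A. a ` F (Suc 0) = carrier A \<and> (\<forall>u\<in>F (Suc 0). a u = \<zero>\<^bsub>A\<^esub> \<longleftrightarrow> u \<in> F 0)"
      by (rule bexI[OF _ a(1)]) (simp add: surj ker)
    then show ?thesis unfolding 0 using step.hyps(1,2) by (intro bexI[of _ A]) simp_all
  next
    case (Suc m)
    then have m: "m < length \<Y>s" using j by simp
    obtain A' a where A': "A' \<in> \<Y>s ! m" "A' \<in> mod_cat R" and a: "a \<in> mhom R (N'\<lparr>carrier := F' (Suc m)\<rparr>) A'"
      "a ` F' (Suc m) = carrier A'" "\<forall>u\<in>F' (Suc m). a u = \<zero>\<^bsub>A'\<^esub> \<longleftrightarrow> u \<in> F' m" using pc[OF m] by blast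
    have "sndc \<in> mhom R (N\<lparr>carrier := F (Suc j)\<rparr>) (N'\<lparr>carrier := F' (Suc m)\<rparr>)"
      using Ns by (auto simp: mhom_def FS Suc)
    then have ah: "(\<lambda>u. a (sndc u)) \<in> mhom R (N\<lparr>carrier := F (Suc j)\<rparr>) A'" using a(1) by (rule mhom_comp)
    have F'c: "F' (Suc m) \<subseteq> carrier N'" using submoduleD(1)[OF F's mods(6)] m by simp
    have "v \<in> sndc ` F (Suc j)" if v: "v \<in> F' (Suc m)" for v
    proof -
      have vc: "v \<in> carrier N'" using v F'c by auto
      obtain e where e: "e \<in> carrier ?E" "g e = p v" using mhom_closed[OF p vc] s(4) by (metis imageE)
      then have "pairc e v \<in> S" unfolding S using vc by simp
      then show ?thesis using v by (intro image_eqI[of _ _ "pairc e v"]) (simp_all add: FS Suc Nc)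
    qed
    then have "sndc ` F (Suc j) = F' (Suc m)" by (auto simp: FS Suc)
    then have "(\<lambda>u. a (sndc u)) ` F (Suc j) = carrier A'" using a(2) by (simp flip: image_image)
    moreover have "\<forall>u\<in>F (Suc j). a (sndc u) = \<zero>\<^bsub>A'\<^esub> \<longleftrightarrow> u \<in> F j" using a(3) by (auto simp: FS Suc)
    ultimately have "\<exists>a\<in>mhom R (N\<lparr>carrier := F (Suc j)\<rparr>) A'.
       a ` F (Suc j) = carrier A' \<and> (\<forall>u\<in>F (Suc j). a u = \<zero>\<^bsub>A'\<^esub> \<longleftrightarrow> u \<in> F j)" using ah by (rule_tac bexI[of _ "\<lambda>u. a (sndc u)"]) simp_all
    then show ?thesis using A' Suc by (intro bexI[of _ A']) simp_all
  qed
  ultimately have "filtered N (\<Y> # \<Y>s)" unfolding filtered_def by (intro exI[of _ F] conjI allI impI)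
  then show ?case using N ret by blast
qed

lemma filtered_filt_closure:
  assumes X: "X \<in> mod_cat R" and N: "N \<in> mod_cat R" and ret: "retract_of X N" and f: "filtered N \<Y>s"
    and Y: "\<And>\<Y>. \<Y> \<in> set \<Y>s \<Longrightarrow> \<Y> \<subseteq> \<X>"
  shows "X \<in> filt_closure R \<X> (length \<Y>s)"
proof -
  note Nm = mod_catD[OF N]
  obtain F where F: "mod_filtration R N (length \<Y>s) F"
    and pc: "\<And>j. j < length \<Y>s \<Longrightarrow> \<exists>A\<in>\<Y>s ! j. A \<in> mod_cat R \<and> (\<exists>a\<in>mhom R (N\<lparr>carrier := F (Suc j)\<rparr>) A.
       a ` F (Suc j) = carrier A \<and> (\<forall>u\<in>F (Suc j). a u = \<zero>\<^bsub>A\<^esub> \<longleftrightarrow> u \<in> F j))"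
    using f unfolding filtered_def by blast
  have "in_cat R (quot_mod R (N\<lparr>carrier := F (Suc j)\<rparr>) (F j)) (add_closure R \<X>)" if j: "j < length \<Y>s" for j
  proof -
    obtain A a where A: "A \<in> \<Y>s ! j" "A \<in> mod_cat R" and a: "a \<in> mhom R (N\<lparr>carrier := F (Suc j)\<rparr>) A"
      "a ` F (Suc j) = carrier A" "\<forall>u\<in>F (Suc j). a u = \<zero>\<^bsub>A\<^esub> \<longleftrightarrow> u \<in> F j" using pc[OF j] by blast
    have s: "submodule (F (Suc j)) R N" "submodule (F j) R N" "F j \<subseteq> F (Suc j)"
      using F j by (auto simp: mod_filtration_def)
    have "mod_iso R (quot_mod R (N\<lparr>carrier := F (Suc j)\<rparr>) (F j)) A"
    proof (rule quot_mod_iso[OF submodule_module[OF s(1) Nm] mod_catD[OF A(2)] _ a(1)])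
      show "submodule (F j) R (N\<lparr>carrier := F (Suc j)\<rparr>)" using s submodule_of_submodule[OF s(1) Nm] by simp
    qed (use a in simp_all)
    moreover have "A \<in> add_closure R \<X>"
      using add_closure.base[of A \<X> A R] Y[OF nth_mem[OF j]] A mod_iso_refl by blast
    ultimately show ?thesis unfolding in_cat_def by blast
  qed
  then show ?thesis unfolding filt_closure_def
    using X N F retract_direct_summand[OF X N ret] by blast
qed

end

section \<open>Modules of finite length\<close>

context noetherian_local_ring
begin

text \<open>
  A quotient of \<open>R\<close> by \<open>\<mm>\<close> is simple because elements outside \<open>\<mm>\<close> are units.
\<close>

lemma residue_map_simple:
  assumes Q: "module R Q" and g: "g \<in> mhom R (self_mod R) Q" and s: "g ` carrier R = carrier Q"
    and k: "\<And>r. r \<in> carrier R \<Longrightarrow> g r = \<zero>\<^bsub>Q\<^esub> \<longleftrightarrow> r \<in> \<mm>"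
  shows "simple_module R Q"
  unfolding simple_module_def
proof (intro conjI allI impI Q)
  have gs: "g (a \<otimes> b) = a \<odot>\<^bsub>Q\<^esub> g b" if "a \<in> carrier R" "b \<in> carrier R" for a b
    using mhom_smult[OF g] that by simp
  have "g \<one> \<noteq> \<zero>\<^bsub>Q\<^esub>" using k[of \<one>] one_not_m by simp
  moreover have "g \<one> \<in> carrier Q" using s by auto
  ultimately show "carrier Q \<noteq> {\<zero>\<^bsub>Q\<^esub>}" by auto
  fix S assume S: "submodule S R Q"
  note sd = submoduleD[OF S Q]
  show "S = {\<zero>\<^bsub>Q\<^esub>} \<or> S = carrier Q"
  proof (cases "S \<subseteq> {\<zero>\<^bsub>Q\<^esub>}")
    case True
    then show ?thesis using sd(2) by auto
  next
    case False
    then obtain z where z: "z \<in> S" "z \<noteq> \<zero>\<^bsub>Q\<^esub>" by auto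
    have "z \<in> carrier Q" using z(1) sd(1) by auto
    then obtain r where r: "r \<in> carrier R" "z = g r" using s by (metis imageE)
    have "r \<notin> \<mm>" using z(2) k r by simp
    then obtain b where b: "b \<in> carrier R" "b \<otimes> r = \<one>" using unit_outside_m r(1) by blast
    have "g \<one> \<in> S" using sd(4)[OF b(1) z(1)] gs[OF b(1) r(1)] b r by simp
    then have "g a \<in> S" if "a \<in> carrier R" for a using sd(4)[of a "g \<one>"] gs[of a \<one>] that by simp
    then have "g ` carrier R \<subseteq> S" by auto
    then have "carrier Q \<subseteq> S" using s by simp
    then show ?thesis using sd(1) by auto
  qed
qed

lemma residue_map_residue_cat:
  assumes Q: "Q \<in> mod_cat R" and g: "g \<in> mhom R (self_mod R) Q" and s: "g ` carrier R = carrier Q"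
    and k: "\<And>r. r \<in> carrier R \<Longrightarrow> g r = \<zero>\<^bsub>Q\<^esub> \<longleftrightarrow> r \<in> \<mm>"
  shows "Q \<in> residue_cat R \<mm>"
proof -
  have m: "submodule \<mm> R (self_mod R)" using m_ideal by (simp add: submodule_self_iff)
  have "mod_iso R (quot_mod R (self_mod R) \<mm>) Q"
    by (rule quot_mod_iso[OF module_self mod_catD[OF Q] m g]) (use s k in simp_all)
  then have "mod_iso R Q (quot_mod R (self_mod R) \<mm>)"
    by (rule mod_iso_sym[OF _ quot_module[OF module_self m] mod_catD[OF Q]])
  then show ?thesis using Q by (simp add: residue_cat_def)
qed

text \<open>\<open>U'/U\<close> is a copy of \<open>R/\<mm>\<close>, generated by the class of \<open>v\<close>.\<close>

definition residue_step :: "('a, 'e, 'k) module_scheme \<Rightarrow> 'e set \<Rightarrow> 'e set \<Rightarrow> bool" where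
  "residue_step H U U' \<longleftrightarrow> (\<exists>v\<in>carrier H. v \<notin> U \<and> (\<forall>r\<in>\<mm>. r \<odot>\<^bsub>H\<^esub> v \<in> U) \<and>
     U' = {r \<odot>\<^bsub>H\<^esub> v \<oplus>\<^bsub>H\<^esub> u | r u. r \<in> carrier R \<and> u \<in> U})"

text \<open>
  The factor \<open>Q\<close> of a residue step is \<open>R/\<mm>\<close>: the class of \<open>rv\<close> vanishes exactly if \<open>r \<in> \<mm>\<close>,
  since a unit \<open>r\<close> would put \<open>v\<close> into \<open>U\<close>.
\<close>

lemma residue_step_map:
  fixes H :: "('a, 'e, 'k) module_scheme" and Q :: "('a, 'f, 'l) module_scheme"
  assumes H: "module R H" and U: "submodule U R H" and U': "submodule U' R H" and st: "residue_step H U U'"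
    and Q: "module R Q" and q: "q \<in> mhom R (H\<lparr>carrier := U'\<rparr>) Q" "q ` U' = carrier Q"
    and k: "\<And>u. u \<in> U' \<Longrightarrow> q u = \<zero>\<^bsub>Q\<^esub> \<longleftrightarrow> u \<in> U"
  obtains g where "g \<in> mhom R (self_mod R) Q" "g ` carrier R = carrier Q"
    "\<And>r. r \<in> carrier R \<Longrightarrow> g r = \<zero>\<^bsub>Q\<^esub> \<longleftrightarrow> r \<in> \<mm>"
proof -
  interpret H: module R H by fact
  interpret Q: module R Q by fact
  obtain v where v: "v \<in> carrier H" "v \<notin> U" "\<And>r. r \<in> \<mm> \<Longrightarrow> r \<odot>\<^bsub>H\<^esub> v \<in> U"
    and U'eq: "U' = {r \<odot>\<^bsub>H\<^esub> v \<oplus>\<^bsub>H\<^esub> u | r u. r \<in> carrier R \<and> u \<in> U}"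
    using st unfolding residue_step_def by (elim bexE conjE) (rule that, simp_all)
  note ud = submoduleD[OF U H] and ud' = submoduleD[OF U' H]
  have "\<one> \<odot>\<^bsub>H\<^esub> v \<oplus>\<^bsub>H\<^esub> \<zero>\<^bsub>H\<^esub> \<in> U'" unfolding U'eq using ud(2) by blast
  then have vU': "v \<in> U'" using v by simp
  have UU': "u \<in> U'" if u: "u \<in> U" for u
  proof -
    have "\<zero> \<odot>\<^bsub>H\<^esub> v \<oplus>\<^bsub>H\<^esub> u \<in> U'" unfolding U'eq using u by blast
    then show ?thesis using v u ud(1) by (simp add: subset_iff)
  qed
  have rv: "r \<odot>\<^bsub>H\<^esub> v \<in> U'" if "r \<in> carrier R" for r using ud'(4)[OF that vU'] .
  have qa: "q (x \<oplus>\<^bsub>H\<^esub> y) = q x \<oplus>\<^bsub>Q\<^esub> q y" if "x \<in> U'" "y \<in> U'" for x y using mhom_add[OF q(1), of x y] that by simp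
  have qc: "q x \<in> carrier Q" if "x \<in> U'" for x using q(2) that by auto
  show ?thesis
  proof (rule that[of "\<lambda>r. q (r \<odot>\<^bsub>H\<^esub> v)"])
    show "(\<lambda>r. q (r \<odot>\<^bsub>H\<^esub> v)) \<in> mhom R (self_mod R) Q"
    proof (rule mhomI)
      show "q (x \<odot>\<^bsub>H\<^esub> v) \<in> carrier Q" if "x \<in> carrier (self_mod R)" for x using qc rv that by simp
      show "q ((x \<oplus>\<^bsub>self_mod R\<^esub> y) \<odot>\<^bsub>H\<^esub> v) = q (x \<odot>\<^bsub>H\<^esub> v) \<oplus>\<^bsub>Q\<^esub> q (y \<odot>\<^bsub>H\<^esub> v)"
        if "x \<in> carrier (self_mod R)" "y \<in> carrier (self_mod R)" for x y
        using that v qa[OF rv rv] by (simp add: H.smult_l_distr)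
      show "q ((a \<odot>\<^bsub>self_mod R\<^esub> x) \<odot>\<^bsub>H\<^esub> v) = a \<odot>\<^bsub>Q\<^esub> q (x \<odot>\<^bsub>H\<^esub> v)"
        if "a \<in> carrier R" "x \<in> carrier (self_mod R)" for a x
        using that v rv mhom_smult[OF q(1), of a "x \<odot>\<^bsub>H\<^esub> v"] by (simp add: H.smult_assoc1)
    qed
    show "(\<lambda>r. q (r \<odot>\<^bsub>H\<^esub> v)) ` carrier R = carrier Q"
    proof
      show "(\<lambda>r. q (r \<odot>\<^bsub>H\<^esub> v)) ` carrier R \<subseteq> carrier Q" using rv qc by auto
      show "carrier Q \<subseteq> (\<lambda>r. q (r \<odot>\<^bsub>H\<^esub> v)) ` carrier R"
      proof
        fix y assume "y \<in> carrier Q"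
        then obtain z where z: "z \<in> U'" "y = q z" using q(2) by (metis imageE)
        then obtain r u where ru: "r \<in> carrier R" "u \<in> U" "z = r \<odot>\<^bsub>H\<^esub> v \<oplus>\<^bsub>H\<^esub> u" unfolding U'eq by blast
        have "q z = q (r \<odot>\<^bsub>H\<^esub> v)"
          using qa[OF rv[OF ru(1)] UU'[OF ru(2)]] k[OF UU'[OF ru(2)]] ru qc[OF rv[OF ru(1)]] by simp
        then show "y \<in> (\<lambda>r. q (r \<odot>\<^bsub>H\<^esub> v)) ` carrier R" using z ru by blast
      qed
    qed
    fix r assume r: "r \<in> carrier R"
    show "q (r \<odot>\<^bsub>H\<^esub> v) = \<zero>\<^bsub>Q\<^esub> \<longleftrightarrow> r \<in> \<mm>"
    proof
      assume "q (r \<odot>\<^bsub>H\<^esub> v) = \<zero>\<^bsub>Q\<^esub>"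
      then have rU: "r \<odot>\<^bsub>H\<^esub> v \<in> U" using k[OF rv[OF r]] by simp
      show "r \<in> \<mm>"
      proof (rule ccontr)
        assume "r \<notin> \<mm>"
        then obtain b where b: "b \<in> carrier R" "b \<otimes> r = \<one>" using unit_outside_m r by metis
        have "b \<odot>\<^bsub>H\<^esub> (r \<odot>\<^bsub>H\<^esub> v) = v" using b r v by (simp flip: H.smult_assoc1)
        then show False using ud(4)[OF b(1) rU] v(2) by simp
      qed
    next
      assume "r \<in> \<mm>"
      then show "q (r \<odot>\<^bsub>H\<^esub> v) = \<zero>\<^bsub>Q\<^esub>" using v(3) k[OF rv[OF r]] by simp
    qed
  qed
qed

definition residue_chain :: "('a, 'e, 'k) module_scheme \<Rightarrow> nat \<Rightarrow> (nat \<Rightarrow> 'e set) \<Rightarrow> bool" where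
  "residue_chain H n F \<longleftrightarrow> (\<forall>j\<le>n. submodule (F j) R H) \<and> F 0 = {\<zero>\<^bsub>H\<^esub>} \<and> (\<forall>j<n. residue_step H (F j) (F (Suc j)))"

lemma residue_step_mono:
  assumes "residue_step H U U'" "module R H" "submodule U R H"
  shows "U \<subseteq> U'"
proof
  interpret H: module R H by fact
  fix u assume u: "u \<in> U"
  obtain v where v: "v \<in> carrier H" "U' = {r \<odot>\<^bsub>H\<^esub> v \<oplus>\<^bsub>H\<^esub> u | r u. r \<in> carrier R \<and> u \<in> U}"
    using assms(1) unfolding residue_step_def by (elim bexE conjE) (rule that, simp_all)
  have "\<zero> \<odot>\<^bsub>H\<^esub> v \<oplus>\<^bsub>H\<^esub> u \<in> U'" unfolding v(2) using u by blast
  then show "u \<in> U'" using v u submoduleD(1)[OF assms(3,2)] by (simp add: subset_iff)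
qed

text \<open>
  A proper submodule \<open>U\<close> admits a class in \<open>H/U\<close> with prime annihilator, which contains that of
  \<open>H\<close> and so can only be \<open>\<mm>\<close>. Thus a maximal submodule with a composition series is everything.
\<close>

lemma residue_chain_exists:
  fixes H :: "('a, 'e, 'k) module_scheme"
  assumes fg: "fg_module R H" and only: "\<And>P. primeideal P R \<Longrightarrow> quot_ann R H {\<zero>\<^bsub>H\<^esub>} \<subseteq> P \<Longrightarrow> P = \<mm>"
  shows "\<exists>n F. residue_chain H n F \<and> F n = carrier H"
proof -
  have H: "module R H" using fg by (simp add: fg_module_def)
  interpret H: module R H by fact
  let ?Q = "\<lambda>U. \<exists>n F. residue_chain H n F \<and> F n = U"
  have z: "submodule {\<zero>\<^bsub>H\<^esub>} R H" by (rule submodule_zero[OF H])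
  have "residue_chain H 0 (\<lambda>_. {\<zero>\<^bsub>H\<^esub>})" using z by (simp add: residue_chain_def)
  then have Q0: "?Q {\<zero>\<^bsub>H\<^esub>}" by blast
  obtain U where U: "submodule U R H" "?Q U"
    and mx: "\<And>T. submodule T R H \<Longrightarrow> ?Q T \<Longrightarrow> U \<subseteq> T \<Longrightarrow> T = U"
    by (rule maximal_submodule[where Q = ?Q, OF fg z Q0]) (rule that)
  note ud = submoduleD[OF U(1) H]
  have "U = carrier H"
  proof (rule ccontr)
    assume "U \<noteq> carrier H"
    then obtain v where v: "v \<in> carrier H" "v \<notin> U" using ud(1) by auto
    obtain P where P: "P \<in> max_colons H U" using colon_below_max[OF H U(1) v] by auto
    then obtain w where w: "P = colon R H U w" "w \<in> carrier H" "w \<notin> U" by (auto simp: max_colons_def)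
    have "quot_ann R H {\<zero>\<^bsub>H\<^esub>} \<subseteq> P" unfolding w(1) using w(2) ud(2) by (auto simp: quot_ann_def colon_def)
    then have "P = \<mm>" using only max_colons_prime[OF H U(1) P] by simp
    then have mw: "r \<odot>\<^bsub>H\<^esub> w \<in> U" if "r \<in> \<mm>" for r using w(1) that by (auto simp: colon_def)
    let ?T = "mspan R H (insert w U)"
    have sp: "mspan R H U = U" by (rule mspan_eqI[OF U(1) subset_refl mspan_incl])
    have Teq: "?T = {r \<odot>\<^bsub>H\<^esub> w \<oplus>\<^bsub>H\<^esub> u | r u. r \<in> carrier R \<and> u \<in> U}"
      using mspan_insert[OF H w(2) ud(1)] unfolding sp .
    have Tc: "insert w U \<subseteq> carrier H" using w ud by auto
    note Ts = mspan_submodule[OF H Tc]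
    have stp: "residue_step H U ?T"
      unfolding residue_step_def by (rule bexI[OF _ w(2)]) (use w mw Teq in simp)
    obtain n F where F: "residue_chain H n F" "F n = U" using U(2) by blast
    have "residue_chain H (Suc n) (F(Suc n := ?T))"
      using F stp Ts by (auto simp: residue_chain_def le_Suc_eq less_Suc_eq)
    moreover have "(F(Suc n := ?T)) (Suc n) = ?T" by simp
    ultimately have "?Q ?T" by blast
    moreover have inc: "insert w U \<subseteq> ?T" by (rule mspan_incl)
    ultimately have "?T = U" using mx[OF Ts] by simp
    then show False using inc w(3) by auto
  qed
  then show ?thesis using U(2) by simp
qed

lemma residue_chain_finite_length:
  assumes H: "module R H" and F: "residue_chain H n F" "F n = carrier H"
  shows "finite_length R H"
proof -
  have Fs: "submodule (F j) R H" if "j \<le> n" for j using F that by (simp add: residue_chain_def)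
  have st: "residue_step H (F j) (F (Suc j))" if "j < n" for j using F that by (simp add: residue_chain_def)
  have mono: "F j \<subseteq> F (Suc j)" if "j < n" for j using residue_step_mono[OF st H Fs] that by simp
  have "simple_module R (quot_mod R (H\<lparr>carrier := F (Suc j)\<rparr>) (F j))" if j: "j < n" for j
  proof -
    have s: "submodule (F (Suc j)) R H" "submodule (F j) R H" using Fs j by simp_all
    let ?H = "H\<lparr>carrier := F (Suc j)\<rparr>"
    have Hm: "module R ?H" by (rule submodule_module[OF s(1) H])
    have K: "submodule (F j) R ?H" using submodule_of_submodule[OF s(1) H] s(2) mono[OF j] by simp
    obtain g where "g \<in> mhom R (self_mod R) (quot_mod R ?H (F j))" "g ` carrier R = carrier (quot_mod R ?H (F j))"
      "\<And>r. r \<in> carrier R \<Longrightarrow> g r = \<zero>\<^bsub>quot_mod R ?H (F j)\<^esub> \<longleftrightarrow> r \<in> \<mm>"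
      by (rule residue_step_map[OF H s(2,1) st[OF j] quot_module[OF Hm K] quot_map[OF Hm K]])
        (use quot_map_surj[OF Hm K] coset_zero_iff[OF Hm K] that in auto)
    then show ?thesis by (rule residue_map_simple[OF quot_module[OF Hm K]])
  qed
  then show ?thesis unfolding finite_length_def mod_filtration_def
    using H F Fs mono by (intro conjI exI[of _ n] exI[of _ F]) (auto simp: residue_chain_def)
qed

text \<open>
  The composition series, read from the bottom, is a filtration in the sense of \<open>built\<close>. The
  induction runs over the quotients \<open>W\<close> of \<open>H\<close> by the members of the series, starting with the
  smallest quotient.
\<close>

lemma residue_chain_built:
  assumes H: "H \<in> mod_cat R" and F: "residue_chain H n F" "F n = carrier H"
  shows "k < n \<Longrightarrow> W \<in> mod_cat R \<Longrightarrow> w \<in> mhom R H W \<Longrightarrow> w ` carrier H = carrier W \<Longrightarrow>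
    (\<And>u. u \<in> carrier H \<Longrightarrow> w u = \<zero>\<^bsub>W\<^esub> \<longleftrightarrow> u \<in> F (n - Suc k)) \<Longrightarrow>
    built (replicate (Suc k) (residue_cat R \<mm>)) W"
proof (induction k arbitrary: W w)
  case 0
  note Hm = mod_catD[OF H] and Wm = mod_catD[OF 0(2)]
  have s: "submodule (F (n - Suc 0)) R H" "submodule (F n) R H" "residue_step H (F (n - Suc 0)) (F n)"
    using F(1) 0(1) Suc_pred[OF 0(1)] unfolding residue_chain_def by (metis diff_le_self order_refl lessI)+
  have HF: "H\<lparr>carrier := F n\<rparr> = H" using F(2) by simp
  obtain g where "g \<in> mhom R (self_mod R) W" "g ` carrier R = carrier W"
      "\<And>r. r \<in> carrier R \<Longrightarrow> g r = \<zero>\<^bsub>W\<^esub> \<longleftrightarrow> r \<in> \<mm>"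
    by (rule residue_step_map[OF Hm s Wm, of w]) (use 0 F HF that in simp_all)
  then have "W \<in> residue_cat R \<mm>" by (rule residue_map_residue_cat[OF 0(2)])
  then show ?case using 0(2) by (simp add: built.base)
next
  case (Suc k)
  note Hm = mod_catD[OF H] and Wm = mod_catD[OF Suc.prems(2)]
  define j where "j = n - Suc (Suc k)"
  have j: "j < n" "n - Suc k = Suc j" using Suc.prems(1) by (simp_all add: j_def)
  have s: "submodule (F j) R H" "submodule (F (Suc j)) R H" "residue_step H (F j) (F (Suc j))"
    using F(1) j(1) by (simp_all add: residue_chain_def)
  have inc: "F j \<subseteq> F (Suc j)" by (rule residue_step_mono[OF s(3) Hm s(1)])
  have sc: "F (Suc j) \<subseteq> carrier H" using submoduleD(1)[OF s(2) Hm] .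
  let ?A = "W\<lparr>carrier := w ` F (Suc j)\<rparr>"
  have As: "submodule (w ` F (Suc j)) R W" by (rule submodule_image[OF Suc.prems(3) Hm Wm s(2)])
  have A: "?A \<in> mod_cat R" by (rule submodule_mod_cat[OF Suc.prems(2) As])
  have wA: "w \<in> mhom R (H\<lparr>carrier := F (Suc j)\<rparr>) ?A"
    using Suc.prems(3) sc by (auto simp: mhom_def subset_iff)
  obtain g where "g \<in> mhom R (self_mod R) ?A" "g ` carrier R = carrier ?A"
      "\<And>r. r \<in> carrier R \<Longrightarrow> g r = \<zero>\<^bsub>?A\<^esub> \<longleftrightarrow> r \<in> \<mm>"
    by (rule residue_step_map[OF Hm s mod_catD[OF A] wA]) (use Suc.prems(5) sc that in \<open>auto simp: j_def\<close>)
  then have AK: "?A \<in> residue_cat R \<mm>" by (rule residue_map_residue_cat[OF A])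
  have fgW: "fg_module R W" using Suc.prems(2) by (simp add: mod_cat_def)
  obtain C c where C: "C \<in> mod_cat R" "c \<in> mhom R W C" "c ` carrier W = carrier C"
    "\<And>x. x \<in> carrier W \<Longrightarrow> c x = \<zero>\<^bsub>C\<^esub> \<longleftrightarrow> x \<in> w ` F (Suc j)"
    by (rule ex_quotient[OF fgW As]) (rule that)
  have ss: "ses (\<lambda>x. x) c ?A W C"
    unfolding ses_def using C submoduleD(1)[OF As Wm] by (auto simp: mhom_def subset_iff)
  have "built (replicate (Suc k) (residue_cat R \<mm>)) C"
  proof (rule Suc.IH[OF _ C(1) mhom_comp[OF Suc.prems(3) C(2)]])
    show "k < n" using Suc.prems(1) by simp
    show "(\<lambda>x. c (w x)) ` carrier H = carrier C" using Suc.prems(4) C(3) by (simp flip: image_image)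
    fix u assume u: "u \<in> carrier H"
    have wu: "w u \<in> carrier W" by (rule mhom_closed[OF Suc.prems(3) u])
    have "w u \<in> w ` F (Suc j) \<longleftrightarrow> u \<in> F (Suc j)"
    proof
      assume "w u \<in> w ` F (Suc j)"
      then obtain u' where u': "u' \<in> F (Suc j)" "w u = w u'" by auto
      have u'c: "u' \<in> carrier H" using u' sc by auto
      interpret H: module R H by (rule Hm)
      have "w (u \<ominus>\<^bsub>H\<^esub> u') = \<zero>\<^bsub>W\<^esub>" using mhom_eq_iff[OF Suc.prems(3) Hm Wm u u'c] u'(2) by simp
      then have "u \<ominus>\<^bsub>H\<^esub> u' \<in> F (Suc j)" using Suc.prems(5)[of "u \<ominus>\<^bsub>H\<^esub> u'"] u u'c inc by (auto simp: j_def)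
      then have "(u \<ominus>\<^bsub>H\<^esub> u') \<oplus>\<^bsub>H\<^esub> u' \<in> F (Suc j)" using submoduleD(3)[OF s(2) Hm] u'(1) by blast
      then show "u \<in> F (Suc j)" using u u'c H.M.cancel_inner(4)[OF u u'c u] by (simp add: a_minus_def)
    qed simp
    then show "c (w u) = \<zero>\<^bsub>C\<^esub> \<longleftrightarrow> u \<in> F (n - Suc k)" using C(4)[OF wu] j(2) by simp
  qed
  from built_extension[OF AK A Suc.prems(2) C(1) ss this] show ?case by simp
qed

lemma finite_length_built:
  assumes H: "H \<in> mod_cat R" and nz: "carrier H \<noteq> {\<zero>\<^bsub>H\<^esub>}" and F: "residue_chain H n F" "F n = carrier H"
  shows "\<exists>r. built (replicate r (residue_cat R \<mm>)) H"
proof -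
  have "n \<noteq> 0" using F nz by (auto simp: residue_chain_def)
  then obtain k where k: "n = Suc k" by (cases n) auto
  have "built (replicate (Suc k) (residue_cat R \<mm>)) H"
    by (rule residue_chain_built[OF H F _ H mhom_id]) (use k F in \<open>auto simp: residue_chain_def\<close>)
  then show ?thesis by blast
qed

text \<open>The modules that only \<open>\<mm>\<close> supports; all of them have finite length.\<close>

definition fl :: "'a rmod set" where
  "fl = {H \<in> mod_cat R. \<forall>P. primeideal P R \<and> quot_ann R H {\<zero>\<^bsub>H\<^esub>} \<subseteq> P \<longrightarrow> P = \<mm>}"

lemma fl_chain:
  assumes "H \<in> fl"
  obtains n F where "residue_chain H n F" "F n = carrier H"
  using residue_chain_exists[of H] assms by (auto simp: fl_def mod_cat_def)

lemma fl_fl_cat: "fl \<subseteq> fl_cat R"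
proof
  fix H assume h: "H \<in> fl"
  obtain n F where "residue_chain H n F" "F n = carrier H" by (rule fl_chain[OF h])
  moreover have H: "H \<in> mod_cat R" using h by (simp add: fl_def)
  ultimately show "H \<in> fl_cat R" using residue_chain_finite_length[OF mod_catD[OF H]] by (simp add: fl_cat_def)
qed

section \<open>Iterated syzygies\<close>

lemma syzygies_mod_cat: "syzygies \<Y> \<subseteq> mod_cat R"
  by (auto simp: syzygies_def)

lemma syzygies_pow_mod_cat: "\<Y> \<subseteq> mod_cat R \<Longrightarrow> (syzygies ^^ i) \<Y> \<subseteq> mod_cat R"
  using syzygies_mod_cat by (cases i) auto

lemma syzygiesI: "Z \<in> mod_cat R \<Longrightarrow> X \<in> \<Y> \<Longrightarrow> X \<in> mod_cat R \<Longrightarrow> P \<in> frees \<Longrightarrow> ses i p Z P X \<Longrightarrow> Z \<in> syzygies \<Y>"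
  unfolding syzygies_def by blast

lemma syzygiesE:
  assumes "Z \<in> syzygies \<Y>"
  obtains X P i p where "Z \<in> mod_cat R" "X \<in> \<Y>" "X \<in> mod_cat R" "P \<in> frees" "ses i p Z P X"
  using assms unfolding syzygies_def by blast

lemma syzygies_mono: "\<Y> \<subseteq> \<Z> \<Longrightarrow> syzygies \<Y> \<subseteq> syzygies \<Z>"
  by (auto simp: syzygies_def)

text \<open>
  Iterated first syzygies are higher syzygies: a free cover of the last kernel is spliced into
  the exact sequence.
\<close>

lemma syzygies_pow_syzygy:
  assumes Y: "\<Y> \<subseteq> mod_cat R"
  shows "(syzygies ^^ i) \<Y> \<subseteq> syzygy R i \<Y>"
proof (induction i)
  case 0
  show ?case
  proof
    fix M assume "M \<in> (syzygies ^^ 0) \<Y>"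
    then have M: "M \<in> \<Y>" by simp
    then show "M \<in> syzygy R 0 \<Y>" unfolding syzygy_def using Y mhom_id[of R M]
      by (intro CollectI conjI exI[of _ "\<lambda>_. M"] exI[of _ "\<lambda>_ x. x"]) auto
  qed
next
  case (Suc i)
  show ?case
  proof
    fix Z assume "Z \<in> (syzygies ^^ Suc i) \<Y>"
    then have "Z \<in> syzygies ((syzygies ^^ i) \<Y>)" by simp
    then obtain X P a p where Z: "Z \<in> mod_cat R" and X: "X \<in> (syzygies ^^ i) \<Y>" and P: "P \<in> frees"
      and s: "ses a p Z P X" by (rule syzygiesE) (rule that)
    have "X \<in> syzygy R i \<Y>" using X Suc.IH by (rule rev_subsetD)
    then obtain E f where Ef: "E 0 \<in> \<Y>" "E (Suc i) = X" "\<forall>j<i. E (Suc j) \<in> mod_cat R \<and> free_module R (E (Suc j))"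
      "\<forall>j\<le>i. f j \<in> mhom R (E (Suc j)) (E j)" "inj_on (f i) (carrier (E (Suc i)))"
      "\<forall>j<i. f (Suc j) ` carrier (E (Suc (Suc j))) = a_kernel (E (Suc j)) (E j) (f j)"
      "f 0 ` carrier (E (Suc 0)) = carrier (E 0)"
      unfolding syzygy_def by (elim CollectE conjE exE) (rule that; assumption)
    note E = Ef(1,2) Ef(3)[rule_format] Ef(4)[rule_format] Ef(5) Ef(6)[rule_format] Ef(7)
    note sd = sesD[OF s]
    define E' where "E' = E(Suc i := P, Suc (Suc i) := Z)"
    define f' where "f' = f(i := (\<lambda>x. f i (p x)), Suc i := a)"
    have Xm: "module R X" using X syzygies_pow_mod_cat[OF Y] mod_catD by blast
    have Ei: "E i \<in> mod_cat R" using E(1,3) Y by (cases i) auto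
    have fi: "f i \<in> mhom R X (E i)" using E(4)[of i] E(2) by simp
    have f0: "f i x = \<zero>\<^bsub>E i\<^esub> \<longleftrightarrow> x = \<zero>\<^bsub>X\<^esub>" if "x \<in> carrier X" for x
      using inj_on_eq_iff[OF E(5), of x "\<zero>\<^bsub>X\<^esub>"] that E(2) mhom_zero[OF fi Xm mod_catD[OF Ei]]
        submoduleD(2)[OF module.carrier_is_submodule[OF Xm] Xm] by simp
    show "Z \<in> syzygy R (Suc i) \<Y>" unfolding syzygy_def
    proof (intro CollectI conjI exI[of _ E'] exI[of _ f'] Z allI impI)
      show "E' 0 \<in> \<Y>" "E' (Suc (Suc i)) = Z" using E(1) by (simp_all add: E'_def)
      show "E' (Suc j) \<in> mod_cat R" "free_module R (E' (Suc j))" if "j < Suc i" for j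
        using that E(3)[of j] frees_mod_cat[OF P] frees_free_module[OF P] by (auto simp: E'_def less_Suc_eq)
      show "f' j \<in> mhom R (E' (Suc j)) (E' j)" if "j \<le> Suc i" for j
        using that E(4)[of j] mhom_comp[OF sd(2) fi] sd(1) by (auto simp: E'_def f'_def le_Suc_eq)
      show "inj_on (f' (Suc i)) (carrier (E' (Suc (Suc i))))" using sd(3) by (simp add: E'_def f'_def)
      have im: "(\<lambda>x. f i (p x)) ` carrier P = f i ` carrier X" using sd(4) by (simp flip: image_image)
      show "f' 0 ` carrier (E' (Suc 0)) = carrier (E' 0)"
        using E(2,7) im by (cases i) (simp_all add: E'_def f'_def)
      show "f' (Suc j) ` carrier (E' (Suc (Suc j))) = a_kernel (E' (Suc j)) (E' j) (f' j)" if j: "j < Suc i" for j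
      proof (cases "j = i")
        case True
        have "a ` carrier Z = {x \<in> carrier P. f i (p x) = \<zero>\<^bsub>E i\<^esub>}"
        proof
          show "a ` carrier Z \<subseteq> {x \<in> carrier P. f i (p x) = \<zero>\<^bsub>E i\<^esub>}"
          proof
            fix x assume x: "x \<in> a ` carrier Z"
            have xP: "x \<in> carrier P" using x mhom_closed[OF sd(1)] by auto
            then show "x \<in> {x \<in> carrier P. f i (p x) = \<zero>\<^bsub>E i\<^esub>}"
              using x sd(5)[OF xP] f0[OF mhom_closed[OF sd(2) xP]] by simp
          qed
          show "{x \<in> carrier P. f i (p x) = \<zero>\<^bsub>E i\<^esub>} \<subseteq> a ` carrier Z"
            using sd(5) f0 mhom_closed[OF sd(2)] by blast
        qed
        then show ?thesis using True by (simp add: E'_def f'_def a_kernel_def')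
      next
        case False
        then have ji: "j < i" using j by simp
        show ?thesis
        proof (cases "Suc j = i")
          case True
          then show ?thesis using E(6)[OF ji] E(2) im by (simp add: E'_def f'_def)
        next
          case False
          then show ?thesis using E(6)[OF ji] ji by (simp add: E'_def f'_def)
        qed
      qed
    qed
  qed
qed

text \<open>Transfers the stability of \<open>built\<close> from first to higher syzygies.\<close>

lemma built_syzygies_pow:
  assumes b: "built \<Y>s L"
  shows "A \<in> (syzygies ^^ i) {L} \<Longrightarrow> built (map (syzygies ^^ i) \<Y>s) A"
proof (induction i arbitrary: A)
  case 0
  then show ?case using b by simp
next
  case (Suc i)
  then have "A \<in> syzygies ((syzygies ^^ i) {L})" by simp
  then obtain X P a p where h: "A \<in> mod_cat R" "X \<in> (syzygies ^^ i) {L}" "P \<in> frees" "ses a p A P X"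
    by (rule syzygiesE) (rule that)
  from built_syzygy[OF Suc.IH[OF h(2)] h(1,3,4)] show ?case by (simp add: comp_def)
qed

lemma syzygies_pow_single: "A \<in> (syzygies ^^ i) \<Y> \<Longrightarrow> \<exists>L\<in>\<Y>. A \<in> (syzygies ^^ i) {L}"
proof (induction i arbitrary: A)
  case (Suc i)
  then have "A \<in> syzygies ((syzygies ^^ i) \<Y>)" by simp
  then obtain X P a p where h: "A \<in> mod_cat R" "X \<in> (syzygies ^^ i) \<Y>" "X \<in> mod_cat R" "P \<in> frees" "ses a p A P X"
    by (rule syzygiesE) (rule that)
  obtain L where L: "L \<in> \<Y>" "X \<in> (syzygies ^^ i) {L}" using Suc.IH[OF h(2)] by blast
  have "A \<in> syzygies ((syzygies ^^ i) {L})"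
    by (rule syzygiesI[OF h(1) L(2) h(3-5)])
  then show ?case using L(1) by auto
qed simp

lemma syzygies_pow_nonempty:
  assumes "\<Y> \<subseteq> mod_cat R" "\<Y> \<noteq> {}"
  shows "(syzygies ^^ i) \<Y> \<noteq> {}"
proof (induction i)
  case (Suc i)
  then obtain X where X: "X \<in> (syzygies ^^ i) \<Y>" by auto
  have Xc: "X \<in> mod_cat R" using X syzygies_pow_mod_cat[OF assms(1)] by blast
  have "fg_module R X" using Xc by (simp add: mod_cat_def)
  then obtain P f where P: "P \<in> frees" "f \<in> mhom R P X" "f ` carrier P = carrier X" by (rule ex_cover) (rule that)
  note k = kernel_ses[OF P(2) frees_mod_cat[OF P(1)] mod_catD[OF Xc] P(3)]
  have "P\<lparr>carrier := {b \<in> carrier P. f b = \<zero>\<^bsub>X\<^esub>}\<rparr> \<in> syzygies ((syzygies ^^ i) \<Y>)"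
    by (rule syzygiesI[OF k(1) X Xc P(1) k(2)])
  then show ?case by auto
qed (use assms in simp)

lemma ses_bip:
  assumes s: "ses f g A B C" and s': "ses f' g' A' B' C'"
  shows "ses (\<lambda>u. pairc (f (fstc u)) (f' (sndc u))) (\<lambda>u. pairc (g (fstc u)) (g' (sndc u))) (bip A A') (bip B B') (bip C C')"
  unfolding ses_def
proof (intro conjI ballI)
  note d = sesD[OF s] and d' = sesD[OF s']
  show "(\<lambda>u. pairc (f (fstc u)) (f' (sndc u))) \<in> mhom R (bip A A') (bip B B')"
    by (intro bip_pair mhom_comp[OF bip_fst d(1)] mhom_comp[OF bip_snd d'(1)])
  show "(\<lambda>u. pairc (g (fstc u)) (g' (sndc u))) \<in> mhom R (bip B B') (bip C C')"
    by (intro bip_pair mhom_comp[OF bip_fst d(2)] mhom_comp[OF bip_snd d'(2)])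
  show "inj_on (\<lambda>u. pairc (f (fstc u)) (f' (sndc u))) (carrier (bip A A'))"
  proof (rule inj_onI)
    fix u v assume uv: "u \<in> carrier (bip A A')" "v \<in> carrier (bip A A')"
      "pairc (f (fstc u)) (f' (sndc u)) = pairc (f (fstc v)) (f' (sndc v))"
    have "fstc u = fstc v" "sndc u = sndc v"
      using uv inj_on_eq_iff[OF d(3)] inj_on_eq_iff[OF d'(3)] bip_mem by (metis pairc_eq_iff)+
    then show "u = v" using uv bip_mem by metis
  qed
  show "(\<lambda>u. pairc (g (fstc u)) (g' (sndc u))) ` carrier (bip B B') = carrier (bip C C')"
  proof
    show "(\<lambda>u. pairc (g (fstc u)) (g' (sndc u))) ` carrier (bip B B') \<subseteq> carrier (bip C C')"
      using mhom_closed[OF d(2)] mhom_closed[OF d'(2)] by (auto elim!: bip_cases)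
    show "carrier (bip C C') \<subseteq> (\<lambda>u. pairc (g (fstc u)) (g' (sndc u))) ` carrier (bip B B')"
    proof
      fix w assume "w \<in> carrier (bip C C')"
      then obtain c c' where w: "w = pairc c c'" "c \<in> carrier C" "c' \<in> carrier C'" by (rule bip_cases)
      have "c \<in> g ` carrier B" "c' \<in> g' ` carrier B'" using w d(4) d'(4) by simp_all
      then obtain b b' where "b \<in> carrier B" "c = g b" "b' \<in> carrier B'" "c' = g' b'" by (elim imageE)
      then show "w \<in> (\<lambda>u. pairc (g (fstc u)) (g' (sndc u))) ` carrier (bip B B')"
        using w by (intro image_eqI[of _ _ "pairc b b'"]) simp_all
    qed
  qed
  fix u assume "u \<in> carrier (bip B B')"
  then obtain b b' where u: "u = pairc b b'" "b \<in> carrier B" "b' \<in> carrier B'" by (rule bip_cases)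
  have "pairc (g (fstc u)) (g' (sndc u)) = \<zero>\<^bsub>bip C C'\<^esub> \<longleftrightarrow> b \<in> f ` carrier A \<and> b' \<in> f' ` carrier A'"
    using d(5)[OF u(2)] d'(5)[OF u(3)] u by simp
  also have "\<dots> \<longleftrightarrow> u \<in> (\<lambda>u. pairc (f (fstc u)) (f' (sndc u))) ` carrier (bip A A')"
  proof
    assume "b \<in> f ` carrier A \<and> b' \<in> f' ` carrier A'"
    then obtain x x' where "x \<in> carrier A" "b = f x" "x' \<in> carrier A'" "b' = f' x'" by auto
    then show "u \<in> (\<lambda>u. pairc (f (fstc u)) (f' (sndc u))) ` carrier (bip A A')"
      using u by (intro image_eqI[of _ _ "pairc x x'"]) simp_all
  qed (use u in \<open>auto elim!: bip_cases\<close>)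
  finally show "pairc (g (fstc u)) (g' (sndc u)) = \<zero>\<^bsub>bip C C'\<^esub> \<longleftrightarrow> u \<in> (\<lambda>u. pairc (f (fstc u)) (f' (sndc u))) ` carrier (bip A A')" .
qed

text \<open>Syzygies of the zero module are absorbed by those of \<open>k\<close>, since \<open>0 \<oplus> k\<close> is \<open>k\<close> again.\<close>

lemma syzygies_zero_absorb:
  assumes L: "L \<in> mod_cat R" "carrier L = {\<zero>\<^bsub>L\<^esub>}"
  shows "A \<in> (syzygies ^^ i) {L} \<Longrightarrow> K \<in> (syzygies ^^ i) (residue_cat R \<mm>) \<Longrightarrow>
    bip A K \<in> (syzygies ^^ i) (residue_cat R \<mm>)"
proof (induction i arbitrary: A K)
  case 0
  then have A: "A = L" and K: "K \<in> mod_cat R" "mod_iso R K (quot_mod R (self_mod R) \<mm>)"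
    by (auto simp: residue_cat_def)
  have B: "bip L K \<in> mod_cat R" by (rule bip_mod_cat[OF L(1) K(1)])
  have "mod_iso R (bip L K) K"
  proof (rule mod_isoI[OF bip_snd mod_catD[OF B] mod_catD[OF K(1)]])
    show "sndc ` carrier (bip L K) = carrier K"
    proof
      show "sndc ` carrier (bip L K) \<subseteq> carrier K" using mhom_closed[OF bip_snd] by auto
      show "carrier K \<subseteq> sndc ` carrier (bip L K)"
      proof
        fix x assume "x \<in> carrier K"
        then show "x \<in> sndc ` carrier (bip L K)" using L(2) by (intro image_eqI[of _ _ "pairc \<zero>\<^bsub>L\<^esub> x"]) simp_all
      qed
    qed
    show "u = \<zero>\<^bsub>bip L K\<^esub>" if "u \<in> carrier (bip L K)" "sndc u = \<zero>\<^bsub>K\<^esub>" for u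
      using that L(2) by (auto elim!: bip_cases)
  qed
  then have "mod_iso R (bip L K) (quot_mod R (self_mod R) \<mm>)" using K(2) by (rule mod_iso_trans)
  then show ?case using A B by (simp add: residue_cat_def)
next
  case (Suc i)
  have AS: "A \<in> syzygies ((syzygies ^^ i) {L})" and KS: "K \<in> syzygies ((syzygies ^^ i) (residue_cat R \<mm>))"
    using Suc.prems by simp_all
  obtain X P a p where h: "A \<in> mod_cat R" "X \<in> (syzygies ^^ i) {L}" "X \<in> mod_cat R" "P \<in> frees" "ses a p A P X"
    by (rule syzygiesE[OF AS]) (rule that)
  obtain X' P' a' p' where h': "K \<in> mod_cat R" "X' \<in> (syzygies ^^ i) (residue_cat R \<mm>)" "X' \<in> mod_cat R"
    "P' \<in> frees" "ses a' p' K P' X'"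
    by (rule syzygiesE[OF KS]) (rule that)
  have "bip X X' \<in> (syzygies ^^ i) (residue_cat R \<mm>)" by (rule Suc.IH[OF h(2) h'(2)])
  then have "bip A K \<in> syzygies ((syzygies ^^ i) (residue_cat R \<mm>))"
    unfolding syzygies_def using ses_bip[OF h(5) h'(5)] bip_mod_cat[OF h(1) h'(1)] bip_mod_cat[OF h(3) h'(3)]
      frees.bip[OF h(4) h'(4)] by blast
  then show ?case by simp
qed

section \<open>Finite direct sums\<close>

lemma dsum_simps [simp]:
  "\<zero>\<^bsub>dsum I K\<^esub> = (\<lambda>i\<in>I. \<zero>\<^bsub>K i\<^esub>)" "carrier (dsum I K) = (\<Pi>\<^sub>E i\<in>I. carrier (K i))"
  "x \<oplus>\<^bsub>dsum I K\<^esub> y = (\<lambda>i\<in>I. x i \<oplus>\<^bsub>K i\<^esub> y i)" "a \<odot>\<^bsub>dsum I K\<^esub> x = (\<lambda>i\<in>I. a \<odot>\<^bsub>K i\<^esub> x i)"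
  by (simp_all add: dsum_def)

lemma PiE_restrict_eq: "x \<in> (\<Pi>\<^sub>E i\<in>I. B i) \<Longrightarrow> (\<And>i. i \<in> I \<Longrightarrow> f i = x i) \<Longrightarrow> (\<lambda>i\<in>I. f i) = x"
  by (auto simp: fun_eq_iff PiE_def extensional_def)

lemma dsum_module:
  assumes K: "\<And>i. i \<in> I \<Longrightarrow> module R (K i)"
  shows "module R (dsum I K)"
proof (rule moduleI[OF is_cring])
  have ag: "abelian_group (K i)" if "i \<in> I" for i using K[OF that] by (simp add: module_def)
  have am: "abelian_monoid (K i)" if "i \<in> I" for i using ag[OF that] by (simp add: abelian_group_def)
  note mo = module.smult_closed[OF K] module.smult_l_distr[OF K] module.smult_r_distr[OF K] module.smult_assoc1[OF K]
    module.smult_one[OF K] abelian_monoid.a_closed[OF am] abelian_monoid.zero_closed[OF am]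
    abelian_monoid.a_assoc[OF am] abelian_monoid.l_zero[OF am]
    abelian_group.a_inv_closed[OF ag] abelian_group.l_neg[OF ag]
  have xc: "x i \<in> carrier (K i)" if "x \<in> (\<Pi>\<^sub>E i\<in>I. carrier (K i))" "i \<in> I" for x i
    using PiE_mem[OF that] .
  show "abelian_group (dsum I K)"
  proof (rule abelian_groupI)
    show "\<zero>\<^bsub>dsum I K\<^esub> \<oplus>\<^bsub>dsum I K\<^esub> x = x" if "x \<in> carrier (dsum I K)" for x
      using that xc[of x] abelian_monoid.l_zero[OF am] abelian_monoid.zero_closed[OF am]
      by simp (rule PiE_restrict_eq, auto)
    show "\<exists>y\<in>carrier (dsum I K). y \<oplus>\<^bsub>dsum I K\<^esub> x = \<zero>\<^bsub>dsum I K\<^esub>" if "x \<in> carrier (dsum I K)" for x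
      using that xc[of x] abelian_group.a_inv_closed[OF ag] abelian_group.l_neg[OF ag]
      by (intro bexI[of _ "\<lambda>i\<in>I. \<ominus>\<^bsub>K i\<^esub> x i"]) (auto intro!: restrict_ext)
    show "x \<oplus>\<^bsub>dsum I K\<^esub> y = y \<oplus>\<^bsub>dsum I K\<^esub> x" if "x \<in> carrier (dsum I K)" "y \<in> carrier (dsum I K)" for x y
      using that xc abelian_monoid.a_comm[OF am] by (auto intro!: restrict_ext)
  qed (auto simp: mo xc intro!: restrict_ext)
  show "\<one> \<odot>\<^bsub>dsum I K\<^esub> x = x" if "x \<in> carrier (dsum I K)" for x
    using that xc[of x] module.smult_one[OF K] by simp (rule PiE_restrict_eq, auto)
  show "a \<odot>\<^bsub>dsum I K\<^esub> x \<in> carrier (dsum I K)" if "a \<in> carrier R" "x \<in> carrier (dsum I K)" for a x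
    using that by (auto simp: mo xc)
  show "(a \<oplus> b) \<odot>\<^bsub>dsum I K\<^esub> x = a \<odot>\<^bsub>dsum I K\<^esub> x \<oplus>\<^bsub>dsum I K\<^esub> b \<odot>\<^bsub>dsum I K\<^esub> x"
    if "a \<in> carrier R" "b \<in> carrier R" "x \<in> carrier (dsum I K)" for a b x
    using that by (auto simp: mo xc intro!: restrict_ext)
  show "a \<odot>\<^bsub>dsum I K\<^esub> (x \<oplus>\<^bsub>dsum I K\<^esub> y) = a \<odot>\<^bsub>dsum I K\<^esub> x \<oplus>\<^bsub>dsum I K\<^esub> a \<odot>\<^bsub>dsum I K\<^esub> y"
    if "a \<in> carrier R" "x \<in> carrier (dsum I K)" "y \<in> carrier (dsum I K)" for a x y
    using that by (auto simp: mo xc intro!: restrict_ext)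
  show "(a \<otimes> b) \<odot>\<^bsub>dsum I K\<^esub> x = a \<odot>\<^bsub>dsum I K\<^esub> (b \<odot>\<^bsub>dsum I K\<^esub> x)"
    if "a \<in> carrier R" "b \<in> carrier R" "x \<in> carrier (dsum I K)" for a b x
    using that by (auto simp: mo xc intro!: restrict_ext)
qed

lemma dsum_proj: "i \<in> I \<Longrightarrow> (\<lambda>x. x i) \<in> mhom R (dsum I K) (K i)"
  by (rule mhomI) auto

lemma dsum_inj:
  assumes K: "\<And>i. i \<in> I \<Longrightarrow> module R (K i)" and j: "j \<in> I"
  shows "(\<lambda>x. \<lambda>i\<in>I. if i = j then x else \<zero>\<^bsub>K i\<^esub>) \<in> mhom R (K j) (dsum I K)"
proof -
  have am: "abelian_monoid (K i)" if "i \<in> I" for i using K[OF that] by (simp add: module_def abelian_group_def)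
  show ?thesis
    by (rule mhomI) (auto simp: abelian_monoid.zero_closed[OF am] abelian_monoid.l_zero[OF am]
        module.smult_r_null[OF K] intro!: restrict_ext)
qed

text \<open>By adding the summands one at a time; each stage is an image of a biproduct.\<close>

lemma dsum_fg:
  assumes fin: "finite I" and K: "\<And>i. i \<in> I \<Longrightarrow> K i \<in> mod_cat R"
  shows "fg_module R (dsum I K)"
proof -
  have Km: "module R (K i)" if "i \<in> I" for i using K[OF that] by (rule mod_catD)
  note D = dsum_module[OF Km]
  interpret D: module R "dsum I K" by (rule D)
  have am: "abelian_monoid (K i)" if "i \<in> I" for i using Km[OF that] by (simp add: module_def abelian_group_def)
  have "\<exists>B\<in>mod_cat R. \<exists>f\<in>mhom R B (dsum I K). {s \<in> carrier (dsum I K). \<forall>i\<in>I - J. s i = \<zero>\<^bsub>K i\<^esub>} \<subseteq> f ` carrier B"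
    if "finite J" "J \<subseteq> I" for J
    using that
  proof (induction J rule: finite_induct)
    case empty
    have z: "{s \<in> carrier (dsum I K). \<forall>i\<in>I - {}. s i = \<zero>\<^bsub>K i\<^esub>} \<subseteq> {\<zero>\<^bsub>dsum I K\<^esub>}"
    proof
      fix s assume "s \<in> {s \<in> carrier (dsum I K). \<forall>i\<in>I - {}. s i = \<zero>\<^bsub>K i\<^esub>}"
      then have s: "s \<in> carrier (dsum I K)" "\<forall>i\<in>I. s i = \<zero>\<^bsub>K i\<^esub>" by simp_all
      have "(\<lambda>i\<in>I. \<zero>\<^bsub>K i\<^esub>) = s" by (rule PiE_restrict_eq) (use s in simp_all)
      then show "s \<in> {\<zero>\<^bsub>dsum I K\<^esub>}" by simp
    qed
    then show ?case
      by (intro bexI[OF _ zero_obj] bexI[OF _ mhom_const_zero[OF D]])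
        (use z in \<open>simp only: zero_obj_simps image_insert image_empty\<close>)
  next
    case (insert j J)
    then obtain B f where B: "B \<in> mod_cat R" "f \<in> mhom R B (dsum I K)"
      "{s \<in> carrier (dsum I K). \<forall>i\<in>I - J. s i = \<zero>\<^bsub>K i\<^esub>} \<subseteq> f ` carrier B" by auto
    have j: "j \<in> I" using insert by simp
    let ?e = "\<lambda>x. \<lambda>i\<in>I. if i = j then x else \<zero>\<^bsub>K i\<^esub>"
    let ?f = "\<lambda>u. ?e (fstc u) \<oplus>\<^bsub>dsum I K\<^esub> f (sndc u)"
    have f: "?f \<in> mhom R (bip (K j) B) (dsum I K)" by (rule bip_copair[OF dsum_inj[OF Km j] B(2) D])
    have "{s \<in> carrier (dsum I K). \<forall>i\<in>I - insert j J. s i = \<zero>\<^bsub>K i\<^esub>} \<subseteq> ?f ` carrier (bip (K j) B)"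
    proof
      fix s assume "s \<in> {s \<in> carrier (dsum I K). \<forall>i\<in>I - insert j J. s i = \<zero>\<^bsub>K i\<^esub>}"
      then have s: "s \<in> carrier (dsum I K)" "\<forall>i\<in>I - insert j J. s i = \<zero>\<^bsub>K i\<^esub>" by simp_all
      have sc: "s i \<in> carrier (K i)" if "i \<in> I" for i
        using s(1) PiE_mem[of s I "\<lambda>i. carrier (K i)" i] that by simp
      let ?s = "\<lambda>i\<in>I. if i = j then \<zero>\<^bsub>K i\<^esub> else s i"
      have "?s \<in> {s \<in> carrier (dsum I K). \<forall>i\<in>I - J. s i = \<zero>\<^bsub>K i\<^esub>}"
        using s sc abelian_monoid.zero_closed[OF am] by auto
      then obtain b where b: "b \<in> carrier B" "f b = ?s" using B(3) by (metis (no_types, lifting) imageE subsetD)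
      have "?f (pairc (s j) b) = s"
        using s(1) sc abelian_monoid.zero_closed[OF am] abelian_monoid.l_zero[OF am] abelian_monoid.r_zero[OF am]
        by (simp add: b(2)) (rule PiE_restrict_eq, auto)
      then show "s \<in> ?f ` carrier (bip (K j) B)"
        using b(1) sc[OF j] by (intro image_eqI[of _ _ "pairc (s j) b"]) simp_all
    qed
    then show ?case using f bip_mod_cat[OF K[OF j] B(1)] by blast
  qed
  from this[OF fin subset_refl] obtain B f where B: "B \<in> mod_cat R" "f \<in> mhom R B (dsum I K)"
    "carrier (dsum I K) \<subseteq> f ` carrier B" by auto
  have "f ` carrier B = carrier (dsum I K)" using B(3) mhom_closed[OF B(2)] by blast
  then show ?thesis using fg_image[OF B(2) _ D] B(1) by (simp add: mod_cat_def)
qed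

lemma residue_cat_mod_cat: "residue_cat R \<mm> \<subseteq> mod_cat R"
  by (auto simp: residue_cat_def)

lemma residue_cat_nonempty: "residue_cat R \<mm> \<noteq> {}"
proof -
  have m: "submodule \<mm> R (self_mod R)" using m_ideal by (simp add: submodule_self_iff)
  obtain W w where W: "W \<in> mod_cat R" "w \<in> mhom R (self_mod R) W" "w ` carrier (self_mod R) = carrier W"
    "\<And>x. x \<in> carrier (self_mod R) \<Longrightarrow> w x = \<zero>\<^bsub>W\<^esub> \<longleftrightarrow> x \<in> \<mm>"
    by (rule ex_quotient[OF fg_self m]) (rule that)
  have "W \<in> residue_cat R \<mm>" by (rule residue_map_residue_cat[OF W(1,2)]) (use W in simp_all)
  then show ?thesis by blast
qed

text \<open>
  A syzygy of \<open>k\<close> in one degree is a direct summand of a sum of syzygies of \<open>k\<close>, one from each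
  degree.
\<close>

lemma residue_syzygies_ext:
  assumes I: "finite I" "i \<in> I"
  shows "(syzygies ^^ i) (residue_cat R \<mm>) \<subseteq> ext_closure R (sum_family R I (\<lambda>i. syzygy R i (residue_cat R \<mm>)))"
proof
  let ?K0 = "residue_cat R \<mm>"
  fix A assume A: "A \<in> (syzygies ^^ i) ?K0"
  have "\<forall>j. \<exists>X. X \<in> (syzygies ^^ j) ?K0"
    using syzygies_pow_nonempty[OF residue_cat_mod_cat residue_cat_nonempty] by blast
  then obtain K0 where K0: "\<And>j. K0 j \<in> (syzygies ^^ j) ?K0" by metis
  define K where "K = K0(i := A)"
  have K: "K j \<in> (syzygies ^^ j) ?K0" for j using K0 A by (simp add: K_def)
  have Kc: "K j \<in> mod_cat R" for j using K syzygies_pow_mod_cat[OF residue_cat_mod_cat] by blast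
  note Km = mod_catD[OF Kc]
  have Ac: "A \<in> mod_cat R" using Kc[of i] by (simp add: K_def)
  have "fg_module R (dsum I K)" by (rule dsum_fg[OF I(1) Kc])
  then obtain S where S: "S \<in> mod_cat R" "mod_iso R (dsum I K) S" using ex_rmod by blast
  have D: "module R (dsum I K)" by (rule dsum_module[OF Km])
  note Sm = mod_catD[OF S(1)]
  have "S \<in> sum_family R I (\<lambda>i. syzygy R i ?K0)"
    unfolding sum_family_def using S(1) K syzygies_pow_syzygy[OF residue_cat_mod_cat] mod_iso_sym[OF S(2) D Sm]
    by (intro CollectI conjI exI[of _ K]) auto
  then have Se: "S \<in> ext_closure R (sum_family R I (\<lambda>i. syzygy R i ?K0))"
    by (rule ext_closure.base[OF _ S(1) mod_iso_refl])
  obtain f g where fg: "f \<in> mhom R (dsum I K) S" "g \<in> mhom R S (dsum I K)"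
    "\<And>x. x \<in> carrier (dsum I K) \<Longrightarrow> g (f x) = x" "\<And>y. y \<in> carrier S \<Longrightarrow> f (g y) = y"
    by (rule mod_isoE[OF S(2) D Sm]) (rule that)
  have inj: "(\<lambda>x. \<lambda>k\<in>I. if k = i then x else \<zero>\<^bsub>K k\<^esub>) \<in> mhom R A (dsum I K)"
    using dsum_inj[of I K i] Km I(2) by (simp add: K_def)
  have pr: "(\<lambda>x. x i) \<in> mhom R (dsum I K) A" using dsum_proj[OF I(2)] by (metis K_def fun_upd_same)
  have "retract_of A S"
    unfolding retract_of_def
    by (rule bexI[OF _ mhom_comp[OF inj fg(1)]], rule bexI[OF _ mhom_comp[OF fg(2) pr]])
      (use fg(3) mhom_closed[OF inj] I(2) in \<open>simp del: dsum_simps\<close>)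
  then show "A \<in> ext_closure R (sum_family R I (\<lambda>i. syzygy R i ?K0))"
    by (rule ext_closure.summand[OF Se Ac retract_direct_summand[OF Ac S(1)]])
qed

text \<open>
  A module of finite length is built from copies of \<open>k\<close>, so its \<open>i\<close>-th syzygies are built from
  \<open>i\<close>-th syzygies of \<open>k\<close>. The zero module has an empty filtration, which \<open>built\<close> excludes; its
  syzygies are free modules and are split off from syzygies of \<open>k\<close>.
\<close>

lemma fl_syzygies_ext:
  assumes I: "finite I" "i \<in> I" and A: "A \<in> (syzygies ^^ i) fl"
  shows "A \<in> ext_closure R (sum_family R I (\<lambda>i. syzygy R i (residue_cat R \<mm>)))" (is "_ \<in> ?E")
proof -
  obtain L where L: "L \<in> fl" "A \<in> (syzygies ^^ i) {L}" using syzygies_pow_single[OF A] by blast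
  have Lc: "L \<in> mod_cat R" using L(1) by (simp add: fl_def)
  note sub = residue_syzygies_ext[OF I]
  show ?thesis
  proof (cases "carrier L = {\<zero>\<^bsub>L\<^esub>}")
    case False
    obtain n F where F: "residue_chain L n F" "F n = carrier L" by (rule fl_chain[OF L(1)])
    obtain r where "built (replicate r (residue_cat R \<mm>)) L" using finite_length_built[OF Lc False F] by blast
    from built_syzygies_pow[OF this L(2)]
    show ?thesis by (rule built_ext_closure) (use sub in auto)
  next
    case True
    obtain K where K: "K \<in> (syzygies ^^ i) (residue_cat R \<mm>)"
      using syzygies_pow_nonempty[OF residue_cat_mod_cat residue_cat_nonempty] by blast
    have c: "A \<in> mod_cat R" "K \<in> mod_cat R"
      using L(2) syzygies_pow_mod_cat[of "{L}"] Lc K syzygies_pow_mod_cat[OF residue_cat_mod_cat] by auto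
    have "bip A K \<in> ?E" using syzygies_zero_absorb[OF Lc True L(2) K] sub by blast
    then show ?thesis
      by (rule ext_closure.summand[OF _ c(1) retract_direct_summand[OF c(1) bip_mod_cat[OF c] retract_bip]])
        (rule mod_catD[OF c(2)])
  qed
qed

end

section \<open>Localisation and local freeness\<close>

context cring
begin

lemma mspan_finite_support:
  assumes N: "module R N" and B: "B \<subseteq> carrier N" and n: "n \<in> mspan R N B"
  shows "\<exists>F. finite F \<and> F \<subseteq> B \<and> n \<in> mspan R N F"
proof -
  let ?T = "{n \<in> carrier N. \<exists>F. finite F \<and> F \<subseteq> B \<and> n \<in> mspan R N F}"
  have sp: "submodule (mspan R N F) R N" if "F \<subseteq> B" for F using mspan_submodule[OF N] that B by auto
  interpret N: module R N by fact
  have "submodule ?T R N"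
  proof (rule submoduleI'[OF N])
    show "\<zero>\<^bsub>N\<^esub> \<in> ?T" using submoduleD(2)[OF sp N, of "{}"] by (intro CollectI conjI exI[of _ "{}"]) simp_all
    show "x \<oplus>\<^bsub>N\<^esub> y \<in> ?T" if x: "x \<in> ?T" and y: "y \<in> ?T" for x y
    proof -
      obtain F where F: "finite F" "F \<subseteq> B" "x \<in> mspan R N F" using x by auto
      obtain G where G: "finite G" "G \<subseteq> B" "y \<in> mspan R N G" using y by auto
      have FG: "F \<union> G \<subseteq> B" using F G by simp
      have "x \<in> mspan R N (F \<union> G)" "y \<in> mspan R N (F \<union> G)"
        using F G mspan_mono[OF N, of F "F \<union> G"] mspan_mono[OF N, of G "F \<union> G"] by auto
      then have "x \<oplus>\<^bsub>N\<^esub> y \<in> mspan R N (F \<union> G)" by (rule submoduleD(3)[OF sp[OF FG] N])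
      then show ?thesis using x y F G FG by (intro CollectI conjI exI[of _ "F \<union> G"]) simp_all
    qed
    show "a \<odot>\<^bsub>N\<^esub> x \<in> ?T" if a: "a \<in> carrier R" and x: "x \<in> ?T" for a x
    proof -
      obtain F where F: "finite F" "F \<subseteq> B" "x \<in> mspan R N F" using x by auto
      then have "a \<odot>\<^bsub>N\<^esub> x \<in> mspan R N F" using submoduleD(4)[OF sp N a] by simp
      then show ?thesis using x a F by (intro CollectI conjI exI[of _ F]) simp_all
    qed
  qed auto
  moreover have "B \<subseteq> ?T"
  proof
    fix b assume b: "b \<in> B"
    have "b \<in> mspan R N {b}" using mspan_incl by fast
    then show "b \<in> ?T" using b B by (intro CollectI conjI exI[of _ "{b}"]) auto
  qed
  ultimately have "mspan R N B \<subseteq> ?T" by (rule mspan_subset)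
  then show ?thesis using n by auto
qed

lemma mspan_finite_coordinates:
  assumes N: "module R N" and F: "finite F" "F \<subseteq> carrier N"
  shows "n \<in> mspan R N F \<Longrightarrow> \<exists>c. (\<forall>b\<in>F. c b \<in> carrier R) \<and> n = (\<Oplus>\<^bsub>N\<^esub>b\<in>F. c b \<odot>\<^bsub>N\<^esub> b)"
  using F
proof (induction F arbitrary: n rule: finite_induct)
  case empty
  interpret N: module R N by fact
  show ?case using empty mspan_empty[OF N] by simp
next
  case (insert g F)
  interpret N: module R N by fact
  have g: "g \<in> carrier N" and Fc: "F \<subseteq> carrier N" using insert by auto
  obtain r y where ry: "n = r \<odot>\<^bsub>N\<^esub> g \<oplus>\<^bsub>N\<^esub> y" "r \<in> carrier R" "y \<in> mspan R N F"
    using insert.prems(1) mspan_insert[OF N g Fc] by auto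
  obtain c where c: "\<forall>b\<in>F. c b \<in> carrier R" "y = (\<Oplus>\<^bsub>N\<^esub>b\<in>F. c b \<odot>\<^bsub>N\<^esub> b)" using insert.IH[OF ry(3) Fc] by auto
  let ?c = "c(g := r)"
  have "(\<Oplus>\<^bsub>N\<^esub>b\<in>F. ?c b \<odot>\<^bsub>N\<^esub> b) = y"
    unfolding c(2) by (rule N.M.finsum_cong') (use c(1) Fc insert.hyps in auto)
  moreover have "(\<Oplus>\<^bsub>N\<^esub>b\<in>insert g F. ?c b \<odot>\<^bsub>N\<^esub> b) = ?c g \<odot>\<^bsub>N\<^esub> g \<oplus>\<^bsub>N\<^esub> (\<Oplus>\<^bsub>N\<^esub>b\<in>F. ?c b \<odot>\<^bsub>N\<^esub> b)"
    by (rule N.M.finsum_insert) (use c(1) Fc g ry insert.hyps in auto)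
  ultimately show ?case using ry c by (intro exI[of _ ?c]) auto
qed

lemma lin_indep_unique:
  assumes N: "module R N" and B: "lin_indep R N B" and F: "finite F" "F \<subseteq> B" "B \<subseteq> carrier N"
    and c: "\<And>b. b \<in> F \<Longrightarrow> c b \<in> carrier R" "\<And>b. b \<in> F \<Longrightarrow> c' b \<in> carrier R"
    and e: "(\<Oplus>\<^bsub>N\<^esub>b\<in>F. c b \<odot>\<^bsub>N\<^esub> b) = (\<Oplus>\<^bsub>N\<^esub>b\<in>F. c' b \<odot>\<^bsub>N\<^esub> b)" and b: "b \<in> F"
  shows "c b = c' b"
proof -
  interpret N: module R N by fact
  have Fc: "b \<in> carrier N" if "b \<in> F" for b using F that by auto
  let ?d = "\<lambda>b. c b \<oplus> \<ominus> \<one> \<otimes> c' b"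
  have "(\<Oplus>\<^bsub>N\<^esub>b\<in>F. ?d b \<odot>\<^bsub>N\<^esub> b) = (\<Oplus>\<^bsub>N\<^esub>b\<in>F. c b \<odot>\<^bsub>N\<^esub> b \<oplus>\<^bsub>N\<^esub> (\<ominus> \<one>) \<odot>\<^bsub>N\<^esub> (c' b \<odot>\<^bsub>N\<^esub> b))"
    by (rule N.M.finsum_cong') (use c Fc in \<open>auto simp: N.smult_l_distr N.smult_assoc1\<close>)
  also have "\<dots> = (\<Oplus>\<^bsub>N\<^esub>b\<in>F. c b \<odot>\<^bsub>N\<^esub> b) \<oplus>\<^bsub>N\<^esub> (\<Oplus>\<^bsub>N\<^esub>b\<in>F. (\<ominus> \<one>) \<odot>\<^bsub>N\<^esub> (c' b \<odot>\<^bsub>N\<^esub> b))"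
    by (rule N.M.finsum_addf) (use c Fc in auto)
  also have "(\<Oplus>\<^bsub>N\<^esub>b\<in>F. (\<ominus> \<one>) \<odot>\<^bsub>N\<^esub> (c' b \<odot>\<^bsub>N\<^esub> b)) = (\<ominus> \<one>) \<odot>\<^bsub>N\<^esub> (\<Oplus>\<^bsub>N\<^esub>b\<in>F. c' b \<odot>\<^bsub>N\<^esub> b)"
    by (rule N.finsum_smult_ldistr[symmetric]) (use F c Fc in auto)
  also have "(\<Oplus>\<^bsub>N\<^esub>b\<in>F. c b \<odot>\<^bsub>N\<^esub> b) \<oplus>\<^bsub>N\<^esub> (\<ominus> \<one>) \<odot>\<^bsub>N\<^esub> (\<Oplus>\<^bsub>N\<^esub>b\<in>F. c' b \<odot>\<^bsub>N\<^esub> b) = \<zero>\<^bsub>N\<^esub>"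
  proof -
    have s: "(\<Oplus>\<^bsub>N\<^esub>b\<in>F. c' b \<odot>\<^bsub>N\<^esub> b) \<in> carrier N" by (rule N.M.finsum_closed) (use c Fc in auto)
    then show ?thesis unfolding e by (simp add: N.smult_l_minus N.M.r_neg)
  qed
  finally have "?d b = \<zero>" using lin_indepD[OF B F(1,2), of ?d b] c b by simp
  then have "c b \<ominus> c' b = \<zero>" using c[OF b] by (simp add: l_minus a_minus_def)
  then show ?thesis using c[OF b] by simp
qed

end

context noetherian_local_ring
begin

definition factors_free :: "('a, 'e, 'k) module_scheme \<Rightarrow> ('e \<Rightarrow> 'e) \<Rightarrow> bool" where
  "factors_free M \<phi> \<longleftrightarrow> (\<exists>P\<in>frees. \<exists>s\<in>mhom R M P. \<exists>g\<in>mhom R P M. \<forall>u\<in>carrier M. \<phi> u = g (s u))"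

lemma factors_free_zero: "module R M \<Longrightarrow> factors_free M (\<lambda>_. \<zero>\<^bsub>M\<^esub>)"
  unfolding factors_free_def
  by (rule bexI[OF _ frees.zero], rule bexI[OF _ mhom_const_zero[OF zero_obj_module]], rule bexI[OF _ mhom_const_zero]) simp_all

lemma factors_free_add:
  assumes M: "module R M" and "factors_free M \<phi>" "factors_free M \<psi>"
  shows "factors_free M (\<lambda>u. \<phi> u \<oplus>\<^bsub>M\<^esub> \<psi> u)"
proof -
  obtain P s g where 1: "P \<in> frees" "s \<in> mhom R M P" "g \<in> mhom R P M" "\<forall>u\<in>carrier M. \<phi> u = g (s u)"
    using assms(2) unfolding factors_free_def by blast
  obtain Q s' g' where 2: "Q \<in> frees" "s' \<in> mhom R M Q" "g' \<in> mhom R Q M" "\<forall>u\<in>carrier M. \<psi> u = g' (s' u)"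
    using assms(3) unfolding factors_free_def by blast
  show ?thesis unfolding factors_free_def
    by (rule bexI[OF _ frees.bip[OF 1(1) 2(1)]], rule bexI[OF _ bip_pair[OF 1(2) 2(2)]],
        rule bexI[OF _ bip_copair[OF 1(3) 2(3) M]]) (simp add: 1(4) 2(4))
qed

lemma factors_free_scale:
  assumes M: "module R M" and "factors_free M \<phi>" and r: "r \<in> carrier R"
  shows "factors_free M (\<lambda>u. r \<odot>\<^bsub>M\<^esub> \<phi> u)"
proof -
  obtain P s g where 1: "P \<in> frees" "s \<in> mhom R M P" "g \<in> mhom R P M" "\<forall>u\<in>carrier M. \<phi> u = g (s u)"
    using assms(2) unfolding factors_free_def by blast
  show ?thesis unfolding factors_free_def
    by (rule bexI[OF _ 1(1)], rule bexI[OF _ 1(2)], rule bexI[OF _ mhom_scale[OF 1(3) M r]]) (simp add: 1(4))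
qed

lemma factors_free_rank_one:
  assumes M: "module R M" and l: "l \<in> mhom R M (self_mod R)" and m: "m \<in> carrier M"
  shows "factors_free M (\<lambda>u. l u \<odot>\<^bsub>M\<^esub> m)"
proof -
  interpret M: module R M by fact
  interpret B: module R base_obj by (rule mod_catD[OF base_obj(1)])
  obtain e c where e: "e \<in> carrier base_obj" "c \<in> mhom R base_obj (self_mod R)"
    "\<And>p. p \<in> carrier base_obj \<Longrightarrow> p = c p \<odot>\<^bsub>base_obj\<^esub> e" "\<And>r. r \<in> carrier R \<Longrightarrow> c (r \<odot>\<^bsub>base_obj\<^esub> e) = r"
    by (rule base_coordinates) (rule that)
  have lc: "l u \<in> carrier R" if "u \<in> carrier M" for u using mhom_closed[OF l that] by simp
  have cc: "c u \<in> carrier R" if "u \<in> carrier base_obj" for u using mhom_closed[OF e(2) that] by simp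
  have s: "(\<lambda>u. l u \<odot>\<^bsub>base_obj\<^esub> e) \<in> mhom R M base_obj"
    by (rule mhomI) (use lc e(1) in \<open>simp_all add: mhom_add[OF l] mhom_smult[OF l] B.smult_l_distr B.smult_assoc1\<close>)
  have g: "(\<lambda>p. c p \<odot>\<^bsub>M\<^esub> m) \<in> mhom R base_obj M"
    by (rule mhomI) (use cc m in \<open>simp_all add: mhom_add[OF e(2)] mhom_smult[OF e(2)] M.smult_l_distr M.smult_assoc1\<close>)
  show ?thesis unfolding factors_free_def
    by (rule bexI[OF _ frees.base], rule bexI[OF _ s], rule bexI[OF _ g]) (simp add: e(4) lc)
qed

text \<open>
  The product of the finitely many elements of \<open>S\<close> serves for all \<open>x\<close> at once.
\<close>

lemma common_multiple:
  assumes fin: "finite X" and S: "\<one> \<in> S" "\<And>a b. a \<in> S \<Longrightarrow> b \<in> S \<Longrightarrow> a \<otimes> b \<in> S" "S \<subseteq> carrier R"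
    and ex: "\<And>x. x \<in> X \<Longrightarrow> \<exists>s\<in>S. Q s x"
    and up: "\<And>r s x. x \<in> X \<Longrightarrow> r \<in> S \<Longrightarrow> s \<in> S \<Longrightarrow> Q s x \<Longrightarrow> Q (r \<otimes> s) x"
  shows "\<exists>s\<in>S. \<forall>x\<in>X. Q s x"
  using fin ex up
proof (induction rule: finite_induct)
  case empty
  then show ?case using S(1) by auto
next
  case (insert x X)
  obtain s where s: "s \<in> S" "\<forall>x\<in>X. Q s x" using insert.IH insert.prems by (metis insertI2)
  obtain t where t: "t \<in> S" "Q t x" using insert.prems(1) by auto
  have "Q (s \<otimes> t) y" if "y \<in> insert x X" for y
  proof (cases "y = x")
    case True
    then show ?thesis using insert.prems(2)[of x s t] s t by simp
  next
    case False
    then have "Q (t \<otimes> s) y" using insert.prems(2)[of y t s] s t that by simp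
    moreover have "t \<otimes> s = s \<otimes> t" using s t S(3) m_comm by (simp add: subset_iff)
    ultimately show ?thesis by simp
  qed
  then show ?case using S(2)[OF s(1) t(1)] by blast
qed

text \<open>
  The following works with any \<open>\<rho> : R \<rightarrow> A\<close> and \<open>\<iota> : M \<rightarrow> N\<close> that behave like the localisation
  maps of \<open>R\<close> and \<open>M\<close> at the multiplicative set \<open>S\<close>; the construction by fractions enters only
  at the end.
\<close>

context
  fixes S :: "'a set" and A :: "('c, 'x) ring_scheme" and \<rho> :: "'a \<Rightarrow> 'c"
  assumes S1: "\<one> \<in> S" and SS: "\<And>a b. a \<in> S \<Longrightarrow> b \<in> S \<Longrightarrow> a \<otimes> b \<in> S" and Sc: "S \<subseteq> carrier R"
    and A: "cring A"
    and \<rho>c: "\<And>r. r \<in> carrier R \<Longrightarrow> \<rho> r \<in> carrier A"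
    and \<rho>a: "\<And>r s. r \<in> carrier R \<Longrightarrow> s \<in> carrier R \<Longrightarrow> \<rho> (r \<oplus> s) = \<rho> r \<oplus>\<^bsub>A\<^esub> \<rho> s"
    and \<rho>m: "\<And>r s. r \<in> carrier R \<Longrightarrow> s \<in> carrier R \<Longrightarrow> \<rho> (r \<otimes> s) = \<rho> r \<otimes>\<^bsub>A\<^esub> \<rho> s"
    and \<rho>1: "\<rho> \<one> = \<one>\<^bsub>A\<^esub>" and \<rho>0: "\<rho> \<zero> = \<zero>\<^bsub>A\<^esub>"
    and \<rho>k: "\<And>r. r \<in> carrier R \<Longrightarrow> \<rho> r = \<zero>\<^bsub>A\<^esub> \<Longrightarrow> \<exists>v\<in>S. v \<otimes> r = \<zero>"
    and \<rho>d: "\<And>X. X \<in> carrier A \<Longrightarrow> \<exists>s\<in>S. \<exists>a\<in>carrier R. \<rho> s \<otimes>\<^bsub>A\<^esub> X = \<rho> a"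
begin

interpretation A: cring A by (rule A)

text \<open>On a free module it suffices to clear the denominators of the values on a basis.\<close>

lemma clear_denominators_free:
  assumes P: "P \<in> frees"
  shows "(\<And>p. p \<in> carrier P \<Longrightarrow> \<nu> p \<in> carrier A) \<Longrightarrow>
    (\<And>p q. p \<in> carrier P \<Longrightarrow> q \<in> carrier P \<Longrightarrow> \<nu> (p \<oplus>\<^bsub>P\<^esub> q) = \<nu> p \<oplus>\<^bsub>A\<^esub> \<nu> q) \<Longrightarrow>
    (\<And>r p. r \<in> carrier R \<Longrightarrow> p \<in> carrier P \<Longrightarrow> \<nu> (r \<odot>\<^bsub>P\<^esub> p) = \<rho> r \<otimes>\<^bsub>A\<^esub> \<nu> p) \<Longrightarrow>
    \<exists>w\<in>S. \<exists>\<theta>\<in>mhom R P (self_mod R). \<forall>p\<in>carrier P. \<rho> (\<theta> p) = \<rho> w \<otimes>\<^bsub>A\<^esub> \<nu> p"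
  using P
proof (induction P arbitrary: \<nu> rule: frees.induct)
  case zero
  have sm: "\<zero> \<odot>\<^bsub>zero_obj\<^esub> {} = {}" by (simp add: zero_obj_def)
  have "\<nu> {} = \<zero>\<^bsub>A\<^esub>" using zero(3)[of \<zero> "{}"] zero(1)[of "{}"] sm \<rho>0 by simp
  then show ?case using mhom_const_zero[OF module_self, of zero_obj] S1 \<rho>0 \<rho>1
    by (intro bexI[OF _ S1] bexI[of _ "\<lambda>_. \<zero>\<^bsub>self_mod R\<^esub>"]) simp_all
next
  case base
  obtain e c where e: "e \<in> carrier base_obj" "c \<in> mhom R base_obj (self_mod R)"
    "\<And>p. p \<in> carrier base_obj \<Longrightarrow> p = c p \<odot>\<^bsub>base_obj\<^esub> e" "\<And>r. r \<in> carrier R \<Longrightarrow> c (r \<odot>\<^bsub>base_obj\<^esub> e) = r"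
    by (rule base_coordinates) (rule that)
  obtain s a where sa: "s \<in> S" "a \<in> carrier R" "\<rho> s \<otimes>\<^bsub>A\<^esub> \<nu> e = \<rho> a" using \<rho>d[OF base(1)[OF e(1)]] by auto
  have sR: "s \<in> carrier R" using sa Sc by auto
  have cc: "c u \<in> carrier R" if "u \<in> carrier base_obj" for u using mhom_closed[OF e(2) that] by simp
  have "(\<lambda>p. a \<odot>\<^bsub>self_mod R\<^esub> c p) \<in> mhom R base_obj (self_mod R)" by (rule mhom_scale[OF e(2) module_self sa(2)])
  moreover have "\<rho> (a \<otimes> c p) = \<rho> s \<otimes>\<^bsub>A\<^esub> \<nu> p" if p: "p \<in> carrier base_obj" for p
  proof -
    have "\<nu> p = \<rho> (c p) \<otimes>\<^bsub>A\<^esub> \<nu> e" using base(3)[OF cc[OF p] e(1)] e(3)[OF p] by simp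
    then have "\<rho> s \<otimes>\<^bsub>A\<^esub> \<nu> p = (\<rho> s \<otimes>\<^bsub>A\<^esub> \<nu> e) \<otimes>\<^bsub>A\<^esub> \<rho> (c p)"
      using \<rho>c[OF sR] \<rho>c[OF cc[OF p]] base(1)[OF e(1)] by (simp add: A.m_ac)
    then show ?thesis using sa cc[OF p] \<rho>m by simp
  qed
  ultimately show ?case using sa(1) by (intro bexI[OF _ sa(1)] bexI[of _ "\<lambda>p. a \<odot>\<^bsub>self_mod R\<^esub> c p"]) simp_all
next
  case (bip P Q)
  note m = frees_module[OF bip.hyps(1)] frees_module[OF bip.hyps(2)]
  interpret P: module R P by (rule m)
  interpret Q: module R Q by (rule m)
  have "\<exists>w\<in>S. \<exists>\<theta>\<in>mhom R P (self_mod R). \<forall>p\<in>carrier P. \<rho> (\<theta> p) = \<rho> w \<otimes>\<^bsub>A\<^esub> \<nu> (pairc p \<zero>\<^bsub>Q\<^esub>)"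
  proof (rule bip.IH(1))
    show "\<nu> (pairc (p \<oplus>\<^bsub>P\<^esub> q) \<zero>\<^bsub>Q\<^esub>) = \<nu> (pairc p \<zero>\<^bsub>Q\<^esub>) \<oplus>\<^bsub>A\<^esub> \<nu> (pairc q \<zero>\<^bsub>Q\<^esub>)"
      if "p \<in> carrier P" "q \<in> carrier P" for p q
      using bip.prems(2)[of "pairc p \<zero>\<^bsub>Q\<^esub>" "pairc q \<zero>\<^bsub>Q\<^esub>"] that by simp
    show "\<nu> (pairc (r \<odot>\<^bsub>P\<^esub> p) \<zero>\<^bsub>Q\<^esub>) = \<rho> r \<otimes>\<^bsub>A\<^esub> \<nu> (pairc p \<zero>\<^bsub>Q\<^esub>)" if "r \<in> carrier R" "p \<in> carrier P" for r p
      using bip.prems(3)[of r "pairc p \<zero>\<^bsub>Q\<^esub>"] that by simp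
  qed (use bip.prems(1) in simp)
  then obtain w1 t1 where 1: "w1 \<in> S" "t1 \<in> mhom R P (self_mod R)"
    "\<And>p. p \<in> carrier P \<Longrightarrow> \<rho> (t1 p) = \<rho> w1 \<otimes>\<^bsub>A\<^esub> \<nu> (pairc p \<zero>\<^bsub>Q\<^esub>)" by auto
  have "\<exists>w\<in>S. \<exists>\<theta>\<in>mhom R Q (self_mod R). \<forall>p\<in>carrier Q. \<rho> (\<theta> p) = \<rho> w \<otimes>\<^bsub>A\<^esub> \<nu> (pairc \<zero>\<^bsub>P\<^esub> p)"
  proof (rule bip.IH(2))
    show "\<nu> (pairc \<zero>\<^bsub>P\<^esub> (p \<oplus>\<^bsub>Q\<^esub> q)) = \<nu> (pairc \<zero>\<^bsub>P\<^esub> p) \<oplus>\<^bsub>A\<^esub> \<nu> (pairc \<zero>\<^bsub>P\<^esub> q)"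
      if "p \<in> carrier Q" "q \<in> carrier Q" for p q
      using bip.prems(2)[of "pairc \<zero>\<^bsub>P\<^esub> p" "pairc \<zero>\<^bsub>P\<^esub> q"] that by simp
    show "\<nu> (pairc \<zero>\<^bsub>P\<^esub> (r \<odot>\<^bsub>Q\<^esub> p)) = \<rho> r \<otimes>\<^bsub>A\<^esub> \<nu> (pairc \<zero>\<^bsub>P\<^esub> p)" if "r \<in> carrier R" "p \<in> carrier Q" for r p
      using bip.prems(3)[of r "pairc \<zero>\<^bsub>P\<^esub> p"] that by simp
  qed (use bip.prems(1) in simp)
  then obtain w2 t2 where 2: "w2 \<in> S" "t2 \<in> mhom R Q (self_mod R)"
    "\<And>p. p \<in> carrier Q \<Longrightarrow> \<rho> (t2 p) = \<rho> w2 \<otimes>\<^bsub>A\<^esub> \<nu> (pairc \<zero>\<^bsub>P\<^esub> p)" by auto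
  have wR: "w1 \<in> carrier R" "w2 \<in> carrier R" using 1 2 Sc by auto
  let ?t = "\<lambda>u. w2 \<odot>\<^bsub>self_mod R\<^esub> t1 (fstc u) \<oplus>\<^bsub>self_mod R\<^esub> w1 \<odot>\<^bsub>self_mod R\<^esub> t2 (sndc u)"
  have t: "?t \<in> mhom R (bip P Q) (self_mod R)"
    by (rule bip_copair[OF mhom_scale[OF 1(2) module_self wR(2)] mhom_scale[OF 2(2) module_self wR(1)] module_self])
  moreover have "\<rho> (?t u) = \<rho> (w1 \<otimes> w2) \<otimes>\<^bsub>A\<^esub> \<nu> u" if "u \<in> carrier (bip P Q)" for u
  proof -
    obtain a b where u: "u = pairc a b" "a \<in> carrier P" "b \<in> carrier Q" using \<open>u \<in> _\<close> by (rule bip_cases)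
    have tc: "t1 a \<in> carrier R" "t2 b \<in> carrier R" using mhom_closed[OF 1(2) u(2)] mhom_closed[OF 2(2) u(3)] by simp_all
    have nc: "\<nu> (pairc a \<zero>\<^bsub>Q\<^esub>) \<in> carrier A" "\<nu> (pairc \<zero>\<^bsub>P\<^esub> b) \<in> carrier A" using bip.prems(1) u by simp_all
    have "\<nu> u = \<nu> (pairc a \<zero>\<^bsub>Q\<^esub>) \<oplus>\<^bsub>A\<^esub> \<nu> (pairc \<zero>\<^bsub>P\<^esub> b)"
      using bip.prems(2)[of "pairc a \<zero>\<^bsub>Q\<^esub>" "pairc \<zero>\<^bsub>P\<^esub> b"] u by simp
    then show ?thesis
      using tc nc wR \<rho>c[OF wR(1)] \<rho>c[OF wR(2)] 1(3)[OF u(2)] 2(3)[OF u(3)] u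
      by (simp add: \<rho>a \<rho>m A.r_distr A.m_ac)
  qed
  ultimately show ?case by (intro bexI[OF _ SS[OF 1(1) 2(1)]] bexI[OF _ t] ballI) simp
qed

text \<open>
  On a free cover of \<open>M\<close> the denominators can be cleared. The resulting map vanishes on the
  kernel of the cover only after localisation, but the kernel is finitely generated, so a
  further factor from \<open>S\<close> kills it.
\<close>

lemma clear_denominators:
  fixes M :: "('a, 'e, 'k) module_scheme"
  assumes fg: "fg_module R M"
    and \<mu>c: "\<And>u. u \<in> carrier M \<Longrightarrow> \<mu> u \<in> carrier A"
    and \<mu>a: "\<And>u v. u \<in> carrier M \<Longrightarrow> v \<in> carrier M \<Longrightarrow> \<mu> (u \<oplus>\<^bsub>M\<^esub> v) = \<mu> u \<oplus>\<^bsub>A\<^esub> \<mu> v"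
    and \<mu>s: "\<And>r u. r \<in> carrier R \<Longrightarrow> u \<in> carrier M \<Longrightarrow> \<mu> (r \<odot>\<^bsub>M\<^esub> u) = \<rho> r \<otimes>\<^bsub>A\<^esub> \<mu> u"
  shows "\<exists>w\<in>S. \<exists>l\<in>mhom R M (self_mod R). \<forall>u\<in>carrier M. \<rho> (l u) = \<rho> w \<otimes>\<^bsub>A\<^esub> \<mu> u"
proof -
  have M: "module R M" using fg by (simp add: fg_module_def)
  interpret M: module R M by fact
  obtain P \<pi> where P: "P \<in> frees" "\<pi> \<in> mhom R P M" "\<pi> ` carrier P = carrier M" by (rule ex_cover[OF fg]) (rule that)
  note Pm = frees_module[OF P(1)]
  interpret P: module R P by (rule Pm)
  have \<pi>c: "\<pi> p \<in> carrier M" if "p \<in> carrier P" for p by (rule mhom_closed[OF P(2) that])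
  have "\<exists>w\<in>S. \<exists>\<theta>\<in>mhom R P (self_mod R). \<forall>p\<in>carrier P. \<rho> (\<theta> p) = \<rho> w \<otimes>\<^bsub>A\<^esub> \<mu> (\<pi> p)"
    by (rule clear_denominators_free[OF P(1)])
      (simp_all add: mhom_add[OF P(2)] mhom_smult[OF P(2)] \<pi>c \<mu>c \<mu>a \<mu>s)
  then obtain w \<theta> where w: "w \<in> S" "\<theta> \<in> mhom R P (self_mod R)"
    "\<And>p. p \<in> carrier P \<Longrightarrow> \<rho> (\<theta> p) = \<rho> w \<otimes>\<^bsub>A\<^esub> \<mu> (\<pi> p)" by auto
  have wR: "w \<in> carrier R" using w Sc by auto
  have \<theta>c: "\<theta> p \<in> carrier R" if "p \<in> carrier P" for p using mhom_closed[OF w(2) that] by simp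
  have \<mu>0: "\<mu> \<zero>\<^bsub>M\<^esub> = \<zero>\<^bsub>A\<^esub>" using \<mu>s[of \<zero> "\<zero>\<^bsub>M\<^esub>"] \<mu>c[of "\<zero>\<^bsub>M\<^esub>"] \<rho>0 by simp
  let ?K = "{p \<in> carrier P. \<pi> p = \<zero>\<^bsub>M\<^esub>}"
  have fgP: "fg_module R P" using frees_mod_cat[OF P(1)] by (simp add: mod_cat_def)
  obtain B where B: "finite B" "B \<subseteq> ?K" "mspan R P B = ?K"
    using submodule_generators[OF fgP submodule_kernel[OF P(2) Pm M]] by auto
  have "\<exists>v\<in>S. \<forall>p\<in>B. v \<otimes> \<theta> p = \<zero>"
  proof (rule common_multiple[OF B(1) S1 SS Sc])
    show "\<exists>v\<in>S. v \<otimes> \<theta> p = \<zero>" if "p \<in> B" for p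
    proof (rule \<rho>k)
      have p: "p \<in> carrier P" "\<pi> p = \<zero>\<^bsub>M\<^esub>" using that B(2) by auto
      show "\<theta> p \<in> carrier R" by (rule \<theta>c[OF p(1)])
      show "\<rho> (\<theta> p) = \<zero>\<^bsub>A\<^esub>" using w(3)[OF p(1)] p(2) \<mu>0 \<rho>c[OF wR] by simp
    qed
    show "(r \<otimes> s) \<otimes> \<theta> p = \<zero>" if "p \<in> B" "r \<in> S" "s \<in> S" "s \<otimes> \<theta> p = \<zero>" for r s p
    proof -
      have "p \<in> carrier P" "r \<in> carrier R" "s \<in> carrier R" using that B(2) Sc by auto
      then show ?thesis using that(4) \<theta>c by (simp add: m_assoc)
    qed
  qed
  then obtain v where v: "v \<in> S" "\<And>p. p \<in> B \<Longrightarrow> v \<otimes> \<theta> p = \<zero>" by auto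
  have vR: "v \<in> carrier R" using v Sc by auto
  let ?\<theta> = "\<lambda>p. v \<odot>\<^bsub>self_mod R\<^esub> \<theta> p"
  have \<theta>h: "?\<theta> \<in> mhom R P (self_mod R)" by (rule mhom_scale[OF w(2) module_self vR])
  have Bc: "B \<subseteq> carrier P" using B(2) by auto
  have kill: "?\<theta> p = \<zero>\<^bsub>self_mod R\<^esub>" if "p \<in> carrier P" "\<pi> p = \<zero>\<^bsub>M\<^esub>" for p
    by (rule mhom_eq_on_mspan[OF \<theta>h mhom_const_zero[OF module_self] Pm module_self Bc])
      (use that v(2) B(3) in simp_all)
  obtain l where l: "l \<in> mhom R M (self_mod R)" "\<forall>p\<in>carrier P. l (\<pi> p) = ?\<theta> p"
    using factor_through_surjection[OF P(2) \<theta>h Pm M module_self P(3) kill] by auto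
  have "\<rho> (l u) = \<rho> (v \<otimes> w) \<otimes>\<^bsub>A\<^esub> \<mu> u" if u: "u \<in> carrier M" for u
  proof -
    have "u \<in> \<pi> ` carrier P" using u P(3) by simp
    then obtain p where p: "p \<in> carrier P" "u = \<pi> p" by auto
    have "\<rho> (l u) = \<rho> v \<otimes>\<^bsub>A\<^esub> (\<rho> w \<otimes>\<^bsub>A\<^esub> \<mu> u)" using l(2) p \<rho>m[OF vR \<theta>c[OF p(1)]] w(3)[OF p(1)] by simp
    then show ?thesis using \<rho>m[OF vR wR] \<rho>c[OF vR] \<rho>c[OF wR] \<mu>c[OF u] by (simp add: A.m_assoc)
  qed
  then show ?thesis using SS[OF v(1) w(1)] l(1) by blast
qed

text \<open>
  A basis of \<open>N\<close> writes the identity of \<open>M\<close>, after localisation, as a finite sum of rank-one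
  maps; clearing denominators gives some \<open>x \<in> S\<close> for which \<open>x\<close> times the identity of \<open>M\<close> is such
  a sum.
\<close>

lemma locally_free_factors:
  fixes M :: "('a, 'e, 'k) module_scheme" and N :: "('c, 'd, 'y) module_scheme" and \<iota> :: "'e \<Rightarrow> 'd"
  assumes fg: "fg_module R M" and free: "free_module A N"
    and \<iota>c: "\<And>u. u \<in> carrier M \<Longrightarrow> \<iota> u \<in> carrier N"
    and \<iota>a: "\<And>u v. u \<in> carrier M \<Longrightarrow> v \<in> carrier M \<Longrightarrow> \<iota> (u \<oplus>\<^bsub>M\<^esub> v) = \<iota> u \<oplus>\<^bsub>N\<^esub> \<iota> v"
    and \<iota>s: "\<And>r u. r \<in> carrier R \<Longrightarrow> u \<in> carrier M \<Longrightarrow> \<iota> (r \<odot>\<^bsub>M\<^esub> u) = \<rho> r \<odot>\<^bsub>N\<^esub> \<iota> u"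
    and \<iota>k: "\<And>u. u \<in> carrier M \<Longrightarrow> \<iota> u = \<zero>\<^bsub>N\<^esub> \<Longrightarrow> \<exists>v\<in>S. v \<odot>\<^bsub>M\<^esub> u = \<zero>\<^bsub>M\<^esub>"
    and \<iota>d: "\<And>Y. Y \<in> carrier N \<Longrightarrow> \<exists>s\<in>S. \<exists>m\<in>carrier M. \<rho> s \<odot>\<^bsub>N\<^esub> Y = \<iota> m"
  shows "\<exists>x\<in>S. factors_through_free M x"
proof -
  have M: "module R M" using fg by (simp add: fg_module_def)
  interpret M: module R M by fact
  have N: "module A N" using free by (simp add: free_module_def)
  interpret N: module A N by fact
  obtain B where B: "B \<subseteq> carrier N" "mspan A N B = carrier N" "lin_indep A N B"
    using free by (auto simp: free_module_def)
  obtain G where G: "finite G" "G \<subseteq> carrier M" "mspan R M G = carrier M" using fg by (auto simp: fg_module_def)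
  have SR: "s \<in> carrier R" if "s \<in> S" for s using that Sc by auto
  have \<iota>0: "\<iota> \<zero>\<^bsub>M\<^esub> = \<zero>\<^bsub>N\<^esub>" using \<iota>s[of \<zero> "\<zero>\<^bsub>M\<^esub>"] \<iota>c[of "\<zero>\<^bsub>M\<^esub>"] \<rho>0 by simp
  have "\<forall>g\<in>G. \<exists>F. finite F \<and> F \<subseteq> B \<and> \<iota> g \<in> mspan A N F"
  proof
    fix g assume "g \<in> G"
    then have "\<iota> g \<in> mspan A N B" using G(2) \<iota>c B(2) by auto
    then show "\<exists>F. finite F \<and> F \<subseteq> B \<and> \<iota> g \<in> mspan A N F" by (rule A.mspan_finite_support[OF N B(1)])
  qed
  then obtain Fs where Fs: "\<And>g. g \<in> G \<Longrightarrow> finite (Fs g) \<and> Fs g \<subseteq> B \<and> \<iota> g \<in> mspan A N (Fs g)" by metis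
  define F where "F = (\<Union>g\<in>G. Fs g)"
  have F: "finite F" "F \<subseteq> B" using Fs G(1) by (auto simp: F_def)
  have Fc: "F \<subseteq> carrier N" using F B by auto
  note sp = mspan_submodule[OF N Fc] and spd = submoduleD[OF mspan_submodule[OF N Fc] N]
  have "submodule {u \<in> carrier M. \<iota> u \<in> mspan A N F} R M"
    by (rule submoduleI'[OF M]) (simp_all add: \<iota>0 \<iota>a \<iota>s spd(2-4) \<rho>c)
  moreover have "G \<subseteq> {u \<in> carrier M. \<iota> u \<in> mspan A N F}"
  proof
    fix g assume g: "g \<in> G"
    have "mspan A N (Fs g) \<subseteq> mspan A N F" by (rule mspan_mono[OF N]) (use g in \<open>auto simp: F_def\<close>)
    then show "g \<in> {u \<in> carrier M. \<iota> u \<in> mspan A N F}" using Fs[OF g] G(2) g by auto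
  qed
  ultimately have "mspan R M G \<subseteq> {u \<in> carrier M. \<iota> u \<in> mspan A N F}" by (rule mspan_subset)
  then have "\<forall>u\<in>carrier M. \<exists>c. (\<forall>b\<in>F. c b \<in> carrier A) \<and> \<iota> u = (\<Oplus>\<^bsub>N\<^esub>b\<in>F. c b \<odot>\<^bsub>N\<^esub> b)"
    using G(3) A.mspan_finite_coordinates[OF N F(1) Fc] by auto
  then obtain c where c: "\<And>u b. u \<in> carrier M \<Longrightarrow> b \<in> F \<Longrightarrow> c u b \<in> carrier A"
    "\<And>u. u \<in> carrier M \<Longrightarrow> \<iota> u = (\<Oplus>\<^bsub>N\<^esub>b\<in>F. c u b \<odot>\<^bsub>N\<^esub> b)" by metis
  have bN: "b \<in> carrier N" if "b \<in> F" for b using that Fc by auto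
  note uniq = A.lin_indep_unique[OF N B(3) F B(1)]
  have ca: "c (u \<oplus>\<^bsub>M\<^esub> v) b = c u b \<oplus>\<^bsub>A\<^esub> c v b" if uv: "u \<in> carrier M" "v \<in> carrier M" and b: "b \<in> F" for u v b
  proof (rule uniq[OF _ _ _ b])
    have "(\<Oplus>\<^bsub>N\<^esub>b\<in>F. (c u b \<oplus>\<^bsub>A\<^esub> c v b) \<odot>\<^bsub>N\<^esub> b) = (\<Oplus>\<^bsub>N\<^esub>b\<in>F. c u b \<odot>\<^bsub>N\<^esub> b \<oplus>\<^bsub>N\<^esub> c v b \<odot>\<^bsub>N\<^esub> b)"
      by (rule N.M.finsum_cong') (use c(1) uv bN in \<open>auto simp: N.smult_l_distr\<close>)
    also have "\<dots> = \<iota> u \<oplus>\<^bsub>N\<^esub> \<iota> v" unfolding c(2)[OF uv(1)] c(2)[OF uv(2)]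
      by (rule N.M.finsum_addf) (use c(1) uv bN in auto)
    finally show "(\<Oplus>\<^bsub>N\<^esub>b\<in>F. c (u \<oplus>\<^bsub>M\<^esub> v) b \<odot>\<^bsub>N\<^esub> b) = (\<Oplus>\<^bsub>N\<^esub>b\<in>F. (c u b \<oplus>\<^bsub>A\<^esub> c v b) \<odot>\<^bsub>N\<^esub> b)"
      using c(2)[of "u \<oplus>\<^bsub>M\<^esub> v"] \<iota>a[OF uv] uv by simp
  qed (use c(1) uv in simp_all)
  have cs: "c (r \<odot>\<^bsub>M\<^esub> u) b = \<rho> r \<otimes>\<^bsub>A\<^esub> c u b" if r: "r \<in> carrier R" and u: "u \<in> carrier M" and b: "b \<in> F" for r u b
  proof (rule uniq[OF _ _ _ b])
    have "(\<Oplus>\<^bsub>N\<^esub>b\<in>F. (\<rho> r \<otimes>\<^bsub>A\<^esub> c u b) \<odot>\<^bsub>N\<^esub> b) = (\<Oplus>\<^bsub>N\<^esub>b\<in>F. \<rho> r \<odot>\<^bsub>N\<^esub> (c u b \<odot>\<^bsub>N\<^esub> b))"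
      by (rule N.M.finsum_cong') (use c(1) u \<rho>c[OF r] bN in \<open>auto simp: N.smult_assoc1\<close>)
    also have "\<dots> = \<rho> r \<odot>\<^bsub>N\<^esub> \<iota> u" unfolding c(2)[OF u]
      by (rule N.finsum_smult_ldistr[symmetric]) (use F \<rho>c[OF r] c(1) u bN in auto)
    finally show "(\<Oplus>\<^bsub>N\<^esub>b\<in>F. c (r \<odot>\<^bsub>M\<^esub> u) b \<odot>\<^bsub>N\<^esub> b) = (\<Oplus>\<^bsub>N\<^esub>b\<in>F. (\<rho> r \<otimes>\<^bsub>A\<^esub> c u b) \<odot>\<^bsub>N\<^esub> b)"
      using c(2)[of "r \<odot>\<^bsub>M\<^esub> u"] \<iota>s[OF r u] r u by simp
  qed (use c(1) r u \<rho>c in simp_all)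
  (* \<Phi> becomes, after multiplication by some w in S, the localisation of an
     endomorphism of M that factors through a free module *)
  define appr where "appr \<Phi> \<longleftrightarrow> (\<exists>w\<in>S. \<exists>\<phi>. factors_free M \<phi> \<and> (\<forall>u\<in>carrier M. \<phi> u \<in> carrier M \<and> \<iota> (\<phi> u) = \<rho> w \<odot>\<^bsub>N\<^esub> \<Phi> u))"
    for \<Phi>
  have single: "appr (\<lambda>u. c u b \<odot>\<^bsub>N\<^esub> b)" if b: "b \<in> F" for b
  proof -
    obtain w l where w: "w \<in> S" "l \<in> mhom R M (self_mod R)" "\<forall>u\<in>carrier M. \<rho> (l u) = \<rho> w \<otimes>\<^bsub>A\<^esub> c u b"
      using clear_denominators[OF fg, of "\<lambda>u. c u b"] c(1) ca cs b by auto
    obtain s m where s: "s \<in> S" "m \<in> carrier M" "\<rho> s \<odot>\<^bsub>N\<^esub> b = \<iota> m" using \<iota>d[OF bN[OF b]] by auto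
    have "l u \<odot>\<^bsub>M\<^esub> m \<in> carrier M \<and> \<iota> (l u \<odot>\<^bsub>M\<^esub> m) = \<rho> (w \<otimes> s) \<odot>\<^bsub>N\<^esub> (c u b \<odot>\<^bsub>N\<^esub> b)" if u: "u \<in> carrier M" for u
    proof -
      have lu: "l u \<in> carrier R" using mhom_closed[OF w(2) u] by simp
      have "\<iota> (l u \<odot>\<^bsub>M\<^esub> m) = (\<rho> w \<otimes>\<^bsub>A\<^esub> c u b) \<odot>\<^bsub>N\<^esub> (\<rho> s \<odot>\<^bsub>N\<^esub> b)" using \<iota>s[OF lu s(2)] w(3) u s(3) by simp
      also have "\<dots> = ((\<rho> w \<otimes>\<^bsub>A\<^esub> c u b) \<otimes>\<^bsub>A\<^esub> \<rho> s) \<odot>\<^bsub>N\<^esub> b"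
        using \<rho>c SR w(1) s(1) c(1)[OF u b] bN[OF b] by (simp add: N.smult_assoc1)
      also have "(\<rho> w \<otimes>\<^bsub>A\<^esub> c u b) \<otimes>\<^bsub>A\<^esub> \<rho> s = \<rho> (w \<otimes> s) \<otimes>\<^bsub>A\<^esub> c u b"
        using \<rho>c SR w(1) s(1) c(1)[OF u b] by (simp add: \<rho>m A.m_ac)
      also have "(\<rho> (w \<otimes> s) \<otimes>\<^bsub>A\<^esub> c u b) \<odot>\<^bsub>N\<^esub> b = \<rho> (w \<otimes> s) \<odot>\<^bsub>N\<^esub> (c u b \<odot>\<^bsub>N\<^esub> b)"
        using \<rho>c SR w(1) s(1) c(1)[OF u b] bN[OF b] by (simp add: N.smult_assoc1)
      finally show ?thesis using lu s(2) by simp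
    qed
    then show ?thesis unfolding appr_def using SS[OF w(1) s(1)] factors_free_rank_one[OF M w(2) s(2)] by blast
  qed
  have sum: "appr (\<lambda>u. \<Oplus>\<^bsub>N\<^esub>b\<in>F'. c u b \<odot>\<^bsub>N\<^esub> b)" if "finite F'" "F' \<subseteq> F" for F'
    using that
  proof (induction F' rule: finite_induct)
    case empty
    have "\<forall>u\<in>carrier M. \<zero>\<^bsub>M\<^esub> \<in> carrier M \<and> \<iota> \<zero>\<^bsub>M\<^esub> = \<rho> \<one> \<odot>\<^bsub>N\<^esub> \<zero>\<^bsub>N\<^esub>" using \<iota>0 \<rho>1 by simp
    then have "appr (\<lambda>u. \<zero>\<^bsub>N\<^esub>)" unfolding appr_def
      by (intro bexI[OF _ S1] exI[of _ "\<lambda>_. \<zero>\<^bsub>M\<^esub>"]) (simp add: factors_free_zero[OF M])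
    then show ?case by simp
  next
    case (insert b F')
    obtain w \<phi> where 1: "w \<in> S" "factors_free M \<phi>"
      "\<And>u. u \<in> carrier M \<Longrightarrow> \<phi> u \<in> carrier M \<and> \<iota> (\<phi> u) = \<rho> w \<odot>\<^bsub>N\<^esub> (\<Oplus>\<^bsub>N\<^esub>b\<in>F'. c u b \<odot>\<^bsub>N\<^esub> b)"
      using insert.IH insert.prems unfolding appr_def by auto
    have bF: "b \<in> F" using insert.prems by simp
    obtain w' \<phi>' where 2: "w' \<in> S" "factors_free M \<phi>'"
      "\<And>u. u \<in> carrier M \<Longrightarrow> \<phi>' u \<in> carrier M \<and> \<iota> (\<phi>' u) = \<rho> w' \<odot>\<^bsub>N\<^esub> (c u b \<odot>\<^bsub>N\<^esub> b)"
      using single[OF bF] unfolding appr_def by auto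
    note wR = SR[OF 1(1)] SR[OF 2(1)]
    let ?\<phi> = "\<lambda>u. w \<odot>\<^bsub>M\<^esub> \<phi>' u \<oplus>\<^bsub>M\<^esub> w' \<odot>\<^bsub>M\<^esub> \<phi> u"
    have ff: "factors_free M ?\<phi>"
      by (rule factors_free_add[OF M factors_free_scale[OF M 2(2) wR(1)] factors_free_scale[OF M 1(2) wR(2)]])
    have "?\<phi> u \<in> carrier M \<and> \<iota> (?\<phi> u) = \<rho> (w \<otimes> w') \<odot>\<^bsub>N\<^esub> (\<Oplus>\<^bsub>N\<^esub>b\<in>insert b F'. c u b \<odot>\<^bsub>N\<^esub> b)" if u: "u \<in> carrier M" for u
    proof -
      have s: "(\<Oplus>\<^bsub>N\<^esub>b\<in>F'. c u b \<odot>\<^bsub>N\<^esub> b) \<in> carrier N"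
        by (rule N.M.finsum_closed) (use c(1)[OF u] bN insert.prems in auto)
      have t: "c u b \<odot>\<^bsub>N\<^esub> b \<in> carrier N" using c(1)[OF u bF] bN[OF bF] by simp
      have i: "(\<Oplus>\<^bsub>N\<^esub>b\<in>insert b F'. c u b \<odot>\<^bsub>N\<^esub> b) = c u b \<odot>\<^bsub>N\<^esub> b \<oplus>\<^bsub>N\<^esub> (\<Oplus>\<^bsub>N\<^esub>b\<in>F'. c u b \<odot>\<^bsub>N\<^esub> b)"
        by (rule N.M.finsum_insert) (use c(1)[OF u] bN insert in auto)
      have cm: "\<rho> w \<otimes>\<^bsub>A\<^esub> \<rho> w' = \<rho> w' \<otimes>\<^bsub>A\<^esub> \<rho> w" using \<rho>c wR by (simp add: A.m_comm)
      have "\<iota> (?\<phi> u) = \<rho> w \<odot>\<^bsub>N\<^esub> (\<rho> w' \<odot>\<^bsub>N\<^esub> (c u b \<odot>\<^bsub>N\<^esub> b)) \<oplus>\<^bsub>N\<^esub> \<rho> w' \<odot>\<^bsub>N\<^esub> (\<rho> w \<odot>\<^bsub>N\<^esub> (\<Oplus>\<^bsub>N\<^esub>b\<in>F'. c u b \<odot>\<^bsub>N\<^esub> b))"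
        using 1(3)[OF u] 2(3)[OF u] wR by (simp add: \<iota>a \<iota>s)
      also have "\<dots> = (\<rho> w \<otimes>\<^bsub>A\<^esub> \<rho> w') \<odot>\<^bsub>N\<^esub> (c u b \<odot>\<^bsub>N\<^esub> b) \<oplus>\<^bsub>N\<^esub> (\<rho> w \<otimes>\<^bsub>A\<^esub> \<rho> w') \<odot>\<^bsub>N\<^esub> (\<Oplus>\<^bsub>N\<^esub>b\<in>F'. c u b \<odot>\<^bsub>N\<^esub> b)"
        using N.smult_assoc1[OF \<rho>c[OF wR(1)] \<rho>c[OF wR(2)] t] N.smult_assoc1[OF \<rho>c[OF wR(2)] \<rho>c[OF wR(1)] s] cm by simp
      also have "\<dots> = \<rho> (w \<otimes> w') \<odot>\<^bsub>N\<^esub> (\<Oplus>\<^bsub>N\<^esub>b\<in>insert b F'. c u b \<odot>\<^bsub>N\<^esub> b)"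
        unfolding i using s t \<rho>c wR by (simp add: \<rho>m N.smult_r_distr)
      finally show ?thesis using 1(3)[OF u] 2(3)[OF u] wR by simp
    qed
    then show ?case unfolding appr_def using SS[OF 1(1) 2(1)] ff by blast
  qed
  obtain w \<phi> where w: "w \<in> S" "factors_free M \<phi>"
    "\<And>u. u \<in> carrier M \<Longrightarrow> \<phi> u \<in> carrier M \<and> \<iota> (\<phi> u) = \<rho> w \<odot>\<^bsub>N\<^esub> (\<Oplus>\<^bsub>N\<^esub>b\<in>F. c u b \<odot>\<^bsub>N\<^esub> b)"
    using sum[OF F(1) subset_refl] unfolding appr_def by auto
  note wR = SR[OF w(1)]
  obtain P s g where P: "P \<in> frees" "s \<in> mhom R M P" "g \<in> mhom R P M" "\<And>u. u \<in> carrier M \<Longrightarrow> \<phi> u = g (s u)"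
    using w(2) unfolding factors_free_def by blast
  have gs: "(\<lambda>u. g (s u)) \<in> mhom R M M" by (rule mhom_comp[OF P(2,3)])
  have ex: "\<exists>v\<in>S. v \<odot>\<^bsub>M\<^esub> g (s u) = v \<odot>\<^bsub>M\<^esub> (w \<odot>\<^bsub>M\<^esub> u)" if u: "u \<in> carrier M" for u
  proof -
    have gsu: "g (s u) \<in> carrier M" by (rule mhom_closed[OF gs u])
    have "\<iota> (g (s u)) = \<iota> (w \<odot>\<^bsub>M\<^esub> u)"
      using w(3)[OF u] P(4)[OF u] c(2)[OF u] \<iota>s[OF wR u] by simp
    moreover have "\<iota> (g (s u) \<ominus>\<^bsub>M\<^esub> w \<odot>\<^bsub>M\<^esub> u) \<oplus>\<^bsub>N\<^esub> \<iota> (w \<odot>\<^bsub>M\<^esub> u) = \<iota> (g (s u))"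
      using gsu u wR M.M.cancel_inner(4)[of "g (s u)" "w \<odot>\<^bsub>M\<^esub> u" "\<zero>\<^bsub>M\<^esub>"]
      by (simp add: a_minus_def flip: \<iota>a)
    ultimately have "\<iota> (g (s u) \<ominus>\<^bsub>M\<^esub> w \<odot>\<^bsub>M\<^esub> u) = \<zero>\<^bsub>N\<^esub>"
      using \<iota>c[of "g (s u) \<ominus>\<^bsub>M\<^esub> w \<odot>\<^bsub>M\<^esub> u"] \<iota>c[of "w \<odot>\<^bsub>M\<^esub> u"] gsu u wR
      by (metis M.M.minus_closed M.smult_closed N.M.add.r_cancel_one')
    then obtain v where v: "v \<in> S" "v \<odot>\<^bsub>M\<^esub> (g (s u) \<ominus>\<^bsub>M\<^esub> w \<odot>\<^bsub>M\<^esub> u) = \<zero>\<^bsub>M\<^esub>"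
      using \<iota>k[of "g (s u) \<ominus>\<^bsub>M\<^esub> w \<odot>\<^bsub>M\<^esub> u"] gsu u wR by auto
    have "v \<odot>\<^bsub>M\<^esub> g (s u) \<ominus>\<^bsub>M\<^esub> v \<odot>\<^bsub>M\<^esub> (w \<odot>\<^bsub>M\<^esub> u) = \<zero>\<^bsub>M\<^esub>"
      using v(2) gsu u wR SR[OF v(1)] by (simp add: a_minus_def M.smult_r_distr M.smult_r_minus)
    then show ?thesis using module_diff_zero_iff[OF M] gsu u wR SR[OF v(1)] v(1) by (intro bexI[OF _ v(1)]) simp
  qed
  (* g s and w agree only in N; on finitely many generators one v makes them agree in M *)
  have "\<exists>v\<in>S. \<forall>u\<in>G. v \<odot>\<^bsub>M\<^esub> g (s u) = v \<odot>\<^bsub>M\<^esub> (w \<odot>\<^bsub>M\<^esub> u)"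
  proof (rule common_multiple[OF G(1) S1 SS Sc])
    show "\<exists>v\<in>S. v \<odot>\<^bsub>M\<^esub> g (s u) = v \<odot>\<^bsub>M\<^esub> (w \<odot>\<^bsub>M\<^esub> u)" if "u \<in> G" for u using ex that G(2) by auto
    fix r v u assume h: "u \<in> G" "r \<in> S" "v \<in> S" "v \<odot>\<^bsub>M\<^esub> g (s u) = v \<odot>\<^bsub>M\<^esub> (w \<odot>\<^bsub>M\<^esub> u)"
    have u: "u \<in> carrier M" using h G by auto
    show "(r \<otimes> v) \<odot>\<^bsub>M\<^esub> g (s u) = (r \<otimes> v) \<odot>\<^bsub>M\<^esub> (w \<odot>\<^bsub>M\<^esub> u)"
      using h(4) SR[OF h(2)] SR[OF h(3)] u mhom_closed[OF gs u] wR by (simp add: M.smult_assoc1)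
  qed
  then obtain v where v: "v \<in> S" "\<And>u. u \<in> G \<Longrightarrow> v \<odot>\<^bsub>M\<^esub> g (s u) = v \<odot>\<^bsub>M\<^esub> (w \<odot>\<^bsub>M\<^esub> u)" by auto
  note vR = SR[OF v(1)]
  have h2: "(\<lambda>u. v \<odot>\<^bsub>M\<^esub> (w \<odot>\<^bsub>M\<^esub> u)) \<in> mhom R M M" by (intro mhom_scale mhom_id M vR wR)
  have h1: "(\<lambda>u. v \<odot>\<^bsub>M\<^esub> g (s u)) \<in> mhom R M M" by (rule mhom_scale[OF gs M vR])
  have "v \<odot>\<^bsub>M\<^esub> g (s u) = (v \<otimes> w) \<odot>\<^bsub>M\<^esub> u" if u: "u \<in> carrier M" for u
  proof -
    have "v \<odot>\<^bsub>M\<^esub> g (s u) = v \<odot>\<^bsub>M\<^esub> (w \<odot>\<^bsub>M\<^esub> u)"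
      by (rule mhom_eq_on_mspan[OF h1 h2 M M G(2)]) (use v u G(3) in simp_all)
    then show ?thesis using vR wR u by (simp add: M.smult_assoc1)
  qed
  then have "factors_through_free M (v \<otimes> w)"
    unfolding factors_through_free_def
    by (intro bexI[OF _ P(1)] bexI[OF _ P(2)] bexI[OF _ mhom_scale[OF P(3) M vR]] ballI)
  then show ?thesis using SS[OF v(1) w(1)] by blast
qed

end

end

section \<open>Modules of fractions\<close>

lemma UN_pair_const: "X \<noteq> {} \<Longrightarrow> (\<And>a b. (a, b) \<in> X \<Longrightarrow> f a b = c) \<Longrightarrow> (\<Union>(a, b)\<in>X. f a b) = c"
  by fastforce

context
  fixes R :: "('a, 'm) ring_scheme" and M :: "('a, 'b, 'n) module_scheme" and S :: "'a set"
  assumes M: "module R M" and S1: "\<one>\<^bsub>R\<^esub> \<in> S" and SS: "\<And>a b. a \<in> S \<Longrightarrow> b \<in> S \<Longrightarrow> a \<otimes>\<^bsub>R\<^esub> b \<in> S"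
    and Sc: "S \<subseteq> carrier R"
begin

interpretation M: module R M by (rule M)

lemma S_carrier: "s \<in> S \<Longrightarrow> s \<in> carrier R"
  using Sc by auto

lemma frac_mem:
  "(y, t) \<in> loc_frac R M S x s \<longleftrightarrow> y \<in> carrier M \<and> t \<in> S \<and> (\<exists>u\<in>S. (u \<otimes>\<^bsub>R\<^esub> t) \<odot>\<^bsub>M\<^esub> x = (u \<otimes>\<^bsub>R\<^esub> s) \<odot>\<^bsub>M\<^esub> y)"
  if "x \<in> carrier M" "s \<in> S"
proof -
  have "u \<odot>\<^bsub>M\<^esub> (t \<odot>\<^bsub>M\<^esub> x) = u \<odot>\<^bsub>M\<^esub> (s \<odot>\<^bsub>M\<^esub> y) \<longleftrightarrow> (u \<otimes>\<^bsub>R\<^esub> t) \<odot>\<^bsub>M\<^esub> x = (u \<otimes>\<^bsub>R\<^esub> s) \<odot>\<^bsub>M\<^esub> y"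
    if "u \<in> S" "t \<in> S" "y \<in> carrier M" for u
    using that \<open>x \<in> carrier M\<close> \<open>s \<in> S\<close> by (simp add: M.smult_assoc1 S_carrier)
  then show ?thesis unfolding loc_frac_def by auto
qed

text \<open>
  Transitivity of the relation that defines fractions, with its witness: multiply the first
  equation by \<open>vr\<close>, the second by \<open>us\<close>.
\<close>

lemma frac_trans:
  assumes c: "x \<in> carrier M" "y \<in> carrier M" "z \<in> carrier M" "s \<in> S" "t \<in> S" "r \<in> S" "u \<in> S" "v \<in> S"
    and e: "(u \<otimes>\<^bsub>R\<^esub> t) \<odot>\<^bsub>M\<^esub> x = (u \<otimes>\<^bsub>R\<^esub> s) \<odot>\<^bsub>M\<^esub> y" "(v \<otimes>\<^bsub>R\<^esub> r) \<odot>\<^bsub>M\<^esub> y = (v \<otimes>\<^bsub>R\<^esub> t) \<odot>\<^bsub>M\<^esub> z"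
  shows "(u \<otimes>\<^bsub>R\<^esub> v \<otimes>\<^bsub>R\<^esub> t \<otimes>\<^bsub>R\<^esub> r) \<odot>\<^bsub>M\<^esub> x = (u \<otimes>\<^bsub>R\<^esub> v \<otimes>\<^bsub>R\<^esub> t \<otimes>\<^bsub>R\<^esub> s) \<odot>\<^bsub>M\<^esub> z"
proof -
  note C = S_carrier[OF c(4)] S_carrier[OF c(5)] S_carrier[OF c(6)] S_carrier[OF c(7)] S_carrier[OF c(8)]
  have "(u \<otimes>\<^bsub>R\<^esub> v \<otimes>\<^bsub>R\<^esub> t \<otimes>\<^bsub>R\<^esub> r) \<odot>\<^bsub>M\<^esub> x = (v \<otimes>\<^bsub>R\<^esub> r) \<odot>\<^bsub>M\<^esub> ((u \<otimes>\<^bsub>R\<^esub> t) \<odot>\<^bsub>M\<^esub> x)"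
    using C c by (simp add: M.R.m_ac flip: M.smult_assoc1)
  also have "\<dots> = (u \<otimes>\<^bsub>R\<^esub> s) \<odot>\<^bsub>M\<^esub> ((v \<otimes>\<^bsub>R\<^esub> r) \<odot>\<^bsub>M\<^esub> y)"
    unfolding e(1) using C c by (simp add: M.R.m_ac flip: M.smult_assoc1)
  also have "\<dots> = (u \<otimes>\<^bsub>R\<^esub> v \<otimes>\<^bsub>R\<^esub> t \<otimes>\<^bsub>R\<^esub> s) \<odot>\<^bsub>M\<^esub> z"
    unfolding e(2) using C c by (simp add: M.R.m_ac flip: M.smult_assoc1)
  finally show ?thesis .
qed

lemma frac_eq_iff:
  assumes "x \<in> carrier M" "y \<in> carrier M" "s \<in> S" "t \<in> S"
  shows "loc_frac R M S x s = loc_frac R M S y t \<longleftrightarrow> (\<exists>u\<in>S. (u \<otimes>\<^bsub>R\<^esub> t) \<odot>\<^bsub>M\<^esub> x = (u \<otimes>\<^bsub>R\<^esub> s) \<odot>\<^bsub>M\<^esub> y)"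
proof
  have "(y, t) \<in> loc_frac R M S y t" using assms S1 by (auto simp: frac_mem)
  moreover assume "loc_frac R M S x s = loc_frac R M S y t"
  ultimately have "(y, t) \<in> loc_frac R M S x s" by simp
  then show "\<exists>u\<in>S. (u \<otimes>\<^bsub>R\<^esub> t) \<odot>\<^bsub>M\<^esub> x = (u \<otimes>\<^bsub>R\<^esub> s) \<odot>\<^bsub>M\<^esub> y" using assms by (simp add: frac_mem)
next
  have sub: "loc_frac R M S y t \<subseteq> loc_frac R M S x s"
    if c: "x \<in> carrier M" "y \<in> carrier M" "s \<in> S" "t \<in> S" "u \<in> S" and e: "(u \<otimes>\<^bsub>R\<^esub> t) \<odot>\<^bsub>M\<^esub> x = (u \<otimes>\<^bsub>R\<^esub> s) \<odot>\<^bsub>M\<^esub> y"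
    for x y s t u
  proof
    fix w assume "w \<in> loc_frac R M S y t"
    then obtain z r v where w: "w = (z, r)" "z \<in> carrier M" "r \<in> S" "v \<in> S"
      "(v \<otimes>\<^bsub>R\<^esub> r) \<odot>\<^bsub>M\<^esub> y = (v \<otimes>\<^bsub>R\<^esub> t) \<odot>\<^bsub>M\<^esub> z" using frac_mem[OF c(2,4)] by (cases w) auto
    have "u \<otimes>\<^bsub>R\<^esub> v \<otimes>\<^bsub>R\<^esub> t \<in> S" using SS w c by simp
    moreover have "(u \<otimes>\<^bsub>R\<^esub> v \<otimes>\<^bsub>R\<^esub> t \<otimes>\<^bsub>R\<^esub> r) \<odot>\<^bsub>M\<^esub> x = (u \<otimes>\<^bsub>R\<^esub> v \<otimes>\<^bsub>R\<^esub> t \<otimes>\<^bsub>R\<^esub> s) \<odot>\<^bsub>M\<^esub> z"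
      by (rule frac_trans[OF c(1,2) w(2) c(3,4) w(3) c(5) w(4) e w(5)])
    ultimately show "w \<in> loc_frac R M S x s" using w frac_mem[OF c(1,3)] by blast
  qed
  assume "\<exists>u\<in>S. (u \<otimes>\<^bsub>R\<^esub> t) \<odot>\<^bsub>M\<^esub> x = (u \<otimes>\<^bsub>R\<^esub> s) \<odot>\<^bsub>M\<^esub> y"
  then obtain u where u: "u \<in> S" "(u \<otimes>\<^bsub>R\<^esub> t) \<odot>\<^bsub>M\<^esub> x = (u \<otimes>\<^bsub>R\<^esub> s) \<odot>\<^bsub>M\<^esub> y" by auto
  show "loc_frac R M S x s = loc_frac R M S y t"
    using sub[OF assms u] sub[OF assms(2,1,4,3) u(1) u(2)[symmetric]] by simp
qed

lemma frac_self: "x \<in> carrier M \<Longrightarrow> s \<in> S \<Longrightarrow> (x, s) \<in> loc_frac R M S x s"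
  using S1 by (auto simp: frac_mem)

text \<open>
  The sum of fractions does not depend on the representatives, so the union over them is a
  single fraction.
\<close>

lemma frac_add:
  assumes c: "x \<in> carrier M" "y \<in> carrier M" "s \<in> S" "t \<in> S"
  shows "(\<Union>(x, s)\<in>loc_frac R M S x s. \<Union>(y, t)\<in>loc_frac R M S y t.
      loc_frac R M S ((t \<odot>\<^bsub>M\<^esub> x) \<oplus>\<^bsub>M\<^esub> (s \<odot>\<^bsub>M\<^esub> y)) (s \<otimes>\<^bsub>R\<^esub> t))
    = loc_frac R M S ((t \<odot>\<^bsub>M\<^esub> x) \<oplus>\<^bsub>M\<^esub> (s \<odot>\<^bsub>M\<^esub> y)) (s \<otimes>\<^bsub>R\<^esub> t)"
proof (intro UN_pair_const)
  show "loc_frac R M S x s \<noteq> {}" "loc_frac R M S y t \<noteq> {}" using frac_self c by auto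
  fix x' s' y' t' assume h: "(x', s') \<in> loc_frac R M S x s" "(y', t') \<in> loc_frac R M S y t"
  obtain p where p: "x' \<in> carrier M" "s' \<in> S" "p \<in> S" "(p \<otimes>\<^bsub>R\<^esub> s') \<odot>\<^bsub>M\<^esub> x = (p \<otimes>\<^bsub>R\<^esub> s) \<odot>\<^bsub>M\<^esub> x'"
    using h(1) frac_mem[OF c(1,3)] by auto
  obtain q where q: "y' \<in> carrier M" "t' \<in> S" "q \<in> S" "(q \<otimes>\<^bsub>R\<^esub> t') \<odot>\<^bsub>M\<^esub> y = (q \<otimes>\<^bsub>R\<^esub> t) \<odot>\<^bsub>M\<^esub> y'"
    using h(2) frac_mem[OF c(2,4)] by auto
  note C = S_carrier[OF c(3)] S_carrier[OF c(4)] S_carrier[OF p(2)] S_carrier[OF p(3)] S_carrier[OF q(2)] S_carrier[OF q(3)]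
  have e1: "((p \<otimes>\<^bsub>R\<^esub> q) \<otimes>\<^bsub>R\<^esub> (s \<otimes>\<^bsub>R\<^esub> t)) \<odot>\<^bsub>M\<^esub> (t' \<odot>\<^bsub>M\<^esub> x') = ((p \<otimes>\<^bsub>R\<^esub> q) \<otimes>\<^bsub>R\<^esub> (s' \<otimes>\<^bsub>R\<^esub> t')) \<odot>\<^bsub>M\<^esub> (t \<odot>\<^bsub>M\<^esub> x)"
  proof -
    have "((p \<otimes>\<^bsub>R\<^esub> q) \<otimes>\<^bsub>R\<^esub> (s \<otimes>\<^bsub>R\<^esub> t)) \<odot>\<^bsub>M\<^esub> (t' \<odot>\<^bsub>M\<^esub> x') = (q \<otimes>\<^bsub>R\<^esub> t \<otimes>\<^bsub>R\<^esub> t') \<odot>\<^bsub>M\<^esub> ((p \<otimes>\<^bsub>R\<^esub> s) \<odot>\<^bsub>M\<^esub> x')"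
      using C p(1) by (simp add: M.R.m_ac flip: M.smult_assoc1)
    also have "\<dots> = ((p \<otimes>\<^bsub>R\<^esub> q) \<otimes>\<^bsub>R\<^esub> (s' \<otimes>\<^bsub>R\<^esub> t')) \<odot>\<^bsub>M\<^esub> (t \<odot>\<^bsub>M\<^esub> x)"
      unfolding p(4)[symmetric] using C c(1) by (simp add: M.R.m_ac flip: M.smult_assoc1)
    finally show ?thesis .
  qed
  have e2: "((p \<otimes>\<^bsub>R\<^esub> q) \<otimes>\<^bsub>R\<^esub> (s \<otimes>\<^bsub>R\<^esub> t)) \<odot>\<^bsub>M\<^esub> (s' \<odot>\<^bsub>M\<^esub> y') = ((p \<otimes>\<^bsub>R\<^esub> q) \<otimes>\<^bsub>R\<^esub> (s' \<otimes>\<^bsub>R\<^esub> t')) \<odot>\<^bsub>M\<^esub> (s \<odot>\<^bsub>M\<^esub> y)"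
  proof -
    have "((p \<otimes>\<^bsub>R\<^esub> q) \<otimes>\<^bsub>R\<^esub> (s \<otimes>\<^bsub>R\<^esub> t)) \<odot>\<^bsub>M\<^esub> (s' \<odot>\<^bsub>M\<^esub> y') = (p \<otimes>\<^bsub>R\<^esub> s \<otimes>\<^bsub>R\<^esub> s') \<odot>\<^bsub>M\<^esub> ((q \<otimes>\<^bsub>R\<^esub> t) \<odot>\<^bsub>M\<^esub> y')"
      using C q(1) by (simp add: M.R.m_ac flip: M.smult_assoc1)
    also have "\<dots> = ((p \<otimes>\<^bsub>R\<^esub> q) \<otimes>\<^bsub>R\<^esub> (s' \<otimes>\<^bsub>R\<^esub> t')) \<odot>\<^bsub>M\<^esub> (s \<odot>\<^bsub>M\<^esub> y)"
      unfolding q(4)[symmetric] using C c(2) by (simp add: M.R.m_ac flip: M.smult_assoc1)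
    finally show ?thesis .
  qed
  have "((p \<otimes>\<^bsub>R\<^esub> q) \<otimes>\<^bsub>R\<^esub> (s \<otimes>\<^bsub>R\<^esub> t)) \<odot>\<^bsub>M\<^esub> ((t' \<odot>\<^bsub>M\<^esub> x') \<oplus>\<^bsub>M\<^esub> (s' \<odot>\<^bsub>M\<^esub> y')) =
      ((p \<otimes>\<^bsub>R\<^esub> q) \<otimes>\<^bsub>R\<^esub> (s' \<otimes>\<^bsub>R\<^esub> t')) \<odot>\<^bsub>M\<^esub> ((t \<odot>\<^bsub>M\<^esub> x) \<oplus>\<^bsub>M\<^esub> (s \<odot>\<^bsub>M\<^esub> y))"
    using C p(1) q(1) c(1,2) e1 e2 by (simp add: M.smult_r_distr del: M.smult_assoc1)
  then show "loc_frac R M S ((t' \<odot>\<^bsub>M\<^esub> x') \<oplus>\<^bsub>M\<^esub> (s' \<odot>\<^bsub>M\<^esub> y')) (s' \<otimes>\<^bsub>R\<^esub> t') = loc_frac R M S ((t \<odot>\<^bsub>M\<^esub> x) \<oplus>\<^bsub>M\<^esub> (s \<odot>\<^bsub>M\<^esub> y)) (s \<otimes>\<^bsub>R\<^esub> t)"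
    using C p q c SS[OF p(3) q(3)] by (subst frac_eq_iff) (auto intro: SS)
qed

end

lemma frac_smult:
  fixes R :: "('a, 'm) ring_scheme" and M :: "('a, 'b, 'n) module_scheme"
  assumes M: "module R M" and S: "\<one>\<^bsub>R\<^esub> \<in> S" "\<And>a b. a \<in> S \<Longrightarrow> b \<in> S \<Longrightarrow> a \<otimes>\<^bsub>R\<^esub> b \<in> S" "S \<subseteq> carrier R"
    and c: "a \<in> carrier R" "x \<in> carrier M" "s \<in> S" "t \<in> S"
  shows "(\<Union>(a, s)\<in>loc_frac R (self_mod R) S a s. \<Union>(x, t)\<in>loc_frac R M S x t. loc_frac R M S (a \<odot>\<^bsub>M\<^esub> x) (s \<otimes>\<^bsub>R\<^esub> t))
    = loc_frac R M S (a \<odot>\<^bsub>M\<^esub> x) (s \<otimes>\<^bsub>R\<^esub> t)"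
proof (intro UN_pair_const)
  interpret M: module R M by fact
  note self = M.R.module_self
  note MS = M S and RS = self S
  have ac: "a \<in> carrier (self_mod R)" using c(1) by simp
  show "loc_frac R (self_mod R) S a s \<noteq> {}" "loc_frac R M S x t \<noteq> {}"
    using frac_self[OF RS ac c(3)] frac_self[OF MS c(2,4)] by auto
  fix a' s' x' t' assume h: "(a', s') \<in> loc_frac R (self_mod R) S a s" "(x', t') \<in> loc_frac R M S x t"
  obtain p where p: "a' \<in> carrier R" "s' \<in> S" "p \<in> S" "(p \<otimes>\<^bsub>R\<^esub> s') \<otimes>\<^bsub>R\<^esub> a = (p \<otimes>\<^bsub>R\<^esub> s) \<otimes>\<^bsub>R\<^esub> a'"
    using h(1) frac_mem[OF RS ac c(3)] by auto
  obtain q where q: "x' \<in> carrier M" "t' \<in> S" "q \<in> S" "(q \<otimes>\<^bsub>R\<^esub> t') \<odot>\<^bsub>M\<^esub> x = (q \<otimes>\<^bsub>R\<^esub> t) \<odot>\<^bsub>M\<^esub> x'"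
    using h(2) frac_mem[OF MS c(2,4)] by auto
  have C: "s \<in> carrier R" "t \<in> carrier R" "s' \<in> carrier R" "t' \<in> carrier R" "p \<in> carrier R" "q \<in> carrier R"
    using c p q S(3) by auto
  have "((p \<otimes>\<^bsub>R\<^esub> q) \<otimes>\<^bsub>R\<^esub> (s \<otimes>\<^bsub>R\<^esub> t)) \<odot>\<^bsub>M\<^esub> (a' \<odot>\<^bsub>M\<^esub> x') = ((p \<otimes>\<^bsub>R\<^esub> s) \<otimes>\<^bsub>R\<^esub> a') \<odot>\<^bsub>M\<^esub> ((q \<otimes>\<^bsub>R\<^esub> t) \<odot>\<^bsub>M\<^esub> x')"
    using C p(1) q(1) by (simp add: M.R.m_ac flip: M.smult_assoc1)
  also have "\<dots> = ((p \<otimes>\<^bsub>R\<^esub> q) \<otimes>\<^bsub>R\<^esub> (s' \<otimes>\<^bsub>R\<^esub> t')) \<odot>\<^bsub>M\<^esub> (a \<odot>\<^bsub>M\<^esub> x)"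
    unfolding p(4)[symmetric] q(4)[symmetric] using C c(1,2) by (simp add: M.R.m_ac flip: M.smult_assoc1)
  finally show "loc_frac R M S (a' \<odot>\<^bsub>M\<^esub> x') (s' \<otimes>\<^bsub>R\<^esub> t') = loc_frac R M S (a \<odot>\<^bsub>M\<^esub> x) (s \<otimes>\<^bsub>R\<^esub> t)"
    using C p q c S(2)[OF p(3) q(3)] by (subst frac_eq_iff[OF MS]) (auto intro: S(2))
qed

context noetherian_local_ring
begin

lemma free_localisation_factors:
  fixes M :: "('a, 'e, 'k) module_scheme"
  assumes fg: "fg_module R M" and P: "primeideal P R" and free: "free_module (loc_ring R P) (loc_mod R P M)"
  shows "\<exists>x\<in>carrier R - P. factors_through_free M x"
proof -
  have M: "module R M" using fg by (simp add: fg_module_def)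
  interpret M: module R M by fact
  let ?S = "carrier R - P"
  define fR where "fR = loc_frac R (self_mod R) ?S"
  define fM where "fM = loc_frac R M ?S"
  have S: "\<one> \<in> ?S" "\<And>a b. a \<in> ?S \<Longrightarrow> b \<in> ?S \<Longrightarrow> a \<otimes> b \<in> ?S" "?S \<subseteq> carrier R"
    using primeD[OF P] by auto
  have N: "module (loc_ring R P) (loc_mod R P M)" using free by (simp add: free_module_def)
  have A: "cring (loc_ring R P)" using N by (simp add: module_def)
  let ?A = "loc_ring R P" and ?N = "loc_mod R P M"
  have Ac: "X \<in> carrier ?A \<longleftrightarrow> (\<exists>a s. X = fR a s \<and> a \<in> carrier R \<and> s \<in> ?S)" for X
    by (auto simp: loc_ring_def Let_def fR_def)
  have Nc: "X \<in> carrier ?N \<longleftrightarrow> (\<exists>a s. X = fM a s \<and> a \<in> carrier M \<and> s \<in> ?S)" for X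
    by (auto simp: loc_mod_def Let_def fM_def)
  have Az: "\<zero>\<^bsub>?A\<^esub> = fR \<zero> \<one>" "\<one>\<^bsub>?A\<^esub> = fR \<one> \<one>" by (simp_all add: loc_ring_def Let_def fR_def)
  have Nz: "\<zero>\<^bsub>?N\<^esub> = fM \<zero>\<^bsub>M\<^esub> \<one>" by (simp add: loc_mod_def Let_def fM_def)
  have Aa: "fR a s \<oplus>\<^bsub>?A\<^esub> fR b t = fR ((t \<otimes> a) \<oplus> (s \<otimes> b)) (s \<otimes> t)"
    if "a \<in> carrier R" "b \<in> carrier R" "s \<in> ?S" "t \<in> ?S" for a b s t
    using frac_add[OF module_self S, of a b s t] that by (simp add: loc_ring_def Let_def fR_def)
  have Na: "fM a s \<oplus>\<^bsub>?N\<^esub> fM b t = fM ((t \<odot>\<^bsub>M\<^esub> a) \<oplus>\<^bsub>M\<^esub> (s \<odot>\<^bsub>M\<^esub> b)) (s \<otimes> t)"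
    if "a \<in> carrier M" "b \<in> carrier M" "s \<in> ?S" "t \<in> ?S" for a b s t
    using frac_add[OF M S, of a b s t] that by (simp add: loc_mod_def Let_def fM_def)
  have Am: "fR a s \<otimes>\<^bsub>?A\<^esub> fR b t = fR (a \<otimes> b) (s \<otimes> t)"
    if "a \<in> carrier R" "b \<in> carrier R" "s \<in> ?S" "t \<in> ?S" for a b s t
    using frac_smult[OF module_self S, of a b s t] that by (simp add: loc_ring_def Let_def fR_def)
  have Ns: "fR a s \<odot>\<^bsub>?N\<^esub> fM b t = fM (a \<odot>\<^bsub>M\<^esub> b) (s \<otimes> t)"
    if "a \<in> carrier R" "b \<in> carrier M" "s \<in> ?S" "t \<in> ?S" for a b s t
    using frac_smult[OF M S, of a b s t] that by (simp add: loc_mod_def Let_def fR_def fM_def)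
  have Re: "fR a s = fR b t \<longleftrightarrow> (\<exists>u\<in>?S. (u \<otimes> t) \<otimes> a = (u \<otimes> s) \<otimes> b)"
    if "a \<in> carrier R" "b \<in> carrier R" "s \<in> ?S" "t \<in> ?S" for a b s t
    using frac_eq_iff[OF module_self S, of a b s t] that by (simp add: fR_def)
  have Me: "fM a s = fM b t \<longleftrightarrow> (\<exists>u\<in>?S. (u \<otimes> t) \<odot>\<^bsub>M\<^esub> a = (u \<otimes> s) \<odot>\<^bsub>M\<^esub> b)"
    if "a \<in> carrier M" "b \<in> carrier M" "s \<in> ?S" "t \<in> ?S" for a b s t
    using frac_eq_iff[OF M S, of a b s t] that by (simp add: fM_def)
  show ?thesis
  proof (rule locally_free_factors[where \<rho> = "\<lambda>r. fR r \<one>" and \<iota> = "\<lambda>u. fM u \<one>" and A = ?A and N = ?N, OF S A])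
    show "fR r \<one> \<in> carrier ?A" if "r \<in> carrier R" for r using that S(1) Ac by blast
    show "fR (r \<oplus> s) \<one> = fR r \<one> \<oplus>\<^bsub>?A\<^esub> fR s \<one>" if "r \<in> carrier R" "s \<in> carrier R" for r s
      using that Aa S(1) by simp
    show "fR (r \<otimes> s) \<one> = fR r \<one> \<otimes>\<^bsub>?A\<^esub> fR s \<one>" if "r \<in> carrier R" "s \<in> carrier R" for r s
      using that Am S(1) by simp
    show "fR \<one> \<one> = \<one>\<^bsub>?A\<^esub>" "fR \<zero> \<one> = \<zero>\<^bsub>?A\<^esub>" by (simp_all add: Az)
    show "\<exists>v\<in>?S. v \<otimes> r = \<zero>" if r: "r \<in> carrier R" "fR r \<one> = \<zero>\<^bsub>?A\<^esub>" for r
    proof -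
      obtain u where u: "u \<in> ?S" "(u \<otimes> \<one>) \<otimes> r = (u \<otimes> \<one>) \<otimes> \<zero>" using r Re[OF r(1) zero_closed S(1) S(1)] Az by auto
      then show ?thesis by (intro bexI[OF _ u(1)]) simp
    qed
    show "\<exists>s\<in>?S. \<exists>a\<in>carrier R. fR s \<one> \<otimes>\<^bsub>?A\<^esub> X = fR a \<one>" if X: "X \<in> carrier ?A" for X
    proof -
      obtain a s where a: "X = fR a s" "a \<in> carrier R" "s \<in> ?S" using X Ac by blast
      have sR: "s \<in> carrier R" using a by simp
      have "fR s \<one> \<otimes>\<^bsub>?A\<^esub> X = fR (s \<otimes> a) s" unfolding a(1) using Am[OF sR a(2) S(1) a(3)] sR by simp
      also have "\<dots> = fR a \<one>"
        using sR a S(1) by (subst Re) (auto intro!: bexI[OF _ S(1)] simp: S)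
      finally show ?thesis using a by blast
    qed
    show "fg_module R M" "free_module ?A ?N" by fact+
    show "fM u \<one> \<in> carrier ?N" if "u \<in> carrier M" for u using that S(1) Nc by blast
    show "fM (u \<oplus>\<^bsub>M\<^esub> v) \<one> = fM u \<one> \<oplus>\<^bsub>?N\<^esub> fM v \<one>" if "u \<in> carrier M" "v \<in> carrier M" for u v
      using that Na S(1) by simp
    show "fM (r \<odot>\<^bsub>M\<^esub> u) \<one> = fR r \<one> \<odot>\<^bsub>?N\<^esub> fM u \<one>" if "r \<in> carrier R" "u \<in> carrier M" for r u
      using that Ns S(1) by simp
    show "\<exists>v\<in>?S. v \<odot>\<^bsub>M\<^esub> u = \<zero>\<^bsub>M\<^esub>" if r: "u \<in> carrier M" "fM u \<one> = \<zero>\<^bsub>?N\<^esub>" for u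
    proof -
      obtain v where v: "v \<in> ?S" "(v \<otimes> \<one>) \<odot>\<^bsub>M\<^esub> u = (v \<otimes> \<one>) \<odot>\<^bsub>M\<^esub> \<zero>\<^bsub>M\<^esub>"
        using r Me[OF r(1) M.M.zero_closed S(1) S(1)] Nz by auto
      then show ?thesis by (intro bexI[OF _ v(1)]) simp
    qed
    show "\<exists>s\<in>?S. \<exists>m\<in>carrier M. fR s \<one> \<odot>\<^bsub>?N\<^esub> Y = fM m \<one>" if Y: "Y \<in> carrier ?N" for Y
    proof -
      obtain a s where a: "Y = fM a s" "a \<in> carrier M" "s \<in> ?S" using Y Nc by blast
      have sR: "s \<in> carrier R" using a by simp
      have "fR s \<one> \<odot>\<^bsub>?N\<^esub> Y = fM (s \<odot>\<^bsub>M\<^esub> a) s" unfolding a(1) using Ns[OF sR a(2) S(1) a(3)] sR by simp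
      also have "\<dots> = fM a \<one>"
        using sR a S(1) by (subst Me) (auto intro!: bexI[OF _ S(1)] simp: S)
      finally show ?thesis using a by blast
    qed
  qed
qed

lemma factors_through_free_iff: "factors_through_free M y \<longleftrightarrow> factors_free M (\<lambda>u. y \<odot>\<^bsub>M\<^esub> u)"
  unfolding factors_through_free_def factors_free_def by (auto simp: eq_commute)

lemma factors_free_cong: "factors_free M \<phi> \<Longrightarrow> (\<And>u. u \<in> carrier M \<Longrightarrow> \<psi> u = \<phi> u) \<Longrightarrow> factors_free M \<psi>"
  unfolding factors_free_def by simp

text \<open>
  Endomorphisms of \<open>M\<close> that factor through free modules are closed under sums: use the biproduct
  of the two free modules.
\<close>

lemma factors_ideal:
  assumes M: "module R M"
  shows "ideal {y \<in> carrier R. factors_through_free M y} R"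
proof (rule idealI')
  interpret M: module R M by fact
  show "\<zero> \<in> {y \<in> carrier R. factors_through_free M y}"
    using factors_free_cong[OF factors_free_zero[OF M], of "\<lambda>u. \<zero> \<odot>\<^bsub>M\<^esub> u"]
    by (simp add: factors_through_free_iff)
  show "x \<oplus> y \<in> {y \<in> carrier R. factors_through_free M y}"
    if "x \<in> {y \<in> carrier R. factors_through_free M y}" "y \<in> {y \<in> carrier R. factors_through_free M y}" for x y
    using that factors_free_cong[OF factors_free_add[OF M], of "\<lambda>u. x \<odot>\<^bsub>M\<^esub> u" "\<lambda>u. y \<odot>\<^bsub>M\<^esub> u" "\<lambda>u. (x \<oplus> y) \<odot>\<^bsub>M\<^esub> u"]
    by (simp add: factors_through_free_iff M.smult_l_distr)
  show "a \<otimes> x \<in> {y \<in> carrier R. factors_through_free M y}"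
    if "a \<in> carrier R" "x \<in> {y \<in> carrier R. factors_through_free M y}" for a x
    using that factors_free_cong[OF factors_free_scale[OF M], of "\<lambda>u. x \<odot>\<^bsub>M\<^esub> u" a "\<lambda>u. (a \<otimes> x) \<odot>\<^bsub>M\<^esub> u"]
    by (simp add: factors_through_free_iff M.smult_assoc1)
qed auto

lemma ideal_Int: "ideal I R \<Longrightarrow> ideal J R \<Longrightarrow> ideal (I \<inter> J) R"
  by (rule i_intersect)

section \<open>Cokernels of iterated cones\<close>

text \<open>
  Let \<open>C n\<close> be the cokernel in degree \<open>n\<close>, \<open>H n\<close> the homology and \<open>B n\<close> the boundaries. The
  exact sequences \<open>0 \<rightarrow> H (n + 1) \<rightarrow> C (n + 1) \<rightarrow> B n \<rightarrow> 0\<close> and \<open>0 \<rightarrow> B n \<rightarrow> G n \<rightarrow> C n \<rightarrow> 0\<close> show that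
  \<open>C (n + 1)\<close> is built from \<open>H (n + 1)\<close> and a syzygy of \<open>C n\<close>; and \<open>C 0 = H 0\<close>. So \<open>C n\<close> is
  built from the \<open>i\<close>-th syzygies of \<open>H (n - i)\<close>, with \<open>n - i\<close> at most \<open>s\<close>. The homology is
  killed by \<open>X\<close> because of the null-homotopies, hence is supported only at \<open>\<mm>\<close>.
\<close>

lemma cokernel_built:
  assumes cx: "chain_complex G d" and nh: "\<And>y. y \<in> X \<Longrightarrow> null_homotopic G d y 0" and X: "X \<subseteq> carrier R"
    and XP: "\<And>P. primeideal P R \<Longrightarrow> X \<subseteq> P \<Longrightarrow> P = \<mm>" and ex: "exact_above G d s"
  shows "W \<in> mod_cat R \<Longrightarrow> w \<in> mhom R (G n) W \<Longrightarrow> w ` carrier (G n) = carrier W \<Longrightarrow>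
    (\<And>a. a \<in> carrier (G n) \<Longrightarrow> w a = \<zero>\<^bsub>W\<^esub> \<longleftrightarrow> a \<in> d n ` carrier (G (Suc n))) \<Longrightarrow>
    built (map (\<lambda>i. (syzygies ^^ i) fl) [n - s..<Suc n]) W"
proof (induction n arbitrary: W w)
  note Gm = cx_module[OF cx]
  interpret G: module R "G n" for n by (rule Gm)
  note dh = cx_d[OF cx]
  have killed: "H \<in> fl" if H: "H \<in> mod_cat R" "\<And>y u. y \<in> X \<Longrightarrow> u \<in> carrier H \<Longrightarrow> y \<odot>\<^bsub>H\<^esub> u = \<zero>\<^bsub>H\<^esub>" for H
  proof -
    have "X \<subseteq> quot_ann R H {\<zero>\<^bsub>H\<^esub>}" using H(2) X by (auto simp: quot_ann_def)
    then show ?thesis using H(1) XP by (auto simp: fl_def)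
  qed
  {
    case 0
    note Wm = mod_catD[OF 0(1)]
    have "y \<odot>\<^bsub>W\<^esub> u = \<zero>\<^bsub>W\<^esub>" if y: "y \<in> X" and u: "u \<in> carrier W" for y u
    proof -
      obtain h where h: "\<And>n. h n \<in> mhom R (G n) (G (Suc n))" "\<And>a. a \<in> carrier (G 0) \<Longrightarrow> d 0 (h 0 a) = y \<odot>\<^bsub>G 0\<^esub> a"
        using nh[OF y] by (rule null_homotopicE) (rule that, simp_all)
      have "u \<in> w ` carrier (G 0)" using u 0(3) by simp
      then obtain a where a: "a \<in> carrier (G 0)" "u = w a" by auto
      have yR: "y \<in> carrier R" using y X by auto
      have "y \<odot>\<^bsub>W\<^esub> u = w (d 0 (h 0 a))" using h(2)[OF a(1)] mhom_smult[OF 0(2) yR a(1)] a(2) by simp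
      also have "\<dots> = \<zero>\<^bsub>W\<^esub>" using 0(4)[of "d 0 (h 0 a)"] mhom_closed[OF h(1) a(1)] by (simp add: dh)
      finally show ?thesis .
    qed
    then have "W \<in> fl" using killed[OF 0(1)] by simp
    then show ?case using 0(1) by (simp add: built.base)
  next
    case (Suc n)
    note Wm = mod_catD[OF Suc.prems(1)]
    interpret W: module R W by (rule Wm)
    have Gc: "G n \<in> mod_cat R" by (rule frees_mod_cat[OF cx_free[OF cx]])
    have fgG: "fg_module R (G n)" using Gc by (simp add: mod_cat_def)
    have Bs: "submodule (d n ` carrier (G (Suc n))) R (G n)"
      by (rule submodule_image[OF cx_hom[OF cx] Gm Gm G.carrier_is_submodule])
    obtain V v where V: "V \<in> mod_cat R" "v \<in> mhom R (G n) V" "v ` carrier (G n) = carrier V"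
      "\<And>x. x \<in> carrier (G n) \<Longrightarrow> v x = \<zero>\<^bsub>V\<^esub> \<longleftrightarrow> x \<in> d n ` carrier (G (Suc n))"
      by (rule ex_quotient[OF fgG Bs]) (rule that)
    have bV: "built (map (\<lambda>i. (syzygies ^^ i) fl) [n - s..<Suc n]) V" by (rule Suc.IH[OF V])
    have shift: "map syzygies (map (\<lambda>i. (syzygies ^^ i) fl) [n - s..<Suc n]) = map (\<lambda>i. (syzygies ^^ i) fl) [Suc (n - s)..<Suc (Suc n)]"
      by (simp add: map_Suc_upt[symmetric] comp_def del: upt_Suc)
    have ker: "d n a = \<zero>\<^bsub>G n\<^esub>" if a: "a \<in> carrier (G (Suc n))" "w a = \<zero>\<^bsub>W\<^esub>" for a
    proof -
      obtain c where "c \<in> carrier (G (Suc (Suc n)))" "a = d (Suc n) c" using Suc.prems(4)[OF a(1)] a(2) by auto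
      then show ?thesis using cx_dd[OF cx] by simp
    qed
    (* the map induced by the differential on the cokernel, with kernel the homology *)
    obtain \<delta> where \<delta>: "\<delta> \<in> mhom R W (G n)" "\<forall>a\<in>carrier (G (Suc n)). \<delta> (w a) = d n a"
      using factor_through_surjection[OF Suc.prems(2) cx_hom[OF cx] Gm Wm Gm Suc.prems(3) ker] by auto
    have Wcase: "\<exists>a\<in>carrier (G (Suc n)). x = w a" if "x \<in> carrier W" for x
      using that Suc.prems(3) by (metis imageE)
    have \<delta>im: "\<delta> ` carrier W = d n ` carrier (G (Suc n))"
      using \<delta>(2) unfolding Suc.prems(3)[symmetric] image_image by simp
    show ?case
    proof (cases "s \<le> n")
      case True
      (* no homology in this degree: the cokernel is the module of boundaries *)
      have inj: "inj_on \<delta> (carrier W)"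
      proof (rule mhom_inj_onI[OF \<delta>(1) Wm Gm])
        fix x assume x: "x \<in> carrier W" "\<delta> x = \<zero>\<^bsub>G n\<^esub>"
        obtain a where a: "a \<in> carrier (G (Suc n))" "x = w a" using Wcase[OF x(1)] by auto
        have "d n a = \<zero>\<^bsub>G n\<^esub>" using \<delta>(2) a x(2) by simp
        then have "a \<in> d (Suc n) ` carrier (G (Suc (Suc n)))" using ex True a(1) unfolding exact_above_def by simp
        then show "x = \<zero>\<^bsub>W\<^esub>" using Suc.prems(4)[OF a(1)] a(2) by simp
      qed
      have "ses \<delta> v W (G n) V" unfolding ses_def using \<delta>(1) V inj \<delta>im by simp
      from built_syzygy[OF bV Suc.prems(1) cx_free[OF cx] this]
      show ?thesis using shift True by (simp add: Suc_diff_le del: upt_Suc)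
    next
      case False
      then have ns: "n - s = 0" "Suc n - s = 0" by simp_all
      define B where "B = (G n)\<lparr>carrier := d n ` carrier (G (Suc n))\<rparr>"
      have B: "B \<in> mod_cat R" unfolding B_def by (rule submodule_mod_cat[OF Gc Bs])
      have "ses (\<lambda>b. b) v B (G n) V"
        unfolding ses_def B_def using V submoduleD(1)[OF Bs Gm] by (auto simp: mhom_def subset_iff)
      from built_syzygy[OF bV B cx_free[OF cx] this]
      have bB: "built (map (\<lambda>i. (syzygies ^^ i) fl) [Suc 0..<Suc (Suc n)]) B" using shift ns(1) by simp
      have \<delta>B: "\<delta> \<in> mhom R W B" using \<delta>(1) \<delta>im by (auto simp: mhom_def B_def)
      have \<delta>s: "\<delta> ` carrier W = carrier B" by (simp add: B_def \<delta>im)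
      define H where "H = W\<lparr>carrier := {b \<in> carrier W. \<delta> b = \<zero>\<^bsub>B\<^esub>}\<rparr>"
      note K = kernel_ses[OF \<delta>B Suc.prems(1) mod_catD[OF B] \<delta>s, folded H_def]
      have "y \<odot>\<^bsub>H\<^esub> u = \<zero>\<^bsub>H\<^esub>" if y: "y \<in> X" and u: "u \<in> carrier H" for y u
      proof -
        obtain h where h: "\<And>n. h n \<in> mhom R (G n) (G (Suc n))"
          "\<And>n a. a \<in> carrier (G (Suc n)) \<Longrightarrow> d (Suc n) (h (Suc n) a) \<oplus>\<^bsub>G (Suc n)\<^esub> h n (d n a) = y \<odot>\<^bsub>G (Suc n)\<^esub> a"
          using nh[OF y] by (rule null_homotopicE) (rule that, simp_all)
        have uW: "u \<in> carrier W" "\<delta> u = \<zero>\<^bsub>G n\<^esub>" using u by (simp_all add: H_def B_def)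
        obtain a where a: "a \<in> carrier (G (Suc n))" "u = w a" using Wcase[OF uW(1)] by auto
        have yR: "y \<in> carrier R" using y X by auto
        have "d n a = \<zero>\<^bsub>G n\<^esub>" using \<delta>(2) a uW(2) by simp
        then have "y \<odot>\<^bsub>G (Suc n)\<^esub> a = d (Suc n) (h (Suc n) a)"
          using h(2)[OF a(1)] mhom_zero[OF h(1) Gm Gm] mhom_closed[OF h(1) a(1)] by (simp add: dh)
        then have "w (y \<odot>\<^bsub>G (Suc n)\<^esub> a) = \<zero>\<^bsub>W\<^esub>"
          using Suc.prems(4)[of "y \<odot>\<^bsub>G (Suc n)\<^esub> a"] yR a(1) mhom_closed[OF h(1) a(1)] by (simp add: dh)
        then show ?thesis using mhom_smult[OF Suc.prems(2) yR a(1)] a(2) by (simp add: H_def)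
      qed
      then have "H \<in> fl" using killed[OF K(1)] by simp
      from built_extension[OF this K(1) Suc.prems(1) B K(2) bB]
      have "built (fl # map (\<lambda>i. (syzygies ^^ i) fl) [Suc 0..<Suc (Suc n)]) W" .
      moreover have "[0..<Suc (Suc n)] = 0 # [Suc 0..<Suc (Suc n)]" by (rule upt_conv_Cons) simp
      ultimately show ?thesis unfolding ns(2) by simp
    qed
  }
qed

text \<open>
  The ideal \<open>J\<close> of elements that factor through a free module is contained in no nonmaximal
  prime, because \<open>M\<close> is free at each of them. So a system of parameters can be chosen in \<open>J \<inter> \<mm>\<close>
  whose first \<open>t\<close> members are regular on \<open>M\<close>. The iterated cone over it makes \<open>M\<close> a retract of a
  cokernel in degree \<open>d\<close>, and its homology lives in degrees \<open>\<le> d - t\<close>.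
\<close>

lemma retract_of_built:
  fixes M :: "('a, 'e, 'k) module_scheme"
  assumes d: "krull_dim R = enat d" and fg: "fg_module R M" and lf: "locally_free_punctured R M"
    and t: "t \<le> d" "depth_ge M t {\<zero>\<^bsub>M\<^esub>}"
  obtains X W where "X \<in> mod_cat R" "mod_iso R M X" "W \<in> mod_cat R" "retract_of X W"
    "built (map (\<lambda>i. (syzygies ^^ i) fl) [t..<Suc d]) W"
proof -
  have M: "module R M" using fg by (simp add: fg_module_def)
  interpret M: module R M by fact
  define J where "J = {y \<in> carrier R. factors_through_free M y}"
  have J: "ideal J R" unfolding J_def by (rule factors_ideal[OF M])
  have I: "ideal (J \<inter> \<mm>) R" by (rule ideal_Int[OF J m_ideal])
  have Jn: "\<not> J \<inter> \<mm> \<subseteq> P" if P: "primeideal P R" "P \<noteq> \<mm>" for P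
  proof -
    have "free_module (loc_ring R P) (loc_mod R P M)"
      using lf P nonmaximal_iff[OF P(1)] by (simp add: locally_free_punctured_def)
    then obtain x where x: "x \<in> carrier R - P" "factors_through_free M x" using free_localisation_factors[OF fg P(1)] by blast
    obtain z where z: "z \<in> \<mm>" "z \<notin> P" using not_m_subset[OF P] by auto
    have zR: "z \<in> carrier R" using z m_carrier by auto
    have xJ: "x \<in> J" using x by (simp add: J_def)
    have "x \<otimes> z \<in> J" by (rule idealD(5)[OF J zR xJ])
    moreover have "x \<otimes> z \<in> \<mm>" using idealD(4)[OF m_ideal _ z(1), of x] x by simp
    moreover have "x \<otimes> z \<notin> P" using primeD(2)[OF P(1), of x z] x z zR by auto
    ultimately show ?thesis by auto
  qed
  obtain xs where xs: "length xs = d" "set xs \<subseteq> J \<inter> \<mm>"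
    "\<And>i. i < t \<Longrightarrow> i < d \<Longrightarrow> regular_mod M (seq_sub M (take i xs)) (xs ! i)"
    "\<And>q. primeideal q R \<Longrightarrow> set xs \<subseteq> q \<Longrightarrow> q = \<mm>"
    by (rule parameters_exist[OF d fg I Jn Int_lower2 t(2)]) (assumption, assumption, rule that)
  have Jc: "J \<inter> \<mm> \<subseteq> carrier R" using idealD(1)[OF J] by auto
  have Jf: "factors_through_free M y" if "y \<in> J \<inter> \<mm>" for y using that by (simp add: J_def)
  have reg: "regular_mod M (seq_sub M (take i xs)) (xs ! i)" if "i < t" "i < length xs" for i
    using xs(1,3) that by simp
  obtain G D P e where G: "chain_complex G D" "\<And>y. y \<in> set xs \<Longrightarrow> null_homotopic G D y 0"
    "retract_of_coker M P e G D (length xs)" "P \<in> frees" "e \<in> mhom R P M" "e ` carrier P = carrier M"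
    "exact_above G D (length xs - t)"
    by (rule iterated_cone[where t = t, OF fg Jc Jf xs(2) reg]) (assumption, assumption, assumption, rule that)
  note Gm = cx_module[OF G(1)]
  interpret G: module R "G n" for n by (rule Gm)
  have fgG: "fg_module R (G d)" using frees_mod_cat[OF cx_free[OF G(1)]] by (simp add: mod_cat_def)
  have Bs: "submodule (D d ` carrier (G (Suc d))) R (G d)"
    by (rule submodule_image[OF cx_hom[OF G(1)] Gm Gm G.carrier_is_submodule])
  obtain W w where W: "W \<in> mod_cat R" "w \<in> mhom R (G d) W" "w ` carrier (G d) = carrier W"
    "\<And>x. x \<in> carrier (G d) \<Longrightarrow> w x = \<zero>\<^bsub>W\<^esub> \<longleftrightarrow> x \<in> D d ` carrier (G (Suc d))"
    by (rule ex_quotient[OF fgG Bs]) (rule that)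
  note Wm = mod_catD[OF W(1)]
  have xsc: "set xs \<subseteq> carrier R" using xs(2) Jc by auto
  have "built (map (\<lambda>i. (syzygies ^^ i) fl) [d - (length xs - t)..<Suc d]) W"
    by (rule cokernel_built[OF G(1,2) xsc xs(4) G(7) W])
  then have b: "built (map (\<lambda>i. (syzygies ^^ i) fl) [t..<Suc d]) W" using xs(1) t(1) by simp
  obtain \<alpha> \<gamma> where a: "\<alpha> \<in> mhom R (G d) M" "\<gamma> \<in> mhom R P (G d)"
    "\<And>a. a \<in> carrier (G (Suc d)) \<Longrightarrow> \<alpha> (D d a) = \<zero>\<^bsub>M\<^esub>" "\<And>p. p \<in> carrier P \<Longrightarrow> \<alpha> (\<gamma> p) = e p"
    "\<And>p. p \<in> carrier P \<Longrightarrow> e p = \<zero>\<^bsub>M\<^esub> \<Longrightarrow> \<gamma> p \<in> D d ` carrier (G (Suc d))"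
    using G(3) xs(1) unfolding retract_of_coker_def by (elim exE conjE) metis
  have k1: "\<alpha> x = \<zero>\<^bsub>M\<^esub>" if "x \<in> carrier (G d)" "w x = \<zero>\<^bsub>W\<^esub>" for x using that W(4) a(3) by auto
  obtain p where p: "p \<in> mhom R W M" "\<forall>x\<in>carrier (G d). p (w x) = \<alpha> x"
    using factor_through_surjection[OF W(2) a(1) Gm Wm M W(3) k1] by auto
  have k2: "w (\<gamma> x) = \<zero>\<^bsub>W\<^esub>" if "x \<in> carrier P" "e x = \<zero>\<^bsub>M\<^esub>" for x
    using W(4)[OF mhom_closed[OF a(2) that(1)]] a(5)[OF that] by simp
  obtain i where i: "i \<in> mhom R M W" "\<forall>x\<in>carrier P. i (e x) = w (\<gamma> x)"
    using factor_through_surjection[OF G(5) mhom_comp[OF a(2) W(2)] frees_module[OF G(4)] M Wm G(6) k2] by auto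
  have pi: "p (i u) = u" if u: "u \<in> carrier M" for u
  proof -
    have "u \<in> e ` carrier P" using u G(6) by simp
    then obtain x where x: "x \<in> carrier P" "u = e x" by auto
    then show ?thesis using i(2) p(2) a(4) mhom_closed[OF a(2) x(1)] by simp
  qed
  obtain X where X: "X \<in> mod_cat R" "mod_iso R M X" using ex_rmod[OF fg] by blast
  note Xm = mod_catD[OF X(1)]
  obtain f g where fg': "f \<in> mhom R M X" "g \<in> mhom R X M"
    "\<And>x. x \<in> carrier M \<Longrightarrow> g (f x) = x" "\<And>y. y \<in> carrier X \<Longrightarrow> f (g y) = y"
    by (rule mod_isoE[OF X(2) M Xm]) (rule that)
  have "retract_of X W"
    unfolding retract_of_def
    by (rule bexI[OF _ mhom_comp[OF fg'(2) i(1)]], rule bexI[OF _ mhom_comp[OF p(1) fg'(1)]])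
      (use pi fg'(4) mhom_closed[OF fg'(2)] in simp)
  then show ?thesis by (rule that[OF X W(1) _ b])
qed

section \<open>The zero module\<close>

lemma zero_obj_sum: "mod_iso R zero_obj (dsum {} K)"
  unfolding mod_iso_def
  by (rule bexI[of _ "\<lambda>_ _. undefined"]) (auto simp: bij_betw_def mhom_def PiE_empty_domain)

text \<open>
  The zero module is the empty direct sum, so it belongs to the closures of the empty
  subcategory.
\<close>

lemma zero_module_in_closures:
  assumes fg: "fg_module R M" and z: "carrier M = {\<zero>\<^bsub>M\<^esub>}"
  shows "in_cat R M (filt_closure R {} 1)" "in_cat R M (ext_closure R (sum_family R {} \<Y>))"
proof -
  have M: "module R M" using fg by (simp add: fg_module_def)
  have iso: "mod_iso R M zero_obj"
    by (rule mod_isoI[OF mhom_const_zero[OF zero_obj_module] M zero_obj_module]) (use z in auto)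
  have "zero_obj \<in> sum_family R {} \<Y>" unfolding sum_family_def using zero_obj zero_obj_sum by auto
  then have "zero_obj \<in> ext_closure R (sum_family R {} \<Y>)" by (rule ext_closure.base[OF _ zero_obj mod_iso_refl])
  then show "in_cat R M (ext_closure R (sum_family R {} \<Y>))" unfolding in_cat_def using iso by blast
  have "zero_obj \<in> add_closure R {}"
    by (rule add_closure.sum[OF finite.emptyI _ zero_obj zero_obj_sum]) simp
  have "zero_obj \<in> filt_closure R {} 1"
    unfolding filt_closure_def
  proof (intro CollectI conjI bexI[OF _ zero_obj] exI[of _ "\<lambda>_. carrier zero_obj"] allI impI zero_obj)
    have "retract_of zero_obj zero_obj"
      unfolding retract_of_def by (rule bexI[OF _ mhom_id], rule bexI[OF _ mhom_id]) simp
    then show "direct_summand R zero_obj zero_obj" by (rule retract_direct_summand[OF zero_obj zero_obj])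
    show "mod_filtration R zero_obj 1 (\<lambda>_. carrier zero_obj)"
      using submodule_zero[OF zero_obj_module] by (simp add: mod_filtration_def)
    have "mod_iso R (quot_mod R zero_obj (carrier zero_obj)) zero_obj"
      by (rule quot_mod_iso[OF zero_obj_module zero_obj_module _ mhom_id])
        (use submodule_zero[OF zero_obj_module] in auto)
    moreover have "zero_obj\<lparr>carrier := carrier zero_obj\<rparr> = zero_obj" by (simp add: zero_obj_def)
    ultimately show "in_cat R (quot_mod R (zero_obj\<lparr>carrier := carrier zero_obj\<rparr>) (carrier zero_obj)) (add_closure R {})"
      unfolding in_cat_def using \<open>zero_obj \<in> add_closure R {}\<close> by metis
  qed
  then show "in_cat R M (filt_closure R {} 1)" unfolding in_cat_def using iso by blast
qed

end

section \<open>Filtrations by syzygies of modules of finite length\<close>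

theorem theorem4p1:
  fixes R :: "('a, 'm) ring_scheme" and M :: "('a, 'b, 'n) module_scheme"
    and \<mm> :: "'a set" and d :: nat and t :: enat
  assumes "noetherian_local_ring R \<mm>"
    and "krull_dim R = enat d"
    and "fg_module R M"
    and "locally_free_punctured R M"
    and "t = depth R \<mm> M"
  shows "in_cat R M (filt_closure R
           (\<Union>i\<in>{i. t \<le> enat i \<and> i \<le> d}. syzygy R i (fl_cat R)) (the_enat (enat d - t + 1)))
    \<and> in_cat R M (ext_closure R
           (sum_family R {i. t \<le> enat i \<and> i \<le> d} (\<lambda>i. syzygy R i (residue_cat R \<mm>))))"
proof -
  interpret noetherian_local_ring R \<mm> by (rule assms(1))
  have M: "module R M" using assms(3) by (simp add: fg_module_def)
  show ?thesis
  proof (cases "carrier M = {\<zero>\<^bsub>M\<^esub>}")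
    case True
    (* the depth is infinite, so no i qualifies; the number of steps is 1 since d - \<infinity> = 0 *)
    then have t: "t = \<infinity>" using assms(5) by (simp add: depth_def)
    then have I: "{i. t \<le> enat i \<and> i \<le> d} = {}" by simp
    have r: "the_enat (enat d - t + 1) = 1" by (simp add: t one_enat_def)
    show ?thesis unfolding I r using zero_module_in_closures[OF assms(3) True] by simp
  next
    case False
    obtain k where k: "depth R \<mm> M = enat k" "k \<le> d" "depth_ge M k {\<zero>\<^bsub>M\<^esub>}"
      by (rule depth_attained[OF assms(2) M False]) (rule that)
    have t: "t = enat k" using assms(5) k(1) by simp
    have r: "the_enat (enat d - t + 1) = d - k + 1" by (simp add: t one_enat_def)
    let ?I = "{i. t \<le> enat i \<and> i \<le> d}"
    have I: "?I = set [k..<Suc d]" by (auto simp: t)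
    obtain X W where X: "X \<in> mod_cat R" "mod_iso R M X" "W \<in> mod_cat R" "retract_of X W"
      "built (map (\<lambda>i. (syzygies ^^ i) fl) [k..<Suc d]) W"
      by (rule retract_of_built[OF assms(2,3,4) k(2,3)]) (rule that)
    have sub: "(syzygies ^^ i) fl \<subseteq> syzygy R i (fl_cat R)" for i
    proof -
      have "fl_cat R \<subseteq> mod_cat R" by (auto simp: fl_cat_def)
      then have "(syzygies ^^ i) (fl_cat R) \<subseteq> syzygy R i (fl_cat R)" by (rule syzygies_pow_syzygy)
      moreover have "(syzygies ^^ i) fl \<subseteq> (syzygies ^^ i) (fl_cat R)"
        by (induction i) (simp_all add: fl_fl_cat syzygies_mono)
      ultimately show ?thesis by simp
    qed
    (* N carries the filtration, one step for each i from k to d *)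
    obtain N where N: "N \<in> mod_cat R" "retract_of W N" "filtered N (map (\<lambda>i. (syzygies ^^ i) fl) [k..<Suc d])"
      using built_filtered[OF X(5)] by blast
    have "retract_of X N" by (rule retract_trans[OF X(4) N(2)])
    then have "X \<in> filt_closure R (\<Union>i\<in>?I. syzygy R i (fl_cat R)) (length (map (\<lambda>i. (syzygies ^^ i) fl) [k..<Suc d]))"
      by (rule filtered_filt_closure[OF X(1) N(1) _ N(3)]) (use sub in \<open>auto simp: I simp del: upt_Suc\<close>)
    then have "in_cat R M (filt_closure R (\<Union>i\<in>?I. syzygy R i (fl_cat R)) (the_enat (enat d - t + 1)))"
      unfolding in_cat_def r using X(2) k(2) by (auto simp: Suc_diff_le)
    moreover have "W \<in> ext_closure R (sum_family R ?I (\<lambda>i. syzygy R i (residue_cat R \<mm>)))"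
    proof (rule built_ext_closure[OF X(5)])
      fix \<Y> assume "\<Y> \<in> set (map (\<lambda>i. (syzygies ^^ i) fl) [k..<Suc d])"
      then obtain i where i: "i \<in> ?I" "\<Y> = (syzygies ^^ i) fl" unfolding I by auto
      have "finite ?I" unfolding I by simp
      then show "\<Y> \<inter> mod_cat R \<subseteq> ext_closure R (sum_family R ?I (\<lambda>i. syzygy R i (residue_cat R \<mm>)))"
        using fl_syzygies_ext[OF _ i(1)] i(2) by auto
    qed
    then have "X \<in> ext_closure R (sum_family R ?I (\<lambda>i. syzygy R i (residue_cat R \<mm>)))"
      by (rule ext_closure.summand[OF _ X(1) retract_direct_summand[OF X(1,3,4)]])
    ultimately show ?thesis unfolding in_cat_def using X(2) by auto
  qed
qed

end
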